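(* Let $p\geq 3$. (i) If $0<\beta<\beta_p$, then $W$ and $T$ are indistinguishable, i.e. $\lim_{N\to\infty} d_{TV}(W,T)=0$, and weak recovery of $u$ is impossible: for every random probability measure $\mu_N$ on $\Omega_N^s\times\mathscr B(S_N)$ and every constant $c>0$, $$\lim_{N\to\infty}\mathbb P\Big(\int_{S_N}|\langle u,\tau\rangle|\,\mu_N(T,d\tau)\geq c\Big)=0.$$ (ii) If $\beta>\beta_p$, then $W$ and $T$ are distinguishable, i.e. $\lim_{N\to\infty}d_{TV}(W,T)=1$, and weak recovery of $u$ is possible: there exist random probability measures $\mu_N$ on $\Omega_N^s\times\mathscr B(S_N)$ and a constant $c>0$ such that $$\lim_{N\to\infty}\mathbb P\Big(\int_{S_N}|\langle u,\tau\rangle|\,\mu_N(T,d\tau)\geq c\Big)=1.$$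
   Context: Fix $p\ge 3$ and $N\ge1$. Let $\Omega_N=\bigotimes_{j=1}^p\mathbb R^N$ be the space of real tensors $Y=(y_{i_1,\dots,i_p})_{1\le i_1,\dots,i_p\le N}$, with inner product $\langle Y,Y'\rangle=\sum_{i_1,\dots,i_p}y_{i_1,\dots,i_p}y'_{i_1,\dots,i_p}$; for $\tau\in\mathbb R^N$, $\tau^{\otimes p}\in\Omega_N$ has entries $\tau_{i_1}\cdots\tau_{i_p}$. For a permutation $\pi$ of $\{1,\dots,p\}$, $Y^\pi$ has entries $y_{i_{\pi(1)},\dots,i_{\pi(p)}}$; $\Omega_N^s$ is the space of symmetric tensors ($Y=Y^\pi$ for all $\pi$). Let $Y$ have i.i.d. $N(0,2/N)$ entries and $W=\frac1{p!}\sum_{\pi}Y^\pi$. Let $S_N=\{\pm1/\sqrt N\}^N$, let $u$ be uniform on $S_N$, independent of $W$, and for $\beta\ge0$ let $T=W+\beta u^{\otimes p}$. $d_{TV}(W,T)=\sup_{A\in\mathscr B(\Omega_N^s)}|\mathbb P(W\in A)-\mathbb P(T\in A)|$. A random probability measure on $\Omega_N^s\times\mathscr B(S_N)$ is a map $\mu_N:\Omega_N^s\times\mathscr B(S_N)\to[0,1]$ such that $\mu_N(\cdot,A)$ is Borel measurable for each $A$ and $\mu_N(w,\cdot)$ is a probability measure on $S_N$ for each $w$. Pure $p$-spin model: $\Sigma_N=\{-1,1\}^N$, $(g_{i_1,\dots,i_p})$ i.i.d. standard Gaussians, $H_N(\sigma)=N^{-(p-1)/2}\sum_{1\le i_1,\dots,i_p\le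 N}g_{i_1,\dots,i_p}\sigma_{i_1}\cdots\sigma_{i_p}$, and free energy $F_N(\beta)=\frac1N\log\sum_{\sigma\in\Sigma_N}2^{-N}\exp\big(\tfrac{\beta}{\sqrt2}H_N(\sigma)\big)$. It is known that $F_N(\beta)$ converges a.s. to a nonrandom limit $F(\beta)$, and $F(\beta)\le\beta^2/4$ for all $\beta\ge0$. Let $\mathcal R=\{\beta>0:F(\beta)=\beta^2/4\}$ and $\beta_p=\max\mathcal R$ (the critical temperature). *)

theory Defs
  imports "HOL-Probability.Probability" "HOL-Combinatorics.Permutations"
begin

text \<open>Multi-indices (i_1,...,i_p) with 0 \<le> i_j < N, represented as lists of length p.
  Tensors are (extensional) functions on this index set; vectors of R^N are functions
  nat \<Rightarrow> real vanishing outside {..<N}.\<close>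

definition idx :: "nat \<Rightarrow> nat \<Rightarrow> nat list set" where
  "idx p N = {is. length is = p \<and> set is \<subseteq> {..<N}}"

definition tensor_space :: "nat \<Rightarrow> nat \<Rightarrow> (nat list \<Rightarrow> real) measure" where
  "tensor_space p N = PiM (idx p N) (\<lambda>_. borel)"

definition permute_idx :: "nat \<Rightarrow> (nat \<Rightarrow> nat) \<Rightarrow> nat list \<Rightarrow> nat list" where
  "permute_idx p \<pi> is = map (\<lambda>j. is ! \<pi> j) [0..<p]"

definition sym_tensors :: "nat \<Rightarrow> nat \<Rightarrow> (nat list \<Rightarrow> real) set" where
  "sym_tensors p N = {w \<in> space (tensor_space p N).
     \<forall>\<pi>. \<pi> permutes {..<p} \<longrightarrow> (\<forall>is \<in> idx p N. w (permute_idx p \<pi> is) = w is)}"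

definition symmetrize :: "nat \<Rightarrow> nat \<Rightarrow> (nat list \<Rightarrow> real) \<Rightarrow> (nat list \<Rightarrow> real)" where
  "symmetrize p N y = (\<lambda>is \<in> idx p N.
     (1 / fact p) * (\<Sum>\<pi> \<in> {\<pi>. \<pi> permutes {..<p}}. y (permute_idx p \<pi> is)))"

definition tensor_power :: "nat \<Rightarrow> nat \<Rightarrow> (nat \<Rightarrow> real) \<Rightarrow> (nat list \<Rightarrow> real)" where
  "tensor_power p N \<tau> = (\<lambda>is \<in> idx p N. \<Prod>j<p. \<tau> (is ! j))"

definition vinner :: "nat \<Rightarrow> (nat \<Rightarrow> real) \<Rightarrow> (nat \<Rightarrow> real) \<Rightarrow> real" where
  "vinner N u v = (\<Sum>i<N. u i * v i)"

definition S :: "nat \<Rightarrow> (nat \<Rightarrow> real) set" where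
  "S N = {\<tau>. (\<forall>i<N. \<tau> i = 1 / sqrt N \<or> \<tau> i = - 1 / sqrt N) \<and> (\<forall>i\<ge>N. \<tau> i = 0)}"

definition Y_law :: "nat \<Rightarrow> nat \<Rightarrow> (nat list \<Rightarrow> real) measure" where
  "Y_law p N = PiM (idx p N) (\<lambda>_. density lborel (normal_density 0 (sqrt (2 / real N))))"

definition joint :: "nat \<Rightarrow> nat \<Rightarrow> ((nat list \<Rightarrow> real) \<times> (nat \<Rightarrow> real)) measure" where
  "joint p N = Y_law p N \<Otimes>\<^sub>M measure_pmf (pmf_of_set (S N))"

definition W_rv :: "nat \<Rightarrow> nat \<Rightarrow> (nat list \<Rightarrow> real) \<times> (nat \<Rightarrow> real) \<Rightarrow> (nat list \<Rightarrow> real)" where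
  "W_rv p N \<omega> = symmetrize p N (fst \<omega>)"

definition T_rv :: "nat \<Rightarrow> nat \<Rightarrow> real \<Rightarrow> (nat list \<Rightarrow> real) \<times> (nat \<Rightarrow> real) \<Rightarrow> (nat list \<Rightarrow> real)" where
  "T_rv p N \<beta> \<omega> = (\<lambda>is \<in> idx p N. symmetrize p N (fst \<omega>) is + \<beta> * tensor_power p N (snd \<omega>) is)"

definition dTV :: "nat \<Rightarrow> nat \<Rightarrow> real \<Rightarrow> real" where
  "dTV p N \<beta> = (SUP A \<in> {A \<in> sets (tensor_space p N). A \<subseteq> sym_tensors p N}.
     \<bar>measure (joint p N) {\<omega> \<in> space (joint p N). W_rv p N \<omega> \<in> A}
      - measure (joint p N) {\<omega> \<in> space (joint p N). T_rv p N \<beta> \<omega> \<in> A}\<bar>)"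

text \<open>A random probability measure on Omega_N^s x B(S_N): a Markov kernel from
  Omega_N^s (with its Borel sigma-algebra) to S_N (with its discrete = Borel sigma-algebra).\<close>
definition random_prob_measure :: "nat \<Rightarrow> nat \<Rightarrow> ((nat list \<Rightarrow> real) \<Rightarrow> (nat \<Rightarrow> real) measure) \<Rightarrow> bool" where
  "random_prob_measure p N \<mu> \<longleftrightarrow>
     \<mu> \<in> measurable (restrict_space (tensor_space p N) (sym_tensors p N)) (prob_algebra (count_space (S N)))"

definition recovery_prob :: "nat \<Rightarrow> nat \<Rightarrow> real \<Rightarrow> ((nat list \<Rightarrow> real) \<Rightarrow> (nat \<Rightarrow> real) measure) \<Rightarrow> real \<Rightarrow> real" where
  "recovery_prob p N \<beta> \<mu> c = measure (joint p N)
     {\<omega> \<in> space (joint p N). c \<le> (\<integral>\<tau>. \<bar>vinner N (snd \<omega>) \<tau>\<bar> \<partial>(\<mu> (T_rv p N \<beta> \<omega>)))}"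

definition Sigma :: "nat \<Rightarrow> (nat \<Rightarrow> real) set" where
  "Sigma N = {\<sigma>. (\<forall>i<N. \<sigma> i = 1 \<or> \<sigma> i = -1) \<and> (\<forall>i\<ge>N. \<sigma> i = 0)}"

text \<open>A single infinite array of i.i.d. standard Gaussians (g_{i_1..i_p}), indexed by all
  lists of length p, so that a.s. convergence of F_N makes sense.\<close>
definition disorder :: "nat \<Rightarrow> (nat list \<Rightarrow> real) measure" where
  "disorder p = PiM {is. length is = p} (\<lambda>_. density lborel (normal_density 0 1))"

definition H :: "nat \<Rightarrow> nat \<Rightarrow> (nat list \<Rightarrow> real) \<Rightarrow> (nat \<Rightarrow> real) \<Rightarrow> real" where
  "H p N g \<sigma> = real N powr (- (real p - 1) / 2) *
     (\<Sum>is \<in> idx p N. g is * (\<Prod>j<p. \<sigma> (is ! j)))"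

definition F_N :: "nat \<Rightarrow> nat \<Rightarrow> real \<Rightarrow> (nat list \<Rightarrow> real) \<Rightarrow> real" where
  "F_N p N \<beta> g = (1 / real N) * ln (\<Sum>\<sigma> \<in> Sigma N. 2 powr (- real N) * exp (\<beta> / sqrt 2 * H p N g \<sigma>))"

definition F :: "nat \<Rightarrow> real \<Rightarrow> real" where
  "F p \<beta> = (THE L. AE g in disorder p. (\<lambda>N. F_N p N \<beta> g) \<longlonglongrightarrow> L)"

definition critical_temp :: "nat \<Rightarrow> real" where
  "critical_temp p = Sup {\<beta>. \<beta> > 0 \<and> F p \<beta> = \<beta>\<^sup>2 / 4}"

end

(* The likelihood ratio of T against W is the partition function L normalised to mean one, and its
   mean logarithm is N (F - beta^2/4). The limit F exists because the free energy is
   superadditive up to o(N) errors: along the Guerra-Toninelli interpolation the error terms have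
   a sign once the overlaps are nonnegative, which a small random perturbation enforces through
   the Ghirlanda-Guerra identities (this is needed for odd p). Below the critical temperature the
   relative entropy is o(N): otherwise the posterior overlap with the signal is bounded below up
   to exponentially small probability, the derivative in beta of E sqrt L then forces E sqrt L to
   decay exponentially, and so does exp (E log L / 2). Small entropy makes configurations far from
   the signal negligible under the planted law, and the second moment of L restricted to such
   typical pairs tends to one. Above the critical temperature L is exponentially small under W
   by Gaussian concentration, which separates W from T and makes the posterior itself recover u. *)

theory Submission
  imports Defs
begin

text \<open>Equality F(b) = b^2/4 says only that \<open>ln (L b)\<close> is o(N), while
  indistinguishability asks for L close to 1, and the plain second moment of L can explode where
  that equality still holds. Slack in the parameter bridges the gap. \<open>critical_temp\<close> is
  a supremum, so some b2 above \<open>be\<close> satisfies F(b2) = b2^2/4. At an intermediate b1 the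
  entropy is then o(N), and lowering the signal strength from b1 to \<open>be\<close> costs every
  configuration with macroscopic overlap an exponential factor, so the second moment may be
  restricted to nearly orthogonal pairs. \<open>F\<close> is a definite description, so existence of
  the limit has to be proved before F(b2) carries any information; most of the machinery of replicas
  serves this alone. Positivity of the overlap is proved uniformly over reference weights, so that
  it survives conditioning on all Gaussians outside the perturbation. The noise is handled as
  unsymmetrised i.i.d. standard Gaussians; the likelihood depends on them only through the
  symmetrised tensor, so this computes the laws of W and T themselves.\<close>

section \<open>Products of standard Gaussians: shifts, scalings and reflections\<close>

definition stdn :: "real measure" where
 "stdn = density lborel (normal_density 0 1)"

definition gau :: "'i set => ('i => real) measure" where
 "gau I = PiM I (%_. stdn)"

lemma sets_stdn [simp, measurable_cong]: "sets stdn = sets borel"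
 by (simp add: stdn_def)

lemma space_stdn [simp]: "space stdn = UNIV"
 by (simp add: stdn_def)

lemma prob_space_stdn: "prob_space stdn"
 unfolding stdn_def by (rule prob_space_normal_density) simp

interpretation stdn: prob_space stdn
 by (rule prob_space_stdn)

interpretation stdnP: product_prob_space "%_::'i. stdn" UNIV
 by standard

lemma sets_gau [simp, measurable_cong]: "sets (gau I) = sets (PiM I (%_. borel))"
 unfolding gau_def by (intro sets_PiM_cong) simp_all

lemma space_gau: "space (gau I) = extensional I"
 by (simp add: gau_def space_PiM PiE_UNIV_domain PiE_def)

lemma prob_space_gau: "prob_space (gau I)"
 unfolding gau_def by (intro prob_space_PiM prob_space_stdn)

lemma stdn_nn_integral:
 assumes [measurable]: "f \<in> borel_measurable borel"
 shows "(\<integral>\<^sup>+x. f x \<partial>stdn) = (\<integral>\<^sup>+x. ennreal (normal_density 0 1 x) * f x \<partial>lborel)"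
 unfolding stdn_def by (subst nn_integral_density) auto

lemma stdn_integral:
 fixes f :: "real => real"
 assumes [measurable]: "f \<in> borel_measurable borel"
 shows "(LINT x|stdn. f x) = (LINT x|lborel. normal_density 0 1 x * f x)"
 unfolding stdn_def by (subst integral_density) auto

text \<open>The one-dimensional Cameron-Martin formula, by completing the square after the
  substitution x -> c + x. Nonnegative integrals are used so that the induction over coordinates in
  \<open>gau_shift\<close> runs on Tonelli alone.\<close>

lemma stdn_shift:
 assumes [measurable]: "f \<in> borel_measurable borel"
 shows "(\<integral>\<^sup>+x. f (x + c) \<partial>stdn) = (\<integral>\<^sup>+x. f x * ennreal (exp (c * x - c\<^sup>2 / 2)) \<partial>stdn)"
proof -
 have "(\<integral>\<^sup>+x. f x * ennreal (exp (c * x - c\<^sup>2 / 2)) \<partial>stdn)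
   = (\<integral>\<^sup>+x. ennreal (normal_density 0 1 x) * (f x * ennreal (exp (c * x - c\<^sup>2 / 2))) \<partial>lborel)"
  by (rule stdn_nn_integral) measurable
 also have "... = (\<integral>\<^sup>+x. ennreal (normal_density 0 1 (c + 1 * x)) * (f (c + 1 * x) * ennreal (exp (c * (c + 1 * x) - c\<^sup>2 / 2))) \<partial>lborel)"
  by (subst nn_integral_real_affine[where c=1 and t=c]) auto
 also have "... = (\<integral>\<^sup>+x. ennreal (normal_density 0 1 x) * f (x + c) \<partial>lborel)"
 proof (rule nn_integral_cong)
  fix x :: real
  have "normal_density 0 1 (c + x) * exp (c * (c + x) - c\<^sup>2 / 2) = normal_density 0 1 x"
   by (simp add: std_normal_density_def mult_exp_exp power2_eq_square field_simps)
  then show "ennreal (normal_density 0 1 (c + 1 * x)) * (f (c + 1 * x) * ennreal (exp (c * (c + 1 * x) - c\<^sup>2 / 2)))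
   = ennreal (normal_density 0 1 x) * f (x + c)"
   by (simp add: ac_simps flip: ennreal_mult)
 qed
 also have "... = (\<integral>\<^sup>+x. f (x + c) \<partial>stdn)"
  by (rule stdn_nn_integral[symmetric]) measurable
 finally show ?thesis by simp
qed

lemma stdn_mgf: "(\<integral>\<^sup>+x. ennreal (exp (c * x)) \<partial>stdn) = ennreal (exp (c\<^sup>2 / 2))"
proof -
 have "1 = (\<integral>\<^sup>+x. ennreal (exp (c * x - c\<^sup>2 / 2)) \<partial>stdn)"
  using stdn_shift[of "%_. 1" c] by (simp add: stdn.emeasure_space_1[simplified])
 also have "... = (\<integral>\<^sup>+x. ennreal (exp (- c\<^sup>2 / 2)) * ennreal (exp (c * x)) \<partial>stdn)"
  by (intro nn_integral_cong) (simp flip: ennreal_mult exp_add)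
 also have "... = ennreal (exp (- c\<^sup>2 / 2)) * (\<integral>\<^sup>+x. ennreal (exp (c * x)) \<partial>stdn)"
  by (rule nn_integral_cmult) measurable
 finally have "ennreal (exp (c\<^sup>2 / 2)) * 1 = ennreal (exp (c\<^sup>2 / 2)) * (ennreal (exp (- c\<^sup>2 / 2)) * (\<integral>\<^sup>+x. ennreal (exp (c * x)) \<partial>stdn))"
  by simp
 then show ?thesis
  by (simp add: mult.assoc[symmetric] flip: ennreal_mult exp_add)
qed

lemma stdn_exp:
 shows "integrable stdn (%x. exp (c * x))" "(LINT x|stdn. exp (c * x)) = exp (c\<^sup>2 / 2)"
proof -
 show "integrable stdn (%x. exp (c * x))"
  by (rule integrableI_nn_integral_finite[where x="exp (c\<^sup>2/2)"]) (auto simp: stdn_mgf)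
 show "(LINT x|stdn. exp (c * x)) = exp (c\<^sup>2 / 2)"
  by (subst integral_eq_nn_integral) (auto simp: stdn_mgf)
qed

lemma stdn_exp_abs: "integrable stdn (%x. exp (c * \<bar>x\<bar>))"
proof (rule Bochner_Integration.integrable_bound)
 show "integrable stdn (%x. exp (c * x) + exp ((-c) * x))"
  by (intro Bochner_Integration.integrable_add stdn_exp)
 show "AE x in stdn. norm (exp (c * \<bar>x\<bar>)) <= norm (exp (c * x) + exp ((- c) * x))"
 proof (rule AE_I2)
  fix x :: real
  have "\<not> exp (c * x) + exp (- (c * x)) < 0" by (simp add: not_less add_nonneg_nonneg)
  then show "norm (exp (c * \<bar>x\<bar>)) <= norm (exp (c * x) + exp ((- c) * x))"
   by (simp add: abs_if)
 qed
qed auto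

lemma measurable_gau_restrict [measurable (raw)]:
 assumes "!!i. i \<in> I ==> (%x. f x i) \<in> borel_measurable M"
 shows "(%x. \<lambda>i\<in>I. f x i) \<in> measurable M (gau I)"
 unfolding gau_def by (rule measurable_restrict) (simp add: assms measurable_cong_sets[OF refl sets_stdn])

lemma measurable_gau_component [measurable (raw)]:
 "i \<in> I ==> (%g. g i) \<in> borel_measurable (gau I)"
 by measurable

text \<open>Induction on the index set, using both iterated forms of the product integral: with the
  new coordinate outermost the induction hypothesis shifts the old ones, with it innermost
  \<open>stdn_shift\<close> treats the new one.\<close>

lemma gau_shift:
 assumes I: "finite I" and [measurable]: "h \<in> borel_measurable (gau I)"
 shows "(\<integral>\<^sup>+g. h (\<lambda>i\<in>I. g i + c i) \<partial>gau I) = (\<integral>\<^sup>+g. h g * ennreal (exp (\<Sum>i\<in>I. c i * g i - (c i)\<^sup>2 / 2)) \<partial>gau I)"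
 using assms
proof (induction I arbitrary: h rule: finite_induct)
 case empty
 then show ?case by (simp add: gau_def PiM_empty nn_integral_count_space_finite restrict_def)
next
 case (insert i I)
 have [measurable]: "h \<in> borel_measurable (PiM (insert i I) (%_. borel))"
  using insert.prems by simp
 have [measurable]: "h \<in> borel_measurable (PiM (insert i I) (%_. stdn))"
  using insert.prems by (simp add: gau_def)
 have sI: "space (PiM I (%_. stdn)) = extensional I" by (simp add: space_PiM PiE_def)
 let ?e = "%g. ennreal (exp (\<Sum>j\<in>I. c j * g j - (c j)\<^sup>2 / 2))"
 let ?d = "%y. ennreal (exp (c i * y - (c i)\<^sup>2 / 2))"
 have mu: "(%g. g(i:=y)) \<in> measurable (PiM I (%_. borel)) (PiM (insert i I) (%_. borel))" for y :: real
  by (rule measurable_fun_upd[where J=I]) auto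
 have mu2: "(%y. g(i:=y)) \<in> measurable borel (PiM (insert i I) (%_. borel))" if "g \<in> extensional I" for g :: "'a => real"
  using measurable_component_update[of g I "%_. borel" i] that insert.hyps by (simp add: space_PiM PiE_def)
 have [measurable]: "(%g. g(i := g i + c i)) \<in> measurable (PiM (insert i I) (%_. borel)) (PiM (insert i I) (%_. borel))"
  by (rule measurable_fun_upd[where J="insert i I"]) auto
 have mF: "(%g. h (g(i:=y))) \<in> borel_measurable (gau I)" for y
  using measurable_compose[OF mu, of h borel y] by simp
 have mF2: "(%y. h (g(i:=y))) \<in> borel_measurable borel" if "g \<in> extensional I" for g
  using measurable_compose[OF mu2[OF that], of h borel] by simp
 have "(\<integral>\<^sup>+g. h (\<lambda>j\<in>insert i I. g j + c j) \<partial>gau (insert i I))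
  = (\<integral>\<^sup>+ y. \<integral>\<^sup>+ x. h (\<lambda>j\<in>insert i I. (x(i := y)) j + c j) \<partial>gau I \<partial>stdn)"
  unfolding gau_def using insert.hyps
  by (subst stdnP.product_nn_integral_insert_rev) auto
 also have "... = (\<integral>\<^sup>+ y. \<integral>\<^sup>+ x. h ((\<lambda>j\<in>I. x j + c j)(i := y + c i)) \<partial>gau I \<partial>stdn)"
  using insert.hyps by (intro nn_integral_cong arg_cong[where f=h]) (auto simp: fun_eq_iff restrict_def)
 also have "... = (\<integral>\<^sup>+ y. \<integral>\<^sup>+ x. h (x(i := y + c i)) * ?e x \<partial>gau I \<partial>stdn)"
  by (intro nn_integral_cong insert.IH mF)
 also have "... = (\<integral>\<^sup>+ g. h (g(i := g i + c i)) * ?e g \<partial>gau (insert i I))"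
  unfolding gau_def using insert.hyps
  by (subst stdnP.product_nn_integral_insert_rev) (auto intro!: nn_integral_cong arg_cong2[where f="(*)"] sum.cong arg_cong[where f=ennreal])
 also have "... = (\<integral>\<^sup>+ x. \<integral>\<^sup>+ y. h (x(i := y + c i)) * ?e x \<partial>stdn \<partial>gau I)"
  unfolding gau_def using insert.hyps
  by (subst stdnP.product_nn_integral_insert) (auto intro!: nn_integral_cong arg_cong2[where f="(*)"] sum.cong arg_cong[where f=ennreal])
 also have "... = (\<integral>\<^sup>+ x. \<integral>\<^sup>+ y. h (x(i := y)) * ?e x * ?d y \<partial>stdn \<partial>gau I)"
  by (intro nn_integral_cong stdn_shift) (use mF2 in \<open>auto simp: space_gau\<close>)
 also have "... = (\<integral>\<^sup>+ g. h g * ennreal (exp (\<Sum>j\<in>insert i I. c j * g j - (c j)\<^sup>2 / 2)) \<partial>gau (insert i I))"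
  unfolding gau_def using insert.hyps
 proof (subst stdnP.product_nn_integral_insert, goal_cases)
  case 4
  have "(\<Sum>j\<in>I. c j * (if j = i then y else x j) - (c j)\<^sup>2 / 2) = (\<Sum>j\<in>I. c j * x j - (c j)\<^sup>2 / 2)" for x y
   using insert.hyps by (intro sum.cong) auto
  then show ?case using insert.hyps
   by (simp add: mult.assoc exp_add ennreal_mult ac_simps)
 qed (use insert.hyps in simp_all)
 finally show ?case .
qed

text \<open>As an identity of measures the formula passes to Bochner integrals of every measurable
  function, integrable or not, which is how \<open>gau_shift_integral\<close> obtains it.\<close>

lemma distr_gau_shift:
 assumes I: "finite I"
 shows "distr (gau I) (gau I) (%g. \<lambda>i\<in>I. g i + c i) = density (gau I) (%g. ennreal (exp (\<Sum>i\<in>I. c i * g i - (c i)\<^sup>2 / 2)))"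
proof (rule measure_eqI)
 fix A assume "A \<in> sets (distr (gau I) (gau I) (%g. \<lambda>i\<in>I. g i + c i))"
 then have A [measurable]: "A \<in> sets (gau I)" by simp
 have "emeasure (distr (gau I) (gau I) (%g. \<lambda>i\<in>I. g i + c i)) A
   = (\<integral>\<^sup>+g. indicator A g \<partial>distr (gau I) (gau I) (%g. \<lambda>i\<in>I. g i + c i))"
  by (rule nn_integral_indicator[symmetric]) (simp only: sets_distr A)
 also have "... = (\<integral>\<^sup>+g. indicator A (\<lambda>i\<in>I. g i + c i) \<partial>gau I)"
  by (rule nn_integral_distr) measurable
 also have "... = (\<integral>\<^sup>+g. indicator A g * ennreal (exp (\<Sum>i\<in>I. c i * g i - (c i)\<^sup>2 / 2)) \<partial>gau I)"
  by (rule gau_shift[OF I]) measurable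
 also have "... = emeasure (density (gau I) (%g. ennreal (exp (\<Sum>i\<in>I. c i * g i - (c i)\<^sup>2 / 2)))) A"
  by (subst emeasure_density) (use A in \<open>auto simp: mult.commute\<close>)
 finally show "emeasure (distr (gau I) (gau I) (%g. \<lambda>i\<in>I. g i + c i)) A
  = emeasure (density (gau I) (%g. ennreal (exp (\<Sum>i\<in>I. c i * g i - (c i)\<^sup>2 / 2)))) A" .
qed simp

lemma gau_shift_integral:
 fixes h :: "('i => real) => real"
 assumes I: "finite I" and [measurable]: "h \<in> borel_measurable (gau I)"
 shows "(LINT g|gau I. h (\<lambda>i\<in>I. g i + c i)) = (LINT g|gau I. exp (\<Sum>i\<in>I. c i * g i - (c i)\<^sup>2 / 2) * h g)"
proof -
 have "(LINT g|gau I. h (\<lambda>i\<in>I. g i + c i)) = (LINT g|distr (gau I) (gau I) (%g. \<lambda>i\<in>I. g i + c i). h g)"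
  by (rule integral_distr[symmetric]) measurable
 also have "... = (LINT g|gau I. exp (\<Sum>i\<in>I. c i * g i - (c i)\<^sup>2 / 2) * h g)"
  by (subst distr_gau_shift[OF I], subst integral_density) auto
 finally show ?thesis .
qed

lemma distr_PiM_component_map:
 fixes M N :: "real measure"
 assumes I: "finite I" and M: "prob_space M" and N: "prob_space N" and f [measurable]: "!!i. i \<in> I ==> f i \<in> measurable M N"
  and d: "!!i. i \<in> I ==> distr M N (f i) = N"
 shows "distr (PiM I (%_. M)) (PiM I (%_. N)) (%g. \<lambda>i\<in>I. f i (g i)) = PiM I (%_. N)"
proof -
 interpret M: prob_space M by fact
 interpret N: prob_space N by fact
 interpret PM: product_prob_space "%_::'a. M" UNIV by standard
 interpret PN: product_prob_space "%_::'a. N" UNIV by standard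
 show ?thesis
 proof (rule PN.PiM_eqI[OF I])
  show "sets (distr (PiM I (%_. M)) (PiM I (%_. N)) (%g. \<lambda>i\<in>I. f i (g i))) = sets (PiM I (%_. N))" by simp
  fix A assume A: "!!i. i \<in> I ==> A i \<in> sets N"
  have [measurable]: "Pi\<^sub>E I A \<in> sets (PiM I (%_. N))" by (rule sets_PiM_I_finite[OF I]) (rule A)
  have "emeasure (distr (PiM I (%_. M)) (PiM I (%_. N)) (%g. \<lambda>i\<in>I. f i (g i))) (Pi\<^sub>E I A)
   = emeasure (PiM I (%_. M)) (Pi\<^sub>E I (%i. f i -` A i \<inter> space M))"
   by (subst emeasure_distr, measurable) (auto intro!: arg_cong2[where f=emeasure] simp: space_PiM PiE_def Pi_def)
  also have "... = (\<Prod>i\<in>I. emeasure M (f i -` A i \<inter> space M))"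
   by (rule PM.emeasure_PiM[OF I]) (use A in auto)
  also have "... = (\<Prod>i\<in>I. emeasure N (A i))"
   by (intro prod.cong refl) (metis A d emeasure_distr f)
  finally show "emeasure (distr (PiM I (%_. M)) (PiM I (%_. N)) (%g. \<lambda>i\<in>I. f i (g i))) (Pi\<^sub>E I A) = (\<Prod>i\<in>I. emeasure N (A i))" .
 qed
qed

text \<open>The absolute value lets one statement serve both the rescaling of the noise to variance
  2 / N and the sign flips behind the gauge symmetry of the signals.\<close>

lemma distr_normal_scale:
 assumes s: "s ~= 0"
 shows "distr stdn (density lborel (normal_density 0 \<bar>s\<bar>)) ((*) s) = density lborel (normal_density 0 \<bar>s\<bar>)"
proof -
 have "distributed stdn lborel (%x. x) (normal_density 0 1)"
  unfolding distributed_def by (auto simp: stdn_def distr_id2)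
 from stdn.normal_density_affine[OF this, of s 0] s
 have "distributed stdn lborel (%x. s * x) (normal_density 0 \<bar>s\<bar>)" by simp
 then have "distr stdn lborel (%x. s * x) = density lborel (normal_density 0 \<bar>s\<bar>)"
  by (simp add: distributed_def)
 moreover have "distr stdn (density lborel (normal_density 0 \<bar>s\<bar>)) ((*) s) = distr stdn lborel (%x. s * x)"
  by (rule distr_cong) auto
 ultimately show ?thesis by simp
qed

lemma distr_gau_scale:
 assumes I: "finite I" and s: "s > 0"
 shows "distr (gau I) (PiM I (%_. density lborel (normal_density 0 s))) (%g. \<lambda>i\<in>I. s * g i)
  = PiM I (%_. density lborel (normal_density 0 s))"
 unfolding gau_def
 by (rule distr_PiM_component_map[OF I prob_space_stdn prob_space_normal_density])
  (use distr_normal_scale[of s] s in auto)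

lemma distr_gau_sign:
 assumes I: "finite I" and s: "!!i. i \<in> I ==> \<bar>s i\<bar> = 1"
 shows "distr (gau I) (gau I) (%g. \<lambda>i\<in>I. s i * g i) = gau I"
 unfolding gau_def
proof (rule distr_PiM_component_map[OF I prob_space_stdn prob_space_stdn])
 fix i assume "i \<in> I"
 then have 1: "\<bar>s i\<bar> = 1" using s by auto
 then show "distr stdn stdn ((*) (s i)) = stdn"
  using distr_normal_scale[of "s i"] by (auto simp: stdn_def)
qed auto

lemma gau_sign_integral:
 fixes h :: "('i => real) => real"
 assumes I: "finite I" and s: "!!i. i \<in> I ==> \<bar>s i\<bar> = 1" and [measurable]: "h \<in> borel_measurable (gau I)"
 shows "(LINT g|gau I. h (\<lambda>i\<in>I. s i * g i)) = (LINT g|gau I. h g)"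
proof -
 have "(LINT g|gau I. h (\<lambda>i\<in>I. s i * g i)) = (LINT g|distr (gau I) (gau I) (%g. \<lambda>i\<in>I. s i * g i). h g)"
  by (rule integral_distr[symmetric]) measurable
 then show ?thesis by (simp add: distr_gau_sign[OF I s])
qed

section \<open>Functions of exponential growth and their integrability\<close>

definition l1 :: "'i set => ('i => real) => real" where
 "l1 I g = (\<Sum>i\<in>I. \<bar>g i\<bar>)"

lemma l1_nonneg [simp]: "0 <= l1 I g"
 by (simp add: l1_def sum_nonneg)

lemma measurable_l1 [measurable]: "l1 I \<in> borel_measurable (gau I)"
 unfolding l1_def[abs_def] by measurable

text \<open>A growth class closed under sums, products and Gibbs averages that contains coordinates,
  log-partition functions and likelihoods and consists of integrable functions; integrability then
  follows from the shape of an expression. The bound is asked only on \<open>extensional I\<close>,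
  the space of the product measure.\<close>

definition expb :: "'i set => (('i => real) => real) => bool" where
 "expb I f \<longleftrightarrow> f \<in> borel_measurable (gau I) \<and>
  (\<exists>C\<ge>0. \<exists>c\<ge>0. \<forall>g\<in>extensional I. \<bar>f g\<bar> <= C * exp (c * l1 I g))"

lemma expbI:
 assumes "f \<in> borel_measurable (gau I)"
  and "!!g. g \<in> extensional I ==> \<bar>f g\<bar> <= C * exp (c * l1 I g)"
 shows "expb I f"
proof -
 have "\<bar>f g\<bar> <= max C 0 * exp (max c 0 * l1 I g)" if "g \<in> extensional I" for g
 proof -
  have "\<bar>f g\<bar> <= C * exp (c * l1 I g)" using that by (rule assms)
  also have "... <= max C 0 * exp (max c 0 * l1 I g)"
   by (intro mult_mono) (auto intro: mult_right_mono)
  finally show ?thesis .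
 qed
 then show ?thesis
  using assms(1) unfolding expb_def by (meson max.cobounded2)
qed

lemma expb_measurable [measurable_dest]: "expb I f ==> f \<in> borel_measurable (gau I)"
 by (simp add: expb_def)

lemma expb_bounded:
 assumes "f \<in> borel_measurable (gau I)" "!!g. g \<in> extensional I ==> \<bar>f g\<bar> <= B"
 shows "expb I f"
 by (rule expbI[where C=B and c=0]) (use assms in auto)

lemma expb_const [simp]: "expb I (%_. a)"
 by (rule expb_bounded) auto

lemma expb_mono:
 assumes "expb I h" "f \<in> borel_measurable (gau I)" "!!g. g \<in> extensional I ==> \<bar>f g\<bar> <= \<bar>h g\<bar>"
 shows "expb I f"
proof -
 from assms(1) obtain C c where "C >= 0" "c >= 0" "!!g. g \<in> extensional I ==> \<bar>h g\<bar> <= C * exp (c * l1 I g)"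
  unfolding expb_def by blast
 with assms(3) show ?thesis by (intro expbI[OF assms(2), of C c]) (meson order_trans)
qed

lemma expb_add:
 assumes "expb I f" "expb I h"
 shows "expb I (%g. f g + h g)"
proof -
 from assms obtain C c C' c' where *: "C >= 0" "c >= 0" "!!g. g \<in> extensional I ==> \<bar>f g\<bar> <= C * exp (c * l1 I g)"
  "C' >= 0" "c' >= 0" "!!g. g \<in> extensional I ==> \<bar>h g\<bar> <= C' * exp (c' * l1 I g)"
  unfolding expb_def by blast
 show ?thesis
 proof (rule expbI)
  fix g :: "'a => real" assume g: "g \<in> extensional I"
  have "\<bar>f g + h g\<bar> <= \<bar>f g\<bar> + \<bar>h g\<bar>" by simp
  also have "... <= C * exp (c * l1 I g) + C' * exp (c' * l1 I g)"
   using *(3)[OF g] *(6)[OF g] by simp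
  also have "... <= C * exp ((c + c') * l1 I g) + C' * exp ((c + c') * l1 I g)"
   using * by (intro add_mono mult_left_mono) (auto intro: mult_right_mono)
  finally show "\<bar>f g + h g\<bar> <= (C + C') * exp ((c + c') * l1 I g)" by (simp add: algebra_simps)
 qed (use assms in measurable)
qed

lemma expb_mult:
 assumes "expb I f" "expb I h"
 shows "expb I (%g. f g * h g)"
proof -
 from assms obtain C c C' c' where *: "C >= 0" "c >= 0" "!!g. g \<in> extensional I ==> \<bar>f g\<bar> <= C * exp (c * l1 I g)"
  "C' >= 0" "c' >= 0" "!!g. g \<in> extensional I ==> \<bar>h g\<bar> <= C' * exp (c' * l1 I g)"
  unfolding expb_def by blast
 show ?thesis
 proof (rule expbI)
  fix g :: "'a => real" assume g: "g \<in> extensional I"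
  have "\<bar>f g * h g\<bar> = \<bar>f g\<bar> * \<bar>h g\<bar>" by (simp add: abs_mult)
  also have "... <= (C * exp (c * l1 I g)) * (C' * exp (c' * l1 I g))"
   using *(3)[OF g] *(6)[OF g] * by (intro mult_mono) auto
  finally show "\<bar>f g * h g\<bar> <= (C * C') * exp ((c + c') * l1 I g)"
   by (simp add: algebra_simps exp_add)
 qed (use assms in measurable)
qed

lemma expb_cmult: "expb I f ==> expb I (%g. a * f g)"
 by (intro expb_mult expb_const)

lemma expb_diff: "expb I f ==> expb I h ==> expb I (%g. f g - h g)"
 using expb_add[of I f "%g. (-1) * h g"] expb_cmult[of I h "-1"] by simp

lemma expb_sum: "(!!x. x \<in> A ==> expb I (f x)) ==> expb I (%g. \<Sum>x\<in>A. f x g)"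
 by (induction A rule: infinite_finite_induct) (auto intro: expb_add)

lemma expb_abs: "expb I f ==> expb I (%g. \<bar>f g\<bar>)"
 by (rule expb_mono) auto

lemma expb_component:
 assumes "finite I" "i \<in> I"
 shows "expb I (%g. g i)"
proof (rule expbI[where C=1 and c=1])
 fix g :: "'a => real"
 have "\<bar>g i\<bar> <= l1 I g" unfolding l1_def using assms by (intro member_le_sum) auto
 also have "... <= exp (l1 I g)" using exp_ge_add_one_self[of "l1 I g"] by linarith
 finally show "\<bar>g i\<bar> <= 1 * exp (1 * l1 I g)" by simp
qed (use assms in measurable)

lemma linear_le_l1:
 assumes "finite I" "!!i. i \<in> I ==> \<bar>a i\<bar> <= A"
 shows "\<bar>\<Sum>i\<in>I. a i * g i\<bar> <= A * l1 I g"
proof -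
 have "\<bar>\<Sum>i\<in>I. a i * g i\<bar> <= (\<Sum>i\<in>I. \<bar>a i\<bar> * \<bar>g i\<bar>)" by (rule order_trans[OF sum_abs]) (simp add: abs_mult)
 also have "... <= (\<Sum>i\<in>I. A * \<bar>g i\<bar>)" by (intro sum_mono mult_right_mono assms) auto
 finally show ?thesis by (simp add: l1_def sum_distrib_left)
qed

lemma expb_exp_linear:
 assumes I: "finite I"
 shows "expb I (%g. exp (\<Sum>i\<in>I. a i * g i))"
proof (rule expbI[where C=1 and c="\<Sum>i\<in>I. \<bar>a i\<bar>"])
 fix g :: "'a => real"
 have "\<bar>\<Sum>i\<in>I. a i * g i\<bar> <= (\<Sum>i\<in>I. \<bar>a i\<bar>) * l1 I g"
  using I by (intro linear_le_l1 member_le_sum) auto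
 then show "\<bar>exp (\<Sum>i\<in>I. a i * g i)\<bar> <= 1 * exp ((\<Sum>i\<in>I. \<bar>a i\<bar>) * l1 I g)" by simp
qed measurable

text \<open>The dominating function exp (c * l1) factorises over the coordinates into functions with
  finite Gaussian integral.\<close>

lemma expb_integrable:
 assumes I: "finite I" and f: "expb I f"
 shows "integrable (gau I) f"
proof -
 from f obtain C c where C: "C >= 0" "c >= 0" "!!g. g \<in> extensional I ==> \<bar>f g\<bar> <= C * exp (c * l1 I g)"
  unfolding expb_def by blast
 have "integrable (PiM I (%_. stdn)) (%g. \<Prod>i\<in>I. exp (c * \<bar>g i\<bar>))"
  by (intro stdnP.product_integrable_prod I stdn_exp_abs)
 then have "integrable (gau I) (%g. C * exp (c * l1 I g))"
  by (simp add: gau_def l1_def sum_distrib_left exp_sum I)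
 then show ?thesis
  by (rule Bochner_Integration.integrable_bound) (use C f in \<open>auto simp: space_gau expb_def\<close>)
qed

lemma measurable_gau_fiber:
 assumes "h \<in> borel_measurable (gau (insert i I))" "i \<notin> I" "g \<in> extensional I"
 shows "(%y. h (g(i:=y))) \<in> borel_measurable borel"
proof -
 have "(%y. g(i:=y)) \<in> measurable borel (PiM (insert i I) (%_. borel))"
  using measurable_component_update[of g I "%_. borel" i] assms by (simp add: space_PiM PiE_def)
 from measurable_compose[OF this, of h borel] assms show ?thesis by simp
qed

text \<open>Growth along one coordinate line, in the form demanded by the one-dimensional
  integration by parts; the other coordinates are absorbed into the constant.\<close>

lemma expb_fiber:
 assumes f: "expb (insert i I) f" and i: "finite I" "i \<notin> I" and g: "g \<in> extensional I"
 shows "\<exists>C c. 0 <= C \<and> 0 <= c \<and> (\<forall>x. \<bar>f (g(i:=x))\<bar> <= C * exp (c * \<bar>x\<bar>))"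
proof -
 from f obtain C c where C: "C >= 0" "c >= 0" "!!g. g \<in> extensional (insert i I) ==> \<bar>f g\<bar> <= C * exp (c * l1 (insert i I) g)"
  unfolding expb_def by blast
 have "\<bar>f (g(i:=x))\<bar> <= (C * exp (c * l1 I g)) * exp (c * \<bar>x\<bar>)" for x
 proof -
  have "g(i:=x) \<in> extensional (insert i I)" using g by (auto simp: extensional_def)
  then have "\<bar>f (g(i:=x))\<bar> <= C * exp (c * l1 (insert i I) (g(i:=x)))" by (rule C)
  moreover have "l1 (insert i I) (g(i:=x)) = \<bar>x\<bar> + l1 I g"
   unfolding l1_def using i by (auto intro!: sum.cong)
  ultimately show ?thesis by (simp add: distrib_left exp_add mult_ac del: fun_upd_apply)
 qed
 with C show ?thesis by (intro exI[of _ "C * exp (c * l1 I g)"] exI[of _ c]) auto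
qed

section \<open>Gaussian integration by parts\<close>

lemma stdn_exp_bound_integrable:
 fixes f :: "real => real"
 assumes [measurable]: "f \<in> borel_measurable borel" and "!!x. \<bar>f x\<bar> <= C * exp (c * \<bar>x\<bar>)"
 shows "integrable stdn f"
proof (rule Bochner_Integration.integrable_bound)
 show "integrable stdn (%x. C * exp (c * \<bar>x\<bar>))" by (intro integrable_mult_right stdn_exp_abs)
 show "AE x in stdn. norm (f x) <= norm (C * exp (c * \<bar>x\<bar>))"
 proof (rule AE_I2)
  fix x show "norm (f x) <= norm (C * exp (c * \<bar>x\<bar>))"
   using assms(2)[of x] by (simp del: abs_mult)
 qed
qed simp

lemma x_le_exp_abs: "\<bar>x\<bar> <= exp \<bar>x :: real\<bar>"
 using exp_ge_add_one_self[of "\<bar>x\<bar>"] by linarith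

lemma normal_density_exp_tendsto:
 assumes "!!x. \<bar>f x\<bar> <= C * exp (c * \<bar>x\<bar>)"
 shows "((%x. normal_density 0 1 x * f x) \<longlongrightarrow> 0) at_top" (is ?A)
  and "((%x. normal_density 0 1 x * f x) \<longlongrightarrow> 0) at_bot" (is ?B)
proof -
 have C: "C >= 0" using assms[of 0] by auto
 have b: "norm (normal_density 0 1 x * f x) <= exp (- (x\<^sup>2) / 4) * (C * exp (c\<^sup>2))" for x :: real
 proof -
  \<comment> \<open>Spends half of the Gaussian exponent x^2 / 2 on the growth c * |x|, leaving the
    decay exp (-x^2 / 4).\<close>
  have "0 <= (\<bar>x\<bar> / 2 - c)\<^sup>2" by simp
  then have 1: "c * \<bar>x\<bar> <= c\<^sup>2 + x\<^sup>2 / 4" by (simp add: power2_eq_square algebra_simps)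
  have "1 <= sqrt (2 * pi)" using pi_gt3 by simp
  then have "normal_density 0 1 x <= exp (- (x\<^sup>2) / 2)"
   unfolding std_normal_density_def by (intro mult_left_le_one_le) (auto simp: divide_le_eq)
  then have "norm (normal_density 0 1 x * f x) <= exp (- (x\<^sup>2) / 2) * (C * exp (c\<^sup>2 + x\<^sup>2 / 4))"
   unfolding norm_mult using assms[of x] C 1
   by (intro mult_mono) (auto intro: order_trans mult_left_mono)
  also have "... = C * exp (- (x\<^sup>2) / 2 + (c\<^sup>2 + x\<^sup>2 / 4))" by (simp only: exp_add mult_ac)
  also have "- (x\<^sup>2) / 2 + (c\<^sup>2 + x\<^sup>2 / 4) = - (x\<^sup>2) / 4 + c\<^sup>2" by simp
  also have "C * exp (- (x\<^sup>2) / 4 + c\<^sup>2) = exp (- (x\<^sup>2) / 4) * (C * exp (c\<^sup>2))" by (simp only: exp_add mult_ac)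
  finally show ?thesis .
 qed
 have e: "((%x::real. exp (- (x\<^sup>2) / 4) * (C * exp (c\<^sup>2))) \<longlongrightarrow> 0) l"
  if "filterlim (%x::real. x\<^sup>2) at_top l" for l
 proof (rule tendsto_mult_left_zero)
  have "filterlim (%x::real. (1/4) * x\<^sup>2) at_top l"
   by (rule filterlim_tendsto_pos_mult_at_top[OF tendsto_const _ that]) simp
  then have "filterlim (%x::real. - (x\<^sup>2) / 4) at_bot l"
   by (simp add: filterlim_uminus_at_top)
  then show "((%x::real. exp (- (x\<^sup>2) / 4)) \<longlongrightarrow> 0) l"
   by (rule filterlim_compose[OF exp_at_bot])
 qed
 have 1: "((%x::real. exp (- (x\<^sup>2) / 4) * (C * exp (c\<^sup>2))) \<longlongrightarrow> 0) at_top"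
  by (intro e filterlim_pow_at_top filterlim_ident) simp
 have 2: "((%x::real. exp (- (x\<^sup>2) / 4) * (C * exp (c\<^sup>2))) \<longlongrightarrow> 0) at_bot"
  using filterlim_pow_at_top[OF _ filterlim_uminus_at_top_at_bot, of 2] by (intro e) simp
 show ?A by (rule Lim_null_comparison[OF _ 1]) (use b in auto)
 show ?B by (rule Lim_null_comparison[OF _ 2]) (use b in auto)
qed

text \<open>The density satisfies p' = -x * p, so p * f' - p * (x * f) is the derivative of p * f,
  which vanishes at both infinities; the fundamental theorem on the whole line gives the
  identity.\<close>

lemma stdn_ibp:
 fixes f f' :: "real => real"
 assumes d: "!!x. (f has_real_derivative f' x) (at x)" and c: "continuous_on UNIV f'"
  and b: "!!x. \<bar>f x\<bar> <= C * exp (c * \<bar>x\<bar>)" and b': "!!x. \<bar>f' x\<bar> <= C' * exp (c' * \<bar>x\<bar>)"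
 shows "(LINT x|stdn. x * f x) = (LINT x|stdn. f' x)"
proof -
 have cf: "continuous_on UNIV f" using d by (meson DERIV_continuous_on has_field_derivative_at_within)
 have [measurable]: "f \<in> borel_measurable borel" "f' \<in> borel_measurable borel"
  using cf c by (auto intro: borel_measurable_continuous_onI)
 have i1: "integrable stdn f'" by (rule stdn_exp_bound_integrable[OF _ b']) measurable
 have i2: "integrable stdn (%x. x * f x)"
 proof (rule stdn_exp_bound_integrable)
  fix x :: real
  have "C >= 0" using b[of 0] by auto
  have "\<bar>x * f x\<bar> <= exp \<bar>x\<bar> * (C * exp (c * \<bar>x\<bar>))"
   unfolding abs_mult using b[of x] x_le_exp_abs[of x] by (intro mult_mono) auto
  then show "\<bar>x * f x\<bar> <= C * exp ((c + 1) * \<bar>x\<bar>)" by (simp add: algebra_simps exp_add)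
 qed measurable
 let ?p = "normal_density 0 1 :: real => real"
 have dp: "(?p has_real_derivative - x * ?p x) (at x)" for x
  unfolding std_normal_density_def[abs_def] by (auto intro!: derivative_eq_intros simp: field_simps)
 have il: "integrable lborel (%x. ?p x * f' x - ?p x * (x * f x))"
  using i1 i2 unfolding stdn_def
  by (intro Bochner_Integration.integrable_diff) (auto simp: integrable_density)
 have "(LBINT x=-\<infinity>..\<infinity>. ?p x * f' x - ?p x * (x * f x)) = 0 - 0"
 proof (rule interval_integral_FTC_integrable[where F="%x. ?p x * f x"])
  fix x
  show "((%x. ?p x * f x) has_vector_derivative ?p x * f' x - ?p x * (x * f x)) (at x)"
   unfolding has_real_derivative_iff_has_vector_derivative[symmetric]
   by (rule derivative_eq_intros dp d | simp)+
  have "isCont ?p x" using dp by (rule DERIV_isCont)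
  moreover have "isCont f x" using d by (rule DERIV_isCont)
  moreover have "isCont f' x" using c by (simp add: continuous_on_eq_continuous_at)
  ultimately show "isCont (%x. ?p x * f' x - ?p x * (x * f x)) x"
   by (intro continuous_intros)
 next
  show "set_integrable lborel (einterval (- \<infinity>) \<infinity>) (%x. ?p x * f' x - ?p x * (x * f x))"
   using il by (simp add: set_integrable_def)
  show "(((%x. ?p x * f x) \<circ> real_of_ereal) \<longlongrightarrow> 0) (at_right (- \<infinity>))"
   using normal_density_exp_tendsto(2)[OF b] by (simp add: ereal_tendsto_simps)
  show "(((%x. ?p x * f x) \<circ> real_of_ereal) \<longlongrightarrow> 0) (at_left \<infinity>)"
   using normal_density_exp_tendsto(1)[OF b] by (simp add: ereal_tendsto_simps)
 qed simp
 then have "(LINT x|lborel. ?p x * f' x - ?p x * (x * f x)) = 0"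
  by (simp add: interval_lebesgue_integral_def set_lebesgue_integral_def)
 also have "(LINT x|lborel. ?p x * f' x - ?p x * (x * f x)) = (LINT x|lborel. ?p x * f' x) - (LINT x|lborel. ?p x * (x * f x))"
  using i1 i2 unfolding stdn_def
  by (intro Bochner_Integration.integral_diff) (auto simp: integrable_density)
 finally show ?thesis by (simp add: stdn_integral)
qed

lemma gau_integral_insert:
 fixes f :: "('i => real) => real"
 assumes "finite I" "i \<notin> I" "integrable (gau (insert i I)) f"
 shows "(LINT g|gau (insert i I). f g) = (LINT g|gau I. (LINT x|stdn. f (g(i:=x))))"
 using stdnP.product_integral_insert[of I i f] assms by (simp add: gau_def)

lemma gau_ibp:
 fixes f f' :: "('i => real) => real"
 assumes I: "finite I" "i \<in> I" and f: "expb I f" and f': "expb I f'"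
  and d: "!!g x. ((%x. f (g(i:=x))) has_real_derivative f' (g(i:=x))) (at x)"
  and c: "!!g. continuous_on UNIV (%x. f' (g(i:=x)))"
 shows "(LINT g|gau I. g i * f g) = (LINT g|gau I. f' g)"
proof -
 define J where "J = I - {i}"
 have J: "I = insert i J" "i \<notin> J" "finite J" using I by (auto simp: J_def)
 have "(LINT g|gau I. g i * f g) = (LINT g|gau J. (LINT x|stdn. (g(i:=x)) i * f (g(i:=x))))"
  unfolding J(1) by (rule gau_integral_insert)
   (use J expb_integrable[OF I(1) expb_mult[OF expb_component[OF I] f]] in auto)
 also have "... = (LINT g|gau J. (LINT x|stdn. f' (g(i:=x))))"
 proof (rule Bochner_Integration.integral_cong[OF refl])
  fix g assume "g \<in> space (gau J)"
  then have g: "g \<in> extensional J" by (simp add: space_gau)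
  obtain C c where b: "!!x. \<bar>f (g(i:=x))\<bar> <= C * exp (c * \<bar>x\<bar>)"
   using expb_fiber[OF f[unfolded J(1)] J(3,2) g] by blast
  obtain C' c' where b': "!!x. \<bar>f' (g(i:=x))\<bar> <= C' * exp (c' * \<bar>x\<bar>)"
   using expb_fiber[OF f'[unfolded J(1)] J(3,2) g] by blast
  show "(LINT x|stdn. (g(i:=x)) i * f (g(i:=x))) = (LINT x|stdn. f' (g(i:=x)))"
   using stdn_ibp[OF d c b b'] by simp
 qed
 also have "... = (LINT g|gau I. f' g)"
  unfolding J(1) by (rule gau_integral_insert[symmetric])
   (use J expb_integrable[OF I(1) f'] in auto)
 finally show ?thesis .
qed

section \<open>Gaussian concentration and differentiation under the integral\<close>

text \<open>Symmetrisation: Jensen bounds exp (-s * E h) by B, so the centred exponential moment is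
  at most A * B, the mean of exp (s * (h x - h y)) over independent x and y. Averaging with the
  roles exchanged turns this into a cosh, which the Lipschitz bound compares with cosh (s * c * (x -
  y)). The exponent is twice the optimal one, which affects only constants.\<close>

lemma stdn_conc:
 fixes h :: "real => real"
 assumes [measurable]: "h \<in> borel_measurable borel" and lip: "!!x y. \<bar>h x - h y\<bar> <= c * \<bar>x - y\<bar>"
 shows "integrable stdn h" "integrable stdn (%x. exp (s * h x))"
  "(LINT x|stdn. exp (s * (h x - (LINT y|stdn. h y)))) <= exp (s\<^sup>2 * c\<^sup>2)"
proof -
 have hb: "\<bar>h x\<bar> <= \<bar>h 0\<bar> + c * \<bar>x\<bar>" for x using lip[of x 0] by simp
 have c0: "c >= 0" using lip[of 1 0] by auto
 show ih: "integrable stdn h"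
 proof (rule stdn_exp_bound_integrable)
  fix x
  have "\<bar>h x\<bar> <= \<bar>h 0\<bar> * exp \<bar>x\<bar> + c * exp \<bar>x\<bar>"
  proof (rule order_trans[OF hb], rule add_mono)
   show "\<bar>h 0\<bar> <= \<bar>h 0\<bar> * exp \<bar>x\<bar>" by (simp add: mult_le_cancel_left1)
   show "c * \<bar>x\<bar> <= c * exp \<bar>x\<bar>" by (rule mult_left_mono[OF x_le_exp_abs c0])
  qed
  then show "\<bar>h x\<bar> <= (\<bar>h 0\<bar> + c) * exp (1 * \<bar>x\<bar>)" by (simp add: algebra_simps)
 qed measurable
 have ie: "integrable stdn (%x. exp (s * h x))" for s
 proof (rule stdn_exp_bound_integrable)
  fix x
  have "s * h x <= \<bar>s\<bar> * (\<bar>h 0\<bar> + c * \<bar>x\<bar>)"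
   using hb[of x] by (metis abs_ge_self abs_ge_zero abs_mult mult_left_mono order_trans)
  then show "\<bar>exp (s * h x)\<bar> <= exp (\<bar>s\<bar> * \<bar>h 0\<bar>) * exp ((\<bar>s\<bar> * c) * \<bar>x\<bar>)"
   by (simp add: exp_add[symmetric] algebra_simps)
 qed measurable
 then show "integrable stdn (%x. exp (s * h x))" .
 define m where "m = (LINT y|stdn. h y)"
 define A where "A = (LINT x|stdn. exp (s * h x))"
 define B where "B = (LINT x|stdn. exp (- s * h x))"
 have "A >= 0" by (auto simp: A_def)
 have "exp (- s * m) <= B"
 proof -
  have "exp (- s * m) = (LINT x|stdn. exp (- s * m) * (1 + - s * (h x - m)))"
   using ih by (simp add: m_def stdn.prob_space[simplified] right_diff_distrib)
  also have "... <= (LINT x|stdn. exp (- s * m) * exp (- s * (h x - m)))"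
  proof (rule integral_mono)
   show "integrable stdn (%x. exp (- s * m) * (1 + - s * (h x - m)))" using ih by auto
   have "(%x. exp (- s * m) * exp (- s * (h x - m))) = (%x. exp ((-s) * h x))"
    by (auto simp: exp_add[symmetric] algebra_simps)
   then show "integrable stdn (%x. exp (- s * m) * exp (- s * (h x - m)))" using ie[of "-s"] by simp
   fix x show "exp (- s * m) * (1 + - s * (h x - m)) <= exp (- s * m) * exp (- s * (h x - m))"
    by (intro mult_left_mono exp_ge_add_one_self) auto
  qed
  also have "... = B" unfolding B_def by (auto simp: exp_add[symmetric] algebra_simps intro!: Bochner_Integration.integral_cong)
  finally show ?thesis .
 qed
 then have 1: "A * exp (- s * m) <= A * B" using \<open>A >= 0\<close> by (intro mult_left_mono)
 have e1: "(LINT x|stdn. exp (a * x) * b) = exp (a\<^sup>2/2) * b" for a b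
  using stdn_exp[of a] by simp
 have ii: "integrable stdn (%y. exp (a * h x) * exp (b * h y))" for a b x by (intro integrable_mult_right ie)
 have ij: "integrable stdn (%y. exp (a * x) * exp (b * y))" for a b x :: real
  by (intro integrable_mult_right stdn_exp)
 have "2 * (A * B) = A * B + B * A" by simp
 also have "... = (LINT x|stdn. exp (s * h x) * B + exp (- s * h x) * A)"
  using ie[of s] ie[of "-s"] by (subst Bochner_Integration.integral_add) (simp_all add: A_def B_def)
 also have "... = (LINT x|stdn. (LINT y|stdn. exp (s * h x) * exp (- s * h y) + exp (- s * h x) * exp (s * h y)))"
  using ie[of s] ie[of "-s"]
  by (intro Bochner_Integration.integral_cong refl, subst Bochner_Integration.integral_add) (simp_all add: A_def B_def)
 also have "... <= (LINT x|stdn. (LINT y|stdn. exp (s * c * x) * exp (- (s * c) * y) + exp (- (s * c) * x) * exp (s * c * y)))"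
 proof (rule integral_mono)
  show "integrable stdn (%x. \<integral>y. exp (s * h x) * exp (- s * h y) + exp (- s * h x) * exp (s * h y) \<partial>stdn)"
  proof -
   have "(LINT y|stdn. exp (s * h x) * exp (- s * h y) + exp (- s * h x) * exp (s * h y)) = exp (s * h x) * B + exp (- s * h x) * A" for x
    using ie[of s] ie[of "-s"]
    by (subst Bochner_Integration.integral_add) (simp_all add: A_def B_def)
   moreover have "integrable stdn (%x. exp (s * h x) * B + exp (- s * h x) * A)"
    using ie[of s] ie[of "-s"] by simp
   ultimately show ?thesis by (simp only:)
  qed
  have ejy: "(LINT y|stdn. exp (s * c * x) * exp (- (s * c) * y) + exp (- (s * c) * x) * exp (s * c * y))
   = exp (s * c * x) * exp ((s*c)\<^sup>2/2) + exp (- (s * c) * x) * exp ((s*c)\<^sup>2/2)" for x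
   using stdn_exp[of "s*c"] stdn_exp[of "-(s*c)"]
   by (subst Bochner_Integration.integral_add) simp_all
  show "integrable stdn (%x. \<integral>y. exp (s * c * x) * exp (- (s * c) * y) + exp (- (s * c) * x) * exp (s * c * y) \<partial>stdn)"
   unfolding ejy using stdn_exp[of "s*c"] stdn_exp[of "-(s*c)"] by simp
  fix x
  show "(LINT y|stdn. exp (s * h x) * exp (- s * h y) + exp (- s * h x) * exp (s * h y))
   <= (LINT y|stdn. exp (s * c * x) * exp (- (s * c) * y) + exp (- (s * c) * x) * exp (s * c * y))"
  proof (rule integral_mono)
   show "integrable stdn (%y. exp (s * h x) * exp (- s * h y) + exp (- s * h x) * exp (s * h y))"
    by (intro Bochner_Integration.integrable_add ii)
   show "integrable stdn (%y. exp (s * c * x) * exp (- (s * c) * y) + exp (- (s * c) * x) * exp (s * c * y))"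
    by (intro Bochner_Integration.integrable_add ij)
   fix y
   have "\<bar>s * (h x - h y)\<bar> <= \<bar>s * c * (x - y)\<bar>"
    using lip[of x y] c0 by (simp add: abs_mult mult.assoc mult_left_mono)
   then have "cosh (s * (h x - h y)) <= cosh (s * c * (x - y))"
    by (metis cosh_real_abs cosh_real_nonneg_le_iff abs_ge_zero)
   then show "exp (s * h x) * exp (- s * h y) + exp (- s * h x) * exp (s * h y)
    <= exp (s * c * x) * exp (- (s * c) * y) + exp (- (s * c) * x) * exp (s * c * y)"
    by (simp add: cosh_field_def exp_add[symmetric] algebra_simps)
  qed
 qed
 also have "... = 2 * exp (s\<^sup>2 * c\<^sup>2)"
 proof -
  have "(LINT y|stdn. exp (s * c * x) * exp (- (s * c) * y) + exp (- (s * c) * x) * exp (s * c * y))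
   = exp (s * c * x) * exp ((s*c)\<^sup>2/2) + exp (- (s * c) * x) * exp ((s*c)\<^sup>2/2)" for x
   using stdn_exp[of "s*c"] stdn_exp[of "-(s*c)"]
   by (subst Bochner_Integration.integral_add) simp_all
  then have "(LINT x|stdn. (LINT y|stdn. exp (s * c * x) * exp (- (s * c) * y) + exp (- (s * c) * x) * exp (s * c * y)))
   = (LINT x|stdn. exp (s * c * x) * exp ((s*c)\<^sup>2/2) + exp (- (s * c) * x) * exp ((s*c)\<^sup>2/2))"
   by (simp only:)
  also have "... = exp ((s*c)\<^sup>2/2) * exp ((s*c)\<^sup>2/2) + exp ((s*c)\<^sup>2/2) * exp ((s*c)\<^sup>2/2)"
   using stdn_exp[of "s*c"] stdn_exp[of "-(s*c)"]
   by (subst Bochner_Integration.integral_add) simp_all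
  also have "... = 2 * exp (s\<^sup>2 * c\<^sup>2)"
   by (simp add: mult_exp_exp power_mult_distrib)
  finally show ?thesis .
 qed
 finally have "A * B <= exp (s\<^sup>2 * c\<^sup>2)" by simp
 moreover have "(LINT x|stdn. exp (s * (h x - m))) = A * exp (- s * m)"
 proof -
  have "(%x. exp (s * (h x - m))) = (%x. exp (s * h x) * exp (- s * m))"
   by (simp add: mult_exp_exp algebra_simps)
  then show ?thesis by (simp add: A_def)
 qed
 ultimately show "(LINT x|stdn. exp (s * (h x - (LINT y|stdn. h y)))) <= exp (s\<^sup>2 * c\<^sup>2)"
  using 1 by (simp add: m_def)
qed

text \<open>The mean value theorem bounds the difference quotients by B, so dominated convergence
  applies along every sequence tending to t.\<close>

lemma has_real_derivative_lebesgue_integral: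
 fixes f f' :: "real => 'a => real"
 assumes t: "t \<in> {lo<..<hi}"
  and i: "!!s. s \<in> {lo<..<hi} ==> integrable M (f s)"
  and d: "!!s x. s \<in> {lo<..<hi} ==> x \<in> space M ==> ((%s. f s x) has_real_derivative f' s x) (at s)"
  and b: "!!s x. s \<in> {lo<..<hi} ==> x \<in> space M ==> \<bar>f' s x\<bar> <= B x"
  and B: "integrable M B" and m: "f' t \<in> borel_measurable M"
 shows "((%s. \<integral>x. f s x \<partial>M) has_real_derivative (LINT x|M. f' t x)) (at t)"
 unfolding has_field_derivative_iff tendsto_at_iff_sequentially
proof (intro allI impI)
 fix X :: "nat => real" assume X: "\<forall>n. X n \<in> UNIV - {t}" and Xt: "X \<longlonglongrightarrow> t"
 have "\<forall>\<^sub>F n in sequentially. X n \<in> {lo<..<hi}"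
  using topological_tendstoD[OF Xt open_greaterThanLessThan t] .
 then obtain n0 where n0: "!!n. n >= n0 ==> X n \<in> {lo<..<hi}" by (auto simp: eventually_sequentially)
 \<comment> \<open>Only a tail of the sequence is known to lie in the interval where the hypotheses
   hold.\<close>
 define Y where "Y n = X (n + n0)" for n
 have Y: "Y n \<in> {lo<..<hi}" "Y n ~= t" for n using n0 X by (auto simp: Y_def)
 have Yt: "Y \<longlonglongrightarrow> t" unfolding Y_def by (rule LIMSEQ_ignore_initial_segment[OF Xt])
 have "(%n. \<integral>x. (f (Y n) x - f t x) / (Y n - t) \<partial>M) \<longlonglongrightarrow> (LINT x|M. f' t x)"
 proof (rule integral_dominated_convergence[where w=B])
  show "AE x in M. (%n. (f (Y n) x - f t x) / (Y n - t)) \<longlonglongrightarrow> f' t x"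
  proof (rule AE_I2)
   fix x assume x: "x \<in> space M"
   from d[OF t x] have "((%s. (f s x - f t x) / (s - t)) \<longlongrightarrow> f' t x) (at t)"
    by (simp add: has_field_derivative_iff)
   then show "(%n. (f (Y n) x - f t x) / (Y n - t)) \<longlonglongrightarrow> f' t x"
    using Y(2) Yt unfolding tendsto_at_iff_sequentially comp_def by auto
  qed
  fix n
  show "AE x in M. norm ((f (Y n) x - f t x) / (Y n - t)) <= B x"
  proof (rule AE_I2)
   fix x assume x: "x \<in> space M"
   have "norm (f (Y n) x - f t x) <= B x * norm (Y n - t)"
   proof (rule field_differentiable_bound[where S="{lo<..<hi}" and f'="%s. f' s x"])
    fix z assume z: "z \<in> {lo<..<hi}"
    show "((%s. f s x) has_field_derivative f' z x) (at z within {lo<..<hi})"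
     using d[OF z x] by (rule has_field_derivative_at_within)
    show "norm (f' z x) <= B x" using b[OF z x] by simp
   qed (use Y t in auto)
   then show "norm ((f (Y n) x - f t x) / (Y n - t)) <= B x"
    using Y(2)[of n] by (simp add: divide_le_eq)
  qed
  show "(%x. (f (Y n) x - f t x) / (Y n - t)) \<in> borel_measurable M"
   using i[OF Y(1)[of n]] i[OF t] by measurable
 qed (use m B in auto)
 also have "(%n. \<integral>x. (f (Y n) x - f t x) / (Y n - t) \<partial>M) = (%n. ((LINT x|M. f (Y n) x) - (LINT x|M. f t x)) / (Y n - t))"
  using i[OF Y(1)] i[OF t] by (intro ext) (simp add: Bochner_Integration.integral_diff)
 finally have "(%n. (%n. ((LINT x|M. f (X n) x) - (LINT x|M. f t x)) / (X n - t)) (n + n0)) \<longlonglongrightarrow> (LINT x|M. f' t x)"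
  by (simp add: Y_def)
 then show "((%y. ((LINT x|M. f y x) - (LINT x|M. f t x)) / (y - t)) \<circ> X) \<longlonglongrightarrow> (LINT x|M. f' t x)"
  unfolding comp_def by (rule LIMSEQ_offset)
qed

text \<open>Moves from the origin to g by switching on one coordinate at a time.\<close>

lemma coordinatewise_lipschitz_growth:
 fixes f :: "('i => real) => real"
 assumes I: "finite I" and g: "g \<in> extensional I"
  and lip: "!!g i x y. g \<in> extensional I ==> i \<in> I ==> \<bar>f (g(i:=x)) - f (g(i:=y))\<bar> <= c i * \<bar>x - y\<bar>"
 shows "\<bar>f g - f (\<lambda>i\<in>I. 0)\<bar> <= (\<Sum>i\<in>I. c i * \<bar>g i\<bar>)"
proof -
 define k where "k J = (\<lambda>i\<in>I. if i \<in> J then g i else 0)" for J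
 have k: "k J \<in> extensional I" for J by (simp add: k_def)
 have "J \<subseteq> I ==> \<bar>f (k J) - f (k {})\<bar> <= (\<Sum>i\<in>J. c i * \<bar>g i\<bar>)" if "finite J" for J
  using that
 proof (induction J rule: finite_induct)
  case (insert j J)
  have j: "j \<in> I" using insert by auto
  have 1: "k (insert j J) = (k J)(j := g j)" "k J = (k J)(j := 0)"
   using j insert.hyps by (auto simp: k_def fun_eq_iff)
  have "\<bar>f (k (insert j J)) - f (k J)\<bar> <= c j * \<bar>g j\<bar>"
   using lip[OF k[of J] j, of "g j" 0] 1 by simp
  moreover have "\<bar>f (k J) - f (k {})\<bar> <= (\<Sum>i\<in>J. c i * \<bar>g i\<bar>)" using insert by auto
  ultimately show ?case using insert.hyps by simp
 qed simp
 from this[of I] I have "\<bar>f (k I) - f (k {})\<bar> <= (\<Sum>i\<in>I. c i * \<bar>g i\<bar>)" by simp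
 moreover have "k I = g" using g by (auto simp: k_def fun_eq_iff extensional_def)
 ultimately show ?thesis by (simp add: k_def)
qed

lemma coordinatewise_lipschitz_linear:
 fixes f :: "('i => real) => real"
 assumes I: "finite I" and g: "g \<in> extensional I"
  and lip: "!!g i x y. g \<in> extensional I ==> i \<in> I ==> \<bar>f (g(i:=x)) - f (g(i:=y))\<bar> <= c i * \<bar>x - y\<bar>"
 shows "\<bar>f g\<bar> <= \<bar>f (\<lambda>i\<in>I. 0)\<bar> + (\<Sum>i\<in>I. \<bar>c i\<bar>) * l1 I g"
proof -
 have "\<bar>f g - f (\<lambda>i\<in>I. 0)\<bar> <= (\<Sum>i\<in>I. c i * \<bar>g i\<bar>)"
  by (rule coordinatewise_lipschitz_growth[OF I g lip])
 also have "... <= (\<Sum>i\<in>I. (\<Sum>i\<in>I. \<bar>c i\<bar>) * \<bar>g i\<bar>)"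
 proof (intro sum_mono mult_right_mono)
  fix i assume "i \<in> I"
  then have "\<bar>c i\<bar> <= (\<Sum>i\<in>I. \<bar>c i\<bar>)" using I by (intro member_le_sum) auto
  then show "c i <= (\<Sum>i\<in>I. \<bar>c i\<bar>)" by linarith
 qed auto
 finally show ?thesis by (simp add: l1_def sum_distrib_left)
qed

lemma expb_lipschitz:
 fixes f :: "('i => real) => real"
 assumes I: "finite I" and m: "f \<in> borel_measurable (gau I)"
  and lip: "!!g i x y. g \<in> extensional I ==> i \<in> I ==> \<bar>f (g(i:=x)) - f (g(i:=y))\<bar> <= c i * \<bar>x - y\<bar>"
 shows "expb I f" "expb I (%g. exp (s * f g))"
proof -
 define A where "A = \<bar>f (\<lambda>i\<in>I. 0)\<bar>"
 define B where "B = (\<Sum>i\<in>I. \<bar>c i\<bar>)"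
 have B: "B >= 0" and A: "A >= 0" by (auto simp: A_def B_def sum_nonneg)
 have b: "\<bar>f g\<bar> <= A + B * l1 I g" if "g \<in> extensional I" for g :: "'i => real"
  unfolding A_def B_def by (rule coordinatewise_lipschitz_linear[OF I that lip])
 show "expb I f"
 proof (rule expbI[OF m])
  fix g :: "'i => real" assume g: "g \<in> extensional I"
  have "\<bar>f g\<bar> <= A + B * l1 I g" by (rule b[OF g])
  also have "... <= A * exp (1 * l1 I g) + B * exp (1 * l1 I g)"
   using A B x_le_exp_abs[of "l1 I g"] by (intro add_mono) (auto intro!: mult_left_mono simp: mult_le_cancel_left1)
  finally show "\<bar>f g\<bar> <= (A + B) * exp (1 * l1 I g)" by (simp add: algebra_simps)
 qed
 show "expb I (%g. exp (s * f g))"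
 proof (rule expbI)
  fix g :: "'i => real" assume g: "g \<in> extensional I"
  have "s * f g <= \<bar>s\<bar> * (A + B * l1 I g)"
   using b[OF g] by (metis abs_ge_self abs_ge_zero abs_mult mult_left_mono order_trans)
  then show "\<bar>exp (s * f g)\<bar> <= exp (\<bar>s\<bar> * A) * exp ((\<bar>s\<bar> * B) * l1 I g)"
   by (simp add: exp_add[symmetric] algebra_simps)
 qed (use m in measurable)
qed

text \<open>Tensorisation: integrating out coordinate i costs the factor exp (s^2 * (c i)^2) of
  \<open>stdn_conc\<close>, and the resulting conditional mean k keeps the Lipschitz constants of
  the remaining coordinates. Coordinatewise constants are the natural hypothesis because the
  features of the Hamiltonians below are bounded entry by entry.\<close>

lemma gau_conc:
 fixes f :: "('i => real) => real"
 assumes I: "finite I" and m: "f \<in> borel_measurable (gau I)"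
  and lip: "!!g i x y. g \<in> extensional I ==> i \<in> I ==> \<bar>f (g(i:=x)) - f (g(i:=y))\<bar> <= c i * \<bar>x - y\<bar>"
 shows "(LINT g|gau I. exp (s * (f g - (LINT g|gau I. f g)))) <= exp (s\<^sup>2 * (\<Sum>i\<in>I. (c i)\<^sup>2))"
 using assms
proof (induction I arbitrary: f rule: finite_induct)
 case empty
 then show ?case by (simp add: gau_def PiM_empty lebesgue_integral_count_space_finite)
next
 case (insert i I)
 have fin: "finite (insert i I)" using insert by auto
 have ef: "expb (insert i I) f" "expb (insert i I) (%g. exp (s * f g))" for s
  using expb_lipschitz[OF fin insert.prems] by auto
 have if1: "integrable (gau (insert i I)) f" by (rule expb_integrable[OF fin ef(1)])
 have if2: "integrable (gau (insert i I)) (%g. exp (s * f g))" for s by (rule expb_integrable[OF fin ef(2)])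
 have ext: "g(i:=y) \<in> extensional (insert i I)" if "g \<in> extensional I" for g y
  using that by (auto simp: extensional_def)
 have ext': "g(j:=y) \<in> extensional I" if "g \<in> extensional I" "j \<in> I" for g j and y :: real
  using that by (auto simp: extensional_def)
 have fm: "(%y. f (g(i:=y))) \<in> borel_measurable borel" if "g \<in> extensional I" for g
  by (rule measurable_gau_fiber[OF insert.prems(1) insert.hyps(2) that])
 have fl: "\<bar>f (g(i:=x)) - f (g(i:=y))\<bar> <= c i * \<bar>x - y\<bar>" if "g \<in> extensional I" for g x y
  using insert.prems(2)[OF ext[OF that, of 0], of i x y] by (simp only: fun_upd_upd insertI1)
 note fc = stdn_conc[OF fm fl]
 define k where "k g = (LINT y|stdn. f (g(i:=y)))" for g
 have km: "k \<in> borel_measurable (gau I)"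
 proof -
  have "(%(x, y). x(i := y)) \<in> measurable (PiM I (%_. stdn) \<Otimes>\<^sub>M stdn) (PiM (insert i I) (%_. stdn))"
   by (rule measurable_add_dim)
  from measurable_compose[OF this, of f borel]
  have [measurable]: "(%p. f ((fst p)(i := snd p))) \<in> borel_measurable (gau I \<Otimes>\<^sub>M stdn)"
   using insert.prems(1) by (simp add: gau_def split_beta')
  show ?thesis unfolding k_def[abs_def]
   by (rule stdn.borel_measurable_lebesgue_integral) (simp add: split_beta')
 qed
 have kl: "\<bar>k (g(j:=x)) - k (g(j:=y))\<bar> <= c j * \<bar>x - y\<bar>" if g: "g \<in> extensional I" and j: "j \<in> I" for g j x y
 proof -
  have ij: "i ~= j" using j insert by auto
  have "k (g(j:=x)) - k (g(j:=y)) = (LINT z|stdn. f ((g(j:=x))(i:=z)) - f ((g(j:=y))(i:=z)))"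
   unfolding k_def by (rule Bochner_Integration.integral_diff[symmetric]; rule fc(1); rule ext'[OF g j])
  also have "\<bar>...\<bar> <= (LINT z|stdn. c j * \<bar>x - y\<bar>)"
  proof (rule integral_abs_bound[THEN order_trans], rule integral_mono)
   show "integrable stdn (%z. \<bar>f ((g(j:=x))(i:=z)) - f ((g(j:=y))(i:=z))\<bar>)"
    by (intro integrable_abs Bochner_Integration.integrable_diff fc(1) ext'[OF g j])
   fix z
   show "\<bar>f ((g(j:=x))(i:=z)) - f ((g(j:=y))(i:=z))\<bar> <= c j * \<bar>x - y\<bar>"
    using insert.prems(2)[OF ext[OF g, of z], of j x y] j unfolding fun_upd_twist[OF ij] by blast
  qed simp
  also have "... = c j * \<bar>x - y\<bar>" by (simp add: stdn.prob_space[simplified])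
  finally show ?thesis .
 qed
 have ek: "expb I k" "expb I (%g. exp (s * k g))" for s
  by (rule expb_lipschitz[OF insert.hyps(1) km kl]; assumption)+
 define M where "M = (LINT g|gau (insert i I). f g)"
 have M: "M = (LINT g|gau I. k g)"
  unfolding M_def k_def by (rule gau_integral_insert[OF insert.hyps if1])
 have "(LINT g|gau (insert i I). exp (s * (f g - M))) = (LINT g|gau I. (LINT y|stdn. exp (s * (f (g(i:=y)) - M))))"
 proof (rule gau_integral_insert[OF insert.hyps])
  have "(%g. exp (s * (f g - M))) = (%g. exp (s * f g) * exp (- s * M))"
   by (auto simp: exp_add[symmetric] algebra_simps)
  then show "integrable (gau (insert i I)) (%g. exp (s * (f g - M)))" using if2 by simp
 qed
 \<comment> \<open>The inner integral is recentred at the conditional mean \<open>k g\<close>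
   instead of M, so that the one-dimensional bound applies fibre by fibre.\<close>
 also have "... <= (LINT g|gau I. exp (s\<^sup>2 * (c i)\<^sup>2) * exp (s * (k g - M)))"
 proof (rule integral_mono)
  have eq: "(LINT y|stdn. exp (s * (f (g(i:=y)) - M))) = exp (s * (k g - M)) * (LINT y|stdn. exp (s * (f (g(i:=y)) - k g)))" for g
  proof -
   have "(LINT y|stdn. exp (s * (f (g(i:=y)) - M))) = (LINT y|stdn. exp (s * (k g - M)) * exp (s * (f (g(i:=y)) - k g)))"
    by (auto simp: exp_add[symmetric] algebra_simps intro!: Bochner_Integration.integral_cong)
   then show ?thesis by simp
  qed
  have le: "(LINT y|stdn. exp (s * (f (g(i:=y)) - M))) <= exp (s\<^sup>2 * (c i)\<^sup>2) * exp (s * (k g - M))" if "g \<in> extensional I" for g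
   unfolding eq using fc(3)[OF that that, of s] by (simp add: k_def mult.commute mult_left_mono)
  have ee: "expb I (%g. exp (s\<^sup>2 * (c i)\<^sup>2) * exp (s * (k g - M)))"
  proof -
   have "(%g. exp (s\<^sup>2 * (c i)\<^sup>2) * exp (s * (k g - M))) = (%g. (exp (s\<^sup>2 * (c i)\<^sup>2) * exp (- s * M)) * exp (s * k g))"
    by (auto simp: exp_add[symmetric] algebra_simps)
   then show ?thesis using expb_cmult[OF ek(2)] by simp
  qed
  show "integrable (gau I) (%g. exp (s\<^sup>2 * (c i)\<^sup>2) * exp (s * (k g - M)))"
   by (rule expb_integrable[OF insert.hyps(1) ee])
  have mm: "(%g. \<integral>y. exp (s * (f (g(i:=y)) - M)) \<partial>stdn) \<in> borel_measurable (gau I)"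
  proof -
   have "(%(x, y). x(i := y)) \<in> measurable (PiM I (%_. stdn) \<Otimes>\<^sub>M stdn) (PiM (insert i I) (%_. stdn))"
    by (rule measurable_add_dim)
   from measurable_compose[OF this, of f borel]
   have [measurable]: "(%p. f ((fst p)(i := snd p))) \<in> borel_measurable (gau I \<Otimes>\<^sub>M stdn)"
    using insert.prems(1) by (simp add: gau_def split_beta')
   show ?thesis
    by (rule stdn.borel_measurable_lebesgue_integral) (simp add: split_beta')
  qed
  show "integrable (gau I) (%g. \<integral>y. exp (s * (f (g(i:=y)) - M)) \<partial>stdn)"
   by (rule expb_integrable[OF insert.hyps(1)], rule expb_mono[OF ee mm])
    (use le in \<open>auto intro!: order_trans[OF _ abs_ge_self] simp: abs_of_nonneg\<close>)
  fix g assume "g \<in> space (gau I)"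
  then show "(LINT y|stdn. exp (s * (f (g(i:=y)) - M))) <= exp (s\<^sup>2 * (c i)\<^sup>2) * exp (s * (k g - M))"
   using le by (simp add: space_gau)
 qed
 also have "... <= exp (s\<^sup>2 * (c i)\<^sup>2) * exp (s\<^sup>2 * (\<Sum>j\<in>I. (c j)\<^sup>2))"
  using insert.IH[OF km kl] by (simp add: M)
 also have "... = exp (s\<^sup>2 * (\<Sum>j\<in>insert i I. (c j)\<^sup>2))"
  using insert.hyps by (simp add: exp_add[symmetric] algebra_simps)
 finally show ?case by (simp add: M_def)
qed

text \<open>Markov's inequality for the exponential with s = r / (2 * V), the minimiser of s^2 * V -
  s * r.\<close>

lemma gau_upper_tail:
 fixes f :: "('i => real) => real"
 assumes I: "finite I" and m: "f \<in> borel_measurable (gau I)"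
  and lip: "!!g i x y. g \<in> extensional I ==> i \<in> I ==> \<bar>f (g(i:=x)) - f (g(i:=y))\<bar> <= c i * \<bar>x - y\<bar>"
  and V: "(\<Sum>i\<in>I. (c i)\<^sup>2) <= V" "V > 0" and r: "r >= 0"
 shows "measure (gau I) {g \<in> space (gau I). f g >= (LINT g|gau I. f g) + r} <= exp (- r\<^sup>2 / (4 * V))"
proof -
 interpret prob_space "gau I" by (rule prob_space_gau)
 define s where "s = r / (2 * V)"
 have s: "s >= 0" using r V by (simp add: s_def)
 define M where "M = (LINT g|gau I. f g)"
 have ee: "integrable (gau I) (%g. exp (s * (f g - M)))"
 proof -
  have "(%g. exp (s * (f g - M))) = (%g. exp (- s * M) * exp (s * f g))"
   by (auto simp: exp_add[symmetric] algebra_simps)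
  then show ?thesis using expb_integrable[OF I expb_lipschitz(2)[OF I m lip], of s] by simp
 qed
 have mset: "{g \<in> space (gau I). exp (s * (f g - M)) >= exp (s * r)} \<in> sets (gau I)"
  using m by measurable
 have "measure (gau I) {g \<in> space (gau I). f g >= M + r} <= measure (gau I) {g \<in> space (gau I). exp (s * (f g - M)) >= exp (s * r)}"
  using s by (intro finite_measure_mono mset) (auto intro!: mult_left_mono simp del: mult_le_cancel_left)
 also have "... <= (LINT g|gau I. exp (s * (f g - M))) / exp (s * r)"
  by (rule integral_Markov_inequality_measure[OF ee sets.top]) auto
 also have "... <= exp (s\<^sup>2 * (\<Sum>i\<in>I. (c i)\<^sup>2)) / exp (s * r)"
  using gau_conc[OF I m lip] by (simp add: M_def divide_right_mono)
 also have "... <= exp (s\<^sup>2 * V) / exp (s * r)"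
  using V by (intro divide_right_mono) (auto intro: mult_left_mono)
 also have "... = exp (s\<^sup>2 * V - s * r)" by (simp add: exp_diff)
 also have "s\<^sup>2 * V - s * r = - r\<^sup>2 / (4 * V)"
  using V by (simp add: s_def power2_eq_square field_simps)
 finally show ?thesis by (simp add: M_def)
qed

lemma gau_lower_tail:
 fixes f :: "('i => real) => real"
 assumes I: "finite I" and m: "f \<in> borel_measurable (gau I)"
  and lip: "!!g i x y. g \<in> extensional I ==> i \<in> I ==> \<bar>f (g(i:=x)) - f (g(i:=y))\<bar> <= c i * \<bar>x - y\<bar>"
  and V: "(\<Sum>i\<in>I. (c i)\<^sup>2) <= V" "V > 0" and r: "r >= 0"
 shows "measure (gau I) {g \<in> space (gau I). f g <= (LINT g|gau I. f g) - r} <= exp (- r\<^sup>2 / (4 * V))"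
proof -
 have "measure (gau I) {g \<in> space (gau I). - f g >= (LINT g|gau I. - f g) + r} <= exp (- r\<^sup>2 / (4 * V))"
  by (rule gau_upper_tail[OF I _ _ V r]) (use m lip in \<open>auto simp: abs_minus_commute\<close>)
 also have "{g \<in> space (gau I). - f g >= (LINT g|gau I. - f g) + r} = {g \<in> space (gau I). f g <= (LINT g|gau I. f g) - r}"
  by auto
 finally show ?thesis .
qed

text \<open>Integrates |z| <= exp z + exp (-z) at the natural scale z = (f - E f) / sqrt V; both
  exponential moments are at most e there, and 2 * e <= 6.\<close>

lemma gau_abs_deviation:
 fixes f :: "('i => real) => real"
 assumes I: "finite I" and m: "f \<in> borel_measurable (gau I)"
  and lip: "!!g i x y. g \<in> extensional I ==> i \<in> I ==> \<bar>f (g(i:=x)) - f (g(i:=y))\<bar> <= c i * \<bar>x - y\<bar>"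
  and V: "(\<Sum>i\<in>I. (c i)\<^sup>2) <= V" "V > 0"
 shows "(LINT g|gau I. \<bar>f g - (LINT g|gau I. f g)\<bar>) <= 6 * sqrt V"
proof -
 interpret prob_space "gau I" by (rule prob_space_gau)
 define s where "s = 1 / sqrt V"
 have s: "s > 0" "s\<^sup>2 * V = 1" using V by (auto simp: s_def power_divide)
 define M where "M = (LINT g|gau I. f g)"
 have ee: "integrable (gau I) (%g. exp (t * (f g - M)))" for t
 proof -
  have "(%g. exp (t * (f g - M))) = (%g. exp (- t * M) * exp (t * f g))"
   by (auto simp: exp_add[symmetric] algebra_simps)
  then show ?thesis using expb_integrable[OF I expb_lipschitz(2)[OF I m lip], of t] by simp
 qed
 have if1: "integrable (gau I) f" using expb_integrable[OF I expb_lipschitz(1)[OF I m lip]] .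
 have le: "(LINT g|gau I. exp (t * (f g - M))) <= exp 1" if "t\<^sup>2 = s\<^sup>2" for t
 proof -
  have "(LINT g|gau I. exp (t * (f g - M))) <= exp (t\<^sup>2 * (\<Sum>i\<in>I. (c i)\<^sup>2))"
   unfolding M_def by (rule gau_conc[OF I m lip])
  also have "... <= exp (t\<^sup>2 * V)" using V by (auto intro!: mult_left_mono)
  finally show ?thesis using s that by simp
 qed
 have "(LINT g|gau I. \<bar>f g - M\<bar>) <= (LINT g|gau I. (1 / s) * (exp (s * (f g - M)) + exp ((- s) * (f g - M))))"
 proof (rule integral_mono)
  show "integrable (gau I) (%g. \<bar>f g - M\<bar>)" using if1 by auto
  show "integrable (gau I) (%g. 1 / s * (exp (s * (f g - M)) + exp (- s * (f g - M))))"
   using ee[of s] ee[of "-s"] by auto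
  fix g
  define z where "z = s * (f g - M)"
  have "\<bar>z\<bar> <= exp \<bar>z\<bar>" by (rule x_le_exp_abs)
  also have "exp \<bar>z\<bar> <= exp z + exp (- z)" by (auto simp: abs_if)
  finally have "\<bar>z\<bar> <= exp z + exp (- z)" .
  then have "s * \<bar>f g - M\<bar> <= exp (s * (f g - M)) + exp ((- s) * (f g - M))"
   using s by (simp add: z_def abs_mult)
  then show "\<bar>f g - M\<bar> <= 1 / s * (exp (s * (f g - M)) + exp (- s * (f g - M)))"
   using s by (simp add: field_simps)
 qed
 also have "... = 1 / s * ((LINT g|gau I. exp (s * (f g - M))) + (LINT g|gau I. exp ((- s) * (f g - M))))"
  using ee[of s] ee[of "-s"] by simp
 also have "... <= 1 / s * (exp 1 + exp 1)"
  using s le[of s] le[of "-s"] by (intro mult_left_mono add_mono) auto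
 also have "... <= 1 / s * 6" using s exp_le by (intro mult_left_mono) auto
 finally show ?thesis by (simp add: M_def s_def)
qed

lemma gau_reindex:
 fixes f :: "('j => real) => real"
 assumes r: "inj_on r J" "r ` J \<subseteq> I" and m: "f \<in> borel_measurable (gau J)"
 shows "(LINT g|gau I. f (\<lambda>j\<in>J. g (r j))) = (LINT g|gau J. f g)"
proof -
 have d: "distr (PiM I (%_. stdn)) (PiM J (%_. stdn)) (%g. \<lambda>j\<in>J. g (r j)) = PiM J (%_. stdn)"
  using distr_PiM_reindex[of I "%_. stdn" r J] r prob_space_stdn by (auto simp: Pi_def)
 have [measurable]: "f \<in> borel_measurable (PiM J (%_. stdn))" using m by (simp add: gau_def)
 have [measurable]: "(%g. \<lambda>j\<in>J. g (r j)) \<in> measurable (PiM I (%_. stdn)) (PiM J (%_. stdn))"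
  using r by (intro measurable_restrict measurable_component_singleton) auto
 have "(LINT g|gau I. f (\<lambda>j\<in>J. g (r j))) = (LINT g|distr (PiM I (%_. stdn)) (PiM J (%_. stdn)) (%g. \<lambda>j\<in>J. g (r j)). f g)"
  unfolding gau_def by (rule integral_distr[symmetric]) measurable
 then show ?thesis by (simp add: d gau_def)
qed

lemma gau_fold:
 fixes f :: "('i => real) => real"
 assumes "I \<inter> J = {}" "finite I" "finite J" "integrable (gau (I \<union> J)) f"
 shows "(LINT g|gau (I \<union> J). f g) = (LINT x|gau I. (LINT y|gau J. f (merge I J (x, y))))"
 using stdnP.product_integral_fold[of I J f] assms by (simp add: gau_def)

section \<open>Gibbs averages and Gaussian Hamiltonians\<close>

definition posw :: "'x set => ('x => real) => bool" where
 "posw X W \<longleftrightarrow> finite X \<and> X ~= {} \<and> (\<forall>sg\<in>X. 0 < W sg)"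

text \<open>The weights are not normalised, so that multiplying them by exponentials, that is adding
  a term to the Hamiltonian, stays inside the same notation.\<close>

definition gavg :: "'x set => ('x => real) => ('x => real) => real" where
 "gavg X W f = (\<Sum>sg\<in>X. W sg * f sg) / (\<Sum>sg\<in>X. W sg)"

lemma posw_sum: "posw X W ==> 0 < (\<Sum>sg\<in>X. W sg)"
 by (auto simp: posw_def intro!: sum_pos)

lemma posw_exp: "posw X W ==> posw X (%sg. W sg * exp (f sg))"
 by (auto simp: posw_def)

lemma gavg_add: "gavg X W (%sg. f sg + h sg) = gavg X W f + gavg X W h"
 by (simp add: gavg_def algebra_simps sum.distrib add_divide_distrib)

lemma gavg_diff: "gavg X W (%sg. f sg - h sg) = gavg X W f - gavg X W h"
 by (simp add: gavg_def algebra_simps sum_subtractf diff_divide_distrib)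

lemma gavg_cmult: "gavg X W (%sg. c * f sg) = c * gavg X W f"
 by (simp add: gavg_def sum_distrib_left algebra_simps)

lemma gavg_multc: "gavg X W (%sg. f sg * c) = gavg X W f * c"
 using gavg_cmult[of X W c f] by (simp add: mult.commute)

lemma gavg_sum: "gavg X W (%sg. \<Sum>i\<in>A. f i sg) = (\<Sum>i\<in>A. gavg X W (f i))"
 by (simp add: gavg_def sum_distrib_left sum_divide_distrib[symmetric] sum.swap[of _ X A])

lemma gavg_const: "posw X W ==> gavg X W (%_. c) = c"
 using posw_sum[of X W] by (simp add: gavg_def flip: sum_distrib_right)

lemma gavg_cong: "(!!sg. sg \<in> X ==> f sg = h sg) ==> gavg X W f = gavg X W h"
 by (simp add: gavg_def)

lemma gavg_mono:
 assumes "posw X W" "!!sg. sg \<in> X ==> f sg <= h sg"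
 shows "gavg X W f <= gavg X W h"
 unfolding gavg_def using assms posw_sum[OF assms(1)]
 by (intro divide_right_mono sum_mono mult_left_mono) (auto simp: posw_def less_imp_le)

lemma gavg_nonneg: "posw X W ==> (!!sg. sg \<in> X ==> 0 <= f sg) ==> 0 <= gavg X W f"
 using gavg_mono[of X W "%_. 0" f] by (simp add: gavg_const)

lemma gavg_le:
 "posw X W ==> (!!sg. sg \<in> X ==> f sg <= c) ==> gavg X W f <= c"
 using gavg_mono[of X W f "%_. c"] by (simp add: gavg_const)

lemma gavg_ge:
 "posw X W ==> (!!sg. sg \<in> X ==> c <= f sg) ==> c <= gavg X W f"
 using gavg_mono[of X W "%_. c" f] by (simp add: gavg_const)

lemma gavg_abs_le:
 assumes "posw X W" "!!sg. sg \<in> X ==> \<bar>f sg\<bar> <= c"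
 shows "\<bar>gavg X W f\<bar> <= c"
 using gavg_le[OF assms(1), of f c] gavg_ge[OF assms(1), of "-c" f] assms(2)
 by (force simp: abs_le_iff minus_le_iff)

lemma gavg_abs: "posw X W ==> \<bar>gavg X W f\<bar> <= gavg X W (%sg. \<bar>f sg\<bar>)"
 using gavg_mono[of X W f "%sg. \<bar>f sg\<bar>"] gavg_mono[of X W "%sg. - f sg" "%sg. \<bar>f sg\<bar>"] gavg_cmult[of X W "-1" f]
 by (auto simp: abs_le_iff)

text \<open>Jensen's inequality from the tangent of exp at the mean m.\<close>

lemma gavg_exp_ge:
 assumes "posw X W" shows "exp (gavg X W f) <= gavg X W (%sg. exp (f sg))"
proof -
 define m where "m = gavg X W f"
 have "exp m = gavg X W (%sg. exp m * (1 + (f sg - m)))"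
  by (simp add: gavg_cmult gavg_add gavg_diff gavg_const[OF assms] m_def[symmetric])
 also have "... <= gavg X W (%sg. exp (f sg))"
 proof (rule gavg_mono[OF assms])
  fix sg
  have "exp m * (1 + (f sg - m)) <= exp m * exp (f sg - m)"
   by (intro mult_left_mono exp_ge_add_one_self) auto
  then show "exp m * (1 + (f sg - m)) <= exp (f sg)" by (simp add: mult_exp_exp)
 qed
 finally show ?thesis by (simp add: m_def)
qed

lemma gavg_sq_le:
 assumes "posw X W" shows "(gavg X W f)\<^sup>2 <= gavg X W (%sg. (f sg)\<^sup>2)"
proof -
 define m where "m = gavg X W f"
 have "0 <= gavg X W (%sg. (f sg - m)\<^sup>2)" by (rule gavg_nonneg[OF assms]) simp
 also have "... = gavg X W (%sg. (f sg)\<^sup>2 - 2 * m * f sg + m\<^sup>2)"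
  by (simp add: power2_diff algebra_simps)
 also have "... = gavg X W (%sg. (f sg)\<^sup>2) - m\<^sup>2"
  by (simp add: gavg_cmult gavg_add gavg_diff gavg_const[OF assms] m_def[symmetric] power2_eq_square)
 finally show ?thesis by (simp add: m_def)
qed

lemma ln_sum_deriv:
 assumes W: "posw X (W x)" and d: "!!sg. sg \<in> X ==> ((%x. W x sg) has_real_derivative W x sg * e sg) (at x)"
 shows "((%x. ln (\<Sum>sg\<in>X. W x sg)) has_real_derivative gavg X (W x) e) (at x)"
proof -
 have "((%x. \<Sum>sg\<in>X. W x sg) has_real_derivative (\<Sum>sg\<in>X. W x sg * e sg)) (at x)"
  by (intro DERIV_sum d)
 from DERIV_chain2[OF DERIV_ln_divide[OF posw_sum[OF W]] this]
 show ?thesis by (simp add: gavg_def field_simps)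
qed

lemma gavg_deriv:
 assumes W: "posw X (W x)" and d: "!!sg. sg \<in> X ==> ((%x. W x sg) has_real_derivative W x sg * e sg) (at x)"
 shows "((%x. gavg X (W x) f) has_real_derivative
  gavg X (W x) (%sg. f sg * e sg) - gavg X (W x) f * gavg X (W x) e) (at x)"
proof -
 define Z where "Z = (\<Sum>sg\<in>X. W x sg)"
 have Z: "Z ~= 0" using posw_sum[OF W] by (simp add: Z_def)
 have 1: "((%x. \<Sum>sg\<in>X. W x sg) has_real_derivative (\<Sum>sg\<in>X. W x sg * e sg)) (at x)"
  by (intro DERIV_sum d)
 have 2: "((%x. \<Sum>sg\<in>X. W x sg * f sg) has_real_derivative (\<Sum>sg\<in>X. W x sg * e sg * f sg)) (at x)"
  by (intro DERIV_sum DERIV_cmult_right d)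
 have "((%x. (\<Sum>sg\<in>X. W x sg * f sg) / (\<Sum>sg\<in>X. W x sg)) has_real_derivative
  ((\<Sum>sg\<in>X. W x sg * e sg * f sg) * Z - (\<Sum>sg\<in>X. W x sg * f sg) * (\<Sum>sg\<in>X. W x sg * e sg)) / (Z * Z)) (at x)"
  using DERIV_divide[OF 2 1] Z unfolding Z_def by simp
 also have "((\<Sum>sg\<in>X. W x sg * e sg * f sg) * Z - (\<Sum>sg\<in>X. W x sg * f sg) * (\<Sum>sg\<in>X. W x sg * e sg)) / (Z * Z)
  = gavg X (W x) (%sg. f sg * e sg) - gavg X (W x) f * gavg X (W x) e"
  using Z unfolding gavg_def Z_def[symmetric] by (simp add: field_simps)
 finally show ?thesis by (simp add: gavg_def)
qed

text \<open>Gibbs weights with a Gaussian Hamiltonian: the coordinate \<open>g i\<close> multiplies the feature \<open>a i\<close>.\<close>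

definition gw :: "'i set => ('i => 'x => real) => ('x => real) => ('i => real) => 'x => real" where
 "gw I a w g sg = w sg * exp (\<Sum>i\<in>I. a i sg * g i)"

definition lnZ :: "'x set => 'i set => ('i => 'x => real) => ('x => real) => ('i => real) => real" where
 "lnZ X I a w g = ln (\<Sum>sg\<in>X. gw I a w g sg)"

lemma posw_gw: "posw X w ==> posw X (gw I a w g)"
 unfolding gw_def by (rule posw_exp)

lemma measurable_gw [measurable]: "(%g. gw I a w g sg) \<in> borel_measurable (gau I)"
 unfolding gw_def by measurable

lemma measurable_lnZ [measurable]: "lnZ X I a w \<in> borel_measurable (gau I)"
 unfolding lnZ_def[abs_def] by measurable

lemma measurable_gavg_gw [measurable]: "(%g. gavg X (gw I a w g) f) \<in> borel_measurable (gau I)"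
 unfolding gavg_def by measurable

lemma measurable_gavg_gw2 [measurable]:
 assumes "!!sg. sg \<in> X ==> (%g. f g sg) \<in> borel_measurable (gau I)"
 shows "(%g. gavg X (gw I a w g) (f g)) \<in> borel_measurable (gau I)"
 unfolding gavg_def using assms by measurable

lemma gw_fiber_deriv:
 assumes "finite I" "i \<in> I"
 shows "((%x. gw I a w (g(i:=x)) sg) has_real_derivative gw I a w (g(i:=x)) sg * a i sg) (at x)"
proof -
 have eq: "(\<Sum>j\<in>I. a j sg * (g(i:=x)) j) = a i sg * x + (\<Sum>j\<in>I-{i}. a j sg * g j)" for x
  using assms by (subst sum.remove[of I i]) (auto intro!: sum.cong)
 show ?thesis unfolding gw_def eq by (auto intro!: derivative_eq_intros)
qed

lemma lnZ_fiber_deriv: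
 assumes "finite I" "i \<in> I" "posw X w"
 shows "((%x. lnZ X I a w (g(i:=x))) has_real_derivative gavg X (gw I a w (g(i:=x))) (a i)) (at x)"
 unfolding lnZ_def
 by (rule ln_sum_deriv[where W="%x. gw I a w (g(i:=x))", OF posw_gw[OF assms(3)] gw_fiber_deriv[OF assms(1,2)]])

lemma gavg_fiber_deriv:
 assumes "finite I" "i \<in> I" "posw X w"
 shows "((%x. gavg X (gw I a w (g(i:=x))) f) has_real_derivative
  gavg X (gw I a w (g(i:=x))) (%sg. f sg * a i sg) - gavg X (gw I a w (g(i:=x))) f * gavg X (gw I a w (g(i:=x))) (a i)) (at x)"
 by (rule gavg_deriv[where W="%x. gw I a w (g(i:=x))", OF posw_gw[OF assms(3)] gw_fiber_deriv[OF assms(1,2)]])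

text \<open>The derivative along coordinate i is a Gibbs average of the feature a i, hence bounded
  by c i.\<close>

lemma lnZ_lipschitz:
 assumes "finite I" "i \<in> I" "posw X w" "!!sg. sg \<in> X ==> \<bar>a i sg\<bar> <= c i"
 shows "\<bar>lnZ X I a w (g(i:=x)) - lnZ X I a w (g(i:=y))\<bar> <= c i * \<bar>x - y\<bar>"
proof -
 have "norm (lnZ X I a w (g(i:=x)) - lnZ X I a w (g(i:=y))) <= c i * norm (x - y)"
 proof (rule field_differentiable_bound[where S=UNIV])
  fix z
  show "((%x. lnZ X I a w (g(i:=x))) has_field_derivative gavg X (gw I a w (g(i:=z))) (a i)) (at z within UNIV)"
   using lnZ_fiber_deriv[OF assms(1-3)] by simp
  show "norm (gavg X (gw I a w (g(i:=z))) (a i)) <= c i"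
   using gavg_abs_le[OF posw_gw[OF assms(3)] assms(4)] by simp
 qed auto
 then show ?thesis by simp
qed

lemma lnZ_linear_bound:
 assumes I: "finite I" and w: "posw X w" and a: "!!i sg. i \<in> I ==> sg \<in> X ==> \<bar>a i sg\<bar> <= A"
 shows "\<bar>lnZ X I a w g\<bar> <= \<bar>ln (\<Sum>sg\<in>X. w sg)\<bar> + A * l1 I g"
proof -
 define Z where "Z = (\<Sum>sg\<in>X. gw I a w g sg)"
 define Z0 where "Z0 = (\<Sum>sg\<in>X. w sg)"
 have Z: "Z > 0" "Z0 > 0" using posw_sum[OF w] posw_sum[OF posw_gw[OF w]] by (auto simp: Z_def Z0_def)
 have b: "\<bar>\<Sum>i\<in>I. a i sg * g i\<bar> <= A * l1 I g" if "sg \<in> X" for sg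
  by (rule linear_le_l1[OF I, of "%i. a i sg" A g]) (rule a[OF _ that])
 have "Z <= Z0 * exp (A * l1 I g)" unfolding Z_def Z0_def gw_def sum_distrib_right
  using w b by (intro sum_mono mult_left_mono) (auto simp: posw_def less_imp_le abs_le_iff)
 then have 1: "ln Z <= ln Z0 + A * l1 I g"
  using Z ln_mult_pos[of Z0 "exp (A * l1 I g)"] ln_le_cancel_iff[of Z "Z0 * exp (A * l1 I g)"] by simp
 have "Z0 * exp (- (A * l1 I g)) <= Z" unfolding Z_def Z0_def gw_def sum_distrib_right
 proof (intro sum_mono mult_left_mono)
  fix sg assume s: "sg \<in> X"
  show "exp (- (A * l1 I g)) <= exp (\<Sum>i\<in>I. a i sg * g i)" using b[OF s] by simp
  show "0 <= w sg" using w s by (auto simp: posw_def less_imp_le)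
 qed
 then have 2: "ln Z0 - A * l1 I g <= ln Z"
  using Z ln_mult_pos[of Z0 "exp (- (A * l1 I g))"] ln_le_cancel_iff[of "Z0 * exp (- (A * l1 I g))" Z] by simp
 from 1 2 show ?thesis by (auto simp: lnZ_def Z_def Z0_def)
qed

text \<open>Each Gaussian coordinate enters the weights only through the exponent a i * g i, so the
  derivative produced by integration by parts is the covariance of f with a i. This is the source of
  all replica identities below.\<close>

lemma gibbs_ibp:
 assumes I: "finite I" "i \<in> I" and w: "posw X w"
 shows "(LINT g|gau I. g i * gavg X (gw I a w g) f)
  = (LINT g|gau I. gavg X (gw I a w g) (%sg. f sg * a i sg) - gavg X (gw I a w g) f * gavg X (gw I a w g) (a i))"
proof (rule gau_ibp[OF I])
 have X: "finite X" using w by (simp add: posw_def)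
 have e: "expb I (%g. gavg X (gw I a w g) f)" for f
 proof (rule expb_bounded)
  fix g
  show "\<bar>gavg X (gw I a w g) f\<bar> <= (\<Sum>sg\<in>X. \<bar>f sg\<bar>)"
  proof (rule gavg_abs_le[OF posw_gw[OF w]])
   fix sg assume "sg \<in> X"
   then show "\<bar>f sg\<bar> <= (\<Sum>sg\<in>X. \<bar>f sg\<bar>)" using X by (intro member_le_sum) auto
  qed
 qed measurable
 show "expb I (%g. gavg X (gw I a w g) f)" by (rule e)
 show "expb I (%g. gavg X (gw I a w g) (%sg. f sg * a i sg) - gavg X (gw I a w g) f * gavg X (gw I a w g) (a i))"
  by (intro expb_diff expb_mult e)
 fix g
 show "((%x. gavg X (gw I a w (g(i := x))) f) has_real_derivative
  gavg X (gw I a w (g(i:=x))) (%sg. f sg * a i sg) - gavg X (gw I a w (g(i:=x))) f * gavg X (gw I a w (g(i:=x))) (a i)) (at x)" for x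
  by (rule gavg_fiber_deriv[OF I w])
 have c: "continuous_on UNIV (%x. gavg X (gw I a w (g(i:=x))) f)" for f
  by (rule DERIV_continuous_on, rule has_field_derivative_at_within, rule gavg_fiber_deriv[OF I w])
 show "continuous_on UNIV (%x. gavg X (gw I a w (g(i:=x))) (%sg. f sg * a i sg) - gavg X (gw I a w (g(i:=x))) f * gavg X (gw I a w (g(i:=x))) (a i))"
  by (intro continuous_intros c)
qed

section \<open>The Gaussian interpolation formula\<close>

lemma expb_comp_linear:
 assumes m: "u \<in> borel_measurable (gau I)" and b: "!!g. g \<in> extensional I ==> \<bar>u g\<bar> <= A + B * l1 I g"
  and p: "!!x. \<bar>Ph x\<bar> <= C * exp (c * \<bar>x\<bar>)" and pm: "Ph \<in> borel_measurable borel" and c: "c >= 0"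
 shows "expb I (%g. Ph (u g))"
proof (rule expbI)
 fix g :: "'a => real" assume g: "g \<in> extensional I"
 have C: "C >= 0" using p[of 0] by auto
 have "\<bar>Ph (u g)\<bar> <= C * exp (c * \<bar>u g\<bar>)" by (rule p)
 also have "... <= C * exp (c * (A + B * l1 I g))"
  using C c b[OF g] by (intro mult_left_mono) (auto intro: mult_left_mono)
 finally show "\<bar>Ph (u g)\<bar> <= (C * exp (c * A)) * exp ((c * B) * l1 I g)"
  by (simp add: mult_exp_exp algebra_simps)
qed (use m pm in measurable)

lemma gau_integral_lincomb:
 assumes I: "finite I" and f: "!!i. i \<in> A ==> expb I (f i)" and h: "expb I h"
 shows "(LINT g|gau I. (\<Sum>i\<in>A. r i * f i g) + q * h g) = (\<Sum>i\<in>A. r i * (LINT g|gau I. f i g)) + q * (LINT g|gau I. h g)"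
proof -
 have i: "integrable (gau I) (%g. r i * f i g)" if "i \<in> A" for i
  using expb_integrable[OF I f[OF that]] by simp
 have "(LINT g|gau I. (\<Sum>i\<in>A. r i * f i g) + q * h g) = (LINT g|gau I. (\<Sum>i\<in>A. r i * f i g)) + (LINT g|gau I. q * h g)"
  using expb_integrable[OF I h] by (intro Bochner_Integration.integral_add Bochner_Integration.integrable_sum i) simp_all
 also have "(LINT g|gau I. (\<Sum>i\<in>A. r i * f i g)) = (\<Sum>i\<in>A. (LINT g|gau I. r i * f i g))"
  by (rule Bochner_Integration.integral_sum) (rule i)
 finally show ?thesis by simp
qed

text \<open>Differentiating in s brings down each g i times its Gibbs-averaged feature; integration
  by parts replaces g i by a derivative, which falls either on Ph' (the Ph'' term) or on the Gibbs
  average (the variance term). A general Ph is carried along because the formula serves the mean of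
  the log-partition function, of the square root of the likelihood ratio and of its entropy; d is
  the deterministic normalisation of the likelihood.\<close>

theorem gaussian_interpolation:
 fixes a :: "'i => 'x => real" and c c' :: "'i => real => real" and Ph Ph' Ph'' :: "real => real"
 assumes I: "finite I" and w: "posw X w" and t: "t \<in> {lo<..<hi}"
  and dPh: "!!x. (Ph has_real_derivative Ph' x) (at x)" "!!x. (Ph' has_real_derivative Ph'' x) (at x)"
  and cPh: "continuous_on UNIV Ph''"
  and bPh: "!!x. \<bar>Ph x\<bar> <= C * exp (k * \<bar>x\<bar>)" "!!x. \<bar>Ph' x\<bar> <= C * exp (k * \<bar>x\<bar>)" "!!x. \<bar>Ph'' x\<bar> <= C * exp (k * \<bar>x\<bar>)"
  and k: "k >= 0"
  and dc: "!!i s. i \<in> I ==> s \<in> {lo<..<hi} ==> (c i has_real_derivative c' i s) (at s)"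
  and dd: "!!s. s \<in> {lo<..<hi} ==> (d has_real_derivative d' s) (at s)"
  and bc: "!!i s. i \<in> I ==> s \<in> {lo<..<hi} ==> \<bar>c i s\<bar> <= B" "!!i s. i \<in> I ==> s \<in> {lo<..<hi} ==> \<bar>c' i s\<bar> <= B"
  and bd: "!!s. s \<in> {lo<..<hi} ==> \<bar>d s\<bar> <= B" "!!s. s \<in> {lo<..<hi} ==> \<bar>d' s\<bar> <= B"
 defines "A == %s i sg. c i s * a i sg"
 shows "((%s. \<integral>g. Ph (lnZ X I (A s) w g + d s) \<partial>gau I) has_real_derivative
  (LINT g|gau I. (\<Sum>i\<in>I. c i t * c' i t * (Ph'' (lnZ X I (A t) w g + d t) * (gavg X (gw I (A t) w g) (a i))\<^sup>2
    + Ph' (lnZ X I (A t) w g + d t) * (gavg X (gw I (A t) w g) (%sg. (a i sg)\<^sup>2) - (gavg X (gw I (A t) w g) (a i))\<^sup>2)))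
    + d' t * Ph' (lnZ X I (A t) w g + d t))) (at t)"
proof -
 have X: "finite X" using w by (simp add: posw_def)
 have B0: "B >= 0" using bd(1)[OF t] by auto
 have C0: "C >= 0" using bPh(1)[of 0] by auto
 define K where "K = (\<Sum>i\<in>I. \<Sum>sg\<in>X. \<bar>a i sg\<bar>)"
 have K: "\<bar>a i sg\<bar> <= K" if "i \<in> I" "sg \<in> X" for i sg
 proof -
  have "\<bar>a i sg\<bar> <= (\<Sum>sg\<in>X. \<bar>a i sg\<bar>)" using that X by (intro member_le_sum) auto
  also have "... <= K" unfolding K_def using that I by (intro member_le_sum[where f="%i. \<Sum>sg\<in>X. \<bar>a i sg\<bar>"]) (auto intro: sum_nonneg)
  finally show ?thesis .
 qed
 have K0: "K >= 0" by (simp add: K_def sum_nonneg)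
 define u where "u s g = lnZ X I (A s) w g + d s" for s g
 define G where "G s g f = gavg X (gw I (A s) w g) f" for s g f
 have um [measurable]: "u s \<in> borel_measurable (gau I)" for s unfolding u_def[abs_def] by measurable
 have Gm [measurable]: "(%g. G s g f) \<in> borel_measurable (gau I)" for s f unfolding G_def by measurable
 define L where "L = \<bar>ln (\<Sum>sg\<in>X. w sg)\<bar> + B"
 have ub: "\<bar>u s g\<bar> <= L + (B * K) * l1 I g" if s: "s \<in> {lo<..<hi}" for s g
 proof -
  have "\<bar>lnZ X I (A s) w g\<bar> <= \<bar>ln (\<Sum>sg\<in>X. w sg)\<bar> + (B * K) * l1 I g"
   using bc(1)[OF _ s] K K0 B0 by (intro lnZ_linear_bound[OF I w]) (auto simp: A_def abs_mult intro!: mult_mono)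
  then show ?thesis using bd(1)[OF s] by (auto simp: u_def L_def)
 qed
 have c1: "continuous_on UNIV Ph" "continuous_on UNIV Ph'"
  by (rule DERIV_continuous_on, rule has_field_derivative_at_within, rule dPh)+
 have [measurable]: "Ph \<in> borel_measurable borel" "Ph' \<in> borel_measurable borel" "Ph'' \<in> borel_measurable borel"
  using c1 cPh by (auto intro: borel_measurable_continuous_onI)
 have eu: "expb I (%g. Ph (u s g))" "expb I (%g. Ph' (u s g))" "expb I (%g. Ph'' (u s g))" if s: "s \<in> {lo<..<hi}" for s
  by (rule expb_comp_linear[OF um ub[OF s] bPh(1) _ k] expb_comp_linear[OF um ub[OF s] bPh(2) _ k]
    expb_comp_linear[OF um ub[OF s] bPh(3) _ k]; measurable)+
 have pG: "posw X (gw I (A s) w g)" for s g by (rule posw_gw[OF w])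
 have eG: "expb I (%g. G s g f)" for s f
 proof (rule expb_bounded)
  fix g show "\<bar>G s g f\<bar> <= (\<Sum>sg\<in>X. \<bar>f sg\<bar>)"
   unfolding G_def
  proof (rule gavg_abs_le[OF pG])
   fix sg assume "sg \<in> X"
   then show "\<bar>f sg\<bar> <= (\<Sum>sg\<in>X. \<bar>f sg\<bar>)" using X by (intro member_le_sum) auto
  qed
 qed measurable
 \<comment> \<open>The pathwise derivative in s, before integration by parts.\<close>
 define D where "D s g = Ph' (u s g) * ((\<Sum>i\<in>I. c' i s * (g i * G s g (a i))) + d' s)" for s g
 have du: "((%s. Ph (u s g)) has_real_derivative D s g) (at s)" if s: "s \<in> {lo<..<hi}" for s g
 proof -
  have "((%s. lnZ X I (A s) w g) has_real_derivative G s g (%sg. \<Sum>i\<in>I. c' i s * a i sg * g i)) (at s)"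
   unfolding lnZ_def G_def
  proof (rule ln_sum_deriv[where W="%s. gw I (A s) w g", OF pG])
   fix sg
   show "((%s. gw I (A s) w g sg) has_real_derivative gw I (A s) w g sg * (\<Sum>i\<in>I. c' i s * a i sg * g i)) (at s)"
    unfolding gw_def A_def
    by (rule derivative_eq_intros DERIV_sum dc[OF _ s] refl | assumption | simp)+
  qed
  also have "G s g (%sg. \<Sum>i\<in>I. c' i s * a i sg * g i) = (\<Sum>i\<in>I. c' i s * (g i * G s g (a i)))"
   unfolding G_def gavg_sum by (simp add: gavg_cmult gavg_multc mult_ac)
  finally have "((%s. u s g) has_real_derivative (\<Sum>i\<in>I. c' i s * (g i * G s g (a i))) + d' s) (at s)"
   unfolding u_def by (intro DERIV_add dd[OF s])
  from DERIV_chain2[OF dPh(1) this] show ?thesis by (simp add: D_def)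
 qed
 have Db: "\<bar>D s g\<bar> <= (C * exp (k * L)) * exp ((k * (B * K)) * l1 I g) * (B * K * l1 I g + B)" if s: "s \<in> {lo<..<hi}" for s g
 proof -
  have "\<bar>Ph' (u s g)\<bar> <= C * exp (k * \<bar>u s g\<bar>)" by (rule bPh)
  also have "... <= C * exp (k * (L + (B * K) * l1 I g))"
   using C0 k ub[OF s] by (intro mult_left_mono) (auto intro: mult_left_mono)
  finally have 1: "\<bar>Ph' (u s g)\<bar> <= (C * exp (k * L)) * exp ((k * (B * K)) * l1 I g)"
   by (simp add: mult_exp_exp algebra_simps)
  have "\<bar>\<Sum>i\<in>I. (c' i s * G s g (a i)) * g i\<bar> <= B * K * l1 I g"
  proof (rule linear_le_l1[OF I])
   fix i assume i: "i \<in> I"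
   have "\<bar>G s g (a i)\<bar> <= K" unfolding G_def by (rule gavg_abs_le[OF pG]) (use K i in auto)
   then show "\<bar>c' i s * G s g (a i)\<bar> <= B * K" unfolding abs_mult
    using bc(2)[OF i s] B0 by (intro mult_mono) auto
  qed
  then have "\<bar>(\<Sum>i\<in>I. c' i s * (g i * G s g (a i))) + d' s\<bar> <= B * K * l1 I g + B"
   using bd(2)[OF s] by (auto simp: mult_ac)
  with 1 show ?thesis unfolding D_def abs_mult using C0 by (intro mult_mono) auto
 qed
 have Dm: "D s \<in> borel_measurable (gau I)" for s unfolding D_def[abs_def] by measurable
 have el1: "expb I (%g. exp (r * l1 I g))" for r by (rule expbI[where C=1]) auto
 have el2: "expb I (l1 I)" by (rule expbI[where C=1 and c=1]) (auto, metis abs_of_nonneg l1_nonneg x_le_exp_abs)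
 have "((%s. \<integral>g. Ph (u s g) \<partial>gau I) has_real_derivative (LINT g|gau I. D t g)) (at t)"
 proof (rule has_real_derivative_lebesgue_integral[OF t])
  show "integrable (gau I) (%g. Ph (u s g))" if "s \<in> {lo<..<hi}" for s
   by (rule expb_integrable[OF I eu(1)[OF that]])
  show "integrable (gau I) (%g. (C * exp (k * L)) * exp ((k * (B * K)) * l1 I g) * (B * K * l1 I g + B))"
   by (intro expb_integrable[OF I] expb_mult expb_add expb_const el1 el2)
 qed (use du Db Dm in auto)
 also have "(LINT g|gau I. D t g) = (\<Sum>i\<in>I. c' i t * (LINT g|gau I. g i * (Ph' (u t g) * G t g (a i)))) + d' t * (LINT g|gau I. Ph' (u t g))"
 proof -
  have "(LINT g|gau I. D t g) = (LINT g|gau I. (\<Sum>i\<in>I. c' i t * (g i * (Ph' (u t g) * G t g (a i)))) + d' t * Ph' (u t g))"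
   by (simp add: D_def algebra_simps sum_distrib_left)
  also have "... = (\<Sum>i\<in>I. c' i t * (LINT g|gau I. g i * (Ph' (u t g) * G t g (a i)))) + d' t * (LINT g|gau I. Ph' (u t g))"
   by (rule gau_integral_lincomb[OF I]) (intro expb_mult expb_component I eu(2)[OF t] eG; assumption)+
  finally show ?thesis .
 qed
 also have "... = (\<Sum>i\<in>I. c' i t * (LINT g|gau I. c i t * (Ph'' (u t g) * (G t g (a i))\<^sup>2 + Ph' (u t g) * (G t g (%sg. (a i sg)\<^sup>2) - (G t g (a i))\<^sup>2)))) + d' t * (LINT g|gau I. Ph' (u t g))"
 proof (intro arg_cong2[where f="(+)"] sum.cong refl arg_cong2[where f="(*)"])
  fix i assume i: "i \<in> I"
  have fd: "((%x. u t (g(i:=x))) has_real_derivative c i t * G t (g(i:=x)) (a i)) (at x)" for g x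
  proof -
   have "((%x. u t (g(i:=x))) has_real_derivative gavg X (gw I (A t) w (g(i:=x))) (A t i) + 0) (at x)"
    unfolding u_def by (intro DERIV_add lnZ_fiber_deriv[OF I i w] DERIV_const)
   then show ?thesis by (simp add: G_def A_def[abs_def] gavg_cmult del: fun_upd_apply)
  qed
  have gd: "((%x. G t (g(i:=x)) f) has_real_derivative c i t * (G t (g(i:=x)) (%sg. f sg * a i sg) - G t (g(i:=x)) f * G t (g(i:=x)) (a i))) (at x)" for g x f
  proof -
   have "gavg X (gw I (A t) w (g(i:=x))) (%sg. f sg * A t i sg) = c i t * gavg X (gw I (A t) w (g(i:=x))) (%sg. f sg * a i sg)"
    unfolding A_def gavg_cmult[symmetric] by (simp add: mult_ac)
   moreover have "gavg X (gw I (A t) w (g(i:=x))) (A t i) = c i t * gavg X (gw I (A t) w (g(i:=x))) (a i)"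
    unfolding A_def gavg_cmult[symmetric] ..
   ultimately show ?thesis
    using gavg_fiber_deriv[OF I i w, of "A t" g f x] unfolding G_def by (simp only: right_diff_distrib mult_ac)
  qed
  have cu: "continuous_on UNIV (%x. u t (g(i:=x)))" for g
   by (rule DERIV_continuous_on, rule has_field_derivative_at_within, rule fd)
  have cG: "continuous_on UNIV (%x. G t (g(i:=x)) f)" for g f
   by (rule DERIV_continuous_on, rule has_field_derivative_at_within, rule gd)
  show "(LINT g|gau I. g i * (Ph' (u t g) * G t g (a i)))
   = (LINT g|gau I. c i t * (Ph'' (u t g) * (G t g (a i))\<^sup>2 + Ph' (u t g) * (G t g (%sg. (a i sg)\<^sup>2) - (G t g (a i))\<^sup>2)))"
  proof (rule gau_ibp[OF I i])
   show "expb I (%g. Ph' (u t g) * G t g (a i))" by (intro expb_mult eu(2)[OF t] eG)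
   show "expb I (%g. c i t * (Ph'' (u t g) * (G t g (a i))\<^sup>2 + Ph' (u t g) * (G t g (%sg. (a i sg)\<^sup>2) - (G t g (a i))\<^sup>2)))"
    unfolding power2_eq_square by (intro expb_cmult expb_add expb_diff expb_mult eu[OF t] eG)
   fix g x
   show "((%x. Ph' (u t (g(i:=x))) * G t (g(i:=x)) (a i)) has_real_derivative
    c i t * (Ph'' (u t (g(i:=x))) * (G t (g(i:=x)) (a i))\<^sup>2 + Ph' (u t (g(i:=x))) * (G t (g(i:=x)) (%sg. (a i sg)\<^sup>2) - (G t (g(i:=x)) (a i))\<^sup>2))) (at x)"
    using DERIV_mult'[OF DERIV_chain2[OF dPh(2) fd[of g x]] gd[of g "a i" x]]
    by (simp only: power2_eq_square algebra_simps)
  next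
   fix g
   show "continuous_on UNIV (%x. c i t * (Ph'' (u t (g(i:=x))) * (G t (g(i:=x)) (a i))\<^sup>2 + Ph' (u t (g(i:=x))) * (G t (g(i:=x)) (%sg. (a i sg)\<^sup>2) - (G t (g(i:=x)) (a i))\<^sup>2)))"
    by (intro continuous_intros cG continuous_on_compose2[OF cPh cu] continuous_on_compose2[OF c1(2) cu]) auto
  qed
 qed
 also have "... = (LINT g|gau I. (\<Sum>i\<in>I. c i t * c' i t * (Ph'' (u t g) * (G t g (a i))\<^sup>2 + Ph' (u t g) * (G t g (%sg. (a i sg)\<^sup>2) - (G t g (a i))\<^sup>2)))
    + d' t * Ph' (u t g))"
 proof -
  have e: "expb I (%g. Ph'' (u t g) * (G t g (a i))\<^sup>2 + Ph' (u t g) * (G t g (%sg. (a i sg)\<^sup>2) - (G t g (a i))\<^sup>2))" for i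
   unfolding power2_eq_square by (intro expb_cmult expb_add expb_diff expb_mult eu[OF t] eG)
  have "(\<Sum>i\<in>I. c' i t * (LINT g|gau I. c i t * (Ph'' (u t g) * (G t g (a i))\<^sup>2 + Ph' (u t g) * (G t g (%sg. (a i sg)\<^sup>2) - (G t g (a i))\<^sup>2)))) + d' t * (LINT g|gau I. Ph' (u t g))
  = (\<Sum>i\<in>I. (c i t * c' i t) * (LINT g|gau I. Ph'' (u t g) * (G t g (a i))\<^sup>2 + Ph' (u t g) * (G t g (%sg. (a i sg)\<^sup>2) - (G t g (a i))\<^sup>2))) + d' t * (LINT g|gau I. Ph' (u t g))"
   by (simp add: mult_ac)
  also have "... = (LINT g|gau I. (\<Sum>i\<in>I. (c i t * c' i t) * (Ph'' (u t g) * (G t g (a i))\<^sup>2 + Ph' (u t g) * (G t g (%sg. (a i sg)\<^sup>2) - (G t g (a i))\<^sup>2)))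
    + d' t * Ph' (u t g))"
   by (rule gau_integral_lincomb[OF I e eu(2)[OF t], symmetric])
  finally show ?thesis .
 qed
 finally show ?thesis unfolding u_def G_def .
qed

section \<open>Multi-indices, replicas and overlaps\<close>

lemma finite_idx [simp]: "finite (idx p N)"
proof -
 have "idx p N = {xs. set xs \<subseteq> {..<N} \<and> length xs = p}" by (auto simp: idx_def)
 then show ?thesis by (simp add: finite_lists_length_eq)
qed

lemma idx_Suc: "idx (Suc p) N = (%(i, l). i # l) ` ({..<N} \<times> idx p N)"
 by (auto simp: idx_def image_iff length_Suc_conv)

text \<open>Distributivity, one position at a time; it is what makes the covariance of tensor
  features a power of the overlap.\<close>

lemma sum_idx_prod:
 fixes f :: "nat => real"
 shows "(\<Sum>is\<in>idx p N. \<Prod>j<p. f (is ! j)) = (\<Sum>i<N. f i) ^ p"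
proof (induction p)
 case 0
 have "idx 0 N = {[]}" by (auto simp: idx_def)
 then show ?case by simp
next
 case (Suc p)
 have "(\<Sum>is\<in>idx (Suc p) N. \<Prod>j<Suc p. f (is ! j)) = (\<Sum>(i, l)\<in>{..<N} \<times> idx p N. \<Prod>j<Suc p. f ((i # l) ! j))"
  unfolding idx_Suc by (subst sum.reindex) (auto simp: inj_on_def split_beta)
 also have "... = (\<Sum>(i, l)\<in>{..<N} \<times> idx p N. f i * (\<Prod>j<p. f (l ! j)))"
  by (simp add: prod.lessThan_Suc_shift del: prod.lessThan_Suc)
 also have "... = (\<Sum>i<N. \<Sum>l\<in>idx p N. f i * (\<Prod>j<p. f (l ! j)))"
  by (simp add: sum.cartesian_product)
 also have "... = (\<Sum>i<N. f i) ^ Suc p"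
  by (simp add: sum_distrib_left[symmetric] sum_distrib_right[symmetric] Suc)
 finally show ?case .
qed

definition replicas :: "nat => 'x set => (nat => 'x) set" where
 "replicas n X = PiE {..<n} (%_. X)"

text \<open>The n-fold product Gibbs measure. It is kept as a single Gibbs average over replica
  tuples because it is itself of the form \<open>gw\<close> with summed features
  (\<open>gw_replicas\<close>), so that \<open>gibbs_ibp\<close> applies to functions of several
  replicas at once.\<close>

definition repavg :: "nat => 'x set => ('x => real) => ((nat => 'x) => real) => real" where
 "repavg n X W f = gavg (replicas n X) (%q. \<Prod>l<n. W (q l)) f"

lemma replicasD: "q \<in> replicas n X ==> l < n ==> q l \<in> X"
 by (auto simp: replicas_def)

lemma posw_replicas: "posw X W ==> posw (replicas n X) (%q. \<Prod>l<n. W (q l))"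
 by (auto simp: posw_def replicas_def PiE_eq_empty_iff intro!: finite_PiE prod_pos)

lemma sum_replicas_Suc:
 "(\<Sum>q\<in>replicas (Suc n) X. f q) = (\<Sum>q\<in>replicas n X. \<Sum>ta\<in>X. f (q(n:=ta)))"
proof -
 have eq: "replicas (Suc n) X = (%(ta, q). q(n:=ta)) ` (X \<times> replicas n X)"
  unfolding replicas_def lessThan_Suc PiE_insert_eq ..
 have inj: "inj_on (%(ta, q). q(n:=ta)) (X \<times> replicas n X)"
  unfolding replicas_def by (rule inj_combinator) simp
 have "(\<Sum>q\<in>replicas (Suc n) X. f q) = (\<Sum>(ta, q)\<in>X \<times> replicas n X. f (q(n:=ta)))"
  unfolding eq by (subst sum.reindex[OF inj]) (simp add: split_beta comp_def)
 also have "... = (\<Sum>ta\<in>X. \<Sum>q\<in>replicas n X. f (q(n:=ta)))"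
  by (simp add: sum.cartesian_product)
 also have "... = (\<Sum>q\<in>replicas n X. \<Sum>ta\<in>X. f (q(n:=ta)))" by (rule sum.swap)
 finally show ?thesis .
qed

lemma repavg_Suc:
 "repavg (Suc n) X W f = repavg n X W (%q. gavg X W (%ta. f (q(n:=ta))))"
proof -
 have p: "(\<Prod>l<Suc n. W ((q(n:=ta)) l)) = (\<Prod>l<n. W (q l)) * W ta" for q ta by simp
 have "(\<Sum>q\<in>replicas (Suc n) X. (\<Prod>l<Suc n. W (q l)) * f q)
  = (\<Sum>q\<in>replicas n X. (\<Prod>l<n. W (q l)) * (\<Sum>ta\<in>X. W ta * f (q(n:=ta))))"
  unfolding sum_replicas_Suc p by (simp only: sum_distrib_left mult.assoc)
 moreover have "(\<Sum>q\<in>replicas (Suc n) X. (\<Prod>l<Suc n. W (q l))) = (\<Sum>q\<in>replicas n X. (\<Prod>l<n. W (q l))) * (\<Sum>ta\<in>X. W ta)"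
  unfolding sum_replicas_Suc p by (simp only: sum_distrib_left[symmetric] sum_distrib_right[symmetric])
 ultimately show ?thesis
  unfolding repavg_def gavg_def by (simp add: sum_divide_distrib[symmetric] mult.commute)
qed

lemma repavg_marginal:
 assumes W: "posw X W" and l: "l < n"
 shows "repavg n X W (%q. h (q l)) = gavg X W h"
 using l
proof (induction n)
 case (Suc n)
 show ?case
 proof (cases "l = n")
  case True
  then show ?thesis unfolding repavg_Suc
   by (simp add: repavg_def gavg_const[OF posw_replicas[OF W]])
 next
  case False
  then show ?thesis using Suc unfolding repavg_Suc by (simp add: gavg_const[OF W])
 qed
qed simp

lemma gw_replicas:
 fixes n :: nat
 assumes "finite I"
 shows "gw I (%i q. \<Sum>l<n. a i (q l)) (%q. \<Prod>l<n. w (q l)) g q = (\<Prod>l<n. gw I a w g (q l))"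
proof -
 have "(\<Sum>i\<in>I. (\<Sum>l<n. a i (q l)) * g i) = (\<Sum>l<n. \<Sum>i\<in>I. a i (q l) * g i)"
  by (simp add: sum_distrib_right sum.swap[of _ I "{..<n}"])
 then have "exp (\<Sum>i\<in>I. (\<Sum>l<n. a i (q l)) * g i) = (\<Prod>l<n. exp (\<Sum>i\<in>I. a i (q l) * g i))"
  by (simp only: exp_sum[OF finite_lessThan])
 then show ?thesis by (simp add: gw_def prod.distrib)
qed

lemma repavg_gw:
 fixes n :: nat
 assumes "finite I"
 shows "repavg n X (gw I a w g) f = gavg (replicas n X) (gw I (%i q. \<Sum>l<n. a i (q l)) (%q. \<Prod>l<n. w (q l)) g) f"
 unfolding repavg_def gw_replicas[OF assms, abs_def] ..

text \<open>Configurations embedded as unit vectors of R^m. The bound b on single entries has square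
  sum at most one, which keeps the sum of squared bounds on the features of every degree at most
  one. The abstraction is applied to each of the two blocks of a larger spin system, with arbitrary
  reference weights.\<close>

locale spins =
 fixes X :: "'x set" and x :: "'x => nat => real" and m :: nat and b :: "nat => real"
 assumes X: "finite X" "X ~= {}"
  and unit: "sg \<in> X ==> (\<Sum>i<m. (x sg i)\<^sup>2) = 1"
  and b: "sg \<in> X ==> i < m ==> \<bar>x sg i\<bar> <= b i" "(\<Sum>i<m. (b i)\<^sup>2) <= 1"
begin

definition R :: "'x => 'x => real" where
 "R sg ta = (\<Sum>i<m. x sg i * x ta i)"

definition ph :: "nat list => 'x => real" where
 "ph is sg = (\<Prod>j<length is. x sg (is ! j))"

definition J :: "nat => nat list set" where
 "J d = (\<Union>s\<in>{1..d}. idx s m)"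

text \<open>Features of the perturbing Hamiltonian, one independent Gaussian for each multi-index in
  \<open>J d\<close>: r is the overall strength and y s the amplitude in degree s. The amplitudes
  are later averaged over a grid in [1, 2].\<close>

definition pert :: "real => (nat => real) => nat list => 'x => real" where
 "pert r y is sg = r * y (length is) * ph is sg"

lemma finite_J [simp]: "finite (J d)"
 unfolding J_def by (intro finite_UN_I finite_atLeastAtMost finite_idx)

lemma idx_subset_J: "s \<in> {1..d} ==> idx s m \<subseteq> J d"
 by (auto simp: J_def)

lemma sum_J: "(\<Sum>is\<in>J d. f is) = (\<Sum>s=1..d. \<Sum>is\<in>idx s m. f is)"
 unfolding J_def by (rule sum.UNION_disjoint) (simp, simp, auto simp: idx_def)

lemma length_idx: "is \<in> idx s m ==> length is = s"
 by (simp add: idx_def)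

lemma sum_ph: "(\<Sum>is\<in>idx s m. ph is sg * ph is ta) = R sg ta ^ s"
proof -
 have "(\<Sum>is\<in>idx s m. ph is sg * ph is ta) = (\<Sum>is\<in>idx s m. \<Prod>j<s. x sg (is ! j) * x ta (is ! j))"
  by (intro sum.cong) (auto simp: ph_def length_idx prod.distrib)
 then show ?thesis by (simp add: sum_idx_prod[of "%i. x sg i * x ta i"] R_def)
qed

lemma R_self [simp]: "sg \<in> X ==> R sg sg = 1"
 using unit by (simp add: R_def power2_eq_square)

lemma R_abs_le: assumes "sg \<in> X" "ta \<in> X" shows "\<bar>R sg ta\<bar> <= 1"
proof -
 have "(R sg ta)\<^sup>2 <= (\<Sum>i<m. (x sg i)\<^sup>2) * (\<Sum>i<m. (x ta i)\<^sup>2)"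
  unfolding R_def by (rule Cauchy_Schwarz_ineq_sum)
 also have "... = 1" using unit assms by simp
 finally show ?thesis by (simp add: abs_square_le_1)
qed

lemma ph_bound:
 assumes "sg \<in> X" "is \<in> idx s m" shows "\<bar>ph is sg\<bar> <= (\<Prod>j<s. b (is ! j))"
proof -
 have l: "length is = s" and i: "is ! j < m" if "j < s" for j
  using assms(2) nth_mem[of j "is"] that by (auto simp: idx_def subset_iff)
 have l: "length is = s" using assms(2) by (rule length_idx)
 show ?thesis
  unfolding ph_def abs_prod l by (rule prod_mono) (use b(1)[OF assms(1) i] in simp)
qed

lemma sum_b: "(\<Sum>is\<in>idx s m. (\<Prod>j<s. b (is ! j))\<^sup>2) <= 1"
proof -
 have "(\<Sum>is\<in>idx s m. (\<Prod>j<s. b (is ! j))\<^sup>2) = (\<Sum>i<m. (b i)\<^sup>2) ^ s"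
  by (simp add: prod_power_distrib sum_idx_prod[of "%i. (b i)\<^sup>2"])
 also have "... <= 1" using b(2) by (intro power_le_one) (auto intro: sum_nonneg)
 finally show ?thesis .
qed

text \<open>The Gaussian process whose covariance is the \<open>s\<close>-th power of the overlap.\<close>
definition G :: "nat => (nat list => real) => 'x => real" where
 "G s g sg = (\<Sum>is\<in>idx s m. ph is sg * g is)"

text \<open>Under the n-replica measure a coordinate of degree s carries the feature r * y s times
  the sum of \<open>ph\<close> over the replicas. Integration by parts therefore produces all pairs
  l, l', the diagonal included, minus a product of Gibbs averages, which is n times the overlap with
  one fresh replica ta.\<close>

lemma replica_ibp:
 fixes r :: real and y :: "nat => real"
 assumes w: "posw X w" and s: "s \<in> {1..d}" and n: "n > 0"
 defines "W == gw (J d) (pert r y) w"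
 shows "(LINT g|gau (J d). repavg n X (W g) (%q. f q * (\<Sum>l<n. G s g (q l))))
  = r * y s * (LINT g|gau (J d). repavg n X (W g) (%q. f q * (\<Sum>l<n. \<Sum>l'<n. R (q l) (q l') ^ s))
   - real n * repavg n X (W g) (%q. f q * (\<Sum>l<n. gavg X (W g) (%ta. R (q l) ta ^ s))))"
proof -
 define A where "A = (%is q. \<Sum>l<n. pert r y is (q l))"
 define wn where "wn = (%q. \<Prod>l<n. w (q l))"
 define Xn where "Xn = replicas n X"
 define P where "P = (%is q. \<Sum>l<n. ph is (q l))"
 have wn: "posw Xn wn" using posw_replicas[OF w] by (simp add: wn_def Xn_def)
 have rw: "repavg n X (W g) h = gavg Xn (gw (J d) A wn g) h" for g h
  unfolding W_def A_def wn_def Xn_def by (rule repavg_gw) simp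
 have pW: "posw X (W g)" for g unfolding W_def by (rule posw_gw[OF w])
 have AP: "A is q = r * y s * P is q" if "is \<in> idx s m" for "is" q
  using that by (simp add: A_def P_def pert_def sum_distrib_left length_idx)
 have ib: "integrable (gau (J d)) (%g. gavg Xn (gw (J d) A wn g) h)" for h
 proof (rule expb_integrable[OF finite_J], rule expb_bounded)
  fix g
  show "\<bar>gavg Xn (gw (J d) A wn g) h\<bar> <= (\<Sum>sg\<in>Xn. \<bar>h sg\<bar>)"
  proof (rule gavg_abs_le[OF posw_gw[OF wn]])
   fix sg assume "sg \<in> Xn"
   then show "\<bar>h sg\<bar> <= (\<Sum>sg\<in>Xn. \<bar>h sg\<bar>)" using wn by (intro member_le_sum) (auto simp: posw_def)
  qed
 qed measurable
 have eb: "expb (J d) (%g. gavg Xn (gw (J d) A wn g) h)" for h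
 proof (rule expb_bounded)
  fix g
  show "\<bar>gavg Xn (gw (J d) A wn g) h\<bar> <= (\<Sum>sg\<in>Xn. \<bar>h sg\<bar>)"
  proof (rule gavg_abs_le[OF posw_gw[OF wn]])
   fix sg assume "sg \<in> Xn"
   then show "\<bar>h sg\<bar> <= (\<Sum>sg\<in>Xn. \<bar>h sg\<bar>)" using wn by (intro member_le_sum) (auto simp: posw_def)
  qed
 qed measurable
 have mem: "is \<in> J d" if "is \<in> idx s m" for "is" using idx_subset_J[OF s] that by auto
 have sumG: "(\<Sum>l<n. G s g (q l)) = (\<Sum>is\<in>idx s m. g is * P is q)" for g q
  by (simp add: G_def P_def sum_distrib_left sum.swap[of _ "{..<n}"] mult.commute)
 have "repavg n X (W g) (%q. f q * (\<Sum>l<n. G s g (q l))) = (\<Sum>is\<in>idx s m. g is * gavg Xn (gw (J d) A wn g) (%q. f q * P is q))" for g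
 proof -
  have "repavg n X (W g) (%q. f q * (\<Sum>l<n. G s g (q l))) = gavg Xn (gw (J d) A wn g) (%q. \<Sum>is\<in>idx s m. g is * (f q * P is q))"
   unfolding rw sumG sum_distrib_left by (simp only: mult_ac)
  then show ?thesis by (simp only: gavg_sum gavg_cmult)
 qed
 then have "(LINT g|gau (J d). repavg n X (W g) (%q. f q * (\<Sum>l<n. G s g (q l))))
  = (LINT g|gau (J d). (\<Sum>is\<in>idx s m. g is * gavg Xn (gw (J d) A wn g) (%q. f q * P is q)))" by simp
 also have "... = (\<Sum>is\<in>idx s m. (LINT g|gau (J d). g is * gavg Xn (gw (J d) A wn g) (%q. f q * P is q)))"
  by (rule Bochner_Integration.integral_sum)
   (intro expb_integrable[OF finite_J] expb_mult expb_component[OF finite_J] eb mem)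
 also have "... = (\<Sum>is\<in>idx s m. (LINT g|gau (J d). gavg Xn (gw (J d) A wn g) (%q. f q * P is q * A is q)
   - gavg Xn (gw (J d) A wn g) (%q. f q * P is q) * gavg Xn (gw (J d) A wn g) (A is)))"
  by (intro sum.cong refl gibbs_ibp[OF finite_J mem wn])
 also have "... = (\<Sum>is\<in>idx s m. (LINT g|gau (J d). r * y s * (gavg Xn (gw (J d) A wn g) (%q. f q * (P is q * P is q))
   - real n * gavg Xn (gw (J d) A wn g) (%q. f q * (P is q * gavg X (W g) (ph is))))))"
 proof (intro sum.cong refl Bochner_Integration.integral_cong)
  fix "is" g assume i: "is \<in> idx s m"
  have "gavg Xn (gw (J d) A wn g) (A is) = r * y s * gavg Xn (gw (J d) A wn g) (P is)"
   unfolding gavg_cmult[symmetric] by (rule gavg_cong) (rule AP[OF i])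
  also have "gavg Xn (gw (J d) A wn g) (P is) = (\<Sum>l<n. gavg X (W g) (ph is))"
   unfolding P_def gavg_sum rw[symmetric] by (intro sum.cong refl repavg_marginal[OF pW]) auto
  finally have 1: "gavg Xn (gw (J d) A wn g) (A is) = r * y s * (real n * gavg X (W g) (ph is))" by simp
  have 2: "gavg Xn (gw (J d) A wn g) (%q. f q * P is q * A is q) = r * y s * gavg Xn (gw (J d) A wn g) (%q. f q * (P is q * P is q))"
   unfolding gavg_cmult[symmetric] AP[OF i] by (simp only: mult_ac)
  have 3: "gavg Xn (gw (J d) A wn g) (%q. f q * (P is q * gavg X (W g) (ph is))) = gavg Xn (gw (J d) A wn g) (%q. f q * P is q) * gavg X (W g) (ph is)"
   unfolding gavg_multc[symmetric] by (simp only: mult_ac)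
  show "gavg Xn (gw (J d) A wn g) (%q. f q * P is q * A is q) - gavg Xn (gw (J d) A wn g) (%q. f q * P is q) * gavg Xn (gw (J d) A wn g) (A is)
   = r * y s * (gavg Xn (gw (J d) A wn g) (%q. f q * (P is q * P is q)) - real n * gavg Xn (gw (J d) A wn g) (%q. f q * (P is q * gavg X (W g) (ph is))))"
   unfolding 1 2 3 by (simp add: algebra_simps)
 qed
 also have "... = (LINT g|gau (J d). (\<Sum>is\<in>idx s m. r * y s * (gavg Xn (gw (J d) A wn g) (%q. f q * (P is q * P is q))
   - real n * gavg Xn (gw (J d) A wn g) (%q. f q * (P is q * gavg X (W g) (ph is))))))"
 proof (rule Bochner_Integration.integral_sum[symmetric])
  fix "is"
  have 3: "gavg Xn (gw (J d) A wn g) (%q. f q * (P is q * gavg X (W g) (ph is))) = gavg Xn (gw (J d) A wn g) (%q. f q * P is q) * gavg X (W g) (ph is)" for g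
   unfolding gavg_multc[symmetric] by (simp only: mult_ac)
  have e1: "expb (J d) (%g. gavg X (W g) (ph is))"
  proof (rule expb_bounded)
   fix g
   show "\<bar>gavg X (W g) (ph is)\<bar> <= (\<Sum>sg\<in>X. \<bar>ph is sg\<bar>)"
   proof (rule gavg_abs_le[OF pW])
    fix sg assume "sg \<in> X"
    then show "\<bar>ph is sg\<bar> <= (\<Sum>sg\<in>X. \<bar>ph is sg\<bar>)" using X by (intro member_le_sum) auto
   qed
  qed (unfold W_def, measurable)
  show "integrable (gau (J d)) (%g. r * y s * (gavg Xn (gw (J d) A wn g) (%q. f q * (P is q * P is q))
   - real n * gavg Xn (gw (J d) A wn g) (%q. f q * (P is q * gavg X (W g) (ph is)))))"
   unfolding 3 by (rule expb_integrable[OF finite_J], rule expb_cmult, rule expb_diff, rule eb, rule expb_cmult, rule expb_mult[OF eb e1])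
 qed
 also have "... = (LINT g|gau (J d). r * y s * (repavg n X (W g) (%q. f q * (\<Sum>l<n. \<Sum>l'<n. R (q l) (q l') ^ s))
   - real n * repavg n X (W g) (%q. f q * (\<Sum>l<n. gavg X (W g) (%ta. R (q l) ta ^ s)))))"
 proof (intro Bochner_Integration.integral_cong refl)
  fix g
  have 1: "(\<Sum>is\<in>idx s m. P is q * P is q) = (\<Sum>l<n. \<Sum>l'<n. R (q l) (q l') ^ s)" for q
  proof -
   have "(\<Sum>is\<in>idx s m. P is q * P is q) = (\<Sum>is\<in>idx s m. \<Sum>l<n. \<Sum>l'<n. ph is (q l) * ph is (q l'))"
    by (simp add: P_def sum_product)
   also have "... = (\<Sum>l<n. \<Sum>is\<in>idx s m. \<Sum>l'<n. ph is (q l) * ph is (q l'))" by (rule sum.swap)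
   also have "... = (\<Sum>l<n. \<Sum>l'<n. \<Sum>is\<in>idx s m. ph is (q l) * ph is (q l'))"
    by (intro sum.cong refl sum.swap)
   finally show ?thesis by (simp add: sum_ph)
  qed
  have 2: "(\<Sum>is\<in>idx s m. P is q * gavg X (W g) (ph is)) = (\<Sum>l<n. gavg X (W g) (%ta. R (q l) ta ^ s))" for q
  proof -
   have "(\<Sum>is\<in>idx s m. P is q * gavg X (W g) (ph is)) = (\<Sum>is\<in>idx s m. \<Sum>l<n. ph is (q l) * gavg X (W g) (ph is))"
    by (simp add: P_def sum_distrib_right)
   also have "... = (\<Sum>l<n. \<Sum>is\<in>idx s m. ph is (q l) * gavg X (W g) (ph is))" by (rule sum.swap)
   finally show ?thesis by (simp add: gavg_cmult[symmetric] gavg_sum[symmetric] sum_ph)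
  qed
  have "(\<Sum>is\<in>idx s m. r * y s * (gavg Xn (gw (J d) A wn g) (%q. f q * (P is q * P is q))
   - real n * gavg Xn (gw (J d) A wn g) (%q. f q * (P is q * gavg X (W g) (ph is)))))
  = r * y s * (gavg Xn (gw (J d) A wn g) (%q. f q * (\<Sum>is\<in>idx s m. P is q * P is q))
   - real n * gavg Xn (gw (J d) A wn g) (%q. f q * (\<Sum>is\<in>idx s m. P is q * gavg X (W g) (ph is))))"
   by (simp only: sum_distrib_left gavg_sum sum_subtractf right_diff_distrib)
  then show "(\<Sum>is\<in>idx s m. r * y s * (gavg Xn (gw (J d) A wn g) (%q. f q * (P is q * P is q))
   - real n * gavg Xn (gw (J d) A wn g) (%q. f q * (P is q * gavg X (W g) (ph is)))))
  = r * y s * (repavg n X (W g) (%q. f q * (\<Sum>l<n. \<Sum>l'<n. R (q l) (q l') ^ s))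
   - real n * repavg n X (W g) (%q. f q * (\<Sum>l<n. gavg X (W g) (%ta. R (q l) ta ^ s))))"
   unfolding rw 1 2 .
 qed
 finally show ?thesis by simp
qed

end

section \<open>Approximate Ghirlanda-Guerra identities\<close>

lemma expb_gavg:
 assumes w: "posw X w" and f: "!!sg. sg \<in> X ==> expb I (%g. f g sg)"
 shows "expb I (%g. gavg X (gw I a w g) (f g))"
proof (rule expb_mono[where h="%g. \<Sum>sg\<in>X. \<bar>f g sg\<bar>"])
 show "expb I (%g. \<Sum>sg\<in>X. \<bar>f g sg\<bar>)" by (rule expb_sum, rule expb_abs, rule f)
 show "(%g. gavg X (gw I a w g) (f g)) \<in> borel_measurable (gau I)"
  by (rule measurable_gavg_gw2) (rule expb_measurable[OF f])
 fix g
 have "\<bar>gavg X (gw I a w g) (f g)\<bar> <= (\<Sum>sg\<in>X. \<bar>f g sg\<bar>)"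
 proof (rule gavg_abs_le[OF posw_gw[OF w]])
  fix sg assume "sg \<in> X"
  then show "\<bar>f g sg\<bar> <= (\<Sum>sg\<in>X. \<bar>f g sg\<bar>)" using w by (intro member_le_sum) (auto simp: posw_def)
 qed
 then show "\<bar>gavg X (gw I a w g) (f g)\<bar> <= \<bar>\<Sum>sg\<in>X. \<bar>f g sg\<bar>\<bar>" by linarith
qed

lemma expb_repavg:
 assumes I: "finite I" and w: "posw X w" and f: "!!q. q \<in> replicas n X ==> expb I (%g. f g q)"
 shows "expb I (%g. repavg n X (gw I a w g) (f g))"
 unfolding repavg_gw[OF I] by (rule expb_gavg[OF posw_replicas[OF w] f])

lemma repavg_add: "repavg n X W (%q. f q + h q) = repavg n X W f + repavg n X W h"
 by (simp add: repavg_def gavg_add)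

lemma repavg_diff: "repavg n X W (%q. f q - h q) = repavg n X W f - repavg n X W h"
 by (simp add: repavg_def gavg_diff)

lemma repavg_cmult: "repavg n X W (%q. c * f q) = c * repavg n X W f"
 by (simp add: repavg_def gavg_cmult)

lemma repavg_sum: "repavg n X W (%q. \<Sum>i\<in>A. f i q) = (\<Sum>i\<in>A. repavg n X W (f i))"
 by (simp add: repavg_def gavg_sum)

lemma repavg_const: "posw X W ==> repavg n X W (%_. c) = c"
 by (simp add: repavg_def gavg_const posw_replicas)

lemma repavg_mono:
 "posw X W ==> (!!q. q \<in> replicas n X ==> f q <= h q) ==> repavg n X W f <= repavg n X W h"
 unfolding repavg_def by (rule gavg_mono[OF posw_replicas])

lemma repavg_abs: "posw X W ==> \<bar>repavg n X W f\<bar> <= repavg n X W (%q. \<bar>f q\<bar>)"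
 unfolding repavg_def by (rule gavg_abs[OF posw_replicas])

lemma gw_scale_shift:
 "gw I (%i sg. a i sg + h i sg) w g sg = gw I a w g sg * exp (\<Sum>i\<in>I. h i sg * g i)"
 by (simp add: gw_def algebra_simps sum.distrib exp_add)

lemma ln_sum_exp:
 assumes "posw X W"
 shows "ln (\<Sum>sg\<in>X. W sg * exp (f sg)) = ln (\<Sum>sg\<in>X. W sg) + ln (gavg X W (%sg. exp (f sg)))"
proof -
 have 1: "(\<Sum>sg\<in>X. W sg) > 0" "(\<Sum>sg\<in>X. W sg * exp (f sg)) > 0"
  using posw_sum[OF assms] posw_sum[OF posw_exp[OF assms]] by auto
 then show ?thesis by (simp add: gavg_def ln_div)
qed

context spins
begin

text \<open>The Gibbs average of f times the sum of G s over the replicas is computed twice: exactly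
  by \<open>replica_ibp\<close>, and approximately by replacing G s by its overall mean mG, with
  error at most n times the mean deviation of G s. The case of one replica and f = 1 gives mG
  itself. Comparing the two and dividing by n * r * y s leaves the identity for the fresh
  replica.\<close>

lemma gg_power:
 fixes r :: real and y :: "nat => real"
 assumes w: "posw X w" and s: "s \<in> {1..d}" and n: "n > 0" and r: "r > 0" and ys: "y s >= 1"
  and f: "!!q. q \<in> replicas n X ==> 0 <= f q \<and> f q <= 1"
 defines "W == gw (J d) (pert r y) w"
 defines "mG == (LINT g|gau (J d). gavg X (W g) (G s g))"
 shows "mG = r * y s * (1 - (LINT g|gau (J d). gavg X (W g) (%sg. gavg X (W g) (%ta. R sg ta ^ s))))"
  and "\<bar>(LINT g|gau (J d). repavg n X (W g) (%q. f q * (\<Sum>l<n. gavg X (W g) (%ta. R (q l) ta ^ s))))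
   - (1 / real n) * (LINT g|gau (J d). repavg n X (W g) (%q. f q * (\<Sum>l<n. \<Sum>l'<n. R (q l) (q l') ^ s)))
   + (1 - (LINT g|gau (J d). gavg X (W g) (%sg. gavg X (W g) (%ta. R sg ta ^ s)))) * (LINT g|gau (J d). repavg n X (W g) f)\<bar>
  <= (LINT g|gau (J d). gavg X (W g) (%sg. \<bar>G s g sg - mG\<bar>)) / r"
proof -
 let ?E = "%h. \<integral>g. h g \<partial>gau (J d)"
 interpret P: prob_space "gau (J d)" by (rule prob_space_gau)
 have pW: "posw X (W g)" for g unfolding W_def by (rule posw_gw[OF w])
 have eW: "expb (J d) (%g. gavg X (W g) (h g))" if "!!sg. sg \<in> X ==> expb (J d) (%g. h g sg)" for h
  unfolding W_def by (rule expb_gavg[OF w that])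
 have eR: "expb (J d) (%g. repavg k X (W g) (h g))" if "!!q. q \<in> replicas k X ==> expb (J d) (%g. h g q)" for h k
  unfolding W_def by (rule expb_repavg[OF finite_J w that])
 note i = expb_integrable[OF finite_J]
 define ka where "ka = ?E (%g. gavg X (W g) (%sg. gavg X (W g) (%ta. R sg ta ^ s)))"
 have eK: "expb (J d) (%g. gavg X (W g) (%ta. R sg ta ^ s))" for sg
  by (rule eW) (rule expb_const)
 have eG: "expb (J d) (%g. G s g sg)" for sg
  unfolding G_def
  by (rule expb_sum, rule expb_cmult, rule expb_component[OF finite_J]) (use idx_subset_J[OF s] in blast)
 have mG: "mG = r * y s * (1 - ka)"
 proof -
  have 1: "repavg (Suc 0) X (W g) (%q. h (q 0)) = gavg X (W g) h" for g h
   by (rule repavg_marginal[OF pW]) simp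
  have 2: "gavg X (W g) (%sg. R sg sg ^ s) = 1" for g
  proof -
   have "gavg X (W g) (%sg. R sg sg ^ s) = gavg X (W g) (%sg. 1)" by (rule gavg_cong) simp
   then show ?thesis by (simp add: gavg_const[OF pW])
  qed
  have 3: "repavg (Suc 0) X (W g) (%q. R (q 0) (q 0) ^ s) = gavg X (W g) (%sg. R sg sg ^ s)" for g by (rule 1)
  have 4: "repavg (Suc 0) X (W g) (%q. gavg X (W g) (%ta. R (q 0) ta ^ s)) = gavg X (W g) (%sg. gavg X (W g) (%ta. R sg ta ^ s))" for g by (rule 1)
  have 5: "repavg (Suc 0) X (W g) (%q. G s g (q 0)) = gavg X (W g) (G s g)" for g by (rule 1)
  have "mG = r * y s * ?E (%g. 1 - gavg X (W g) (%sg. gavg X (W g) (%ta. R sg ta ^ s)))"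
   using replica_ibp[OF w s, of 1 r y "%_. 1", folded W_def]
   by (simp add: 2 3 4 5 mG_def)
  also have "?E (%g. 1 - gavg X (W g) (%sg. gavg X (W g) (%ta. R sg ta ^ s))) = 1 - ka"
   unfolding ka_def using i[OF eW[OF eK]] by (simp add: P.prob_space)
  finally show ?thesis .
 qed
 then show "mG = r * y s * (1 - ?E (%g. gavg X (W g) (%sg. gavg X (W g) (%ta. R sg ta ^ s))))"
  by (simp add: ka_def)
 define B where "B = ?E (%g. repavg n X (W g) (%q. f q * (\<Sum>l<n. gavg X (W g) (%ta. R (q l) ta ^ s))))"
 define A where "A = ?E (%g. repavg n X (W g) (%q. f q * (\<Sum>l<n. \<Sum>l'<n. R (q l) (q l') ^ s)))"
 define p where "p = ?E (%g. repavg n X (W g) f)"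
 define Dv where "Dv = ?E (%g. gavg X (W g) (%sg. \<bar>G s g sg - mG\<bar>))"
 have eSG: "expb (J d) (%g. f q * (\<Sum>l<n. G s g (q l)))" for q
  by (rule expb_cmult, rule expb_sum, rule eG)
 have eB: "expb (J d) (%g. f q * (\<Sum>l<n. gavg X (W g) (%ta. R (q l) ta ^ s)))" for q
  by (rule expb_cmult, rule expb_sum, rule eK)
 have ibp: "?E (%g. repavg n X (W g) (%q. f q * (\<Sum>l<n. G s g (q l)))) = r * y s * (A - real n * B)"
 proof -
  have "?E (%g. repavg n X (W g) (%q. f q * (\<Sum>l<n. \<Sum>l'<n. R (q l) (q l') ^ s))
   - real n * repavg n X (W g) (%q. f q * (\<Sum>l<n. gavg X (W g) (%ta. R (q l) ta ^ s)))) = A - real n * B"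
   unfolding A_def B_def
   using i[OF eR[OF expb_const]] i[OF eR[OF eB]] by simp
  then show ?thesis using replica_ibp[OF w s n, of r y f, folded W_def] by simp
 qed
 have D: "?E (%g. repavg n X (W g) (%q. f q * (\<Sum>l<n. G s g (q l) - mG))) = r * y s * (A - real n * B) - real n * mG * p"
 proof -
  have "repavg n X (W g) (%q. f q * (\<Sum>l<n. G s g (q l) - mG))
   = repavg n X (W g) (%q. f q * (\<Sum>l<n. G s g (q l))) - (real n * mG) * repavg n X (W g) f" for g
   unfolding repavg_cmult[symmetric] repavg_diff[symmetric]
   by (simp add: sum_subtractf algebra_simps)
  then show ?thesis
   using i[OF eR[OF eSG]] i[OF eR[OF expb_const], of n f] by (simp add: ibp p_def)
 qed
 have "\<bar>?E (%g. repavg n X (W g) (%q. f q * (\<Sum>l<n. G s g (q l) - mG)))\<bar>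
  <= ?E (%g. real n * gavg X (W g) (%sg. \<bar>G s g sg - mG\<bar>))"
 proof (rule order_trans[OF integral_abs_bound], rule integral_mono)
  have e1: "expb (J d) (%g. f q * (\<Sum>l<n. G s g (q l) - mG))" for q
   by (rule expb_cmult, rule expb_sum, rule expb_diff, rule eG, rule expb_const)
  show "integrable (gau (J d)) (%g. \<bar>repavg n X (W g) (%q. f q * (\<Sum>l<n. G s g (q l) - mG))\<bar>)"
   by (rule i, rule expb_abs, rule eR, rule e1)
  show "integrable (gau (J d)) (%g. real n * gavg X (W g) (%sg. \<bar>G s g sg - mG\<bar>))"
   by (rule i, rule expb_cmult, rule eW, rule expb_abs, rule expb_diff, rule eG, rule expb_const)
  fix g
  have "\<bar>repavg n X (W g) (%q. f q * (\<Sum>l<n. G s g (q l) - mG))\<bar>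
   <= repavg n X (W g) (%q. \<bar>f q * (\<Sum>l<n. G s g (q l) - mG)\<bar>)" by (rule repavg_abs[OF pW])
  also have "... <= repavg n X (W g) (%q. \<Sum>l<n. \<bar>G s g (q l) - mG\<bar>)"
  proof (rule repavg_mono[OF pW])
   fix q assume q: "q \<in> replicas n X"
   have "\<bar>f q * (\<Sum>l<n. G s g (q l) - mG)\<bar> <= 1 * (\<Sum>l<n. \<bar>G s g (q l) - mG\<bar>)"
    unfolding abs_mult using f[OF q] by (intro mult_mono sum_abs) auto
   then show "\<bar>f q * (\<Sum>l<n. G s g (q l) - mG)\<bar> <= (\<Sum>l<n. \<bar>G s g (q l) - mG\<bar>)" by simp
  qed
  also have "... = (\<Sum>l<n. gavg X (W g) (%sg. \<bar>G s g sg - mG\<bar>))"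
   unfolding repavg_sum by (intro sum.cong refl repavg_marginal[OF pW]) simp
  finally show "\<bar>repavg n X (W g) (%q. f q * (\<Sum>l<n. G s g (q l) - mG))\<bar> <= real n * gavg X (W g) (%sg. \<bar>G s g sg - mG\<bar>)"
   by simp
 qed
 then have "\<bar>r * y s * (A - real n * B) - real n * mG * p\<bar> <= real n * Dv"
  unfolding D by (simp add: Dv_def)
 then have "\<bar>r * y s * (A - real n * B) - real n * (r * y s * (1 - ka)) * p\<bar> <= real n * Dv"
  by (simp only: mG)
 also have "r * y s * (A - real n * B) - real n * (r * y s * (1 - ka)) * p = - (real n * r * y s) * (B - (1 / real n) * A + (1 - ka) * p)"
  using n by (simp add: field_simps)
 finally have "real n * r * y s * \<bar>B - (1 / real n) * A + (1 - ka) * p\<bar> <= real n * Dv"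
  using n r ys by (simp add: abs_mult)
 then have 1: "r * y s * \<bar>B - (1 / real n) * A + (1 - ka) * p\<bar> <= Dv" using n by (simp add: mult.assoc)
 have "r * \<bar>B - (1 / real n) * A + (1 - ka) * p\<bar> <= r * y s * \<bar>B - (1 / real n) * A + (1 - ka) * p\<bar>"
  using r ys by (intro mult_right_mono) auto
 from order_trans[OF this 1] have "\<bar>B - (1 / real n) * A + (1 - ka) * p\<bar> <= Dv / r"
  using r by (simp only: pos_le_divide_eq mult.commute)
 then show "\<bar>?E (%g. repavg n X (W g) (%q. f q * (\<Sum>l<n. gavg X (W g) (%ta. R (q l) ta ^ s))))
   - (1 / real n) * ?E (%g. repavg n X (W g) (%q. f q * (\<Sum>l<n. \<Sum>l'<n. R (q l) (q l') ^ s)))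
   + (1 - ?E (%g. gavg X (W g) (%sg. gavg X (W g) (%ta. R sg ta ^ s)))) * ?E (%g. repavg n X (W g) f)\<bar>
  <= ?E (%g. gavg X (W g) (%sg. \<bar>G s g sg - mG\<bar>)) / r"
  unfolding A_def B_def p_def ka_def Dv_def .
qed

text \<open>Mean absolute deviation of G s under the joint law of the disorder and one replica. It
  is the error in every identity below and is made small by averaging over the amplitudes.\<close>

definition dev :: "nat => ('x => real) => real => (nat => real) => nat => real" where
 "dev d w r y s = (LINT g|gau (J d). gavg X (gw (J d) (pert r y) w g)
  (%sg. \<bar>G s g sg - (LINT g|gau (J d). gavg X (gw (J d) (pert r y) w g) (G s g))\<bar>))"

text \<open>Linear in the powers. For s = 0 the identity is trivially exact, so the error sum starts
  at degree 1, matching the degrees present in \<open>J\<close>.\<close>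

lemma gg_polynomial:
 fixes r :: real and y :: "nat => real" and c :: "nat => real"
 assumes w: "posw X w" and n: "n > 0" and r: "r > 0" and ys: "!!s. s \<in> {1..d} ==> y s >= 1"
  and f: "!!q. q \<in> replicas n X ==> 0 <= f q \<and> f q <= 1"
 defines "W == gw (J d) (pert r y) w"
 defines "ps == %z. \<Sum>s\<le>d. c s * z ^ s"
 shows "\<bar>(LINT g|gau (J d). repavg n X (W g) (%q. f q * (\<Sum>l<n. gavg X (W g) (%ta. ps (R (q l) ta)))))
   - (1 / real n) * (LINT g|gau (J d). repavg n X (W g) (%q. f q * (\<Sum>l<n. \<Sum>l'<n. ps (R (q l) (q l')))))
   + (ps 1 - (LINT g|gau (J d). gavg X (W g) (%sg. gavg X (W g) (%ta. ps (R sg ta))))) * (LINT g|gau (J d). repavg n X (W g) f)\<bar>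
  <= (\<Sum>s=1..d. \<bar>c s\<bar> * dev d w r y s) / r"
proof -
 let ?E = "%h. \<integral>g. h g \<partial>gau (J d)"
 interpret P: prob_space "gau (J d)" by (rule prob_space_gau)
 have pW: "posw X (W g)" for g unfolding W_def by (rule posw_gw[OF w])
 have eW: "expb (J d) (%g. gavg X (W g) (h g))" if "!!sg. sg \<in> X ==> expb (J d) (%g. h g sg)" for h
  unfolding W_def by (rule expb_gavg[OF w that])
 have eR: "expb (J d) (%g. repavg k X (W g) (h g))" if "!!q. q \<in> replicas k X ==> expb (J d) (%g. h g q)" for h k
  unfolding W_def by (rule expb_repavg[OF finite_J w that])
 note i = expb_integrable[OF finite_J]
 define K where "K s g sg = gavg X (W g) (%ta. R sg ta ^ s)" for s g sg
 define p where "p = ?E (%g. repavg n X (W g) f)"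
 define ka where "ka s = ?E (%g. gavg X (W g) (K s g))" for s
 define B where "B s = ?E (%g. repavg n X (W g) (%q. f q * (\<Sum>l<n. K s g (q l))))" for s
 define A where "A s = ?E (%g. repavg n X (W g) (%q. f q * (\<Sum>l<n. \<Sum>l'<n. R (q l) (q l') ^ s)))" for s
 have eK: "expb (J d) (%g. K s g sg)" for s sg
  unfolding K_def by (rule eW) (rule expb_const)
 have eB: "expb (J d) (%g. f q * (\<Sum>l<n. K s g (q l)))" for s q
  by (rule expb_cmult, rule expb_sum, rule eK)
 have Kps: "gavg X (W g) (%ta. ps (R sg ta)) = (\<Sum>s\<le>d. c s * K s g sg)" for g sg
  unfolding ps_def K_def gavg_sum gavg_cmult ..
 have 1: "?E (%g. repavg n X (W g) (%q. f q * (\<Sum>l<n. gavg X (W g) (%ta. ps (R (q l) ta))))) = (\<Sum>s\<le>d. c s * B s)"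
 proof -
  have "repavg n X (W g) (%q. f q * (\<Sum>l<n. gavg X (W g) (%ta. ps (R (q l) ta))))
   = (\<Sum>s\<le>d. c s * repavg n X (W g) (%q. f q * (\<Sum>l<n. K s g (q l))))" for g
  proof -
   have "f q * (\<Sum>l<n. gavg X (W g) (%ta. ps (R (q l) ta))) = (\<Sum>s\<le>d. c s * (f q * (\<Sum>l<n. K s g (q l))))" for q
    unfolding Kps by (subst sum.swap) (simp add: sum_distrib_left mult_ac)
   then show ?thesis by (simp add: repavg_sum repavg_cmult)
  qed
  then have "?E (%g. repavg n X (W g) (%q. f q * (\<Sum>l<n. gavg X (W g) (%ta. ps (R (q l) ta)))))
   = ?E (%g. \<Sum>s\<le>d. c s * repavg n X (W g) (%q. f q * (\<Sum>l<n. K s g (q l))))" by simp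
  also have "... = (\<Sum>s\<le>d. ?E (%g. c s * repavg n X (W g) (%q. f q * (\<Sum>l<n. K s g (q l)))))"
   by (rule Bochner_Integration.integral_sum, rule i, rule expb_cmult, rule eR, rule eB)
  finally show ?thesis by (simp add: B_def)
 qed
 have 2: "?E (%g. repavg n X (W g) (%q. f q * (\<Sum>l<n. \<Sum>l'<n. ps (R (q l) (q l'))))) = (\<Sum>s\<le>d. c s * A s)"
 proof -
  have "repavg n X (W g) (%q. f q * (\<Sum>l<n. \<Sum>l'<n. ps (R (q l) (q l'))))
   = (\<Sum>s\<le>d. c s * repavg n X (W g) (%q. f q * (\<Sum>l<n. \<Sum>l'<n. R (q l) (q l') ^ s)))" for g
  proof -
   have "(\<Sum>l<n. \<Sum>l'<n. ps (R (q l) (q l'))) = (\<Sum>l<n. \<Sum>s\<le>d. \<Sum>l'<n. c s * R (q l) (q l') ^ s)" for q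
    unfolding ps_def by (rule sum.cong[OF refl], rule sum.swap)
   also have "... q = (\<Sum>s\<le>d. \<Sum>l<n. \<Sum>l'<n. c s * R (q l) (q l') ^ s)" for q by (rule sum.swap)
   finally have "f q * (\<Sum>l<n. \<Sum>l'<n. ps (R (q l) (q l'))) = (\<Sum>s\<le>d. c s * (f q * (\<Sum>l<n. \<Sum>l'<n. R (q l) (q l') ^ s)))" for q
    by (simp add: sum_distrib_left mult_ac)
   then show ?thesis by (simp add: repavg_sum repavg_cmult)
  qed
  then have "?E (%g. repavg n X (W g) (%q. f q * (\<Sum>l<n. \<Sum>l'<n. ps (R (q l) (q l')))))
   = ?E (%g. \<Sum>s\<le>d. c s * repavg n X (W g) (%q. f q * (\<Sum>l<n. \<Sum>l'<n. R (q l) (q l') ^ s)))" by simp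
  also have "... = (\<Sum>s\<le>d. ?E (%g. c s * repavg n X (W g) (%q. f q * (\<Sum>l<n. \<Sum>l'<n. R (q l) (q l') ^ s))))"
   by (rule Bochner_Integration.integral_sum, rule i, rule expb_cmult, rule eR, rule expb_const)
  finally show ?thesis by (simp add: A_def)
 qed
 have 3: "?E (%g. gavg X (W g) (%sg. gavg X (W g) (%ta. ps (R sg ta)))) = (\<Sum>s\<le>d. c s * ka s)"
 proof -
  have "?E (%g. gavg X (W g) (%sg. gavg X (W g) (%ta. ps (R sg ta)))) = ?E (%g. \<Sum>s\<le>d. c s * gavg X (W g) (K s g))"
   unfolding Kps gavg_sum gavg_cmult by simp
  also have "... = (\<Sum>s\<le>d. ?E (%g. c s * gavg X (W g) (K s g)))"
   by (rule Bochner_Integration.integral_sum, rule i, rule expb_cmult, rule eW, rule eK)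
  finally show ?thesis by (simp add: ka_def)
 qed
 define T where "T s = B s - (1 / real n) * A s + (1 - ka s) * p" for s
 have T0: "T 0 = 0"
 proof -
  have k: "K 0 g sg = 1" for g sg by (simp add: K_def gavg_const[OF pW])
  have "repavg n X (W g) (%q. f q * real n) = real n * repavg n X (W g) f" for g
   using repavg_cmult[of n X "W g" "real n" f] by (simp add: mult.commute)
  moreover have "repavg n X (W g) (%q. f q * (real n * real n)) = real n * real n * repavg n X (W g) f" for g
   using repavg_cmult[of n X "W g" "real n * real n" f] by (simp add: mult.commute)
  moreover have "gavg X (W g) (K 0 g) = 1" for g
  proof -
   have "gavg X (W g) (K 0 g) = gavg X (W g) (%_. 1)" by (rule gavg_cong) (rule k)
   then show ?thesis by (simp add: gavg_const[OF pW])
  qed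
  ultimately show ?thesis
   unfolding T_def B_def A_def ka_def using n by (simp add: k p_def P.prob_space)
 qed
 have Ts: "\<bar>T s\<bar> <= dev d w r y s / r" if s: "s \<in> {1..d}" for s
  using gg_power(2)[of w s d n r y f, OF w s n r ys[OF s] f] unfolding T_def A_def B_def ka_def K_def p_def dev_def W_def .
 have "(\<Sum>s\<le>d. c s * B s) - (1 / real n) * (\<Sum>s\<le>d. c s * A s) + (ps 1 - (\<Sum>s\<le>d. c s * ka s)) * p = (\<Sum>s\<le>d. c s * T s)"
  by (simp add: T_def ps_def algebra_simps sum.distrib sum_subtractf sum_distrib_left)
 also have "... = (\<Sum>s=1..d. c s * T s)"
  by (simp add: T0 atMost_atLeast0 sum.atLeast_Suc_atMost)
 also have "\<bar>...\<bar> <= (\<Sum>s=1..d. \<bar>c s\<bar> * (dev d w r y s / r))"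
  by (rule order_trans[OF sum_abs], rule sum_mono, unfold abs_mult, rule mult_left_mono[OF Ts]) auto
 finally show ?thesis unfolding 1 2 3 p_def[symmetric] by (simp add: sum_divide_distrib)
qed

end

section \<open>Talagrand's positivity principle\<close>

context spins
begin

text \<open>The event whose probability is bounded below one replica at a time, until geometry makes
  it impossible.\<close>

definition ind :: "nat => real => (nat => 'x) => real" where
 "ind n a q = (if \<forall>l<n. \<forall>l'<n. l ~= l' --> R (q l) (q l') <= - a then 1 else 0)"

lemma R_sym: "R sg ta = R ta sg"
 by (simp add: R_def mult.commute)

text \<open>The sum of M unit vectors has nonnegative squared norm, but pairwise inner products at
  most -a would make it at most M * (1 - (M - 1) * a) < 0.\<close>

lemma ind_eq_0:
 assumes q: "q \<in> replicas M X" and M: "(real M - 1) * a > 1" "M > 0"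
 shows "ind M a q = 0"
proof (rule ccontr)
 assume "ind M a q ~= 0"
 then have le: "R (q l) (q l') <= - a" if "l < M" "l' < M" "l ~= l'" for l l'
  using that by (auto simp: ind_def split: if_splits)
 have "0 <= (\<Sum>i<m. (\<Sum>l<M. x (q l) i)\<^sup>2)" by (simp add: sum_nonneg)
 also have "... = (\<Sum>i<m. \<Sum>l<M. \<Sum>l'<M. x (q l) i * x (q l') i)"
  by (simp add: power2_eq_square sum_product)
 also have "... = (\<Sum>l<M. \<Sum>i<m. \<Sum>l'<M. x (q l) i * x (q l') i)" by (rule sum.swap)
 also have "... = (\<Sum>l<M. \<Sum>l'<M. R (q l) (q l'))"
  unfolding R_def by (rule sum.cong[OF refl], rule sum.swap)
 also have "... <= (\<Sum>l<M. 1 + (real M - 1) * (- a))"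
 proof (rule sum_mono)
  fix l assume l: "l \<in> {..<M}"
  have "(\<Sum>l'<M. R (q l) (q l')) = R (q l) (q l) + (\<Sum>l'\<in>{..<M} - {l}. R (q l) (q l'))"
   using l by (simp add: sum.remove)
  also have "... <= 1 + real (card ({..<M} - {l})) * (- a)"
   using replicasD[OF q] l le by (intro add_mono sum_bounded_above) auto
  also have "real (card ({..<M} - {l})) = real M - 1" using l by (simp add: of_nat_diff)
  finally show "(\<Sum>l'<M. R (q l) (q l')) <= 1 + (real M - 1) * (- a)" .
 qed
 also have "... = real M * (1 - (real M - 1) * a)" by simp
 also have "... < 0" using M by (intro mult_pos_neg) auto
 finally show False by simp
qed

text \<open>Union bound with ps in place of the indicator of overlap <= -a': the factor of
  \<open>ind n a q\<close> is 1 minus the sum of 1 + ka - ps over the old replicas. It is always at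
  most 1, and at most 0 as soon as one overlap exceeds -a'.\<close>

lemma ind_Suc_ge:
 assumes q: "q \<in> replicas n X" and t: "ta \<in> X" and n: "n > 0" and a: "a' <= a" and ka: "ka >= 0"
  and ps: "!!z. \<bar>z\<bar> <= 1 ==> ps z <= 1 + ka" "!!z. \<bar>z\<bar> <= 1 ==> - a' < z ==> ps z <= ka"
 shows "ind n a q * (1 - real n - real n * ka + (\<Sum>l<n. ps (R (q l) ta))) <= ind (Suc n) a' (q(n:=ta))"
proof (cases "ind n a q = 0")
 case True then show ?thesis by (simp add: ind_def)
next
 case False
 then have i1: "ind n a q = 1" and le: "!!l l'. l < n ==> l' < n ==> l ~= l' ==> R (q l) (q l') <= - a"
  by (auto simp: ind_def split: if_splits)
 have Rb: "\<bar>R (q l) ta\<bar> <= 1" if "l < n" for l using R_abs_le[OF replicasD[OF q that] t] .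
 show ?thesis
 proof (cases "\<forall>l<n. R (q l) ta <= - a'")
  case True
  have "ind (Suc n) a' (q(n:=ta)) = 1"
  proof -
   have "R ((q(n:=ta)) l) ((q(n:=ta)) l') <= - a'" if "l < Suc n" "l' < Suc n" "l ~= l'" for l l'
   proof (cases "l = n")
    case l: True
    then have "l' < n" using that by auto
    then show ?thesis using l True that by (simp add: R_sym[of ta])
   next
    case l: False
    show ?thesis
    proof (cases "l' = n")
     case True' : True
     then show ?thesis using l True that by simp
    next
     case False
     then show ?thesis using l that le[of l l'] a by simp
    qed
   qed
   then show ?thesis by (simp add: ind_def)
  qed
  moreover have "(\<Sum>l<n. ps (R (q l) ta)) <= real (card {..<n}) * (1 + ka)"
   by (rule sum_bounded_above) (use ps(1) Rb in auto)
  ultimately show ?thesis by (simp add: i1 algebra_simps)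
 next
  case False
  then obtain k where k: "k < n" "R (q k) ta > - a'" by force
  have "(\<Sum>l<n. ps (R (q l) ta)) = ps (R (q k) ta) + (\<Sum>l\<in>{..<n} - {k}. ps (R (q l) ta))"
   using k by (simp add: sum.remove)
  also have "... <= ka + real (card ({..<n} - {k})) * (1 + ka)"
   using k ps Rb by (intro add_mono sum_bounded_above) auto
  also have "real (card ({..<n} - {k})) = real n - 1" using k by (simp add: of_nat_diff)
  finally have "1 - real n - real n * ka + (\<Sum>l<n. ps (R (q l) ta)) <= 0" by (simp add: algebra_simps)
  then show ?thesis by (simp add: i1) (simp add: ind_def)
 qed
qed

text \<open>By the Ghirlanda-Guerra identity the overlap of a fresh replica with a given one is, on
  average, either one of the n - 1 old overlaps or that of an independent pair. On the event
  \<open>ind n a\<close> the old overlaps are already at most -a, so the union bound over the n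
  replicas loses everything except the independent part, whose probability of overlap <= -ep is ze.
  One more negatively correlated replica thus costs only the factor ze, up to the approximation
  error ka and the deviations. The threshold weakens from a to a' to leave room for a continuous
  cutoff.\<close>

lemma replica_step:
 fixes r :: real and y :: "nat => real" and c :: "nat => real"
 assumes w: "posw X w" and n: "n > 0" and r: "r > 0" and ys: "!!s. s \<in> {1..d} ==> y s >= 1"
  and a: "a' <= a" "a <= ep" and ka: "ka >= 0"
  and ps0: "!!z. 0 <= ps0 z \<and> ps0 z <= 1" "!!z. z <= - a ==> ps0 z = 1" "!!z. - a' < z ==> ps0 z = 0"
  and ps: "!!z. \<bar>z\<bar> <= 1 ==> \<bar>ps0 z - (\<Sum>s\<le>d. c s * z ^ s)\<bar> <= ka"
  and C: "!!s. \<bar>c s\<bar> <= C"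
 defines "W == gw (J d) (pert r y) w"
 defines "ze == (LINT g|gau (J d). gavg X (W g) (%sg. gavg X (W g) (%ta. if R sg ta <= - ep then 1 else 0)))"
 shows "(LINT g|gau (J d). repavg n X (W g) (ind n a)) * ze - 2 * real n * ka - C * (\<Sum>s=1..d. dev d w r y s) / r
  <= (LINT g|gau (J d). repavg (Suc n) X (W g) (ind (Suc n) a'))"
proof -
 let ?E = "%h. \<integral>g. h g \<partial>gau (J d)"
 interpret P: prob_space "gau (J d)" by (rule prob_space_gau)
 have pW: "posw X (W g)" for g unfolding W_def by (rule posw_gw[OF w])
 have eW: "expb (J d) (%g. gavg X (W g) (h g))" if "!!sg. sg \<in> X ==> expb (J d) (%g. h g sg)" for h
  unfolding W_def by (rule expb_gavg[OF w that])
 have eR: "expb (J d) (%g. repavg k X (W g) (h g))" if "!!q. q \<in> replicas k X ==> expb (J d) (%g. h g q)" for h k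
  unfolding W_def by (rule expb_repavg[OF finite_J w that])
 note i = expb_integrable[OF finite_J]
 define ps where "ps z = (\<Sum>s\<le>d. c s * z ^ s)" for z
 have psb: "\<bar>ps0 z - ps z\<bar> <= ka" if "\<bar>z\<bar> <= 1" for z using ps[OF that] by (simp add: ps_def)
 define f where "f = ind n a"
 have f01: "0 <= f q \<and> f q <= 1" for q by (simp add: f_def ind_def)
 define p where "p = ?E (%g. repavg n X (W g) f)"
 have eF: "expb (J d) (%g. repavg n X (W g) f)" by (rule eR) (rule expb_const)
 have p01: "0 <= p" "p <= 1"
 proof -
  have "0 <= repavg n X (W g) f" "repavg n X (W g) f <= 1" for g
   using repavg_mono[OF pW, of n "%_. 0" f] repavg_mono[OF pW, of n f "%_. 1"] f01 by (auto simp: repavg_const[OF pW])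
  then show "0 <= p" "p <= 1" unfolding p_def using i[OF eF]
   by (auto intro!: integral_nonneg_AE P.integral_le_const)
 qed
 define B where "B = ?E (%g. repavg n X (W g) (%q. f q * (\<Sum>l<n. gavg X (W g) (%ta. ps (R (q l) ta)))))"
 define A where "A = ?E (%g. repavg n X (W g) (%q. f q * (\<Sum>l<n. \<Sum>l'<n. ps (R (q l) (q l')))))"
 define v where "v = ?E (%g. gavg X (W g) (%sg. gavg X (W g) (%ta. ps (R sg ta))))"
 define err where "err = C * (\<Sum>s=1..d. dev d w r y s) / r"
 have eK: "expb (J d) (%g. gavg X (W g) (h sg))" for h :: "'x => 'x => real" and sg
  by (rule eW) (rule expb_const)
 have eB: "expb (J d) (%g. f q * (\<Sum>l<n. gavg X (W g) (%ta. ps (R (q l) ta))))" for q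
  by (rule expb_cmult, rule expb_sum, rule eW, rule expb_const)
 have dev0: "0 <= dev d w r y s" for s unfolding dev_def W_def[symmetric]
  by (rule integral_nonneg_AE, rule AE_I2, rule gavg_nonneg[OF pW]) simp
 have gg: "\<bar>B - (1 / real n) * A + (ps 1 - v) * p\<bar> <= err"
 proof -
  have "\<bar>B - (1 / real n) * A + (ps 1 - v) * p\<bar> <= (\<Sum>s=1..d. \<bar>c s\<bar> * dev d w r y s) / r"
   using gg_polynomial[of w n r d y f c, OF w n r ys f01]
   unfolding A_def B_def v_def p_def ps_def W_def .
  also have "... <= (\<Sum>s=1..d. C * dev d w r y s) / r"
   using r by (intro divide_right_mono sum_mono mult_right_mono C dev0) auto
  finally show ?thesis by (simp add: err_def sum_distrib_left)
 qed
 have A: "real n * ((ps 1 + (real n - 1) * (1 - ka)) * p) <= A"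
 proof -
  have "real n * ((ps 1 + (real n - 1) * (1 - ka)) * p) = ?E (%g. (real n * (ps 1 + (real n - 1) * (1 - ka))) * repavg n X (W g) f)"
   by (simp add: p_def)
  also have "... <= A" unfolding A_def
  proof (rule integral_mono)
   show "integrable (gau (J d)) (%g. (real n * (ps 1 + (real n - 1) * (1 - ka))) * repavg n X (W g) f)"
    by (rule i, rule expb_cmult, rule eF)
   show "integrable (gau (J d)) (%g. repavg n X (W g) (%q. f q * (\<Sum>l<n. \<Sum>l'<n. ps (R (q l) (q l')))))"
    by (rule i, rule eR, rule expb_const)
   fix g
   show "(real n * (ps 1 + (real n - 1) * (1 - ka))) * repavg n X (W g) f <= repavg n X (W g) (%q. f q * (\<Sum>l<n. \<Sum>l'<n. ps (R (q l) (q l'))))"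
    unfolding repavg_cmult[symmetric]
   proof (rule repavg_mono[OF pW])
    fix q assume q: "q \<in> replicas n X"
    show "real n * (ps 1 + (real n - 1) * (1 - ka)) * f q <= f q * (\<Sum>l<n. \<Sum>l'<n. ps (R (q l) (q l')))"
    proof (cases "f q = 0")
     case False
     then have f1: "f q = 1" and le: "!!l l'. l < n ==> l' < n ==> l ~= l' ==> R (q l) (q l') <= - a"
      by (auto simp: f_def ind_def split: if_splits)
     have "(\<Sum>l<n. ps 1 + (real n - 1) * (1 - ka)) <= (\<Sum>l<n. \<Sum>l'<n. ps (R (q l) (q l')))"
     proof (rule sum_mono)
      fix l assume l: "l \<in> {..<n}"
      have "real (card ({..<n} - {l})) * (1 - ka) <= (\<Sum>l'\<in>{..<n} - {l}. ps (R (q l) (q l')))"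
      proof (rule sum_bounded_below)
       fix l' assume l': "l' \<in> {..<n} - {l}"
       have "\<bar>R (q l) (q l')\<bar> <= 1" using l l' by (intro R_abs_le replicasD[OF q]) auto
       from psb[OF this] show "1 - ka <= ps (R (q l) (q l'))"
        using ps0(2)[OF le[of l l']] l l' by auto
      qed
      moreover have "real (card ({..<n} - {l})) = real n - 1" using l by (simp add: of_nat_diff)
      moreover have "(\<Sum>l'<n. ps (R (q l) (q l'))) = ps 1 + (\<Sum>l'\<in>{..<n} - {l}. ps (R (q l) (q l')))"
       using l replicasD[OF q] by (simp add: sum.remove)
      ultimately show "ps 1 + (real n - 1) * (1 - ka) <= (\<Sum>l'<n. ps (R (q l) (q l')))" by simp
     qed
     then show ?thesis by (simp add: f1)
    qed simp
   qed
  qed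
  finally show ?thesis .
 qed
 have v: "ze - ka <= v"
 proof -
  have "ze - ka = ?E (%g. gavg X (W g) (%sg. gavg X (W g) (%ta. if R sg ta <= - ep then 1 else 0)) - ka)"
  proof -
   have "integrable (gau (J d)) (%g. gavg X (W g) (%sg. gavg X (W g) (%ta. if R sg ta <= - ep then 1 else 0)))"
    by (rule i, rule eW, rule eK)
   then show ?thesis unfolding ze_def by (simp add: P.prob_space)
  qed
  also have "... <= v" unfolding v_def
  proof (rule integral_mono)
   show "integrable (gau (J d)) (%g. gavg X (W g) (%sg. gavg X (W g) (%ta. if R sg ta <= - ep then 1 else 0)) - ka)"
    by (rule i, rule expb_diff, rule eW, rule eK, rule expb_const)
   show "integrable (gau (J d)) (%g. gavg X (W g) (%sg. gavg X (W g) (%ta. ps (R sg ta))))"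
    by (rule i, rule eW, rule eK)
   fix g
   have "gavg X (W g) (%sg. gavg X (W g) (%ta. if R sg ta <= - ep then 1 else 0)) - ka
    = gavg X (W g) (%sg. gavg X (W g) (%ta. (if R sg ta <= - ep then 1 else 0) - ka))"
    by (simp add: gavg_diff gavg_const[OF pW])
   also have "... <= gavg X (W g) (%sg. gavg X (W g) (%ta. ps (R sg ta)))"
   proof (rule gavg_mono[OF pW], rule gavg_mono[OF pW])
    fix sg ta assume st: "sg \<in> X" "ta \<in> X"
    show "(if R sg ta <= - ep then 1 else 0) - ka <= ps (R sg ta)"
     using psb[OF R_abs_le[OF st]] ps0(1)[of "R sg ta"] ps0(2)[of "R sg ta"] a by (auto simp: abs_le_iff)
   qed
   finally show "gavg X (W g) (%sg. gavg X (W g) (%ta. if R sg ta <= - ep then 1 else 0)) - ka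
    <= gavg X (W g) (%sg. gavg X (W g) (%ta. ps (R sg ta)))" .
  qed
  finally show ?thesis .
 qed
 have step: "(1 - real n - real n * ka) * p + B <= ?E (%g. repavg (Suc n) X (W g) (ind (Suc n) a'))"
 proof -
  have "(1 - real n - real n * ka) * p + B = ?E (%g. (1 - real n - real n * ka) * repavg n X (W g) f + repavg n X (W g) (%q. f q * (\<Sum>l<n. gavg X (W g) (%ta. ps (R (q l) ta)))))"
   unfolding p_def B_def using i[OF eF] i[OF eR[OF eB]] by simp
  also have "... <= ?E (%g. repavg (Suc n) X (W g) (ind (Suc n) a'))"
  proof (rule integral_mono)
   show "integrable (gau (J d)) (%g. (1 - real n - real n * ka) * repavg n X (W g) f + repavg n X (W g) (%q. f q * (\<Sum>l<n. gavg X (W g) (%ta. ps (R (q l) ta)))))"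
    by (rule i, rule expb_add, rule expb_cmult, rule eF, rule eR, rule eB)
   show "integrable (gau (J d)) (%g. repavg (Suc n) X (W g) (ind (Suc n) a'))"
    by (rule i, rule eR, rule expb_const)
   fix g
   have "(1 - real n - real n * ka) * repavg n X (W g) f + repavg n X (W g) (%q. f q * (\<Sum>l<n. gavg X (W g) (%ta. ps (R (q l) ta))))
    = repavg n X (W g) (%q. gavg X (W g) (%ta. f q * (1 - real n - real n * ka + (\<Sum>l<n. ps (R (q l) ta)))))"
   proof -
    have "gavg X (W g) (%ta. f q * (1 - real n - real n * ka + (\<Sum>l<n. ps (R (q l) ta))))
     = (1 - real n - real n * ka) * f q + f q * (\<Sum>l<n. gavg X (W g) (%ta. ps (R (q l) ta)))" for q
     unfolding gavg_cmult gavg_add gavg_sum gavg_const[OF pW] by (simp add: algebra_simps)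
    then show ?thesis by (simp add: repavg_add repavg_cmult)
   qed
   also have "... <= repavg n X (W g) (%q. gavg X (W g) (%ta. ind (Suc n) a' (q(n:=ta))))"
   proof (rule repavg_mono[OF pW], rule gavg_mono[OF pW], unfold f_def, rule ind_Suc_ge)
    fix z :: real assume z: "\<bar>z\<bar> <= 1"
    show "ps z <= 1 + ka" using psb[OF z] ps0(1)[of z] by (auto simp: abs_le_iff)
    show "ps z <= ka" if "- a' < z" using psb[OF z] ps0(3)[OF that] by (auto simp: abs_le_iff)
   qed (use n a ka in auto)
   finally show "(1 - real n - real n * ka) * repavg n X (W g) f + repavg n X (W g) (%q. f q * (\<Sum>l<n. gavg X (W g) (%ta. ps (R (q l) ta))))
    <= repavg (Suc n) X (W g) (ind (Suc n) a')" unfolding repavg_Suc .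
  qed
  finally show ?thesis .
 qed
 \<comment> \<open>The diagonal value \<open>ps 1\<close> enters once through A and once through the
   identity itself, and cancels.\<close>
 have "p * ze - 2 * real n * ka - err <= (1 - real n - real n * ka) * p + B"
 proof -
  have 1: "(ps 1 + (real n - 1) * (1 - ka)) * p <= (1 / real n) * A" using A n by (simp add: field_simps)
  have 2: "(ze - ka) * p <= v * p" using v p01 by (intro mult_right_mono)
  have "B >= (1 / real n) * A - (ps 1 - v) * p - err" using gg by (simp add: abs_le_iff)
  then have "B >= (ps 1 + (real n - 1) * (1 - ka)) * p - ps 1 * p + (ze - ka) * p - err"
   using 1 2 by (simp add: algebra_simps)
  then have "(1 - real n - real n * ka) * p + B >= p * ze - (2 * real n * ka) * p - err"
   by (simp add: algebra_simps)
  moreover have "(2 * real n * ka) * p <= (2 * real n * ka) * 1" using p01 ka by (intro mult_left_mono) auto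
  ultimately show ?thesis by simp
 qed
 with step show ?thesis unfolding p_def err_def f_def by linarith
qed

text \<open>The second difference in v of the mean log-partition function th controls the
  fluctuations of G s. Under the Gibbs measure exp |z| <= exp z + exp (-z) turns the deviation of G
  s into the two increments L (v + de) - L v and L (v - de) - L v. Each increment is replaced by its
  mean up to Gaussian concentration; the linear terms in mG cancel and the second difference
  remains. The other two bounds control the end terms when the estimate is summed over a
  grid.\<close>

lemma gaussian_dev_bound:
 fixes y :: "nat => real"
 assumes w: "posw X w" and s: "s \<in> {1..d}" and r: "r > 0" and y: "!!t. t \<in> {1..d} ==> 0 <= y t \<and> y t <= 3"
  and v: "0 <= v - de" "v + de <= 3" "v >= 0" and de: "de > 0"
 defines "th == %v. \<integral>g. lnZ X (J d) (pert r (y(s:=v))) w g \<partial>gau (J d)"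
 shows "de * r * dev d w r (y(s:=v)) s <= ln 2 + 72 * r * sqrt (real d) + (th (v + de) + th (v - de) - 2 * th v)"
  and "0 <= th (v + de) - th v" and "th v - th (v - de) <= de * r\<^sup>2 * v"
proof -
 let ?E = "%h. \<integral>g. h g \<partial>gau (J d)"
 interpret P: prob_space "gau (J d)" by (rule prob_space_gau)
 define W where "W = gw (J d) (pert r (y(s:=v))) w"
 have pW: "posw X (W g)" for g unfolding W_def by (rule posw_gw[OF w])
 have eW: "expb (J d) (%g. gavg X (W g) (h g))" if "!!sg. sg \<in> X ==> expb (J d) (%g. h g sg)" for h
  unfolding W_def by (rule expb_gavg[OF w that])
 note i = expb_integrable[OF finite_J]
 have eG: "expb (J d) (%g. G s g sg)" for sg
  unfolding G_def
  by (rule expb_sum, rule expb_cmult, rule expb_component[OF finite_J]) (use idx_subset_J[OF s] in blast)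
 define mG where "mG = ?E (%g. gavg X (W g) (G s g))"
 define L where "L v g = lnZ X (J d) (pert r (y(s:=v))) w g" for v g
 have th: "th v = ?E (L v)" for v by (simp add: th_def L_def)
 define cc where "cc is = 3 * r * (\<Prod>j<length is. b (is ! j))" for "is"
 have lip: "\<bar>L u (g(j:=x1)) - L u (g(j:=x2))\<bar> <= cc j * \<bar>x1 - x2\<bar>" if "0 <= u" "u <= 3" "j \<in> J d" for u g j x1 x2
  unfolding L_def
 proof (rule lnZ_lipschitz[OF finite_J that(3) w])
  fix sg assume sg: "sg \<in> X"
  from that(3) obtain t where t: "t \<in> {1..d}" "j \<in> idx t m" by (auto simp: J_def)
  have "\<bar>ph j sg\<bar> <= (\<Prod>k<t. b (j ! k))" by (rule ph_bound[OF sg t(2)])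
  moreover have "\<bar>(y(s:=u)) t\<bar> <= 3" using y[OF t(1)] that by auto
  ultimately have "(r * \<bar>(y(s:=u)) t\<bar>) * \<bar>ph j sg\<bar> <= (r * 3) * (\<Prod>k<t. b (j ! k))"
   using r by (intro mult_mono) auto
  then show "\<bar>pert r (y(s := u)) j sg\<bar> <= cc j"
   using r length_idx[OF t(2)] by (simp add: pert_def cc_def abs_mult mult_ac del: fun_upd_apply)
 qed
 have Lm: "L u \<in> borel_measurable (gau (J d))" for u unfolding L_def by measurable
 have eL: "expb (J d) (L u)" if "0 <= u" "u <= 3" for u
  by (rule expb_lipschitz(1)[OF finite_J Lm lip[OF that]])
 have V: "(\<Sum>j\<in>J d. (cc j)\<^sup>2) <= 9 * r\<^sup>2 * real d"
 proof -
  have "(\<Sum>j\<in>J d. (cc j)\<^sup>2) = (\<Sum>t=1..d. 9 * r\<^sup>2 * (\<Sum>is\<in>idx t m. (\<Prod>j<t. b (is ! j))\<^sup>2))"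
   unfolding sum_J by (intro sum.cong refl) (simp add: cc_def power_mult_distrib sum_distrib_left length_idx)
  also have "... <= (\<Sum>t=1..d. 9 * r\<^sup>2 * 1)"
   by (intro sum_mono mult_left_mono sum_b) auto
  finally show ?thesis by (simp add: mult_ac)
 qed
 have d: "d > 0" using s by auto
 have fl: "?E (%g. \<bar>L u g - ?E (L u)\<bar>) <= 18 * r * sqrt (real d)" if "0 <= u" "u <= 3" for u
 proof -
  have "?E (%g. \<bar>L u g - ?E (L u)\<bar>) <= 6 * sqrt (9 * r\<^sup>2 * real d)"
   by (rule gau_abs_deviation[OF finite_J Lm lip[OF that] V]) (use r d in auto)
  also have "sqrt (9 * r\<^sup>2 * real d) = 3 * r * sqrt (real d)"
   using r by (simp add: real_sqrt_mult)
  finally show ?thesis by simp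
 qed
 have shift: "L (v + h) g = L v g + ln (gavg X (W g) (%sg. exp (h * r * G s g sg)))" for h g
 proof -
  have "pert r (y(s:=v+h)) = (%is sg. pert r (y(s:=v)) is sg + (if length is = s then h * r * ph is sg else 0))"
   by (auto simp: pert_def fun_eq_iff algebra_simps)
  then have "gw (J d) (pert r (y(s:=v+h))) w g sg = W g sg * exp (\<Sum>is\<in>J d. (if length is = s then h * r * ph is sg else 0) * g is)" for sg
   by (simp only: gw_scale_shift W_def)
  moreover have "(\<Sum>is\<in>J d. (if length is = s then h * r * ph is sg else 0) * g is) = h * r * G s g sg" for sg
  proof -
   have "(\<Sum>is\<in>J d. (if length is = s then h * r * ph is sg else 0) * g is) = (\<Sum>is\<in>idx s m. h * r * (ph is sg * g is))"
   proof (rule sum.mono_neutral_cong_right)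
    have "length j ~= s" if "j \<in> J d - idx s m" for j using that by (auto simp: J_def idx_def)
    then show "\<forall>j\<in>J d - idx s m. (if length j = s then h * r * ph j sg else 0) * g j = 0" by simp
   qed (use idx_subset_J[OF s] in \<open>simp_all add: length_idx\<close>)
   then show ?thesis by (simp add: G_def sum_distrib_left)
  qed
  ultimately have "L (v + h) g = ln (\<Sum>sg\<in>X. W g sg * exp (h * r * G s g sg))"
   by (simp add: L_def lnZ_def del: fun_upd_apply)
  also have "... = L v g + ln (gavg X (W g) (%sg. exp (h * r * G s g sg)))"
   unfolding ln_sum_exp[OF pW] by (simp add: L_def lnZ_def W_def)
  finally show ?thesis .
 qed
 have gpos: "gavg X (W g) (%sg. exp (h sg)) > 0" for g h
  using gavg_exp_ge[OF pW, of g h] by (rule less_le_trans[OF exp_gt_zero])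
 have low: "h * r * gavg X (W g) (G s g) <= L (v + h) g - L v g" for h g
 proof -
  have "exp (gavg X (W g) (%sg. h * r * G s g sg)) <= gavg X (W g) (%sg. exp (h * r * G s g sg))"
   by (rule gavg_exp_ge[OF pW])
  then have "gavg X (W g) (%sg. h * r * G s g sg) <= ln (gavg X (W g) (%sg. exp (h * r * G s g sg)))"
   using gpos by (simp add: ln_ge_iff)
  then show ?thesis by (simp add: shift gavg_cmult)
 qed
 have iG: "integrable (gau (J d)) (%g. gavg X (W g) (G s g))" by (rule i, rule eW, rule eG)
 have Elow: "h * r * mG <= th (v + h) - th v" if "0 <= v + h" "v + h <= 3" for h
 proof -
  have v3: "v <= 3" using v de by simp
  have "h * r * mG = ?E (%g. h * r * gavg X (W g) (G s g))" by (simp add: mG_def)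
  also have "... <= ?E (%g. L (v + h) g - L v g)"
   using iG i[OF eL[OF that]] i[OF eL[OF v(3) v3]] by (intro integral_mono low) auto
  also have "... = th (v + h) - th v"
   using i[OF eL[OF that]] i[OF eL[OF v(3) v3]] by (simp add: th)
  finally show ?thesis .
 qed
 have v3: "0 <= v + de" "v + de <= 3" "0 <= v + - de" "v + - de <= 3" "v <= 3" using v de by auto
 have mG_eq: "mG = r * v * (1 - ?E (%g. gavg X (W g) (%sg. gavg X (W g) (%ta. R sg ta ^ s))))"
 proof -
  have 1: "repavg (Suc 0) X (W g) (%q. h (q 0)) = gavg X (W g) h" for g h
   by (rule repavg_marginal[OF pW]) simp
  have 2: "gavg X (W g) (%sg. R sg sg ^ s) = 1" for g
  proof -
   have "gavg X (W g) (%sg. R sg sg ^ s) = gavg X (W g) (%sg. 1)" by (rule gavg_cong) simp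
   then show ?thesis by (simp add: gavg_const[OF pW])
  qed
  have 3: "repavg (Suc 0) X (W g) (%q. R (q 0) (q 0) ^ s) = gavg X (W g) (%sg. R sg sg ^ s)" for g by (rule 1)
  have 4: "repavg (Suc 0) X (W g) (%q. gavg X (W g) (%ta. R (q 0) ta ^ s)) = gavg X (W g) (%sg. gavg X (W g) (%ta. R sg ta ^ s))" for g by (rule 1)
  have 5: "repavg (Suc 0) X (W g) (%q. G s g (q 0)) = gavg X (W g) (G s g)" for g by (rule 1)
  have "mG = r * v * ?E (%g. 1 - gavg X (W g) (%sg. gavg X (W g) (%ta. R sg ta ^ s)))"
   using replica_ibp[OF w s, of 1 r "y(s:=v)" "%_. 1", folded W_def]
   by (simp add: 2 3 4 5 mG_def)
  also have "?E (%g. 1 - gavg X (W g) (%sg. gavg X (W g) (%ta. R sg ta ^ s))) = 1 - ?E (%g. gavg X (W g) (%sg. gavg X (W g) (%ta. R sg ta ^ s)))"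
  proof -
   have "integrable (gau (J d)) (%g. gavg X (W g) (%sg. gavg X (W g) (%ta. R sg ta ^ s)))"
    by (rule i, rule eW, rule eW, rule expb_const)
   then show ?thesis by (simp add: P.prob_space)
  qed
  finally show ?thesis .
 qed
 have ka01: "0 <= gavg X (W g) (%sg. gavg X (W g) (%ta. R sg ta ^ s)) \<and> gavg X (W g) (%sg. gavg X (W g) (%ta. R sg ta ^ s)) <= 1" for g
 proof
  have "gavg X (W g) (%sg. gavg X (W g) (%ta. R sg ta ^ s)) = (\<Sum>is\<in>idx s m. gavg X (W g) (ph is) * gavg X (W g) (ph is))"
   unfolding sum_ph[symmetric] gavg_sum gavg_cmult gavg_multc ..
  then show "0 <= gavg X (W g) (%sg. gavg X (W g) (%ta. R sg ta ^ s))" by (simp add: sum_nonneg)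
  show "gavg X (W g) (%sg. gavg X (W g) (%ta. R sg ta ^ s)) <= 1"
  proof (rule gavg_le[OF pW], rule gavg_le[OF pW])
   fix sg ta assume "sg \<in> X" "ta \<in> X"
   then have "\<bar>R sg ta ^ s\<bar> <= 1" unfolding power_abs by (intro power_le_one R_abs_le) auto
   then show "R sg ta ^ s <= 1" by simp
  qed
 qed
 have kaE: "0 <= ?E (%g. gavg X (W g) (%sg. gavg X (W g) (%ta. R sg ta ^ s)))" "?E (%g. gavg X (W g) (%sg. gavg X (W g) (%ta. R sg ta ^ s))) <= 1"
 proof -
  have ik: "integrable (gau (J d)) (%g. gavg X (W g) (%sg. gavg X (W g) (%ta. R sg ta ^ s)))"
   by (rule i, rule eW, rule eW, rule expb_const)
  show "0 <= ?E (%g. gavg X (W g) (%sg. gavg X (W g) (%ta. R sg ta ^ s)))"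
   by (rule integral_nonneg_AE) (use ka01 in auto)
  show "?E (%g. gavg X (W g) (%sg. gavg X (W g) (%ta. R sg ta ^ s))) <= 1"
   by (rule P.integral_le_const[OF ik]) (use ka01 in auto)
 qed
 have mG0: "0 <= mG" unfolding mG_eq using r v kaE by (intro mult_nonneg_nonneg) auto
 have mG1: "mG <= r * v" unfolding mG_eq using r v kaE by (intro mult_left_le) auto
 show "0 <= th (v + de) - th v"
 proof -
  have "0 <= de * r * mG" using mG0 r de by simp
  then show ?thesis using Elow[OF v3(1,2)] by linarith
 qed
 show "th v - th (v - de) <= de * r\<^sup>2 * v"
 proof -
  have "de * r * mG <= de * r * (r * v)" using mG1 de r by (intro mult_left_mono) auto
  then show ?thesis using Elow[OF v3(3,4)] by (simp add: power2_eq_square algebra_simps)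
 qed
 define Dg where "Dg g = gavg X (W g) (%sg. \<bar>G s g sg - mG\<bar>)" for g
 have dev_eq: "dev d w r (y(s:=v)) s = ?E Dg"
  unfolding dev_def Dg_def mG_def W_def ..
 define Ag where "Ag g = L (v + de) g - L v g - de * r * mG" for g
 define Bg where "Bg g = L (v + - de) g - L v g + de * r * mG" for g
 \<comment> \<open>exp (de * r * Dg g) is at most exp (Ag g) + exp (Bg g); taking logarithms of the
   sum produces ln 2.\<close>
 have path: "de * r * Dg g <= ln 2 + \<bar>Ag g\<bar> + \<bar>Bg g\<bar>" for g
 proof -
  have "de * r * Dg g = gavg X (W g) (%sg. \<bar>de * r * (G s g sg - mG)\<bar>)"
   unfolding Dg_def gavg_cmult[symmetric] using de r by (simp add: abs_mult)
  then have "exp (de * r * Dg g) <= gavg X (W g) (%sg. exp \<bar>de * r * (G s g sg - mG)\<bar>)"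
   using gavg_exp_ge[OF pW] by simp
  also have "... <= gavg X (W g) (%sg. exp (- (de * r * mG)) * exp (de * r * G s g sg) + exp (de * r * mG) * exp ((- de) * r * G s g sg))"
  proof (rule gavg_mono[OF pW])
   fix sg
   define z where "z = de * r * (G s g sg - mG)"
   have "exp \<bar>z\<bar> <= exp z + exp (- z)" by (auto simp: abs_if)
   then show "exp \<bar>de * r * (G s g sg - mG)\<bar> <= exp (- (de * r * mG)) * exp (de * r * G s g sg) + exp (de * r * mG) * exp ((- de) * r * G s g sg)"
    by (simp add: z_def mult_exp_exp algebra_simps)
  qed
  also have "... = exp (Ag g) + exp (Bg g)"
  proof -
   have "Ag g = - (de * r * mG) + ln (gavg X (W g) (%sg. exp (de * r * G s g sg)))"
    "Bg g = de * r * mG + ln (gavg X (W g) (%sg. exp ((- de) * r * G s g sg)))"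
    unfolding Ag_def Bg_def shift by simp_all
   then show ?thesis
    by (simp only: gavg_add gavg_cmult exp_add exp_ln[OF gpos])
  qed
  also have "... <= exp (\<bar>Ag g\<bar> + \<bar>Bg g\<bar>) + exp (\<bar>Ag g\<bar> + \<bar>Bg g\<bar>)" by (intro add_mono) auto
  also have "... = exp (ln 2 + \<bar>Ag g\<bar> + \<bar>Bg g\<bar>)" by (simp add: exp_add)
  finally show ?thesis by simp
 qed
 have eA: "expb (J d) Ag" "expb (J d) Bg" "expb (J d) Dg"
  unfolding Ag_def[abs_def] Bg_def[abs_def] Dg_def[abs_def]
  by (rule expb_diff[OF expb_diff[OF eL[OF v3(1,2)] eL[OF v(3) v3(5)]] expb_const],
    rule expb_add[OF expb_diff[OF eL[OF v3(3,4)] eL[OF v(3) v3(5)]] expb_const],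
    rule eW[OF expb_abs[OF expb_diff[OF eG expb_const]]])
 \<comment> \<open>As q is at most the mean increment (the supporting line at v), the absolute value
   costs two concentration errors of 18 * r * sqrt d plus the mean excess.\<close>
 have fluct: "?E (%g. \<bar>L u g - L v g - q\<bar>) <= 36 * r * sqrt (real d) + (th u - th v - q)"
  if u: "0 <= u" "u <= 3" and q: "q <= th u - th v" for u q
 proof -
  note e = expb_diff[OF expb_diff[OF eL[OF u] eL[OF v(3) v3(5)]] expb_const]
  have i1: "integrable (gau (J d)) (%g. \<bar>L u g - ?E (L u)\<bar>)" and i2: "integrable (gau (J d)) (%g. \<bar>L v g - ?E (L v)\<bar>)"
   by (rule i[OF expb_abs[OF expb_diff[OF eL[OF u] expb_const]]], rule i[OF expb_abs[OF expb_diff[OF eL[OF v(3) v3(5)] expb_const]]])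
  have "?E (%g. \<bar>L u g - L v g - q\<bar>) <= ?E (%g. \<bar>L u g - ?E (L u)\<bar> + \<bar>L v g - ?E (L v)\<bar> + (th u - th v - q))"
  proof (rule integral_mono)
   show "integrable (gau (J d)) (%g. \<bar>L u g - L v g - q\<bar>)" by (rule i[OF expb_abs[OF e]])
   show "integrable (gau (J d)) (%g. \<bar>L u g - ?E (L u)\<bar> + \<bar>L v g - ?E (L v)\<bar> + (th u - th v - q))"
    using i1 i2 by simp
   fix g show "\<bar>L u g - L v g - q\<bar> <= \<bar>L u g - ?E (L u)\<bar> + \<bar>L v g - ?E (L v)\<bar> + (th u - th v - q)"
    using q unfolding th by (simp add: abs_if split: if_splits)
  qed
  also have "... = ?E (%g. \<bar>L u g - ?E (L u)\<bar>) + ?E (%g. \<bar>L v g - ?E (L v)\<bar>) + (th u - th v - q)"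
   using i1 i2 by (simp add: P.prob_space)
  finally show ?thesis using fl[OF u] fl[OF v(3) v3(5)] by simp
 qed
 have "de * r * ?E Dg = ?E (%g. de * r * Dg g)" by simp
 also have "... <= ?E (%g. ln 2 + \<bar>Ag g\<bar> + \<bar>Bg g\<bar>)"
  using i[OF eA(3)] i[OF eA(1)] i[OF eA(2)] by (intro integral_mono path) auto
 also have "... = ln 2 + ?E (%g. \<bar>Ag g\<bar>) + ?E (%g. \<bar>Bg g\<bar>)"
  using i[OF eA(1)] i[OF eA(2)] by (simp add: P.prob_space)
 also have "... <= ln 2 + (36 * r * sqrt (real d) + (th (v + de) - th v - de * r * mG)) + (36 * r * sqrt (real d) + (th (v + - de) - th v - (- (de * r * mG))))"
 proof (intro add_mono order_refl)
  show "?E (%g. \<bar>Ag g\<bar>) <= 36 * r * sqrt (real d) + (th (v + de) - th v - de * r * mG)"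
   unfolding Ag_def by (rule fluct[OF v3(1,2) Elow[OF v3(1,2)]])
  show "?E (%g. \<bar>Bg g\<bar>) <= 36 * r * sqrt (real d) + (th (v + - de) - th v - (- (de * r * mG)))"
   using fluct[OF v3(3,4), of "- (de * r * mG)"] Elow[OF v3(3,4)] unfolding Bg_def by simp
 qed
 finally show "de * r * dev d w r (y(s:=v)) s <= ln 2 + 72 * r * sqrt (real d) + (th (v + de) + th (v - de) - 2 * th v)"
  unfolding dev_eq by simp
qed

end

text \<open>Continuous cutoff between two thresholds. Continuity permits polynomial approximation,
  and the identities are available only for polynomials of the overlap.\<close>

definition ramp :: "real => real => real => real" where
 "ramp a a' z = max 0 (min 1 ((- a' - z) / (a - a')))"

lemma ramp_bounds: "0 <= ramp a a' z \<and> ramp a a' z <= 1"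
 by (simp add: ramp_def)

lemma ramp_eq_1: "a' < a ==> z <= - a ==> ramp a a' z = 1"
 by (simp add: ramp_def min_def max_def field_simps)

lemma ramp_eq_0: "a' < a ==> - a' < z ==> ramp a a' z = 0"
 by (simp add: ramp_def min_def max_def field_simps)

lemma ramp_polynomial:
 assumes "a' < a" "ka > 0"
 shows "\<exists>c d. \<forall>z. \<bar>z\<bar> <= 1 --> \<bar>ramp a a' z - (\<Sum>s\<le>(d::nat). c s * z ^ s)\<bar> < ka"
proof -
 have "continuous_on {-1..1} (ramp a a')"
  unfolding ramp_def[abs_def] using assms by (intro continuous_intros) auto
 then obtain g where g: "real_polynomial_function g" "!!z. z \<in> {-1..1} ==> \<bar>ramp a a' z - g z\<bar> < ka"
  using Stone_Weierstrass_real_polynomial_function[of "{-1..1}" "ramp a a'" ka] assms by auto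
 then obtain c d where "g = (%z. \<Sum>s\<le>d. c s * z ^ s)"
  unfolding real_polynomial_function_iff_sum by auto
 with g(2) have "\<forall>z. \<bar>z\<bar> <= 1 --> \<bar>ramp a a' z - (\<Sum>s\<le>d. c s * z ^ s)\<bar> < ka" by (auto simp: abs_le_iff)
 then show ?thesis by blast
qed

text \<open>A common degree d and a common coefficient bound C, because one perturbation, of a
  degree fixed in advance, has to serve every replica step.\<close>

lemma ramp_polynomials:
 fixes a :: "nat => real"
 assumes a: "!!n. n < M ==> a (Suc n) < a n" and k: "ka > 0"
 shows "\<exists>c d C. d >= 1 \<and> C > 0 \<and> (\<forall>n<M. (\<forall>s. \<bar>c n s\<bar> <= C) \<and>
  (\<forall>z. \<bar>z\<bar> <= 1 --> \<bar>ramp (a n) (a (Suc n)) z - (\<Sum>s\<le>(d::nat). c n s * z ^ s)\<bar> <= ka))"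
proof -
 have "\<forall>n. \<exists>c d. n < M --> (\<forall>z. \<bar>z\<bar> <= 1 --> \<bar>ramp (a n) (a (Suc n)) z - (\<Sum>s\<le>(d::nat). c s * z ^ s)\<bar> < ka)"
  using ramp_polynomial[OF a k] by blast
 then obtain c0 d0 where cd: "!!n z. n < M ==> \<bar>z\<bar> <= 1 ==> \<bar>ramp (a n) (a (Suc n)) z - (\<Sum>s\<le>d0 n. c0 n s * z ^ s)\<bar> < ka"
  by metis
 define d where "d = 1 + (\<Sum>n<M. d0 n)"
 define c where "c n s = (if s <= d0 n then c0 n s else 0)" for n s
 define C where "C = 1 + (\<Sum>n<M. \<Sum>s\<le>d0 n. \<bar>c0 n s\<bar>)"
 have dn: "d0 n <= d" if "n < M" for n
  using that member_le_sum[of n "{..<M}" d0] by (simp add: d_def)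
 have "(\<Sum>s\<le>d. c n s * z ^ s) = (\<Sum>s\<le>d0 n. c0 n s * z ^ s)" if "n < M" for n z
  by (rule sum.mono_neutral_cong_right) (use dn[OF that] in \<open>auto simp: c_def\<close>)
 moreover have "\<bar>c n s\<bar> <= C" if n: "n < M" for n s
 proof (cases "s <= d0 n")
  case True
  have "\<bar>c0 n s\<bar> <= (\<Sum>s\<le>d0 n. \<bar>c0 n s\<bar>)" using True by (intro member_le_sum) auto
  also have "... <= (\<Sum>n<M. \<Sum>s\<le>d0 n. \<bar>c0 n s\<bar>)"
   using n by (intro member_le_sum[where f="%n. \<Sum>s\<le>d0 n. \<bar>c0 n s\<bar>"]) (auto intro: sum_nonneg)
  finally show ?thesis using True by (simp add: c_def C_def)
 next
  case False
  then show ?thesis by (simp add: c_def C_def sum_nonneg add_nonneg_nonneg)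
 qed
 moreover have "C > 0" unfolding C_def by (intro add_pos_nonneg sum_nonneg) auto
 moreover have "d >= 1" by (simp add: d_def)
 ultimately show ?thesis using cd by (intro exI[of _ c] exI[of _ d] exI[of _ C]) (auto intro: less_imp_le)
qed

context spins
begin

definition negprob :: "nat => ('x => real) => real => (nat => real) => real => real" where
 "negprob d w r y ep = (LINT g|gau (J d). gavg X (gw (J d) (pert r y) w g)
  (%sg. gavg X (gw (J d) (pert r y) w g) (%ta. if R sg ta <= - ep then 1 else 0)))"

lemma integrable_gavg2:
 assumes w: "posw X w"
 shows "integrable (gau (J d)) (%g. gavg X (gw (J d) a w g) (%sg. gavg X (gw (J d) a w g) (f sg)))"
 by (rule expb_integrable[OF finite_J], rule expb_gavg[OF w], rule expb_gavg[OF w], rule expb_const)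

lemma negprob_bounds:
 assumes w: "posw X w" shows "0 <= negprob d w r y ep" "negprob d w r y ep <= 1"
proof -
 interpret P: prob_space "gau (J d)" by (rule prob_space_gau)
 have p: "posw X (gw (J d) (pert r y) w g)" for g by (rule posw_gw[OF w])
 show "0 <= negprob d w r y ep" unfolding negprob_def
  by (rule integral_nonneg_AE, rule AE_I2, rule gavg_nonneg[OF p], rule gavg_nonneg[OF p]) simp
 show "negprob d w r y ep <= 1" unfolding negprob_def
  by (rule P.integral_le_const[OF integrable_gavg2[OF w]], rule AE_I2, rule gavg_le[OF p], rule gavg_le[OF p]) simp
qed

lemma dev_nonneg: assumes w: "posw X w" shows "0 <= dev d w r y s"
 unfolding dev_def by (rule integral_nonneg_AE, rule AE_I2, rule gavg_nonneg[OF posw_gw[OF w]]) simp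

text \<open>Starts from one replica, where the event is certain, and applies
  \<open>replica_step\<close> M - 1 times along thresholds decreasing from about ep to ep / 2; at M
  replicas the event is impossible by \<open>ind_eq_0\<close>. So the (M - 1)-th power of
  \<open>negprob\<close> is bounded by the accumulated errors.\<close>

lemma negprob_power_bound:
 fixes c :: "nat => nat => real" and M :: nat
 assumes w: "posw X w" and r: "r > 0" and ys: "!!s. s \<in> {1..d} ==> y s >= 1"
  and M: "M > 0" "(real M - 1) * (ep / 2) > 1" and ep: "ep > 0" and ka: "ka >= 0"
 defines "a == %n. ep * (1 - real n / (2 * real M))"
 assumes c: "!!n s. n < M ==> \<bar>c n s\<bar> <= C"
  and ps: "!!n z. n < M ==> \<bar>z\<bar> <= 1 ==> \<bar>ramp (a n) (a (Suc n)) z - (\<Sum>s\<le>d. c n s * z ^ s)\<bar> <= ka"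
 shows "negprob d w r y ep ^ (M - 1) <= real M * (2 * real M * ka + C * (\<Sum>s=1..d. dev d w r y s) / r)"
proof -
 interpret P: prob_space "gau (J d)" by (rule prob_space_gau)
 define W where "W = gw (J d) (pert r y) w"
 have pW: "posw X (W g)" for g unfolding W_def by (rule posw_gw[OF w])
 define ze where "ze = negprob d w r y ep"
 have ze: "0 <= ze" "ze <= 1" using negprob_bounds[OF w] by (auto simp: ze_def)
 define p where "p n = (LINT g|gau (J d). repavg n X (W g) (ind n (a n)))" for n
 define err where "err = C * (\<Sum>s=1..d. dev d w r y s) / r"
 define e where "e = 2 * real M * ka + err"
 have C0: "C >= 0" using c[of 0 0] M by (auto intro: order_trans[OF abs_ge_zero])
 have err0: "err >= 0" unfolding err_def using r C0 dev_nonneg[OF w] by (simp add: sum_nonneg)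
 have e0: "e >= 0" using ka err0 by (simp add: e_def)
 have amono: "a (Suc n) < a n" for n using ep M by (simp add: a_def divide_strict_right_mono)
 have ale: "a n <= ep" for n using ep M by (simp add: a_def mult_le_cancel_left1)
 have step: "p n * ze - 2 * real n * ka - err <= p (Suc n)" if n: "n > 0" "n < M" for n
  unfolding p_def ze_def err_def negprob_def W_def
  by (rule replica_step[OF w n(1) r ys less_imp_le[OF amono] ale ka ramp_bounds ramp_eq_1[OF amono] ramp_eq_0[OF amono] ps[OF n(2)] c[OF n(2)]])
 have main: "ze ^ n - real n * e <= p (Suc n)" if "n < M" for n
  using that
 proof (induction n)
  case 0
  have "repavg (Suc 0) X (W g) (ind (Suc 0) (a (Suc 0))) = 1" for g
  proof -
   have "ind (Suc 0) (a (Suc 0)) = (%_. 1)" by (auto simp: ind_def fun_eq_iff)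
   then show ?thesis by (simp add: repavg_const[OF pW])
  qed
  then show ?case by (simp add: p_def P.prob_space)
 next
  case (Suc n)
  then have IH: "ze ^ n - real n * e <= p (Suc n)" by simp
  have "ze ^ Suc n - real (Suc n) * e <= (ze ^ n - real n * e) * ze - e"
  proof -
   have "real n * e * ze <= real n * e * 1" using e0 ze by (intro mult_left_mono) auto
   then show ?thesis by (simp add: algebra_simps)
  qed
  also have "... <= p (Suc n) * ze - e" using IH ze by (intro diff_right_mono mult_right_mono)
  also have "... <= p (Suc n) * ze - 2 * real (Suc n) * ka - err"
  proof -
   have "2 * real (Suc n) * ka <= 2 * real M * ka" using Suc.prems ka by (intro mult_right_mono) auto
   then show ?thesis unfolding e_def by linarith
  qed
  also have "... <= p (Suc (Suc n))" by (rule step) (use Suc.prems in auto)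
  finally show ?case .
 qed
 have "p M = 0"
 proof -
  have "(real M - 1) * a M > 1"
   using M by (simp add: a_def)
  then have "repavg M X (W g) (ind M (a M)) = repavg M X (W g) (%_. 0)" for g
   unfolding repavg_def by (intro gavg_cong ind_eq_0 M(1))
  then show ?thesis by (simp add: p_def repavg_const[OF pW])
 qed
 with main[of "M - 1"] M have "ze ^ (M - 1) <= real (M - 1) * e" by simp
 also have "... <= real M * e" using e0 by (intro mult_right_mono) auto
 finally show ?thesis by (simp add: ze_def e_def err_def)
qed

text \<open>Summed over a grid of step 1 / n the second differences of th telescope to two boundary
  slopes, of order r^2 / n. The averaged value of dev / r is therefore of order n / r + 1 / n: small
  if n is large and r much larger still.\<close>

lemma sum_dev_grid:
 fixes n :: nat
 assumes w: "posw X w" and s: "s \<in> {1..d}" and r: "r > 0" and n: "n >= 2"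
  and y: "!!t. t \<in> {1..d} ==> 1 <= y t \<and> y t <= 2"
 shows "(\<Sum>j<n. dev d w r (y(s := 1 + real j / real n)) s / r)
  <= real n * (real n * (ln 2 + 72 * r * sqrt (real d)) / r\<^sup>2 + 4 / real n)"
proof -
 define de where "de = 1 / real n"
 have de: "0 < de" "de <= 1 / 2" using n by (auto simp: de_def field_simps)
 define th where "th v = (LINT g|gau (J d). lnZ X (J d) (pert r (y(s:=v))) w g)" for v
 define q where "q = ln 2 + 72 * r * sqrt (real d)"
 have y3: "0 <= y t \<and> y t <= 3" if "t \<in> {1..d}" for t using y[OF that] by auto
 note gb = gaussian_dev_bound[where y=y, OF w s r y3 _ _ _ de(1), folded th_def]
 have v: "1 + real j * de <= 2" if "j < n" for j using that n by (simp add: de_def field_simps)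
 have v1: "0 <= 1 + real j * de - de" for j
 proof -
  have "0 <= real j * de" using de by simp
  then show ?thesis using de by linarith
 qed
 have v0: "0 <= 1 + real j * de" for j using de by simp
 have b: "de * r * dev d w r (y(s:=1 + real j * de)) s <= q + ((th (1 + real (Suc j) * de) - th (1 + real j * de)) - (th (1 + real j * de) - th (1 + real j * de - de)))" if "j < n" for j
 proof -
  have "1 + real j * de + de <= 3" using v[OF that] de by linarith
  from gb(1)[OF _ v1 this v0] show ?thesis unfolding q_def by (simp add: algebra_simps)
 qed
 have tel: "(\<Sum>j<k. (th (1 + real (Suc j) * de) - th (1 + real j * de)) - (th (1 + real j * de) - th (1 + real j * de - de)))
  = (th (1 + real k * de) - th (1 + real k * de - de)) - (th 1 - th (1 - de))" for k
 proof (induction k)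
  case (Suc k)
  have "1 + real (Suc k) * de - de = 1 + real k * de" by (simp add: algebra_simps)
  note e = this
  show ?case unfolding sum.lessThan_Suc Suc.IH e by linarith
 qed simp
 have "(\<Sum>j<n. de * r * dev d w r (y(s:=1 + real j * de)) s) <= (\<Sum>j<n. q + ((th (1 + real (Suc j) * de) - th (1 + real j * de)) - (th (1 + real j * de) - th (1 + real j * de - de))))"
  by (intro sum_mono b) auto
 also have "... = real n * q + ((th (1 + real n * de) - th (1 + real n * de - de)) - (th 1 - th (1 - de)))"
  unfolding sum.distrib tel by simp
 also have "1 + real n * de = 2" using n by (simp add: de_def)
 also have "real n * q + ((th 2 - th (2 - de)) - (th 1 - th (1 - de))) <= real n * q + de * r\<^sup>2 * 2"
 proof -
  have "th 2 - th (2 - de) <= de * r\<^sup>2 * 2" by (rule gb(3)) (use de in auto)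
  moreover have "0 <= th ((1 - de) + de) - th (1 - de)"
   by (rule gb(2)) (use de in auto)
  ultimately show ?thesis by simp
 qed
 finally have 1: "de * r * (\<Sum>j<n. dev d w r (y(s:=1 + real j * de)) s) <= real n * q + 2 * de * r\<^sup>2"
  unfolding sum_distrib_left[symmetric] by linarith
 have "(\<Sum>j<n. dev d w r (y(s := 1 + real j / real n)) s / r) = (de * r * (\<Sum>j<n. dev d w r (y(s:=1 + real j * de)) s)) / (de * r\<^sup>2)"
  using de r by (simp add: de_def sum_divide_distrib power2_eq_square field_simps)
 also have "... <= (real n * q + 2 * de * r\<^sup>2) / (de * r\<^sup>2)"
  using de r 1 by (intro divide_right_mono) auto
 also have "... = real n * (real n * q / r\<^sup>2) + 2"
  using de r n by (simp add: de_def field_simps)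
 also have "... <= real n * (real n * q / r\<^sup>2 + 4 / real n)"
  using n by (simp add: algebra_simps)
 finally show ?thesis by (simp add: q_def)
qed

end

text \<open>Either \<open>negprob\<close> is at most ep already, or its power bound forces the sum
  of the deviations above the threshold rh, and then the right-hand side is at least 1. This linear
  form survives averaging over the amplitudes. The constants d and rh depend on ep alone, not on the
  spin system.\<close>

lemma negprob_le_dev:
 assumes ep: "0 < ep"
 shows "\<exists>d rh. d >= 1 \<and> rh > 0 \<and> (\<forall>(X :: 'x set) x m b w r y. spins X x m b --> posw X w --> r > 0 -->
  (\<forall>s\<in>{1..d}. y s >= 1) -->
  spins.negprob X x m d w r y ep <= ep + (1 / rh) * (\<Sum>s=1..d. spins.dev X x m d w r y s / r))"
proof -
 obtain M0 :: nat where M0: "2 / ep < real M0" using reals_Archimedean2 by blast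
 define M where "M = Suc (Suc M0)"
 have M: "M > 0" "(real M - 1) * (ep / 2) > 1" using M0 ep by (auto simp: M_def field_simps)
 define et where "et = ep ^ (M - 1)"
 have et: "et > 0" using ep by (simp add: et_def)
 \<comment> \<open>Makes the polynomial error \<open>real M * (2 * real M * ka)\<close> equal to et
   / 2, half of the power of ep that has to be beaten.\<close>
 define ka where "ka = et / (4 * real M ^ 2)"
 have ka: "ka > 0" using et M by (simp add: ka_def)
 define a where "a n = ep * (1 - real n / (2 * real M))" for n
 have amono: "a (Suc n) < a n" for n using ep M by (simp add: a_def divide_strict_right_mono)
 obtain c :: "nat => nat => real" and d C where d: "d >= (1::nat)" and C: "C > 0"
  and c: "!!n s. n < M ==> \<bar>c n s\<bar> <= C"
  and ps: "!!n z. n < M ==> \<bar>z\<bar> <= 1 ==> \<bar>ramp (a n) (a (Suc n)) z - (\<Sum>s\<le>d. c n s * z ^ s)\<bar> <= ka"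
  using ramp_polynomials[of M a ka, OF amono ka] by blast
 define rh where "rh = et / (2 * real M * C)"
 have rh: "rh > 0" using et M C by (simp add: rh_def)
 have "spins.negprob X x m d w r y ep <= ep + (1 / rh) * (\<Sum>s=1..d. spins.dev X x m d w r y s / r)"
  if sp: "spins X x m b" and w: "posw X w" and r: "r > 0" and ys: "\<forall>s\<in>{1..d}. y s >= 1"
  for X :: "'x set" and x m b w r y
 proof -
  interpret spins X x m b by fact
  define T where "T = (\<Sum>s=1..d. dev d w r y s)"
  have T0: "T >= 0" unfolding T_def by (intro sum_nonneg dev_nonneg[OF w])
  have T1: "(\<Sum>s=1..d. dev d w r y s / r) = T / r" by (simp add: T_def sum_divide_distrib)
  show ?thesis
  proof (cases "negprob d w r y ep <= ep")
   case True
   have "0 <= 1 / rh * (T / r)" using rh r T0 by simp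
   then show ?thesis using True unfolding T1 by linarith
  next
   case False
   have "et <= negprob d w r y ep ^ (M - 1)" unfolding et_def using False ep by (intro power_mono) auto
   also have "... <= real M * (2 * real M * ka + C * (\<Sum>s=1..d. dev d w r y s) / r)"
    by (rule negprob_power_bound[where c=c, OF w r _ M ep less_imp_le[OF ka] c, folded a_def, OF _ _ ps]) (use ys in auto)
   also have "... = et / 2 + real M * C * (T / r)"
    using M by (simp add: ka_def T_def power2_eq_square algebra_simps)
   finally have "et / 2 <= (real M * C) * (T / r)" by linarith
   then have "et <= 2 * (real M * C * (T / r))" by linarith
   then have "1 <= (2 * (real M * C * (T / r))) / et" using et by (subst le_divide_eq_1_pos) auto
   also have "... = 1 / rh * (T / r)" by (simp add: rh_def mult_ac)
   finally have "1 <= 1 / rh * (T / r)" .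
   then show ?thesis using negprob_bounds(2)[OF w, of d r y ep] ep unfolding T1 by linarith
  qed
 qed
 with d rh show ?thesis by blast
qed

lemma sum_PiE_remove:
 assumes "s \<in> A" "finite A"
 shows "(\<Sum>y\<in>PiE A (%_. V). h y) = (\<Sum>z\<in>PiE (A - {s}) (%_. V). \<Sum>v\<in>V. h (z(s:=v)))"
proof -
 have A: "A = insert s (A - {s})" using assms by auto
 have eq: "PiE A (%_. V) = (%(v, z). z(s:=v)) ` (V \<times> PiE (A - {s}) (%_. V))"
  by (subst A) (simp only: PiE_insert_eq)
 have inj: "inj_on (%(v, z). z(s:=v)) (V \<times> PiE (A - {s}) (%_. V))"
  by (rule inj_combinator) simp
 have "(\<Sum>y\<in>PiE A (%_. V). h y) = (\<Sum>(v, z)\<in>V \<times> PiE (A - {s}) (%_. V). h (z(s:=v)))"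
  unfolding eq by (subst sum.reindex[OF inj]) (simp add: split_beta comp_def)
 also have "... = (\<Sum>v\<in>V. \<Sum>z\<in>PiE (A - {s}) (%_. V). h (z(s:=v)))"
  by (simp add: sum.cartesian_product)
 also have "... = (\<Sum>z\<in>PiE (A - {s}) (%_. V). \<Sum>v\<in>V. h (z(s:=v)))" by (rule sum.swap)
 finally show ?thesis .
qed

text \<open>Random amplitudes are replaced by a uniform average over finitely many values in [1, 2),
  so that all averages over y are finite sums.\<close>

definition grid :: "nat => nat => (nat => real) set" where
 "grid d n = PiE {1..d} (%_. (%j. 1 + real j / real n) ` {..<n})"

lemma grid_bounds: "n > 0 ==> y \<in> grid d n ==> s \<in> {1..d} ==> 1 <= y s \<and> y s <= 2"
proof -
 assume n: "n > 0" and y: "y \<in> grid d n" and s: "s \<in> {1..d}"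
 from PiE_mem[OF y[unfolded grid_def] s] obtain j where j: "j < n" "y s = 1 + real j / real n" by auto
 then have "0 <= real j / real n" "real j / real n <= 1" by auto
 then show ?thesis using j(2) by simp
qed

lemma finite_grid: "finite (grid d n)"
 unfolding grid_def by (intro finite_PiE) auto

lemma inj_grid: "n > 0 ==> inj_on (%j. 1 + real j / real n) {..<n}"
 by (auto simp: inj_on_def)

lemma card_grid: "n > 0 ==> card (grid d n) = n ^ d"
 unfolding grid_def by (simp add: card_PiE card_image[OF inj_grid])

text \<open>A random perturbation by Gaussian processes with covariances \<open>R ^ s\<close>, \<open>s <= d\<close>, makes the
 overlap of two replicas essentially nonnegative, uniformly over all reference weights \<open>w\<close>; this is
 Talagrand's positivity principle, derived from the Ghirlanda-Guerra identities.\<close>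
theorem universal_positivity:
 assumes ep: "0 < ep"
 shows "\<exists>d n r. n > 0 \<and> r > 0 \<and> (\<forall>(X :: 'x set) x m b w. spins X x m b --> posw X w -->
  (\<Sum>y\<in>grid d n. \<integral>g. gavg X (gw (spins.J m d) (spins.pert x r y) w g)
   (%sg. gavg X (gw (spins.J m d) (spins.pert x r y) w g) (%ta. max 0 (- spins.R x m sg ta))) \<partial>gau (spins.J m d))
  <= ep * real (card (grid d n)))"
proof -
 define e where "e = ep / 4"
 have e: "e > 0" using ep by (simp add: e_def)
 obtain d rh where d: "d >= (1::nat)" and rh: "rh > 0" and
  np: "!!(X :: 'x set) x m b w r y. spins X x m b ==> posw X w ==> r > 0 ==>
  (\<forall>s\<in>{1..d}. y s >= 1) ==>
  spins.negprob X x m d w r y e <= e + (1 / rh) * (\<Sum>s=1..d. spins.dev X x m d w r y s / r)"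
  using negprob_le_dev[OF e, where 'x='x] by blast
 define et where "et = e * rh / real d"
 have et: "et > 0" using e rh d by (simp add: et_def)
 obtain n0 :: nat where n0: "8 / et < real n0" using reals_Archimedean2 by blast
 define n where "n = Suc (Suc n0)"
 have n: "n >= 2" "n > 0" by (auto simp: n_def)
 have n1: "4 / real n <= et / 2"
 proof -
  have "8 / et <= real n" using n0 by (simp add: n_def)
  then show ?thesis using et n by (simp add: field_simps)
 qed
 define K where "K = real n * (ln 2 + 72 * sqrt (real d))"
 have K: "K > 0" using n unfolding K_def by (intro mult_pos_pos add_pos_nonneg) auto
 \<comment> \<open>Chosen after n, since K grows with n: the strength has to dominate the
   concentration error of order n / r.\<close>
 define r where "r = 1 + 2 * K / et"
 have r: "r >= 1" "r > 0" "K / r <= et / 2"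
 proof -
  have "2 * K / et > 0" using K et by simp
  then show "r >= 1" "r > 0" unfolding r_def by linarith+
  then show "K / r <= et / 2" using K et unfolding r_def by (simp add: field_simps)
 qed
 have bnd: "real n * (ln 2 + 72 * r * sqrt (real d)) / r\<^sup>2 + 4 / real n <= et"
 proof -
  have "ln 2 + 72 * r * sqrt (real d) <= r * (ln 2 + 72 * sqrt (real d))"
  proof -
   have "1 * ln 2 <= r * ln (2::real)" using r by (intro mult_right_mono) auto
   then show ?thesis by (simp add: algebra_simps)
  qed
  then have "real n * (ln 2 + 72 * r * sqrt (real d)) / r\<^sup>2 <= real n * (r * (ln 2 + 72 * sqrt (real d))) / r\<^sup>2"
   using r by (intro divide_right_mono mult_left_mono) auto
  also have "... = K / r" using r by (simp add: K_def power2_eq_square)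
  finally show ?thesis using r(3) n1 by linarith
 qed
 have "(\<Sum>y\<in>grid d n. \<integral>g. gavg X (gw (spins.J m d) (spins.pert x r y) w g)
   (%sg. gavg X (gw (spins.J m d) (spins.pert x r y) w g) (%ta. max 0 (- spins.R x m sg ta))) \<partial>gau (spins.J m d))
  <= ep * real (card (grid d n))" if sp: "spins X x m b" and w: "posw X w" for X :: "'x set" and x m b w
 proof -
  interpret spins X x m b by fact
  have pW: "posw X (gw (J d) (pert r y) w g)" for y g by (rule posw_gw[OF w])
  have 1: "(LINT g|gau (J d). gavg X (gw (J d) (pert r y) w g) (%sg. gavg X (gw (J d) (pert r y) w g) (%ta. max 0 (- R sg ta))))
   <= e + negprob d w r y e" for y
  proof -
   interpret P: prob_space "gau (J d)" by (rule prob_space_gau)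
   note ii = integrable_gavg2[OF w, of d "pert r y"]
   have "(LINT g|gau (J d). gavg X (gw (J d) (pert r y) w g) (%sg. gavg X (gw (J d) (pert r y) w g) (%ta. max 0 (- R sg ta))))
    <= (LINT g|gau (J d). gavg X (gw (J d) (pert r y) w g) (%sg. gavg X (gw (J d) (pert r y) w g) (%ta. e + (if R sg ta <= - e then 1 else 0))))"
   proof (rule integral_mono[OF ii ii], rule gavg_mono[OF pW], rule gavg_mono[OF pW])
    fix sg ta assume "sg \<in> X" "ta \<in> X"
    from R_abs_le[OF this] show "max 0 (- R sg ta) <= e + (if R sg ta <= - e then 1 else 0)"
     using e by (auto simp: abs_le_iff)
   qed
   also have "... = (LINT g|gau (J d). e + gavg X (gw (J d) (pert r y) w g) (%sg. gavg X (gw (J d) (pert r y) w g) (%ta. if R sg ta <= - e then 1 else 0)))"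
    by (simp add: gavg_add gavg_const[OF pW])
   also have "... = e + negprob d w r y e"
    unfolding negprob_def by (subst Bochner_Integration.integral_add[OF _ ii]) (simp_all add: P.prob_space)
   finally show ?thesis .
  qed
  have 2: "e + negprob d w r y e <= 2 * e + (1 / rh) * (\<Sum>s=1..d. dev d w r y s / r)" if "y \<in> grid d n" for y
   using np[OF sp w r(2), of y] grid_bounds[OF n(2) that] by auto
  have 3: "(\<Sum>y\<in>grid d n. dev d w r y s / r) <= et * real (card (grid d n))" if s: "s \<in> {1..d}" for s
  proof -
   define V where "V = (%j. 1 + real j / real n) ` {..<n}"
   have "(\<Sum>y\<in>grid d n. dev d w r y s / r) = (\<Sum>z\<in>PiE ({1..d} - {s}) (%_. V). \<Sum>v\<in>V. dev d w r (z(s:=v)) s / r)"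
    unfolding grid_def V_def by (rule sum_PiE_remove[OF s]) simp
   also have "... <= (\<Sum>z\<in>PiE ({1..d} - {s}) (%_. V). real n * et)"
   proof (rule sum_mono)
    fix z assume z: "z \<in> PiE ({1..d} - {s}) (%_. V)"
    define z' where "z' = z(s := 1)"
    have z'b: "1 <= z' t \<and> z' t <= 2" if "t \<in> {1..d}" for t
    proof (cases "t = s")
     case False
     then have "z t \<in> V" using that by (intro PiE_mem[OF z]) simp
     then obtain j where j: "j < n" "z t = 1 + real j / real n" by (auto simp: V_def)
     then have "0 <= real j / real n" "real j / real n <= 1" by auto
     then show ?thesis using False j(2) by (simp add: z'_def)
    qed (simp add: z'_def)
    have "(\<Sum>v\<in>V. dev d w r (z(s:=v)) s / r) = (\<Sum>j<n. dev d w r (z'(s := 1 + real j / real n)) s / r)"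
     unfolding V_def z'_def by (subst sum.reindex[OF inj_grid[OF n(2)]]) (simp add: comp_def)
    also have "... <= real n * (real n * (ln 2 + 72 * r * sqrt (real d)) / r\<^sup>2 + 4 / real n)"
     by (rule sum_dev_grid[OF w s r(2) n(1) z'b])
    also have "... <= real n * et" by (intro mult_left_mono bnd) auto
    finally show "(\<Sum>v\<in>V. dev d w r (z(s:=v)) s / r) <= real n * et" .
   qed
   also have "... = et * (\<Sum>z\<in>PiE ({1..d} - {s}) (%_. V). \<Sum>v\<in>V. 1)"
    using card_image[OF inj_grid[OF n(2)]] by (simp add: V_def)
   also have "(\<Sum>z\<in>PiE ({1..d} - {s}) (%_. V). \<Sum>v\<in>V. (1::real)) = real (card (grid d n))"
    using sum_PiE_remove[OF s finite_atLeastAtMost, where V=V and h="%_. 1::real"] unfolding grid_def V_def[symmetric] by simp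
   finally show ?thesis .
  qed
  have "(\<Sum>y\<in>grid d n. \<integral>g. gavg X (gw (J d) (pert r y) w g) (%sg. gavg X (gw (J d) (pert r y) w g) (%ta. max 0 (- R sg ta))) \<partial>gau (J d))
   <= (\<Sum>y\<in>grid d n. 2 * e + (1 / rh) * (\<Sum>s=1..d. dev d w r y s / r))"
   by (intro sum_mono order_trans[OF 1 2])
  also have "... = 2 * e * real (card (grid d n)) + (1 / rh) * (\<Sum>s=1..d. \<Sum>y\<in>grid d n. dev d w r y s / r)"
  proof -
   have "(\<Sum>y\<in>grid d n. \<Sum>s=1..d. dev d w r y s / r) = (\<Sum>s=1..d. \<Sum>y\<in>grid d n. dev d w r y s / r)" by (rule sum.swap)
   moreover have "(\<Sum>y\<in>grid d n. 2 * e + (1 / rh) * (\<Sum>s=1..d. dev d w r y s / r))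
    = 2 * e * real (card (grid d n)) + (1 / rh) * (\<Sum>y\<in>grid d n. \<Sum>s=1..d. dev d w r y s / r)"
    unfolding sum.distrib sum_distrib_left[symmetric] by simp
   ultimately show ?thesis by simp
  qed
  also have "... <= 2 * e * real (card (grid d n)) + (1 / rh) * (\<Sum>s=1..d. et * real (card (grid d n)))"
   using rh 3 by (intro add_mono order_refl mult_left_mono sum_mono) auto
  also have "... = 3 * e * real (card (grid d n))"
   using rh d by (simp add: et_def field_simps)
  also have "... <= ep * real (card (grid d n))" using ep by (intro mult_right_mono) (auto simp: e_def)
  finally show ?thesis .
 qed
 with n r show ?thesis by blast
qed

section \<open>Almost convexity of the p-th power of the overlap\<close>

lemma power_tangent:
 fixes a b :: real
 assumes "0 <= a" "0 <= b"
 shows "b ^ p + real p * b ^ (p - 1) * (a - b) <= a ^ p"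
proof (induction p)
 case (Suc p)
 have "b ^ Suc p + real (Suc p) * b ^ p * (a - b) <= a * (b ^ p + real p * b ^ (p - 1) * (a - b))"
 proof (cases p)
  case (Suc q)
  have "a * (b ^ p + real p * b ^ (p - 1) * (a - b)) - (b ^ Suc p + real (Suc p) * b ^ p * (a - b)) = real p * b ^ q * (a - b)\<^sup>2"
   by (simp add: Suc power2_eq_square algebra_simps)
  also have "... >= 0" using assms by simp
  finally show ?thesis by simp
 qed simp
 also have "... <= a * a ^ p" using Suc assms by (intro mult_left_mono) auto
 finally show ?case by simp
qed simp

text \<open>Tangent inequality for the convex function (positive part)^p, which is differentiable at
  0 because p >= 2.\<close>

lemma pospart_power_tangent:
 fixes x y :: real
 assumes p: "p >= 2"
 shows "max 0 y ^ p + real p * max 0 y ^ (p - 1) * (x - y) <= max 0 x ^ p"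
proof (cases "y <= 0")
 case True
 then show ?thesis using p by (simp add: max_def power_0_left)
next
 case y: False
 show ?thesis
 proof (cases "x >= 0")
  case True
  then show ?thesis using power_tangent[of x y p] y by (simp add: max_def)
 next
  case False
  obtain q where q: "p = Suc q" using p by (cases p) auto
  have "real p * y ^ q * x <= 0" using False y by (intro mult_nonneg_nonpos) auto
  moreover have "y ^ p <= real p * y ^ p" using p y by (simp add: mult_le_cancel_right1)
  ultimately have "y ^ p + real p * y ^ q * (x - y) <= 0" by (simp add: q algebra_simps)
  then show ?thesis using y False q by (simp add: max_def)
 qed
qed

lemma pospart_power_convex:
 fixes x1 x2 y :: real and M n :: nat
 assumes p: "p >= 2" and y: "real (M + n) * y = real M * x1 + real n * x2"
 shows "real (M + n) * max 0 y ^ p <= real M * max 0 x1 ^ p + real n * max 0 x2 ^ p"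
proof -
 define D where "D = real p * max 0 y ^ (p - 1)"
 have "real M * (max 0 y ^ p + D * (x1 - y)) + real n * (max 0 y ^ p + D * (x2 - y)) <= real M * max 0 x1 ^ p + real n * max 0 x2 ^ p"
  unfolding D_def by (intro add_mono mult_left_mono pospart_power_tangent[OF p]) auto
 moreover have "real M * (max 0 y ^ p + D * (x1 - y)) + real n * (max 0 y ^ p + D * (x2 - y))
  = real (M + n) * max 0 y ^ p + D * (real M * x1 + real n * x2 - real (M + n) * y)"
  by (simp add: algebra_simps)
 ultimately show ?thesis using y by simp
qed

lemma power_split_parts:
 fixes x :: real
 assumes "p >= 1" shows "x ^ p = max 0 x ^ p + (- 1) ^ p * max 0 (- x) ^ p"
proof (cases "x >= 0")
 case True
 then have "max 0 x = x" "max 0 (- x) = 0" by auto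
 then show ?thesis using assms by (simp add: power_0_left)
next
 case False
 then have "max 0 x = 0" "max 0 (- x) = - x" by auto
 moreover have "(- 1) ^ p * (- x) ^ p = x ^ p" by (simp flip: power_mult_distrib)
 ultimately show ?thesis using assms by (simp add: power_0_left)
qed

text \<open>For even p this is convexity and the left side is nonpositive. For odd p the power is
  the convex p-th power of the positive part minus that of the negative part, and the latter has the
  wrong sign; its error is paid by the negative parts of x1 and x2. Both errors carry the factor n
  of the second block only, since y - x1 = n * (x2 - x1) / (M + n): adding a small block to a large
  system costs little.\<close>

lemma power_two_block:
 fixes x1 x2 y :: real and M n :: nat
 assumes p: "p >= 2" and y: "real (M + n) * y = real M * x1 + real n * x2"
  and b: "\<bar>x1\<bar> <= 1" "\<bar>x2\<bar> <= 1" and pos: "M + n > 0"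
 shows "real (M + n) * y ^ p - real M * x1 ^ p - real n * x2 ^ p
  <= 2 * real n * real p * max 0 (- x1) + real n * max 0 (- x2)"
proof -
 have p1: "p >= 1" using p by simp
 define N where "N = real (M + n)"
 have N: "N > 0" using pos unfolding N_def by linarith
 define P where "P = (%x::real. max 0 x ^ p)"
 define Q where "Q = (%x::real. max 0 (- x) ^ p)"
 have xp: "x ^ p = P x + (- 1) ^ p * Q x" for x unfolding P_def Q_def by (rule power_split_parts[OF p1])
 have cP: "N * P y <= real M * P x1 + real n * P x2"
  unfolding N_def P_def by (rule pospart_power_convex[OF p y])
 have ext: "0 <= 2 * real n * real p * max 0 (- x1) + real n * max 0 (- x2)" by simp
 show ?thesis
 proof (cases "even p")
  case True
  have cQ: "N * Q y <= real M * Q x1 + real n * Q x2"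
   unfolding N_def Q_def by (rule pospart_power_convex[OF p]) (use y in \<open>simp add: algebra_simps\<close>)
  have "N * y ^ p <= real M * x1 ^ p + real n * x2 ^ p"
  proof -
   have "x ^ p = P x + Q x" for x using xp[of x] True by simp
   then show ?thesis using cP cQ by (simp add: algebra_simps)
  qed
  then show ?thesis using ext unfolding N_def[symmetric] by linarith
 next
  case False
  have Qy: "0 <= Q y" by (simp add: Q_def)
  \<comment> \<open>The tangent at -x1 bounds Q x1 - Q y by the slope D times y - x1, and M * (y -
    x1) is at most 2 * n.\<close>
  have q1: "real M * (Q x1 - Q y) <= 2 * real n * real p * max 0 (- x1)"
  proof -
   define D where "D = real p * max 0 (- x1) ^ (p - 1)"
   have D: "0 <= D" "D <= real p * max 0 (- x1)"
   proof -
    show "0 <= D" by (simp add: D_def)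
    have "max 0 (- x1) ^ (p - 1) <= max 0 (- x1) ^ 1"
     using p b by (intro power_decreasing) auto
    then show "D <= real p * max 0 (- x1)" unfolding D_def by (intro mult_left_mono) auto
   qed
   have "Q x1 + D * ((- y) - (- x1)) <= Q y"
    unfolding Q_def D_def by (rule pospart_power_tangent[OF p])
   then have "Q x1 - Q y <= D * (y - x1)" by (simp add: algebra_simps)
   then have "real M * (Q x1 - Q y) <= real M * (D * (y - x1))" by (intro mult_left_mono) auto
   also have "... = D * (real M * (y - x1))" by simp
   also have "... <= D * (2 * real n)"
   proof (intro mult_left_mono D(1))
    have "N * (y - x1) = real n * (x2 - x1)" using y by (simp add: N_def algebra_simps)
    then have "y - x1 = real n * (x2 - x1) / N" using N by (simp add: field_simps)
    then have "real M * (y - x1) = (real M / N) * (real n * (x2 - x1))" by simp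
    also have "... <= (real M / N) * (real n * 2)" using b N by (intro mult_left_mono) auto
    also have "... <= 1 * (real n * 2)" using N by (intro mult_right_mono) (auto simp: N_def)
    finally show "real M * (y - x1) <= 2 * real n" by simp
   qed
   also have "... <= real p * max 0 (- x1) * (2 * real n)" by (intro mult_right_mono D(2)) auto
   finally show ?thesis by (simp add: mult_ac)
  qed
  have q2: "real n * (Q x2 - Q y) <= real n * max 0 (- x2)"
  proof (intro mult_left_mono)
   have "max 0 (- x2) ^ p <= max 0 (- x2) ^ 1" using p b by (intro power_decreasing) auto
   then show "Q x2 - Q y <= max 0 (- x2)" using Qy unfolding Q_def power_one_right by linarith
  qed simp
  have "N * y ^ p - real M * x1 ^ p - real n * x2 ^ p = (N * P y - real M * P x1 - real n * P x2) + real M * (Q x1 - Q y) + real n * (Q x2 - Q y)"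
  proof -
   have e: "x ^ p = P x - Q x" for x using xp[of x] False by simp
   show ?thesis unfolding e by (simp add: N_def algebra_simps)
  qed
  also have "... <= 2 * real n * real p * max 0 (- x1) + real n * max 0 (- x2)"
   using cP q1 q2 by linarith
  finally show ?thesis by (simp add: N_def)
 qed
qed

section \<open>Superadditivity of the free energy by the Guerra-Toninelli interpolation\<close>

text \<open>Expands squared Gibbs averages as averages over two replicas, the form in which overlaps
  appear.\<close>

lemma gavg2_square_sum:
 "(\<Sum>i\<in>A. (gavg X W (a i))\<^sup>2) = gavg X W (%sg. gavg X W (%ta. \<Sum>i\<in>A. a i sg * a i ta))"
 by (simp only: gavg_sum gavg_cmult gavg_multc power2_eq_square)

lemma free_energy_derivative:
 fixes a :: "'i => 'x => real" and c c' :: "'i => real => real"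
 assumes I: "finite I" and w: "posw X w" and t: "t \<in> {lo<..<hi}"
  and dc: "!!i s. i \<in> I ==> s \<in> {lo<..<hi} ==> (c i has_real_derivative c' i s) (at s)"
  and bc: "!!i s. i \<in> I ==> s \<in> {lo<..<hi} ==> \<bar>c i s\<bar> <= B" "!!i s. i \<in> I ==> s \<in> {lo<..<hi} ==> \<bar>c' i s\<bar> <= B"
 defines "A == %s i sg. c i s * a i sg"
 shows "((%s. \<integral>g. lnZ X I (A s) w g \<partial>gau I) has_real_derivative
  (LINT g|gau I. (\<Sum>i\<in>I. c i t * c' i t * (gavg X (gw I (A t) w g) (%sg. (a i sg)\<^sup>2) - (gavg X (gw I (A t) w g) (a i))\<^sup>2)))) (at t)"
proof -
 have e1: "1 <= exp \<bar>x\<bar>" "\<bar>x\<bar> <= exp \<bar>x\<bar>" for x :: real using x_le_exp_abs[of x] by auto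
 have "((%s. \<integral>g. (%x. x) (lnZ X I (%i sg. c i s * a i sg) w g + (%_. 0) s) \<partial>gau I) has_real_derivative
  (LINT g|gau I. (\<Sum>i\<in>I. c i t * c' i t * ((%_. 0) (lnZ X I (%i sg. c i t * a i sg) w g + (%_. 0) t) * (gavg X (gw I (%i sg. c i t * a i sg) w g) (a i))\<^sup>2
    + (%_. 1) (lnZ X I (%i sg. c i t * a i sg) w g + (%_. 0) t) * (gavg X (gw I (%i sg. c i t * a i sg) w g) (%sg. (a i sg)\<^sup>2) - (gavg X (gw I (%i sg. c i t * a i sg) w g) (a i))\<^sup>2)))
    + (%_. 0) t * (%_. 1) (lnZ X I (%i sg. c i t * a i sg) w g + (%_. 0) t))) (at t)"
 proof (rule gaussian_interpolation[OF I w t, where Ph="%x. x" and Ph'="%_. 1" and Ph''="%_. 0" and d="%_. 0" and d'="%_. 0" and C=1 and k=1 and B="max B 0" and c=c and c'=c'])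
  show "\<bar>c i s\<bar> <= max B 0" if "i \<in> I" "s \<in> {lo<..<hi}" for i s using bc(1)[OF that] by simp
  show "\<bar>c' i s\<bar> <= max B 0" if "i \<in> I" "s \<in> {lo<..<hi}" for i s using bc(2)[OF that] by simp
 qed (use dc e1 in \<open>auto intro!: derivative_eq_intros\<close>)
 then show ?thesis unfolding A_def by simp
qed

text \<open>Scale the features in K by t from 0 to 1: the derivative is t times a sum of Gibbs
  variances, hence between 0 and v. Perturbations of bounded variance thus move the mean
  log-partition function by O(1), which is negligible against N.\<close>

lemma free_energy_perturbation:
 fixes a :: "'i => 'x => real"
 assumes I: "finite I" and w: "posw X w" and K: "K \<subseteq> I"
  and v: "!!sg. sg \<in> X ==> (\<Sum>i\<in>K. (a i sg)\<^sup>2) <= v"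
 defines "u == \<integral>g. lnZ X I a w g \<partial>gau I" and "u0 == \<integral>g. lnZ X I (%i sg. if i \<in> K then 0 else a i sg) w g \<partial>gau I"
 shows "u0 <= u" "u <= u0 + v"
proof -
 define c where "c i t = (if i \<in> K then t else (1::real))" for i t
 define c' where "c' i t = (if i \<in> K then 1 else (0::real))" for i and t :: real
 define q where "q t = (LINT g|gau I. lnZ X I (%i sg. c i t * a i sg) w g)" for t
 have p: "posw X (gw I A w g)" for A g by (rule posw_gw[OF w])
 interpret P: prob_space "gau I" by (rule prob_space_gau)
 define D where "D t g = (\<Sum>i\<in>I. c i t * c' i t * (gavg X (gw I (%i sg. c i t * a i sg) w g) (%sg. (a i sg)\<^sup>2) - (gavg X (gw I (%i sg. c i t * a i sg) w g) (a i))\<^sup>2))" for t g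
 have d: "(q has_real_derivative (LINT g|gau I. D t g)) (at t)" if "t \<in> {-1<..<2}" for t
  unfolding q_def[abs_def] D_def
  by (rule free_energy_derivative[OF I w that, where B=2]) (auto simp: c_def c'_def)
 have X0: "X ~= {}" using w by (simp add: posw_def)
 have v0: "0 <= v" using X0 v by (meson ex_in_conv order_trans sum_nonneg zero_le_power2)
 have D: "0 <= D t g \<and> D t g <= v" if t: "0 <= t" "t <= 1" for t g
 proof
  have eq: "D t g = (\<Sum>i\<in>K. t * (gavg X (gw I (%i sg. c i t * a i sg) w g) (%sg. (a i sg)\<^sup>2) - (gavg X (gw I (%i sg. c i t * a i sg) w g) (a i))\<^sup>2))"
   unfolding D_def by (rule sum.mono_neutral_cong_right) (use I K in \<open>auto simp: c_def c'_def\<close>)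
  show "0 <= D t g" unfolding eq using gavg_sq_le[OF p] t by (intro sum_nonneg mult_nonneg_nonneg) auto
  have "D t g <= (\<Sum>i\<in>K. 1 * gavg X (gw I (%i sg. c i t * a i sg) w g) (%sg. (a i sg)\<^sup>2))"
   unfolding eq using t gavg_sq_le[OF p] by (intro sum_mono mult_mono) auto
  also have "... = gavg X (gw I (%i sg. c i t * a i sg) w g) (%sg. \<Sum>i\<in>K. (a i sg)\<^sup>2)" by (simp add: gavg_sum)
  also have "... <= v" by (rule gavg_le[OF p v])
  finally show "D t g <= v" .
 qed
 have Dm: "D t \<in> borel_measurable (gau I)" for t unfolding D_def[abs_def] by measurable
 have iD: "integrable (gau I) (D t)" if t: "0 <= t" "t <= 1" for t
  by (rule expb_integrable[OF I], rule expb_bounded[OF Dm, of _ v]) (use D[OF t] in auto)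
 have ED: "0 <= (LINT g|gau I. D t g)" "(LINT g|gau I. D t g) <= v" if t: "0 <= t" "t <= 1" for t
  by (rule integral_nonneg_AE, use D[OF t] in simp) (rule P.integral_le_const[OF iD[OF t]], use D[OF t] in simp)
 have "q 0 <= q 1"
 proof (rule DERIV_nonneg_imp_nondecreasing[where f=q and a=0 and b=1])
  fix t :: real assume t: "0 <= t" "t <= 1"
  show "\<exists>y. (q has_real_derivative y) (at t) \<and> 0 <= y"
   using d[of t] ED(1)[OF t] t by (intro exI[of _ "\<integral>g. D t g \<partial>gau I"]) simp
 qed simp
 moreover have "q 1 - q 0 <= v"
 proof -
  have "0 * v - q 0 <= 1 * v - q 1"
  proof (rule DERIV_nonneg_imp_nondecreasing[where f="%t. t * v - q t" and a=0 and b=1])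
   fix t :: real assume t: "0 <= t" "t <= 1"
   have "((%t. t * v - q t) has_real_derivative v - (LINT g|gau I. D t g)) (at t)"
    using DERIV_diff[OF DERIV_cmult_right[OF DERIV_ident, of v] d[of t]] t by simp
   then show "\<exists>y. ((%t. t * v - q t) has_real_derivative y) (at t) \<and> 0 <= y"
    using ED(2)[OF t] by (intro exI[of _ "v - (LINT g|gau I. D t g)"]) simp
  qed simp
  then show ?thesis by simp
 qed
 moreover have "q 1 = u" by (simp add: q_def u_def c_def)
 moreover have "q 0 = u0"
 proof -
  have "(%i sg. c i 0 * a i sg) = (%i sg. if i \<in> K then 0 else a i sg)" by (auto simp: c_def fun_eq_iff)
  then show ?thesis by (simp only: q_def u0_def)
 qed
 ultimately show "u0 <= u" "u <= u0 + v" by auto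
qed

lemma lnZ_gau_reindex:
 fixes a :: "'i => 'x => real" and r :: "'j => 'i"
 assumes I: "finite I" and r: "inj_on r J" "r ` J \<subseteq> I"
  and a: "!!j sg. j \<in> J ==> sg \<in> X ==> a (r j) sg = b j sg" "!!i sg. i \<in> I - r ` J ==> sg \<in> X ==> a i sg = 0"
 shows "(LINT g|gau I. lnZ X I a w g) = (LINT g|gau J. lnZ X J b w g)"
proof -
 have "lnZ X I a w g = lnZ X J b w (\<lambda>j\<in>J. g (r j))" for g
 proof -
  have "(\<Sum>i\<in>I. a i sg * g i) = (\<Sum>j\<in>J. b j sg * g (r j))" if s: "sg \<in> X" for sg
  proof -
   have "(\<Sum>i\<in>I. a i sg * g i) = (\<Sum>i\<in>r ` J. a i sg * g i)"
    by (rule sum.mono_neutral_right) (use I r a(2)[OF _ s] in auto)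
   also have "... = (\<Sum>j\<in>J. b j sg * g (r j))"
    by (subst sum.reindex[OF r(1)]) (simp add: a(1)[OF _ s])
   finally show ?thesis .
  qed
  then show ?thesis by (simp add: lnZ_def gw_def)
 qed
 then show ?thesis using gau_reindex[OF r measurable_lnZ] by simp
qed

text \<open>Conditionally on the Gaussians outside the perturbation, the rest of the Hamiltonian is
  only a change of the reference weights, and \<open>up\<close> holds uniformly in them; Fubini then
  integrates the bound. This is why positivity holds along the whole interpolation path.\<close>

lemma universal_positivity_embedded:
 fixes a :: "(nat => real) => nat \<times> nat list => 'x => real"
 assumes sp: "spins X x m b" and w: "posw X w" and I': "finite I'"
  and I: "I = I' \<union> Pair t ` spins.J m d" and dj: "I' \<inter> Pair t ` spins.J m d = {}" and Y: "finite Y"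
  and up: "!!w. posw X w ==> (\<Sum>y\<in>Y. \<integral>g. gavg X (gw (spins.J m d) (spins.pert x r y) w g)
   (%sg. gavg X (gw (spins.J m d) (spins.pert x r y) w g) (%ta. max 0 (- spins.R x m sg ta))) \<partial>gau (spins.J m d))
  <= E"
  and a1: "!!y j sg. y \<in> Y ==> j \<in> spins.J m d ==> a y (t, j) sg = spins.pert x r y j sg"
  and a2: "!!y i sg. y \<in> Y ==> i \<in> I' ==> a y i sg = ab i sg" and E: "E >= 0"
 shows "(\<Sum>y\<in>Y. \<integral>g. gavg X (gw I (a y) w g) (%sg. gavg X (gw I (a y) w g) (%ta. max 0 (- spins.R x m sg ta))) \<partial>gau I) <= E"
proof -
 interpret spins X x m b by fact
 define f where "f = (%sg ta. max 0 (- R sg ta))"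
 define h where "h y g = gavg X (gw I (a y) w g) (%sg. gavg X (gw I (a y) w g) (f sg))" for y g
 have fI: "finite I" using I I' by simp
 have eh: "expb I (h y)" for y
  unfolding h_def by (rule expb_gavg[OF w], rule expb_gavg[OF w], rule expb_const)
 note ih = expb_integrable[OF fI eh]
 have "(\<Sum>y\<in>Y. \<integral>g. h y g \<partial>gau I) = (LINT g|gau I. (\<Sum>y\<in>Y. h y g))"
  by (rule Bochner_Integration.integral_sum[symmetric]) (rule ih)
 also have "... = (LINT z|gau I'. (LINT g|gau (Pair t ` J d). (\<Sum>y\<in>Y. h y (merge I' (Pair t ` J d) (z, g)))))"
  unfolding I by (rule gau_fold[OF dj I']) (auto intro!: Bochner_Integration.integrable_sum ih[unfolded I])
 also have "... <= E"
 proof -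
  define q where "q z = (LINT g|gau (Pair t ` J d). (\<Sum>y\<in>Y. h y (merge I' (Pair t ` J d) (z, g))))" for z
  have "q z <= E" for z
  proof -
   define w' where "w' sg = w sg * exp (\<Sum>i\<in>I'. ab i sg * z i)" for sg
   have w': "posw X w'" unfolding w'_def[abs_def] by (rule posw_exp[OF w])
   define h' where "h' y g = gavg X (gw (J d) (pert r y) w' g) (%sg. gavg X (gw (J d) (pert r y) w' g) (f sg))" for y g
   have eh': "expb (J d) (h' y)" for y
    unfolding h'_def by (rule expb_gavg[OF w'], rule expb_gavg[OF w'], rule expb_const)
   have hh: "h y (merge I' (Pair t ` J d) (z, g)) = h' y (\<lambda>j\<in>J d. g (t, j))" if y: "y \<in> Y" for y g
   proof -
    have "gw I (a y) w (merge I' (Pair t ` J d) (z, g)) sg = gw (J d) (pert r y) w' (\<lambda>j\<in>J d. g (t, j)) sg" for sg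
    proof -
     let ?g = "merge I' (Pair t ` J d) (z, g)"
     have "(\<Sum>i\<in>I. a y i sg * ?g i) = (\<Sum>i\<in>I'. a y i sg * ?g i) + (\<Sum>i\<in>Pair t ` J d. a y i sg * ?g i)"
      unfolding I by (rule sum.union_disjoint[OF I' _ dj]) simp
     also have "(\<Sum>i\<in>I'. a y i sg * ?g i) = (\<Sum>i\<in>I'. ab i sg * z i)"
      by (rule sum.cong[OF refl]) (simp add: a2[OF y] merge_def)
     also have "(\<Sum>i\<in>Pair t ` J d. a y i sg * ?g i) = (\<Sum>j\<in>J d. pert r y j sg * g (t, j))"
     proof (subst sum.reindex)
      show "inj_on (Pair t) (J d)" by (simp add: inj_on_def)
      show "sum ((%i. a y i sg * ?g i) \<circ> Pair t) (J d) = (\<Sum>j\<in>J d. pert r y j sg * g (t, j))"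
       using dj by (intro sum.cong refl) (auto simp: a1[OF y] merge_def)
     qed
     finally show ?thesis by (simp add: gw_def w'_def exp_add)
    qed
    then show ?thesis unfolding h_def h'_def by presburger
   qed
   have "q z = (LINT g|gau (Pair t ` J d). (\<Sum>y\<in>Y. h' y (\<lambda>j\<in>J d. g (t, j))))"
    unfolding q_def using hh by (simp cong: sum.cong)
   also have "... = (LINT g|gau (J d). (\<Sum>y\<in>Y. h' y g))"
    by (rule gau_reindex) (auto simp: inj_on_def intro!: borel_measurable_sum expb_measurable[OF eh'])
   also have "... = (\<Sum>y\<in>Y. \<integral>g. h' y g \<partial>gau (J d))"
    by (rule Bochner_Integration.integral_sum) (rule expb_integrable[OF finite_J eh'])
   also have "... <= E" using up[OF w'] unfolding h'_def f_def .
   finally show ?thesis .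
  qed
  then have le: "AE z in gau I'. q z <= E" by simp
  interpret P: prob_space "gau I'" by (rule prob_space_gau)
  have "(LINT z|gau I'. q z) <= E"
  \<comment> \<open>If q were not integrable its Bochner integral would be 0, which is at most E as
    well.\<close>
  proof (cases "integrable (gau I') q")
   case True then show ?thesis by (rule P.integral_le_const[OF _ le])
  next
   case False then show ?thesis using E by (simp add: not_integrable_integral_eq)
  qed
  then show ?thesis unfolding q_def .
 qed
 finally show ?thesis unfolding h_def f_def .
qed

definition comb :: "nat => (nat => real) => (nat => real) => nat => real" where
 "comb M sg1 sg2 i = (if i < M then sg1 i else sg2 (i - M))"

lemma bij_comb: "bij_betw (%(sg1, sg2). comb M sg1 sg2) (Defs.Sigma M \<times> Defs.Sigma n) (Defs.Sigma (M + n))"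
proof (rule bij_betw_byWitness[where f'="%sg. (%i. if i < M then sg i else 0, %i. sg (M + i))"])
 show "\<forall>q\<in>Defs.Sigma M \<times> Defs.Sigma n. (%sg. (%i. if i < M then sg i else 0, %i. sg (M + i))) (case q of (sg1, sg2) => comb M sg1 sg2) = q"
  by (auto simp: Defs.Sigma_def comb_def fun_eq_iff)
 show "\<forall>sg\<in>Defs.Sigma (M + n). (case (%i. if i < M then sg i else 0, %i. sg (M + i)) of (sg1, sg2) => comb M sg1 sg2) = sg"
  by (auto simp: Defs.Sigma_def comb_def fun_eq_iff)
 show "(%(sg1, sg2). comb M sg1 sg2) ` (Defs.Sigma M \<times> Defs.Sigma n) \<subseteq> Defs.Sigma (M + n)"
 proof (clarify)
  fix sg1 sg2 assume s: "sg1 \<in> Defs.Sigma M" "sg2 \<in> Defs.Sigma n"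
  have "sg1 i = 1 \<or> sg1 i = - 1" if "i < M" for i using s(1) that by (simp add: Defs.Sigma_def)
  moreover have "sg2 (i - M) = 1 \<or> sg2 (i - M) = - 1" if "i < M + n" "\<not> i < M" for i
   using s(2) that by (simp add: Defs.Sigma_def)
  ultimately show "comb M sg1 sg2 \<in> Defs.Sigma (M + n)"
   using s by (simp add: Defs.Sigma_def comb_def)
 qed
 show "(%sg. (%i. if i < M then sg i else 0, %i. sg (M + i))) ` Defs.Sigma (M + n) \<subseteq> Defs.Sigma M \<times> Defs.Sigma n"
 proof (clarify, intro conjI)
  fix sg assume s: "sg \<in> Defs.Sigma (M + n)"
  have "sg i = 1 \<or> sg i = - 1" if "i < M + n" for i using s that by (simp add: Defs.Sigma_def)
  moreover have "sg i = 0" if "i >= M + n" for i using s that by (simp add: Defs.Sigma_def)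
  ultimately show "(%i. if i < M then sg i else 0) \<in> Defs.Sigma M" "(%i. sg (M + i)) \<in> Defs.Sigma n"
   by (simp_all add: Defs.Sigma_def)
 qed
qed

lemma Sigma_one: "Defs.Sigma 1 = {(%i. if i = 0 then 1 else 0), (%i. if i = 0 then - 1 else 0)}"
 by (force simp: Defs.Sigma_def fun_eq_iff)

lemma finite_Sigma_card: "finite (Defs.Sigma N) \<and> card (Defs.Sigma N) = 2 ^ N"
proof (induction N)
 case 0
 have "Defs.Sigma 0 = {%_. 0}" by (auto simp: Defs.Sigma_def fun_eq_iff)
 then show ?case by simp
next
 case (Suc N)
 have ne: "(%i::nat. if i = 0 then 1 else (0::real)) ~= (%i. if i = 0 then - 1 else 0)"
  by (metis one_neq_neg_one)
 have c1: "card (Defs.Sigma 1) = 2" "finite (Defs.Sigma 1)" unfolding Sigma_one using ne by auto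
 have "card (Defs.Sigma (N + 1)) = card (Defs.Sigma N \<times> Defs.Sigma 1)"
  by (rule bij_betw_same_card[OF bij_comb, symmetric])
 moreover have "finite (Defs.Sigma (N + 1))"
  using bij_betw_finite[OF bij_comb[of N 1]] Suc c1 by simp
 ultimately show ?case using Suc c1 by (simp add: card_cartesian_product)
qed

lemma posw_Sigma: "posw (Defs.Sigma N) (%_. 2 powr - real N)"
 using finite_Sigma_card[of N] by (auto simp: posw_def)

lemma Sigma_mult: "sg \<in> Defs.Sigma N ==> i < N ==> sg i * sg i = 1"
 by (auto simp: Defs.Sigma_def)

lemma Sigma_abs: "sg \<in> Defs.Sigma N ==> i < N ==> \<bar>sg i\<bar> = 1"
 by (auto simp: Defs.Sigma_def)

text \<open>The coefficient of the disorder variable in (be / sqrt 2) * H, so that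
  \<open>free_energy\<close> is N times the mean of \<open>F_N\<close>.\<close>

definition pfeat :: "real => nat => nat => nat list => (nat => real) => real" where
 "pfeat be p N is sg = be / sqrt 2 * real N powr (- (real p - 1) / 2) * (\<Prod>j<p. sg (is ! j))"

definition free_energy :: "real => nat => nat => real" where
 "free_energy be p N = (LINT g|gau (idx p N). lnZ (Defs.Sigma N) (idx p N) (pfeat be p N) (%_. 2 powr - real N) g)"

lemma sum_pfeat:
 assumes N: "N > 0" and p: "p >= 1"
 shows "(\<Sum>is\<in>idx p N. pfeat be p N is sg * pfeat be p N is ta) = be\<^sup>2 / 2 * real N * ((\<Sum>i<N. sg i * ta i) / real N) ^ p"
proof -
 have "(\<Sum>is\<in>idx p N. pfeat be p N is sg * pfeat be p N is ta)
  = (\<Sum>is\<in>idx p N. (be\<^sup>2 / 2 * (real N powr (- (real p - 1) / 2) * real N powr (- (real p - 1) / 2))) * (\<Prod>j<p. sg (is ! j) * ta (is ! j)))"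
  by (rule sum.cong[OF refl]) (simp add: pfeat_def prod.distrib power2_eq_square)
 also have "... = (be\<^sup>2 / 2 * (real N powr (- (real p - 1) / 2) * real N powr (- (real p - 1) / 2))) * (\<Sum>i<N. sg i * ta i) ^ p"
  unfolding sum_distrib_left[symmetric] sum_idx_prod[of "%i. sg i * ta i"] ..
 also have "real N powr (- (real p - 1) / 2) * real N powr (- (real p - 1) / 2) = real N powr (1 - real p)"
 proof -
  have "- (real p - 1) / 2 + - (real p - 1) / 2 = 1 - real p" by simp
  then show ?thesis by (simp only: powr_add[symmetric])
 qed
 also have "... = real N / real N ^ p" using N by (simp add: powr_diff powr_realpow)
 finally show ?thesis by (simp add: power_divide)
qed

lemma comb_lower: "i < M ==> comb M sg1 sg2 i = sg1 i"
 by (simp add: comb_def)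

lemma comb_upper: "comb M sg1 sg2 (M + i) = sg2 i"
 by (simp add: comb_def)

lemma idx_nth: "is \<in> idx p N ==> j < p ==> is ! j < N"
 using nth_mem[of j "is"] by (auto simp: idx_def subset_iff)

lemma pfeat_comb_lower: "is \<in> idx p M ==> pfeat be p M is (comb M sg1 sg2) = pfeat be p M is sg1"
 unfolding pfeat_def by (intro arg_cong2[where f="(*)"] refl prod.cong) (simp add: comb_lower idx_nth)

text \<open>Without coupling between the blocks the partition function factorises along
  \<open>comb\<close>.\<close>

lemma lnZ_product:
 "ln (\<Sum>sg\<in>Defs.Sigma (M + n). 2 powr - real (M + n) * exp ((\<Sum>is\<in>idx p M. pfeat be p M is sg * g1 is) + (\<Sum>is\<in>idx p n. pfeat be p n is (%i. sg (M + i)) * g2 is)))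
 = lnZ (Defs.Sigma M) (idx p M) (pfeat be p M) (%_. 2 powr - real M) g1 + lnZ (Defs.Sigma n) (idx p n) (pfeat be p n) (%_. 2 powr - real n) g2"
proof -
 define E1 where "E1 sg = gw (idx p M) (pfeat be p M) (%_. 2 powr - real M) g1 sg" for sg
 define E2 where "E2 sg = gw (idx p n) (pfeat be p n) (%_. 2 powr - real n) g2 sg" for sg
 have pos: "(\<Sum>sg\<in>Defs.Sigma M. E1 sg) > 0" "(\<Sum>sg\<in>Defs.Sigma n. E2 sg) > 0"
  unfolding E1_def E2_def by (rule posw_sum[OF posw_gw[OF posw_Sigma]])+
 have "(\<Sum>sg\<in>Defs.Sigma (M + n). 2 powr - real (M + n) * exp ((\<Sum>is\<in>idx p M. pfeat be p M is sg * g1 is) + (\<Sum>is\<in>idx p n. pfeat be p n is (%i. sg (M + i)) * g2 is)))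
  = (\<Sum>(sg1, sg2)\<in>Defs.Sigma M \<times> Defs.Sigma n. E1 sg1 * E2 sg2)"
 proof (subst sum.reindex_bij_betw[OF bij_comb, symmetric], rule sum.cong[OF refl])
  fix q :: "(nat => real) \<times> (nat => real)"
  obtain sg1 sg2 where q: "q = (sg1, sg2)" by (cases q)
  have "(\<Sum>is\<in>idx p M. pfeat be p M is (comb M sg1 sg2) * g1 is) = (\<Sum>is\<in>idx p M. pfeat be p M is sg1 * g1 is)"
   by (rule sum.cong[OF refl]) (simp add: pfeat_comb_lower)
  then show "2 powr - real (M + n) * exp ((\<Sum>is\<in>idx p M. pfeat be p M is (case q of (sg1, sg2) => comb M sg1 sg2) * g1 is) + (\<Sum>is\<in>idx p n. pfeat be p n is (%i. (case q of (sg1, sg2) => comb M sg1 sg2) (M + i)) * g2 is))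
   = (case q of (sg1, sg2) => E1 sg1 * E2 sg2)"
   by (simp add: q comb_upper E1_def E2_def gw_def exp_add powr_add[symmetric])
 qed
 also have "... = (\<Sum>sg\<in>Defs.Sigma M. E1 sg) * (\<Sum>sg\<in>Defs.Sigma n. E2 sg)"
  by (simp add: sum.cartesian_product[symmetric] sum_product)
 finally show ?thesis using pos by (simp add: lnZ_def E1_def[symmetric] E2_def[symmetric] ln_mult_pos)
qed

lemma spins_block:
 assumes m: "m > 0" and k: "k + m <= N"
 shows "spins (Defs.Sigma N) (%sg i. sg (k + i) / sqrt (real m)) m (%_. 1 / sqrt (real m))"
proof
 show "finite (Defs.Sigma N)" "Defs.Sigma N ~= {}" using posw_Sigma[of N] by (auto simp: posw_def)
 fix sg assume s: "sg \<in> Defs.Sigma N"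
 show "(\<Sum>i<m. (sg (k + i) / sqrt (real m))\<^sup>2) = 1"
 proof -
  have "(\<Sum>i<m. (sg (k + i) / sqrt (real m))\<^sup>2) = (\<Sum>i<m. 1 / real m)"
   by (rule sum.cong[OF refl]) (use k Sigma_mult[OF s] in \<open>simp add: power_divide power2_eq_square\<close>)
  then show ?thesis using m by simp
 qed
 show "\<bar>sg (k + i) / sqrt (real m)\<bar> <= 1 / sqrt (real m)" if "i < m" for i
  using Sigma_abs[OF s, of "k + i"] that k by simp
next
 show "(\<Sum>i<m. (1 / sqrt (real m))\<^sup>2) <= 1" using m by (simp add: power_divide)
qed

lemma block_R:
 assumes m: "m > 0" and k: "k + m <= N"
 shows "spins.R (%sg i. sg (k + i) / sqrt (real m)) m sg ta = (\<Sum>i<m. sg (k + i) * ta (k + i)) / real m"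
proof -
 interpret spins "Defs.Sigma N" "%sg i. sg (k + i) / sqrt (real m)" m "%_. 1 / sqrt (real m)"
  by (rule spins_block[OF m k])
 show ?thesis unfolding R_def sum_divide_distrib
  by (rule sum.cong[OF refl]) simp
qed

text \<open>The features of each degree have square sum r^2 * (y t)^2 on a unit vector, and grid
  amplitudes are at most 2.\<close>

lemma block_pert_variance:
 assumes sp: "spins X x m b" and y: "y \<in> grid d nn" "nn > 0" and s: "sg \<in> X"
 shows "(\<Sum>j\<in>spins.J m d. (spins.pert x r y j sg)\<^sup>2) <= 4 * r\<^sup>2 * real d"
proof -
 interpret spins X x m b by fact
 have "(\<Sum>j\<in>J d. (pert r y j sg)\<^sup>2) = (\<Sum>t=1..d. r\<^sup>2 * (y t)\<^sup>2 * (\<Sum>is\<in>idx t m. ph is sg * ph is sg))"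
  unfolding sum_J by (intro sum.cong refl) (simp add: pert_def length_idx power_mult_distrib sum_distrib_left power2_eq_square mult_ac)
 also have "... = (\<Sum>t=1..d. r\<^sup>2 * (y t)\<^sup>2)" using s by (simp add: sum_ph)
 also have "... <= (\<Sum>t=1..d. r\<^sup>2 * 2\<^sup>2)"
 proof (intro sum_mono mult_left_mono)
  fix t assume "t \<in> {1..d}"
  then have "1 <= y t \<and> y t <= 2" by (rule grid_bounds[OF y(2,1)])
  then show "(y t)\<^sup>2 <= 2\<^sup>2" by (intro power_mono) auto
 qed simp
 finally show ?thesis by (simp add: mult_ac)
qed

text \<open>Interpolates with sin s on the full system and cos s on the two separate blocks. The
  diagonal terms cancel, and the derivative is -(be^2 / 2) * sin s * cos s times the two-replica
  average of N * ov^p - M * R1^p - n * R2^p. \<open>power_two_block\<close> bounds that average by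
  negative parts of block overlaps, and the perturbations of both blocks, present along the whole
  path and averaged over their grids, make those small. Removing the perturbations again costs 8 *
  r^2 * d.\<close>

lemma guerra_toninelli:
 fixes M n p d nn :: nat and r ep be :: real
 assumes M: "M > 0" and n: "n > 0" and p: "p >= 2" and nn: "nn > 0" and ep: "ep > 0"
  and up: "!!(X :: (nat => real) set) x m b w. spins X x m b ==> posw X w ==>
  (\<Sum>y\<in>grid d nn. \<integral>g. gavg X (gw (spins.J m d) (spins.pert x r y) w g)
   (%sg. gavg X (gw (spins.J m d) (spins.pert x r y) w g) (%ta. max 0 (- spins.R x m sg ta))) \<partial>gau (spins.J m d))
  <= ep * real (card (grid d nn))"
 shows "free_energy be p M + free_energy be p n <= free_energy be p (M + n) + 8 * r\<^sup>2 * real d + be\<^sup>2 * (2 * real p + 1) * real n * ep"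
proof -
 define N where "N = M + n"
 have N: "N > 0" using M by (simp add: N_def)
 define X where "X = Defs.Sigma N"
 define w where "w = (%_::nat => real. 2 powr - real N)"
 have w: "posw X w" unfolding X_def w_def by (rule posw_Sigma)
 define x1 where "x1 = (%sg i. (sg :: nat => real) (0 + i) / sqrt (real M))"
 define x2 where "x2 = (%sg i. (sg :: nat => real) (M + i) / sqrt (real n))"
 have sp1: "spins X x1 M (%_. 1 / sqrt (real M))" unfolding X_def x1_def by (rule spins_block[OF M]) (simp add: N_def)
 have sp2: "spins X x2 n (%_. 1 / sqrt (real n))" unfolding X_def x2_def by (rule spins_block[OF n]) (simp add: N_def)
 define R1 where "R1 = spins.R x1 M"
 define R2 where "R2 = spins.R x2 n"
 have R1: "R1 sg ta = (\<Sum>i<M. sg i * ta i) / real M" for sg ta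
  unfolding R1_def x1_def by (subst block_R[OF M, of 0 N]) (auto simp: N_def)
 have R2: "R2 sg ta = (\<Sum>i<n. sg (M + i) * ta (M + i)) / real n" for sg ta
  unfolding R2_def x2_def by (subst block_R[OF n, of M N]) (auto simp: N_def)
 define ov where "ov sg ta = (\<Sum>i<N. sg i * ta i) / real N" for sg ta :: "nat => real"
 have ov: "real (M + n) * ov sg ta = real M * R1 sg ta + real n * R2 sg ta" for sg ta
 proof -
  have "(\<Sum>i<M + n. sg i * ta i) = (\<Sum>i<M. sg i * ta i) + (\<Sum>i<n. sg (M + i) * ta (M + i))"
   by (induction n) (auto simp: add.assoc)
  then show ?thesis unfolding ov_def R1 R2 N_def using M n by simp
 qed
 have R1b: "\<bar>R1 sg ta\<bar> <= 1" "R1 sg sg = 1" if "sg \<in> X" "ta \<in> X" for sg ta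
  unfolding R1_def using spins.R_abs_le[OF sp1 that] spins.R_self[OF sp1 that(1)] by auto
 have R2b: "\<bar>R2 sg ta\<bar> <= 1" "R2 sg sg = 1" if "sg \<in> X" "ta \<in> X" for sg ta
  unfolding R2_def using spins.R_abs_le[OF sp2 that] spins.R_self[OF sp2 that(1)] by auto
 define J1 where "J1 = spins.J M d"
 define J2 where "J2 = spins.J n d"
 have fJ: "finite J1" "finite J2" unfolding J1_def J2_def using spins.finite_J[OF sp1] spins.finite_J[OF sp2] by auto
 \<comment> \<open>The tags 0 to 4 keep five families of Gaussians disjoint: full system, first
   block, second block and the two perturbations.\<close>
 define I0 where "I0 = Pair (0::nat) ` idx p N"
 define I1 where "I1 = Pair (1::nat) ` idx p M"
 define I2 where "I2 = Pair (2::nat) ` idx p n"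
 define I3 where "I3 = Pair (3::nat) ` J1"
 define I4 where "I4 = Pair (4::nat) ` J2"
 define I where "I = I0 \<union> I1 \<union> I2 \<union> I3 \<union> I4"
 note Idefs = I0_def I1_def I2_def I3_def I4_def
 have fI: "finite I" "finite I0" "finite I1" "finite I2" "finite I3" "finite I4"
  unfolding I_def Idefs using fJ by auto
 have inj: "inj_on (Pair t) A" for t :: nat and A :: "nat list set" by (simp add: inj_on_def)
 define a where "a y1 y2 = (%(t :: nat, is) sg. if t = 0 then pfeat be p N is sg else if t = 1 then pfeat be p M is sg
  else if t = 2 then pfeat be p n is (%i. sg (M + i)) else if t = 3 then spins.pert x1 r y1 is sg else spins.pert x2 r y2 is sg)"
  for y1 y2 :: "nat => real"
 \<comment> \<open>The product c * c' is sin s * cos s for the full system, its negative for the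
   blocks, and 0 for the perturbations, which stay switched on.\<close>
 define c where "c = (%(t :: nat, is :: nat list) s. if t = 0 then sin s else if t = 1 \<or> t = 2 then cos s else (1::real))"
 define c' where "c' = (%(t :: nat, is :: nat list) s. if t = 0 then cos s else if t = 1 \<or> t = 2 then - sin s else (0::real))"
 define A where "A y1 y2 s i sg = c i s * a y1 y2 i sg" for y1 y2 s i sg
 define u where "u y1 y2 s = (LINT g|gau I. lnZ X I (A y1 y2 s) w g)" for y1 y2 s
 define W where "W y1 y2 s g = gw I (A y1 y2 s) w g" for y1 y2 s g
 have pW: "posw X (W y1 y2 s g)" for y1 y2 s g unfolding W_def by (rule posw_gw[OF w])
 define D where "D y1 y2 s g = (\<Sum>i\<in>I. c i s * c' i s * (gavg X (W y1 y2 s g) (%sg. (a y1 y2 i sg)\<^sup>2) - (gavg X (W y1 y2 s g) (a y1 y2 i))\<^sup>2))"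
  for y1 y2 s g
 have du: "(u y1 y2 has_real_derivative (LINT g|gau I. D y1 y2 s g)) (at s)" if "s \<in> {-1<..<2}" for y1 y2 s
  unfolding u_def[abs_def] D_def W_def A_def
  by (rule free_energy_derivative[OF fI(1) w that, where B=1])
   (auto simp: c_def c'_def split: prod.splits intro!: derivative_eq_intros)
 define f1 where "f1 = (%sg ta. max 0 (- R1 sg ta))"
 define f2 where "f2 = (%sg ta. max 0 (- R2 sg ta))"
 define h1 where "h1 y1 y2 s g = gavg X (W y1 y2 s g) (%sg. gavg X (W y1 y2 s g) (f1 sg))" for y1 y2 s g
 define h2 where "h2 y1 y2 s g = gavg X (W y1 y2 s g) (%sg. gavg X (W y1 y2 s g) (f2 sg))" for y1 y2 s g
 have eh: "expb I (%g. gavg X (W y1 y2 s g) (%sg. gavg X (W y1 y2 s g) (f sg)))" for y1 y2 s f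
  unfolding W_def by (rule expb_gavg[OF w], rule expb_gavg[OF w], rule expb_const)
 note ih = expb_integrable[OF fI(1) eh]
 have Dlow: "- (be\<^sup>2 / 2) * (2 * real n * real p * h1 y1 y2 s g + real n * h2 y1 y2 s g) <= D y1 y2 s g"
  if s: "0 <= s" "s <= pi / 2" for y1 y2 s g
 proof -
  let ?G = "gavg X (W y1 y2 s g)"
  define v where "v i = ?G (%sg. (a y1 y2 i sg)\<^sup>2) - (?G (a y1 y2 i))\<^sup>2" for i
  have sp: "sum f I = sum f I0 + sum f I1 + sum f I2 + sum f I3 + sum f I4" for f :: "nat \<times> nat list => real"
   unfolding I_def using fI by (subst sum.union_disjoint, simp, simp, force simp: Idefs)+ simp
  have z3: "(\<Sum>i\<in>I3. c i s * c' i s * v i) = 0" "(\<Sum>i\<in>I4. c i s * c' i s * v i) = 0"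
   by (rule sum.neutral, force simp: Idefs c'_def)+
  have s0: "(\<Sum>i\<in>I0. c i s * c' i s * v i) = sin s * cos s * (\<Sum>i\<in>I0. v i)"
   and s1: "(\<Sum>i\<in>I1. c i s * c' i s * v i) = - (sin s * cos s) * (\<Sum>i\<in>I1. v i)"
   and s2: "(\<Sum>i\<in>I2. c i s * c' i s * v i) = - (sin s * cos s) * (\<Sum>i\<in>I2. v i)"
   unfolding sum_distrib_left by (rule sum.cong[OF refl], force simp: Idefs c_def c'_def)+
  have vs: "(\<Sum>i\<in>K. v i) = ?G (%sg. \<Sum>i\<in>K. a y1 y2 i sg * a y1 y2 i sg) - ?G (%sg. ?G (%ta. \<Sum>i\<in>K. a y1 y2 i sg * a y1 y2 i ta))" for K
   unfolding v_def sum_subtractf gavg2_square_sum gavg_sum[symmetric] by (simp only: power2_eq_square)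
  have p1: "p >= 1" using p by simp
  have k0: "(\<Sum>i\<in>I0. a y1 y2 i sg * a y1 y2 i ta) = be\<^sup>2 / 2 * real N * ov sg ta ^ p" for sg ta
   unfolding I0_def ov_def sum_pfeat[OF N p1, symmetric] by (subst sum.reindex[OF inj]) (simp add: a_def)
  have k1: "(\<Sum>i\<in>I1. a y1 y2 i sg * a y1 y2 i ta) = be\<^sup>2 / 2 * real M * R1 sg ta ^ p" for sg ta
   unfolding I1_def R1 sum_pfeat[OF M p1, symmetric] by (subst sum.reindex[OF inj]) (simp add: a_def)
  have k2: "(\<Sum>i\<in>I2. a y1 y2 i sg * a y1 y2 i ta) = be\<^sup>2 / 2 * real n * R2 sg ta ^ p" for sg ta
   unfolding I2_def R2 sum_pfeat[OF n p1, of be "%i. sg (M + i)" "%i. ta (M + i)", symmetric] by (subst sum.reindex[OF inj]) (simp add: a_def)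
  have one: "?G (%sg. be\<^sup>2 / 2 * q * h sg sg ^ p) = be\<^sup>2 / 2 * q" if "!!sg. sg \<in> X ==> h sg sg = 1" for q h
  proof -
   have "?G (%sg. be\<^sup>2 / 2 * q * h sg sg ^ p) = ?G (%sg. be\<^sup>2 / 2 * q)" by (rule gavg_cong) (simp add: that)
   then show ?thesis by (simp add: gavg_const[OF pW])
  qed
  have ov1: "ov sg sg = 1" if "sg \<in> X" for sg
  proof -
   have "real (M + n) * ov sg sg = real (M + n)" unfolding ov using R1b(2)[OF that that] R2b(2)[OF that that] by simp
   then show ?thesis using M by simp
  qed
  define T where "T sg ta = real N * ov sg ta ^ p - real M * R1 sg ta ^ p - real n * R2 sg ta ^ p" for sg ta
  have "D y1 y2 s g = (\<Sum>i\<in>I. c i s * c' i s * v i)" by (simp add: D_def v_def)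
  also have "... = sin s * cos s * ((\<Sum>i\<in>I0. v i) - (\<Sum>i\<in>I1. v i) - (\<Sum>i\<in>I2. v i))"
   unfolding sp z3 s0 s1 s2 by (simp add: algebra_simps)
  also have "(\<Sum>i\<in>I0. v i) - (\<Sum>i\<in>I1. v i) - (\<Sum>i\<in>I2. v i) = - (be\<^sup>2 / 2) * ?G (%sg. ?G (T sg))"
  proof -
   have "?G (%sg. ?G (T sg)) = real N * ?G (%sg. ?G (%ta. ov sg ta ^ p)) - real M * ?G (%sg. ?G (%ta. R1 sg ta ^ p)) - real n * ?G (%sg. ?G (%ta. R2 sg ta ^ p))"
    unfolding T_def[abs_def] gavg_diff gavg_cmult ..
   note eT = this
   have off: "?G (%sg. ?G (%ta. be\<^sup>2 / 2 * q * h sg ta ^ p)) = be\<^sup>2 / 2 * q * ?G (%sg. ?G (%ta. h sg ta ^ p))" for q h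
    by (simp only: gavg_cmult)
   have eN: "real N = real M + real n" by (simp add: N_def)
   have "(\<Sum>i\<in>I0. v i) - (\<Sum>i\<in>I1. v i) - (\<Sum>i\<in>I2. v i)
    = (be\<^sup>2 / 2 * real N - be\<^sup>2 / 2 * real N * ?G (%sg. ?G (%ta. ov sg ta ^ p)))
    - (be\<^sup>2 / 2 * real M - be\<^sup>2 / 2 * real M * ?G (%sg. ?G (%ta. R1 sg ta ^ p)))
    - (be\<^sup>2 / 2 * real n - be\<^sup>2 / 2 * real n * ?G (%sg. ?G (%ta. R2 sg ta ^ p)))"
   proof -
    have o0: "?G (%sg. be\<^sup>2 / 2 * q * ov sg sg ^ p) = be\<^sup>2 / 2 * q"
     for q by (rule one, erule ov1)
    have o1: "?G (%sg. be\<^sup>2 / 2 * q * R1 sg sg ^ p) = be\<^sup>2 / 2 * q"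
     for q by (rule one, rule R1b(2), assumption+)
    have o2: "?G (%sg. be\<^sup>2 / 2 * q * R2 sg sg ^ p) = be\<^sup>2 / 2 * q" for q
     by (rule one, rule R2b(2), assumption+)
    show ?thesis unfolding vs k0 k1 k2 off o0 o1 o2 ..
   qed
   note eS = this
   show ?thesis unfolding eS eT eN by (simp add: algebra_simps add_divide_distrib)
  qed
  also have "sin s * cos s * (- (be\<^sup>2 / 2) * ?G (%sg. ?G (T sg))) = - (sin s * cos s * (be\<^sup>2 / 2)) * ?G (%sg. ?G (T sg))" by simp
  also have "... >= - (sin s * cos s * (be\<^sup>2 / 2)) * (2 * real n * real p * h1 y1 y2 s g + real n * h2 y1 y2 s g)"
  proof -
   have sc: "0 <= sin s * cos s"
    using s pi_gt_zero by (intro mult_nonneg_nonneg sin_ge_zero cos_ge_zero) linarith+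
   have "?G (%sg. ?G (T sg)) <= ?G (%sg. ?G (%ta. 2 * real n * real p * f1 sg ta + real n * f2 sg ta))"
   proof (rule gavg_mono[OF pW], rule gavg_mono[OF pW])
    fix sg ta assume st: "sg \<in> X" "ta \<in> X"
    show "T sg ta <= 2 * real n * real p * f1 sg ta + real n * f2 sg ta"
     unfolding T_def f1_def f2_def N_def
     by (rule power_two_block[OF p ov R1b(1)[OF st] R2b(1)[OF st]]) (use M in simp)
   qed
   also have "... = 2 * real n * real p * h1 y1 y2 s g + real n * h2 y1 y2 s g"
    unfolding h1_def h2_def gavg_add gavg_cmult ..
   finally have "(sin s * cos s * (be\<^sup>2 / 2)) * ?G (%sg. ?G (T sg)) <= (sin s * cos s * (be\<^sup>2 / 2)) * (2 * real n * real p * h1 y1 y2 s g + real n * h2 y1 y2 s g)"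
    using sc by (intro mult_left_mono) auto
   then show ?thesis by simp
  qed
  also have "- (sin s * cos s * (be\<^sup>2 / 2)) * (2 * real n * real p * h1 y1 y2 s g + real n * h2 y1 y2 s g) >= - (be\<^sup>2 / 2) * (2 * real n * real p * h1 y1 y2 s g + real n * h2 y1 y2 s g)"
  proof -
   have "0 <= h1 y1 y2 s g" "0 <= h2 y1 y2 s g"
    unfolding h1_def h2_def f1_def f2_def by (intro gavg_nonneg[OF pW]; simp)+
   then have h: "0 <= (be\<^sup>2 / 2) * (2 * real n * real p * h1 y1 y2 s g + real n * h2 y1 y2 s g)" by simp
   have "sin s * cos s <= 1"
    using abs_sin_le_one[of s] abs_cos_le_one[of s] by (metis abs_ge_self abs_mult abs_ge_zero mult_le_one order_trans)
   from mult_right_mono[OF this h] show ?thesis by simp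
  qed
  finally show ?thesis by simp
 qed
 have Dm: "D y1 y2 s \<in> borel_measurable (gau I)" for y1 y2 s unfolding D_def[abs_def] W_def by measurable
 have iD: "integrable (gau I) (D y1 y2 s)" for y1 y2 s
  unfolding D_def[abs_def] W_def power2_eq_square[of "gavg _ _ _"]
  by (rule expb_integrable[OF fI(1)], rule expb_sum, rule expb_cmult, rule expb_diff, rule expb_gavg[OF w expb_const], rule expb_mult; rule expb_gavg[OF w expb_const])
 let ?Y = "grid d nn"
 define C where "C = real (card ?Y)"
 have C: "C > 0" unfolding C_def using card_grid[OF nn, of d] nn by simp
 have I': "I = (I0 \<union> I1 \<union> I2 \<union> I4) \<union> Pair 3 ` spins.J M d" "I = (I0 \<union> I1 \<union> I2 \<union> I3) \<union> Pair 4 ` spins.J n d"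
  unfolding I_def I3_def I4_def J1_def J2_def by auto
 \<comment> \<open>For the perturbation of the first block everything else, the second perturbation
   at fixed y2 included, goes into the reference weights. None of it depends on y1, hence the
   placeholder \<open>undefined\<close>.\<close>
 have up1: "(\<Sum>y1\<in>?Y. \<integral>g. h1 y1 y2 s g \<partial>gau I) <= ep * C" for y2 s
  unfolding h1_def f1_def R1_def W_def C_def
 proof (rule universal_positivity_embedded[OF sp1 w _ I'(1) _ finite_grid up[OF sp1], where ab="A undefined y2 s"])
  show "(I0 \<union> I1 \<union> I2 \<union> I4) \<inter> Pair 3 ` spins.J M d = {}" by (auto simp: Idefs)
  show "A y1 y2 s (3, j) sg = spins.pert x1 r y1 j sg" for y1 j sg by (simp add: A_def a_def c_def)
  show "A y1 y2 s i sg = A undefined y2 s i sg" if "i \<in> I0 \<union> I1 \<union> I2 \<union> I4" for y1 i sg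
   using that by (auto simp: A_def a_def Idefs)
 qed (use fI ep in auto)
 have up2: "(\<Sum>y2\<in>?Y. \<integral>g. h2 y1 y2 s g \<partial>gau I) <= ep * C" for y1 s
  unfolding h2_def f2_def R2_def W_def C_def
 proof (rule universal_positivity_embedded[OF sp2 w _ I'(2) _ finite_grid up[OF sp2], where ab="A y1 undefined s"])
  show "(I0 \<union> I1 \<union> I2 \<union> I3) \<inter> Pair 4 ` spins.J n d = {}" by (auto simp: Idefs)
  show "A y1 y2 s (4, j) sg = spins.pert x2 r y2 j sg" for y2 j sg by (simp add: A_def a_def c_def)
  show "A y1 y2 s i sg = A y1 undefined s i sg" if "i \<in> I0 \<union> I1 \<union> I2 \<union> I3" for y2 i sg
   using that by (auto simp: A_def a_def Idefs)
 qed (use fI ep in auto)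
 define U where "U s = (\<Sum>y1\<in>?Y. \<Sum>y2\<in>?Y. u y1 y2 s)" for s
 define k where "k = (be\<^sup>2 / 2) * (2 * real n * real p + real n) * ep * C * C"
 have dU: "(U has_real_derivative (\<Sum>y1\<in>?Y. \<Sum>y2\<in>?Y. (LINT g|gau I. D y1 y2 s g))) (at s)" if "s \<in> {-1<..<2}" for s
  unfolding U_def[abs_def] by (intro DERIV_sum du that)
 have dlow: "- k <= (\<Sum>y1\<in>?Y. \<Sum>y2\<in>?Y. (LINT g|gau I. D y1 y2 s g))" if s: "0 <= s" "s <= pi / 2" for s
 proof -
  define H1 where "H1 y1 y2 = (LINT g|gau I. h1 y1 y2 s g)" for y1 y2
  define H2 where "H2 y1 y2 = (LINT g|gau I. h2 y1 y2 s g)" for y1 y2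
  have "- (be\<^sup>2 / 2) * (2 * real n * real p * H1 y1 y2 + real n * H2 y1 y2) <= (LINT g|gau I. D y1 y2 s g)" for y1 y2
  proof -
   have i1: "integrable (gau I) (h1 y1 y2 s)" "integrable (gau I) (h2 y1 y2 s)"
    unfolding h1_def[abs_def] h2_def[abs_def] by (rule ih)+
   have "- (be\<^sup>2 / 2) * (2 * real n * real p * H1 y1 y2 + real n * H2 y1 y2) = (LINT g|gau I. - (be\<^sup>2 / 2) * (2 * real n * real p * h1 y1 y2 s g + real n * h2 y1 y2 s g))"
    using i1 by (simp add: H1_def H2_def)
   also have "... <= (LINT g|gau I. D y1 y2 s g)"
    by (rule integral_mono[OF _ iD Dlow[OF s]]) (use i1 in simp)
   finally show ?thesis .
  qed
  then have "(\<Sum>y1\<in>?Y. \<Sum>y2\<in>?Y. - (be\<^sup>2 / 2) * (2 * real n * real p * H1 y1 y2 + real n * H2 y1 y2)) <= (\<Sum>y1\<in>?Y. \<Sum>y2\<in>?Y. (LINT g|gau I. D y1 y2 s g))"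
   by (intro sum_mono)
  moreover have "(\<Sum>y1\<in>?Y. \<Sum>y2\<in>?Y. - (be\<^sup>2 / 2) * (2 * real n * real p * H1 y1 y2 + real n * H2 y1 y2))
   = - (be\<^sup>2 / 2) * (2 * real n * real p * (\<Sum>y1\<in>?Y. \<Sum>y2\<in>?Y. H1 y1 y2) + real n * (\<Sum>y1\<in>?Y. \<Sum>y2\<in>?Y. H2 y1 y2))"
   by (simp only: sum_distrib_left[symmetric] sum.distrib)
  moreover have "(\<Sum>y1\<in>?Y. \<Sum>y2\<in>?Y. H1 y1 y2) <= ep * C * C"
  proof -
   have "(\<Sum>y1\<in>?Y. \<Sum>y2\<in>?Y. H1 y1 y2) = (\<Sum>y2\<in>?Y. \<Sum>y1\<in>?Y. H1 y1 y2)" by (rule sum.swap)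
   also have "... <= (\<Sum>y2\<in>?Y. ep * C)" unfolding H1_def by (intro sum_mono up1)
   finally show ?thesis by (simp add: C_def mult_ac)
  qed
  moreover have "(\<Sum>y1\<in>?Y. \<Sum>y2\<in>?Y. H2 y1 y2) <= ep * C * C"
  proof -
   have "(\<Sum>y1\<in>?Y. \<Sum>y2\<in>?Y. H2 y1 y2) <= (\<Sum>y1\<in>?Y. ep * C)" unfolding H2_def by (intro sum_mono up2)
   then show ?thesis by (simp add: C_def mult_ac)
  qed
  ultimately show ?thesis
  proof -
   assume le: "(\<Sum>y1\<in>?Y. \<Sum>y2\<in>?Y. H1 y1 y2) <= ep * C * C" "(\<Sum>y1\<in>?Y. \<Sum>y2\<in>?Y. H2 y1 y2) <= ep * C * C"
   have "2 * real n * real p * (\<Sum>y1\<in>?Y. \<Sum>y2\<in>?Y. H1 y1 y2) + real n * (\<Sum>y1\<in>?Y. \<Sum>y2\<in>?Y. H2 y1 y2)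
    <= 2 * real n * real p * (ep * C * C) + real n * (ep * C * C)"
    using le by (intro add_mono mult_left_mono) auto
   then have "(be\<^sup>2 / 2) * (2 * real n * real p * (\<Sum>y1\<in>?Y. \<Sum>y2\<in>?Y. H1 y1 y2) + real n * (\<Sum>y1\<in>?Y. \<Sum>y2\<in>?Y. H2 y1 y2))
    <= (be\<^sup>2 / 2) * (2 * real n * real p * (ep * C * C) + real n * (ep * C * C))"
    by (rule mult_left_mono) simp
   also have "... = k" by (simp add: k_def algebra_simps)
   finally have "- k <= - (be\<^sup>2 / 2) * (2 * real n * real p * (\<Sum>y1\<in>?Y. \<Sum>y2\<in>?Y. H1 y1 y2) + real n * (\<Sum>y1\<in>?Y. \<Sum>y2\<in>?Y. H2 y1 y2))" by simp
   then show ?thesis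
    using \<open>(\<Sum>y1\<in>?Y. \<Sum>y2\<in>?Y. - (be\<^sup>2 / 2) * (2 * real n * real p * H1 y1 y2 + real n * H2 y1 y2)) <= (\<Sum>y1\<in>?Y. \<Sum>y2\<in>?Y. (LINT g|gau I. D y1 y2 s g))\<close>
     \<open>(\<Sum>y1\<in>?Y. \<Sum>y2\<in>?Y. - (be\<^sup>2 / 2) * (2 * real n * real p * H1 y1 y2 + real n * H2 y1 y2))
   = - (be\<^sup>2 / 2) * (2 * real n * real p * (\<Sum>y1\<in>?Y. \<Sum>y2\<in>?Y. H1 y1 y2) + real n * (\<Sum>y1\<in>?Y. \<Sum>y2\<in>?Y. H2 y1 y2))\<close>
    by linarith
  qed
 qed
 have UU: "U 0 - 2 * k <= U (pi / 2)"
 proof -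
  have "(%s. U s + k * s) 0 <= (%s. U s + k * s) (pi / 2)"
  proof (rule DERIV_nonneg_imp_nondecreasing[where f="%s. U s + k * s" and a=0 and b="pi/2"])
   fix s :: real assume s: "0 <= s" "s <= pi / 2"
   then have s': "s <= pi / 2" "s \<in> {-1<..<2}" using pi_less_4 by auto
   show "\<exists>y. ((%s. U s + k * s) has_real_derivative y) (at s) \<and> 0 <= y"
    using DERIV_add[OF dU[OF s'(2)] DERIV_cmult[OF DERIV_ident, of k]] dlow[OF s(1) s'(1)]
    by (intro exI[of _ "(\<Sum>y1\<in>?Y. \<Sum>y2\<in>?Y. (LINT g|gau I. D y1 y2 s g)) + k * 1"]) simp
  qed simp
  \<comment> \<open>The path has length pi / 2 <= 2.\<close>
  moreover have "k * (pi / 2) <= k * 2" using ep C pi_less_4 unfolding k_def by (intro mult_left_mono) auto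
  ultimately show ?thesis by simp
 qed
 have ends: "free_energy be p M + free_energy be p n <= u y1 y2 0" "u y1 y2 (pi / 2) <= free_energy be p N + 8 * r\<^sup>2 * real d"
  if y: "y1 \<in> ?Y" "y2 \<in> ?Y" for y1 y2
 proof -
  \<comment> \<open>With both perturbations switched off, what remains at s = pi / 2 is the full
    system and at s = 0 the two independent blocks.\<close>
  define K where "K = I3 \<union> I4"
  have K: "K \<subseteq> I" by (auto simp: K_def I_def)
  have v: "(\<Sum>i\<in>K. (A y1 y2 s i sg)\<^sup>2) <= 8 * r\<^sup>2 * real d" if "sg \<in> X" for s sg
  proof -
   have "(\<Sum>i\<in>K. (A y1 y2 s i sg)\<^sup>2) = (\<Sum>i\<in>I3. (A y1 y2 s i sg)\<^sup>2) + (\<Sum>i\<in>I4. (A y1 y2 s i sg)\<^sup>2)"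
    unfolding K_def using fI by (intro sum.union_disjoint) (auto simp: Idefs)
   also have "(\<Sum>i\<in>I3. (A y1 y2 s i sg)\<^sup>2) = (\<Sum>j\<in>J1. (spins.pert x1 r y1 j sg)\<^sup>2)"
    unfolding I3_def by (subst sum.reindex[OF inj]) (simp add: A_def a_def c_def)
   also have "(\<Sum>i\<in>I4. (A y1 y2 s i sg)\<^sup>2) = (\<Sum>j\<in>J2. (spins.pert x2 r y2 j sg)\<^sup>2)"
    unfolding I4_def by (subst sum.reindex[OF inj]) (simp add: A_def a_def c_def)
   also have "(\<Sum>j\<in>J1. (spins.pert x1 r y1 j sg)\<^sup>2) + (\<Sum>j\<in>J2. (spins.pert x2 r y2 j sg)\<^sup>2) <= 4 * r\<^sup>2 * real d + 4 * r\<^sup>2 * real d"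
    unfolding J1_def J2_def
    by (intro add_mono block_pert_variance[OF sp1 y(1) nn that] block_pert_variance[OF sp2 y(2) nn that])
   finally show ?thesis by (simp add: mult_ac)
  qed
  have "(LINT g|gau I. lnZ X I (%i sg. if i \<in> K then 0 else A y1 y2 (pi/2) i sg) w g) = free_energy be p N"
   unfolding free_energy_def X_def[symmetric] w_def[symmetric]
  proof (rule lnZ_gau_reindex[OF fI(1) inj, of 0])
   show "Pair 0 ` idx p N \<subseteq> I" by (auto simp: I_def I0_def)
   show "(if (0, j) \<in> K then 0 else A y1 y2 (pi/2) (0, j) sg) = pfeat be p N j sg" for j sg
    by (auto simp: K_def Idefs A_def a_def c_def)
   show "(if i \<in> K then 0 else A y1 y2 (pi/2) i sg) = 0" if "i \<in> I - Pair 0 ` idx p N" for i sg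
    using that by (auto simp: K_def I_def Idefs A_def a_def c_def)
  qed
  then show "u y1 y2 (pi / 2) <= free_energy be p N + 8 * r\<^sup>2 * real d"
   using free_energy_perturbation(2)[where a="A y1 y2 (pi/2)", OF fI(1) w K v] unfolding u_def by simp
  have "(LINT g|gau I. lnZ X I (%i sg. if i \<in> K then 0 else A y1 y2 0 i sg) w g) = free_energy be p M + free_energy be p n"
  proof -
   define L1 where "L1 = lnZ (Defs.Sigma M) (idx p M) (pfeat be p M) (%_. 2 powr - real M)"
   define L2 where "L2 = lnZ (Defs.Sigma n) (idx p n) (pfeat be p n) (%_. 2 powr - real n)"
   have L1c: "L1 (\<lambda>j\<in>idx p M. g j) = L1 g" for g unfolding L1_def lnZ_def gw_def by simp
   have L2c: "L2 (\<lambda>j\<in>idx p n. g j) = L2 g" for g unfolding L2_def lnZ_def gw_def by simp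
   have eq: "lnZ X I (%i sg. if i \<in> K then 0 else A y1 y2 0 i sg) w g = L1 (\<lambda>j\<in>idx p M. g (1, j)) + L2 (\<lambda>j\<in>idx p n. g (2, j))" for g
   proof -
    have "(\<Sum>i\<in>I. (if i \<in> K then 0 else A y1 y2 0 i sg) * g i) = (\<Sum>is\<in>idx p M. pfeat be p M is sg * g (1, is)) + (\<Sum>is\<in>idx p n. pfeat be p n is (%i. sg (M + i)) * g (2, is))" for sg
    proof -
     have "(\<Sum>i\<in>I. (if i \<in> K then 0 else A y1 y2 0 i sg) * g i) = (\<Sum>i\<in>I1 \<union> I2. A y1 y2 0 i sg * g i)"
      by (rule sum.mono_neutral_cong_right[OF fI(1)]) (auto simp: I_def Idefs K_def A_def c_def)
     also have "... = (\<Sum>i\<in>I1. A y1 y2 0 i sg * g i) + (\<Sum>i\<in>I2. A y1 y2 0 i sg * g i)"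
      using fI by (intro sum.union_disjoint) (auto simp: Idefs)
     also have "(\<Sum>i\<in>I1. A y1 y2 0 i sg * g i) = (\<Sum>is\<in>idx p M. pfeat be p M is sg * g (1, is))"
      unfolding I1_def by (subst sum.reindex[OF inj]) (simp add: A_def a_def c_def)
     also have "(\<Sum>i\<in>I2. A y1 y2 0 i sg * g i) = (\<Sum>is\<in>idx p n. pfeat be p n is (%i. sg (M + i)) * g (2, is))"
      unfolding I2_def by (subst sum.reindex[OF inj]) (simp add: A_def a_def c_def)
     finally show ?thesis .
    qed
    then have "lnZ X I (%i sg. if i \<in> K then 0 else A y1 y2 0 i sg) w g = L1 (%j. g (1, j)) + L2 (%j. g (2, j))"
     unfolding L1_def L2_def lnZ_product[symmetric] by (simp add: lnZ_def gw_def X_def w_def N_def)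
    then show ?thesis unfolding L1c[of "%j. g (1, j)"] L2c[of "%j. g (2, j)"] .
   qed
   have e1: "(LINT g|gau I. L1 (\<lambda>j\<in>idx p M. g (1, j))) = free_energy be p M"
    unfolding free_energy_def L1_def
    by (rule gau_reindex[OF inj _ measurable_lnZ]) (auto simp: I_def I1_def)
   have e2: "(LINT g|gau I. L2 (\<lambda>j\<in>idx p n. g (2, j))) = free_energy be p n"
    unfolding free_energy_def L2_def
    by (rule gau_reindex[OF inj _ measurable_lnZ]) (auto simp: I_def I2_def)
   have lin: "expb I (%g. lnZ Z I b v g)" if "posw Z v" for Z :: "(nat => real) set" and b v
   proof (rule expb_lipschitz(1)[OF fI(1) measurable_lnZ, where c="%i. \<Sum>sg\<in>Z. \<bar>b i sg\<bar>"], rule lnZ_lipschitz[OF fI(1) _ that])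
    fix i sg assume "sg \<in> Z"
    then show "\<bar>b i sg\<bar> <= (\<Sum>sg\<in>Z. \<bar>b i sg\<bar>)" using that by (intro member_le_sum) (auto simp: posw_def)
   qed
   have lift: "lnZ Z J b v (\<lambda>j\<in>J. g (t, j)) = lnZ Z I (%i sg. if i \<in> Pair t ` J then b (snd i) sg else 0) v g"
    if "Pair t ` J \<subseteq> I" for Z :: "(nat => real) set" and J b v g t
   proof -
    have "(\<Sum>i\<in>I. (if i \<in> Pair t ` J then b (snd i) sg else 0) * g i) = (\<Sum>j\<in>J. b j sg * g (t, j))" for sg
    proof -
     have "(\<Sum>i\<in>I. (if i \<in> Pair t ` J then b (snd i) sg else 0) * g i) = (\<Sum>i\<in>Pair t ` J. b (snd i) sg * g i)"
      by (rule sum.mono_neutral_cong_right[OF fI(1) that]) auto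
     then show ?thesis by (simp add: sum.reindex[OF inj])
    qed
    then show ?thesis by (simp add: lnZ_def gw_def)
   qed
   have i1: "integrable (gau I) (%g. L1 (\<lambda>j\<in>idx p M. g (1, j)))"
   proof -
    have sub: "Pair 1 ` idx p M \<subseteq> I" by (auto simp: I_def I1_def)
    show ?thesis unfolding L1_def lift[OF sub] by (rule expb_integrable[OF fI(1) lin[OF posw_Sigma]])
   qed
   have i2: "integrable (gau I) (%g. L2 (\<lambda>j\<in>idx p n. g (2, j)))"
   proof -
    have sub: "Pair 2 ` idx p n \<subseteq> I" by (auto simp: I_def I2_def)
    show ?thesis unfolding L2_def lift[OF sub] by (rule expb_integrable[OF fI(1) lin[OF posw_Sigma]])
   qed
   show ?thesis unfolding eq Bochner_Integration.integral_add[OF i1 i2] e1 e2 ..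
  qed
  then show "free_energy be p M + free_energy be p n <= u y1 y2 0"
   using free_energy_perturbation(1)[where a="A y1 y2 0", OF fI(1) w K v] unfolding u_def by simp
 qed
 have "C * C * (free_energy be p M + free_energy be p n) = (\<Sum>y1\<in>?Y. \<Sum>y2\<in>?Y. free_energy be p M + free_energy be p n)"
  by (simp add: C_def)
 also have "... <= U 0" unfolding U_def by (intro sum_mono ends(1))
 also have "... <= U (pi / 2) + 2 * k" using UU by simp
 also have "U (pi / 2) <= (\<Sum>y1\<in>?Y. \<Sum>y2\<in>?Y. free_energy be p N + 8 * r\<^sup>2 * real d)"
  unfolding U_def by (intro sum_mono ends(2))
 also have "(\<Sum>y1\<in>?Y. \<Sum>y2\<in>?Y. free_energy be p N + 8 * r\<^sup>2 * real d) + 2 * k = C * C * (free_energy be p N + 8 * r\<^sup>2 * real d + be\<^sup>2 * (2 * real p + 1) * real n * ep)"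
  by (simp add: C_def[symmetric] k_def algebra_simps)
 finally have "C * C * (free_energy be p M + free_energy be p n) <= C * C * (free_energy be p N + 8 * r\<^sup>2 * real d + be\<^sup>2 * (2 * real p + 1) * real n * ep)" by simp
 then show ?thesis using C by (simp add: N_def)
qed

text \<open>The perturbation is chosen from e, p and be alone, so its cost K is uniform in M and
  n.\<close>

lemma free_energy_superadditive:
 assumes p: "p >= 2" and e: "e > 0"
 shows "\<exists>K. \<forall>M n. M > 0 --> n > 0 --> free_energy be p M + free_energy be p n <= free_energy be p (M + n) + K + e * real n"
proof -
 define q where "q = be\<^sup>2 * (2 * real p + 1) + 1"
 have q: "q > 0" unfolding q_def by (intro add_nonneg_pos) auto
 define ep where "ep = e / q"
 have ep: "ep > 0" using e q by (simp add: ep_def)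
 obtain d nn r where nn: "nn > (0::nat)" and up: "!!(X :: (nat => real) set) x m b w. spins X x m b ==> posw X w ==>
  (\<Sum>y\<in>grid d nn. \<integral>g. gavg X (gw (spins.J m d) (spins.pert x r y) w g)
   (%sg. gavg X (gw (spins.J m d) (spins.pert x r y) w g) (%ta. max 0 (- spins.R x m sg ta))) \<partial>gau (spins.J m d))
  <= ep * real (card (grid d nn))"
  using universal_positivity[OF ep, where 'x="nat => real"] by blast
 have "free_energy be p M + free_energy be p n <= free_energy be p (M + n) + 8 * r\<^sup>2 * real d + e * real n" if "M > 0" "n > 0" for M n
 proof -
  have "be\<^sup>2 * (2 * real p + 1) * real n * ep <= q * real n * ep"
   using ep by (intro mult_right_mono) (auto simp: q_def)
  also have "... = e * real n" using q by (simp add: ep_def)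
  finally have 1: "be\<^sup>2 * (2 * real p + 1) * real n * ep <= e * real n" .
  have "free_energy be p M + free_energy be p n <= free_energy be p (M + n) + 8 * r\<^sup>2 * real d + be\<^sup>2 * (2 * real p + 1) * real n * ep"
   by (rule guerra_toninelli[OF that p nn ep]) (rule up; assumption)
  with 1 show ?thesis by linarith
 qed
 then show ?thesis by blast
qed

section \<open>Convergence of the free energy\<close>

lemma free_energy_bounds:
 assumes N: "N > 0" and p: "p >= 1"
 shows "0 <= free_energy be p N" "free_energy be p N <= be\<^sup>2 / 2 * real N"
proof -
 have v: "(\<Sum>is\<in>idx p N. (pfeat be p N is sg)\<^sup>2) <= be\<^sup>2 / 2 * real N" if "sg \<in> Defs.Sigma N" for sg
 proof -
  have "(\<Sum>i<N. sg i * sg i) = real N" using Sigma_mult[OF that] by simp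
  then show ?thesis using sum_pfeat[OF N p, of be sg sg] N by (simp add: power2_eq_square)
 qed
 have z: "lnZ (Defs.Sigma N) (idx p N) (%i sg. if i \<in> idx p N then 0 else pfeat be p N i sg) (%_. 2 powr - real N) g = 0" for g
 proof -
  have "(\<Sum>i\<in>idx p N. (if i \<in> idx p N then 0 else pfeat be p N i sg) * g i) = 0" for sg by (rule sum.neutral) simp
  then show ?thesis using finite_Sigma_card[of N] by (simp add: lnZ_def gw_def powr_minus powr_realpow)
 qed
 show "0 <= free_energy be p N" "free_energy be p N <= be\<^sup>2 / 2 * real N"
  using free_energy_perturbation[where a="pfeat be p N", OF finite_idx posw_Sigma[of N] order_refl v] unfolding z free_energy_def by simp_all
qed

text \<open>Every late value is, up to e, an eventual lower bound of the sequence. The limit L of a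
  convergent subsequence is therefore at least every late value up to e, while a late term of the
  subsequence close to L bounds the sequence from below.\<close>

lemma almost_increasing_convergent:
 fixes b :: "nat => real"
 assumes bd: "!!N. b N \<in> {l..u}"
  and inc: "!!e. e > 0 ==> \<exists>n0. \<forall>n\<ge>n0. \<forall>\<^sub>F N in sequentially. b n - e <= b N"
 shows "\<exists>L. b \<longlonglongrightarrow> L"
proof -
 have "seq_compact {l..u}" by (simp add: compact_imp_seq_compact)
 then obtain L f where f: "strict_mono f" "(b \<circ> f) \<longlonglongrightarrow> L"
  using bd unfolding seq_compact_def by blast
 have "b \<longlonglongrightarrow> L"
 proof (rule LIMSEQ_I)
  fix r :: real assume r: "0 < r"
  define e where "e = r / 4"
  have e: "e > 0" using r by (simp add: e_def)
  obtain n0 where n0: "!!n. n >= n0 ==> \<forall>\<^sub>F N in sequentially. b n - e <= b N" using inc[OF e] by blast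
  have up: "b n <= L + e" if "n >= n0" for n
  proof -
   have "\<forall>\<^sub>F k in sequentially. b n - e <= (b \<circ> f) k"
    using eventually_subseq[OF f(1) n0[OF that]] by simp
   then have "b n - e <= L" by (rule tendsto_lowerbound[OF f(2)]) simp
   then show ?thesis by simp
  qed
  obtain k0 where k0: "!!k. k >= k0 ==> \<bar>b (f k) - L\<bar> < e"
   using LIMSEQ_D[OF f(2) e] by auto
  define n where "n = f (max k0 n0)"
  have "n >= n0" unfolding n_def using seq_suble[OF f(1), of "max k0 n0"] by linarith
  moreover have "b n >= L - e" using k0[of "max k0 n0"] unfolding n_def by (simp add: abs_if split: if_splits)
  ultimately have "\<forall>\<^sub>F N in sequentially. L - 2 * e <= b N"
   using eventually_mono[OF n0[of n]] by (smt (verit))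
  then obtain N1 where N1: "!!N. N >= N1 ==> L - 2 * e <= b N" by (auto simp: eventually_sequentially)
  show "\<exists>no. \<forall>N\<ge>no. norm (b N - L) < r"
  proof (intro exI[of _ "max N1 n0"] allI impI)
   fix N assume "N >= max N1 n0"
   then show "norm (b N - L) < r" using up[of N] N1[of N] e by (simp add: e_def abs_if)
  qed
 qed
 then show ?thesis ..
qed

text \<open>Fekete's argument with an error: adding k blocks of fixed size n costs k * (K + e3 * n),
  that is K / n + e3 per spin, which is small for large n. Here it matters that the linear error is
  proportional to the added block only.\<close>

lemma free_energy_limit:
 assumes p: "p >= 2"
 shows "\<exists>L. (%N. free_energy be p N / real N) \<longlonglongrightarrow> L"
proof (rule almost_increasing_convergent)
 define a where "a = free_energy be p"
 have p1: "p >= 1" using p by simp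
 have a0: "0 <= a N" if "N > 0" for N unfolding a_def by (rule free_energy_bounds(1)[OF that p1])
 fix N show "free_energy be p N / real N \<in> {0..be\<^sup>2 / 2}"
  using free_energy_bounds[OF _ p1, of N be] by (cases "N = 0") (auto simp: divide_le_eq)
next
 define a where "a = free_energy be p"
 have p1: "p >= 1" using p by simp
 have a0: "0 <= a N" if "N > 0" for N unfolding a_def by (rule free_energy_bounds(1)[OF that p1])
 fix e :: real assume e: "e > 0"
 define e3 where "e3 = e / 3"
 have e3: "e3 > 0" using e by (simp add: e3_def)
 obtain K where K: "!!M n. M > 0 ==> n > 0 ==> a M + a n <= a (M + n) + K + e3 * real n"
  using free_energy_superadditive[OF p e3, of be] unfolding a_def by blast
 obtain n0 :: nat where n0: "\<bar>K\<bar> / e3 < real n0" using reals_Archimedean2 by blast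
 show "\<exists>n0. \<forall>n\<ge>n0. \<forall>\<^sub>F N in sequentially. free_energy be p n / real n - e <= free_energy be p N / real N"
  unfolding a_def[symmetric]
 proof (intro exI[of _ "Suc n0"] allI impI)
  fix n assume n: "n >= Suc n0"
  have n_pos: "n > 0" using n by simp
  define q where "q = a n - K - e3 * real n"
  have it: "real k * q <= a (k * n + r)" if "r > 0" for k r
  proof (induction k)
   case 0 then show ?case using a0[OF that] by simp
  next
   case (Suc k)
   have "a (k * n + r) + a n <= a ((k * n + r) + n) + K + e3 * real n" by (rule K) (use that n_pos in auto)
   moreover have "Suc k * n + r = (k * n + r) + n" by simp
   ultimately show ?case using Suc by (simp add: q_def algebra_simps)
  qed
  have qn: "a n / real n - 2 * e3 <= q / real n"
  proof -
   have "\<bar>K\<bar> <= e3 * real n0" using n0 e3 by (simp add: field_simps)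
   also have "... <= e3 * real n" using n e3 by (intro mult_left_mono) auto
   finally have "K <= e3 * real n" by linarith
   then have "(a n - 2 * e3 * real n) / real n <= q / real n" by (intro divide_right_mono) (auto simp: q_def)
   then show ?thesis using n_pos by (simp add: diff_divide_distrib)
  qed
  obtain N0 :: nat where N0: "\<bar>q\<bar> / e3 < real N0" using reals_Archimedean2 by blast
  show "\<forall>\<^sub>F N in sequentially. a n / real n - e <= a N / real N"
  proof (rule eventually_sequentiallyI[of "Suc N0"])
   fix N assume N: "Suc N0 <= N"
   have N_pos: "N > 0" using N by simp
   have "q / real n - \<bar>q\<bar> / real N <= a N / real N"
   proof (cases "q >= 0")
    case True
    \<comment> \<open>Dividing N - 1 leaves a remainder r between 1 and n, as superadditivity is
      available for nonempty systems only.\<close>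
    define k where "k = (N - 1) div n"
    define r where "r = (N - 1) mod n + 1"
    have Nkr: "N = k * n + r" using N_pos div_mult_mod_eq[of "N - 1" n] unfolding k_def r_def by linarith
    have "real N <= real (k * n + n)" unfolding of_nat_le_iff using Nkr mod_less_divisor[OF n_pos, of "N - 1"] unfolding r_def by linarith
    then have "real N / real n - 1 <= real k" using n_pos by (simp add: field_simps)
    then have "(real N / real n - 1) * q <= real k * q" using True by (intro mult_right_mono)
    also have "... <= a N" unfolding Nkr by (rule it) (simp add: r_def)
    finally have "((real N / real n - 1) * q) / real N <= a N / real N" by (intro divide_right_mono) auto
    moreover have "((real N / real n - 1) * q) / real N = q / real n - \<bar>q\<bar> / real N"
     using N_pos True by (simp add: field_simps)
    ultimately show ?thesis by simp
   next
    case False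
    have "q / real n <= 0" using False n_pos by (simp add: divide_nonpos_pos)
    moreover have "0 <= a N / real N" using a0[OF N_pos] by simp
    moreover have "0 <= \<bar>q\<bar> / real N" by simp
    ultimately show ?thesis by linarith
   qed
   moreover have "\<bar>q\<bar> / real N <= e3"
   proof -
    have "\<bar>q\<bar> <= e3 * real N0" using N0 e3 by (simp add: field_simps)
    also have "... <= e3 * real N" using N e3 by (intro mult_left_mono) auto
    finally show ?thesis using N_pos by (simp add: divide_le_eq)
   qed
   ultimately show "a n / real n - e <= a N / real N" using qn by (simp add: e3_def)
  qed
 qed
qed

lemma pfeat_lipschitz:
 assumes w: "posw (Defs.Sigma N) w" and i: "is \<in> idx p N"
 shows "\<bar>lnZ (Defs.Sigma N) (idx p N) (pfeat be p N) w (g(is:=x)) - lnZ (Defs.Sigma N) (idx p N) (pfeat be p N) w (g(is:=y))\<bar>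
  <= (\<bar>be\<bar> / sqrt 2 * real N powr (- (real p - 1) / 2)) * \<bar>x - y\<bar>"
proof -
 have "\<bar>pfeat be p N is sg\<bar> = \<bar>be\<bar> / sqrt 2 * real N powr (- (real p - 1) / 2)" if "sg \<in> Defs.Sigma N" for sg
 proof -
  have "\<bar>\<Prod>j<p. sg (is ! j)\<bar> = 1" unfolding abs_prod by (rule prod.neutral) (use Sigma_abs[OF that] idx_nth[OF i] in auto)
  then show ?thesis by (simp add: pfeat_def abs_mult)
 qed
 then show ?thesis by (intro lnZ_lipschitz[where c="%_. \<bar>be\<bar> / sqrt 2 * real N powr (- (real p - 1) / 2)", OF finite_idx i w]) simp
qed

lemma card_idx: "card (idx p N) = N ^ p"
proof -
 have "idx p N = {xs. set xs \<subseteq> {..<N} \<and> length xs = p}" by (auto simp: idx_def)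
 then show ?thesis by (simp add: card_lists_length_eq)
qed

text \<open>There are N^p coordinates, each with squared bound be^2 / 2 * N / N^p. The variance
  proxy is linear in N, so deviations of order N are exponentially unlikely.\<close>

lemma pfeat_lipschitz_sum:
 assumes N: "N > 0" and p: "p >= 1"
 shows "(\<Sum>is\<in>idx p N. (\<bar>be\<bar> / sqrt 2 * real N powr (- (real p - 1) / 2))\<^sup>2) = be\<^sup>2 / 2 * real N"
proof -
 have "(real N powr (- (real p - 1) / 2))\<^sup>2 = real N powr (1 - real p)"
 proof -
  have "- (real p - 1) / 2 + - (real p - 1) / 2 = 1 - real p" by simp
  then show ?thesis by (simp only: power2_eq_square powr_add[symmetric])
 qed
 also have "... = real N / real N ^ p" using N by (simp add: powr_diff powr_realpow)
 finally have e: "(real N powr (- (real p - 1) / 2))\<^sup>2 = real N / real N ^ p" .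
 show ?thesis unfolding power_mult_distrib e using N by (simp add: card_idx power_divide)
qed

lemma free_energy_tails:
 assumes N: "N > 0" and p: "p >= 1" and be: "be > 0" and r: "r >= 0"
 defines "L == lnZ (Defs.Sigma N) (idx p N) (pfeat be p N) (%_. 2 powr - real N)"
 shows "measure (gau (idx p N)) {g \<in> space (gau (idx p N)). L g >= free_energy be p N + r * real N} <= exp (- (r\<^sup>2 / (2 * be\<^sup>2)) * real N)"
  and "measure (gau (idx p N)) {g \<in> space (gau (idx p N)). L g <= free_energy be p N - r * real N} <= exp (- (r\<^sup>2 / (2 * be\<^sup>2)) * real N)"
proof -
 define V where "V = be\<^sup>2 / 2 * real N"
 have V: "V > 0" using be N by (simp add: V_def)
 have Vs: "(\<Sum>is\<in>idx p N. (\<bar>be\<bar> / sqrt 2 * real N powr (- (real p - 1) / 2))\<^sup>2) <= V"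
  using pfeat_lipschitz_sum[OF N p, of be] by (simp add: V_def)
 have e: "- (r * real N)\<^sup>2 / (4 * V) = - (r\<^sup>2 / (2 * be\<^sup>2)) * real N"
  using N be by (simp add: V_def power2_eq_square field_simps)
 have Lm: "L \<in> borel_measurable (gau (idx p N))" unfolding L_def by measurable
 have rN: "r * real N >= 0" using r by simp
 have m: "free_energy be p N = (LINT g|gau (idx p N). L g)" by (simp add: free_energy_def L_def)
 show "measure (gau (idx p N)) {g \<in> space (gau (idx p N)). L g >= free_energy be p N + r * real N} <= exp (- (r\<^sup>2 / (2 * be\<^sup>2)) * real N)"
  unfolding m e[symmetric]
  by (rule gau_upper_tail[OF finite_idx Lm _ Vs V rN]) (unfold L_def, rule pfeat_lipschitz[OF posw_Sigma])
 show "measure (gau (idx p N)) {g \<in> space (gau (idx p N)). L g <= free_energy be p N - r * real N} <= exp (- (r\<^sup>2 / (2 * be\<^sup>2)) * real N)"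
  unfolding m e[symmetric]
  by (rule gau_lower_tail[OF finite_idx Lm _ Vs V rN]) (unfold L_def, rule pfeat_lipschitz[OF posw_Sigma])
qed

lemma disorder_eq: "disorder p = gau {is. length is = p}"
 by (simp add: disorder_def gau_def stdn_def)

lemma F_N_eq_lnZ: "F_N p N be g = lnZ (Defs.Sigma N) (idx p N) (pfeat be p N) (%_. 2 powr - real N) g / real N"
proof -
 have "be / sqrt 2 * H p N g sg = (\<Sum>is\<in>idx p N. pfeat be p N is sg * g is)" for sg
  unfolding H_def pfeat_def sum_distrib_left by (rule sum.cong[OF refl]) simp
 then show ?thesis by (simp add: F_N_def lnZ_def gw_def)
qed

text \<open>\<open>F\<close> is a definite description, so both existence and uniqueness of the
  almost sure limit have to be shown. Exponential Gaussian tails and Borel-Cantelli put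
  \<open>F_N\<close> eventually within e of its mean, and two almost sure limits coincide because a
  probability space is not a null set.\<close>

lemma F_limit:
 assumes p: "p >= 2" and be: "be > 0"
 shows "(%N. free_energy be p N / real N) \<longlonglongrightarrow> F p be"
proof -
 have p1: "p >= 1" using p by simp
 obtain L where L: "(%N. free_energy be p N / real N) \<longlonglongrightarrow> L" using free_energy_limit[OF p] by blast
 define b where "b N = free_energy be p N / real N" for N
 interpret P: prob_space "disorder p" unfolding disorder_eq by (rule prob_space_gau)
 have sub: "idx p N \<subseteq> {is. length is = p}" for N by (auto simp: idx_def)
 have proj: "distr (disorder p) (gau (idx p N)) (%g. restrict g (idx p N)) = gau (idx p N)" for N
 proof -
  interpret Q: product_prob_space "%_. stdn" "{is :: nat list. length is = p}" by standard
  show ?thesis unfolding disorder_eq gau_def by (rule Q.distr_PiM_restrict_finite[OF finite_idx sub])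
 qed
 have pm: "(%g. restrict g (idx p N)) \<in> measurable (disorder p) (gau (idx p N))" for N
  unfolding disorder_eq gau_def by (rule measurable_restrict_subset[OF sub])
 define La where "La N = lnZ (Defs.Sigma N) (idx p N) (pfeat be p N) (%_. 2 powr - real N)" for N
 have Lar: "La N (restrict g (idx p N)) = La N g" for N g unfolding La_def lnZ_def gw_def by simp
 have Lam [measurable]: "La N \<in> borel_measurable (gau (idx p N))" for N unfolding La_def by measurable
 have FNm: "F_N p N be \<in> borel_measurable (disorder p)" for N
 proof -
  have "(%g. La N (restrict g (idx p N)) / real N) \<in> borel_measurable (disorder p)"
   using measurable_compose[OF pm Lam] by measurable
  then have "(%g. La N g / real N) \<in> borel_measurable (disorder p)" by (simp only: Lar)
  then show ?thesis by (simp only: F_N_eq_lnZ[abs_def] La_def)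
 qed
 have ev: "AE g in disorder p. eventually (%N. \<bar>F_N p N be g - b N\<bar> < e) sequentially" if e: "e > 0" for e
 proof -
  define A where "A N = {g \<in> space (disorder p). \<bar>F_N p N be g - b N\<bar> >= e}" for N
  have Am: "A N \<in> sets (disorder p)" for N unfolding A_def using FNm by measurable
  define rh where "rh = exp (- (e\<^sup>2 / (2 * be\<^sup>2)))"
  have rh: "0 < rh" "rh < 1" using e be by (auto simp: rh_def)
  have bound: "measure (disorder p) (A N) <= 2 * rh ^ N" for N
  proof (cases "N = 0")
   case True
   have "measure (disorder p) (A N) <= 1" by (rule P.prob_le_1)
   then show ?thesis unfolding True by (simp del: P.prob_le_1)
  next
   case False
   then have N: "N > 0" by simp
   let ?U = "{g \<in> space (gau (idx p N)). La N g >= free_energy be p N + e * real N}"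
   let ?V = "{g \<in> space (gau (idx p N)). La N g <= free_energy be p N - e * real N}"
   have UV: "?U \<in> sets (gau (idx p N))" "?V \<in> sets (gau (idx p N))" by measurable
   have "A N \<subseteq> (%g. restrict g (idx p N)) -` (?U \<union> ?V) \<inter> space (disorder p)"
   proof
    fix g assume "g \<in> A N"
    then have g: "g \<in> space (disorder p)" "e <= \<bar>La N g / real N - free_energy be p N / real N\<bar>"
     by (auto simp: A_def b_def F_N_eq_lnZ La_def)
    then have "e * real N <= \<bar>La N g - free_energy be p N\<bar>"
     using N by (simp add: diff_divide_distrib[symmetric] le_divide_eq)
    then show "g \<in> (%g. restrict g (idx p N)) -` (?U \<union> ?V) \<inter> space (disorder p)"
     using g(1) measurable_space[OF pm g(1)] by (auto simp: Lar abs_if split: if_splits)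
   qed
   then have "measure (disorder p) (A N) <= measure (disorder p) ((%g. restrict g (idx p N)) -` (?U \<union> ?V) \<inter> space (disorder p))"
    using UV by (intro P.finite_measure_mono measurable_sets[OF pm]) auto
   also have "... = measure (gau (idx p N)) (?U \<union> ?V)"
    using UV by (subst (2) proj[symmetric], subst measure_distr[OF pm]) auto
   also have "... <= measure (gau (idx p N)) ?U + measure (gau (idx p N)) ?V"
    using UV by (rule measure_Un_le)
   also have "... <= rh ^ N + rh ^ N"
   proof -
    have "exp (- (e\<^sup>2 / (2 * be\<^sup>2)) * real N) = rh ^ N" unfolding rh_def by (simp add: exp_of_nat_mult[symmetric] mult.commute)
    then show ?thesis using free_energy_tails[OF N p1 be less_imp_le[OF e]] unfolding La_def by (intro add_mono) simp_all
   qed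
   finally show ?thesis by simp
  qed
  have "summable (%N. measure (disorder p) (A N))"
  proof (rule summable_comparison_test[OF exI[of _ 0]])
   show "\<forall>n\<ge>0. norm (measure (disorder p) (A n)) <= 2 * rh ^ n" using bound by simp
   show "summable (%n. 2 * rh ^ n)" using rh by (intro summable_mult summable_geometric) simp
  qed
  then have "AE g in disorder p. eventually (%N. g \<in> space (disorder p) - A N) sequentially"
   by (intro borel_cantelli_AE1 Am) (simp_all add: P.emeasure_finite less_top[symmetric])
  then show ?thesis
   by (rule AE_mp, intro AE_I2 impI, elim eventually_mono) (auto simp: A_def not_le)
 qed
 \<comment> \<open>Countably many radii 1 / (k + 1), so that the exceptional null sets can be
   united.\<close>
 have "AE g in disorder p. \<forall>k. eventually (%N. \<bar>F_N p N be g - b N\<bar> < 1 / real (Suc k)) sequentially"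
  unfolding AE_all_countable by (intro allI ev) simp
 then have conv: "AE g in disorder p. (%N. F_N p N be g) \<longlonglongrightarrow> L"
 proof (rule AE_mp, intro AE_I2 impI)
  fix g assume k: "\<forall>k. eventually (%N. \<bar>F_N p N be g - b N\<bar> < 1 / real (Suc k)) sequentially"
  have "(%N. F_N p N be g - b N) \<longlonglongrightarrow> 0"
  proof (rule tendstoI)
   fix e :: real assume "0 < e"
   then obtain j where j: "inverse (real (Suc j)) < e" using reals_Archimedean by blast
   show "\<forall>\<^sub>F N in sequentially. dist (F_N p N be g - b N) 0 < e"
    using k[rule_format, of j] by (rule eventually_mono) (use j in \<open>simp add: inverse_eq_divide\<close>)
  qed
  from tendsto_add[OF this L[folded b_def]] show "(%N. F_N p N be g) \<longlonglongrightarrow> L" by simp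
 qed
 have "F p be = L" unfolding F_def
 proof (rule the_equality)
  show "AE g in disorder p. (%N. F_N p N be g) \<longlonglongrightarrow> L" by (rule conv)
 next
  fix L' assume "AE g in disorder p. (%N. F_N p N be g) \<longlonglongrightarrow> L'"
  with conv have "AE g in disorder p. L' = L"
   by eventually_elim (rule LIMSEQ_unique)
  then show "L' = L" by simp
 qed
 with L show ?thesis by simp
qed

section \<open>The planted model: likelihood, posterior, entropy and Hellinger affinity\<close>

text \<open>A signal is a configuration with feature vector \<open>ph\<close>. All signals have the
  same squared norm V, so their likelihoods share the normalising factor exp (-b^2 * V / 2).\<close>

locale planted =
 fixes X :: "'x set" and I :: "'i set" and ph :: "'i => 'x => real" and V :: real
 assumes X: "finite X" "X ~= {}" and I: "finite I"
  and norm: "sg \<in> X ==> (\<Sum>i\<in>I. (ph i sg)\<^sup>2) = V"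
begin

definition K :: "'x => 'x => real" where
 "K sg ta = (\<Sum>i\<in>I. ph i sg * ph i ta)"

definition avg :: "('x => real) => real" where
 "avg f = (\<Sum>sg\<in>X. f sg) / real (card X)"

definition lik :: "real => 'x => ('i => real) => real" where
 "lik b sg g = exp (b * (\<Sum>i\<in>I. ph i sg * g i) - b\<^sup>2 * V / 2)"

definition L :: "real => ('i => real) => real" where
 "L b g = avg (%sg. lik b sg g)"

text \<open>The observation when the signal is \<open>sg\<close> and the noise is \<open>g\<close>.\<close>
definition obs :: "real => 'x => ('i => real) => 'i => real" where
 "obs b sg g = (\<lambda>i\<in>I. g i + b * ph i sg)"

definition post :: "real => ('i => real) => ('x => real) => real" where
 "post b g f = gavg X (%sg. lik b sg g) f"

lemma card_pos: "real (card X) > 0"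
 using X by (simp add: card_gt_0_iff)

lemma avg_add: "avg (%sg. f sg + h sg) = avg f + avg h"
 by (simp add: avg_def sum.distrib add_divide_distrib)

lemma avg_cmult: "avg (%sg. c * f sg) = c * avg f"
 by (simp add: avg_def sum_distrib_left)

lemma avg_const: "avg (%_. c) = c"
 using card_pos by (simp add: avg_def)

lemma avg_mono: "(!!sg. sg \<in> X ==> f sg <= h sg) ==> avg f <= avg h"
 unfolding avg_def by (intro divide_right_mono sum_mono) auto

lemma avg_nonneg: "(!!sg. sg \<in> X ==> 0 <= f sg) ==> 0 <= avg f"
 unfolding avg_def by (intro divide_nonneg_nonneg sum_nonneg) auto

lemma avg_cong: "(!!sg. sg \<in> X ==> f sg = h sg) ==> avg f = avg h"
 by (simp add: avg_def)

lemma avg_integral: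
 "(!!sg. sg \<in> X ==> integrable M (%g. f sg g)) ==> (LINT g|M. avg (%sg. f sg g)) = avg (%sg. \<integral>g. f sg g \<partial>M)"
 unfolding avg_def by (simp add: Bochner_Integration.integral_sum)

lemma lik_pos: "lik b sg g > 0"
 by (simp add: lik_def)

lemma posw_lik: "posw X (%sg. lik b sg g)"
 using X by (simp add: posw_def lik_pos)

lemma L_pos: "L b g > 0"
 unfolding L_def avg_def using card_pos posw_sum[OF posw_lik] by simp

lemma L_post: "L b g * post b g f = avg (%sg. lik b sg g * f sg)"
 unfolding L_def avg_def post_def gavg_def using posw_sum[OF posw_lik, of b g] by simp

lemma K_sym: "K sg ta = K ta sg"
 by (simp add: K_def mult.commute)

lemma lik_obs: "lik b ta (obs b' sg g) = lik b ta g * exp (b * b' * K ta sg)"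
proof -
 have "(\<Sum>i\<in>I. ph i ta * obs b' sg g i) = (\<Sum>i\<in>I. ph i ta * g i) + b' * K ta sg"
  by (simp add: obs_def K_def algebra_simps sum.distrib sum_distrib_left)
 then show ?thesis by (simp add: lik_def exp_add[symmetric] algebra_simps)
qed

lemma lik_eq_gw: "lik b sg g = exp (- (b\<^sup>2 * V / 2)) * gw I (%i sg. b * ph i sg) (%_. 1) g sg"
 by (simp add: lik_def gw_def sum_distrib_left exp_add[symmetric] mult.assoc)

lemma post_eq_gavg: "post b g f = gavg X (gw I (%i sg. b * ph i sg) w g) f" if "!!sg. w sg = c" "c > 0"
proof -
 have "gw I (%i sg. b * ph i sg) w g sg = c * gw I (%i sg. b * ph i sg) (%_. 1) g sg" for sg
  using that by (simp add: gw_def)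
 then show ?thesis unfolding post_def gavg_def lik_eq_gw using that
  by (simp add: mult.assoc sum_distrib_left[symmetric])
qed

lemma ln_L: "ln (L b g) = lnZ X I (%i sg. b * ph i sg) (%_. 1 / real (card X)) g + - (b\<^sup>2 * V / 2)"
proof -
 have p: "posw X (%_. 1 / real (card X))" using X card_pos by (simp add: posw_def)
 have 1: "L b g = exp (- (b\<^sup>2 * V / 2)) * (\<Sum>sg\<in>X. gw I (%i sg. b * ph i sg) (%_. 1 / real (card X)) g sg)"
  unfolding L_def avg_def lik_eq_gw by (simp add: gw_def sum_distrib_left sum_divide_distrib)
 show ?thesis unfolding 1 lnZ_def using posw_sum[OF posw_gw[OF p], of I "%i sg. b * ph i sg" g] by (simp add: ln_mult_pos)
qed

lemma measurable_lik [measurable]: "lik b sg \<in> borel_measurable (gau I)"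
 unfolding lik_def[abs_def] by measurable

lemma measurable_L [measurable]: "L b \<in> borel_measurable (gau I)"
 unfolding L_def[abs_def] avg_def by measurable

lemma measurable_obs [measurable]: "obs b sg \<in> measurable (gau I) (gau I)"
 unfolding obs_def[abs_def] by measurable

lemma measurable_post [measurable]:
 assumes "!!sg. sg \<in> X ==> (%g. f g sg) \<in> borel_measurable (gau I)"
 shows "(%g. post b g (f g)) \<in> borel_measurable (gau I)"
 unfolding post_def gavg_def using assms by measurable

lemma expb_lik: "expb I (lik b sg)"
proof -
 have "lik b sg = (%g. exp (- (b\<^sup>2 * V / 2)) * exp (\<Sum>i\<in>I. (b * ph i sg) * g i))"
  by (simp add: fun_eq_iff lik_def exp_add[symmetric] sum_distrib_left mult.assoc)
 then show ?thesis using expb_cmult[OF expb_exp_linear[OF I]] by simp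
qed

lemma expb_avg: "(!!sg. sg \<in> X ==> expb I (%g. f sg g)) ==> expb I (%g. avg (%sg. f sg g))"
 unfolding avg_def divide_inverse by (rule expb_mult[OF expb_sum expb_const])

lemma expb_L: "expb I (L b)"
 unfolding L_def[abs_def] by (rule expb_avg, rule expb_lik)

lemma expb_lnL: "expb I (%g. ln (L b g))"
proof -
 have p: "posw X (%_. 1 / real (card X))" using X card_pos by (simp add: posw_def)
 have "expb I (%g. lnZ X I (%i sg. b * ph i sg) (%_. 1 / real (card X)) g)"
 proof (rule expb_lipschitz(1)[OF I measurable_lnZ, where c="%i. \<Sum>sg\<in>X. \<bar>b * ph i sg\<bar>"], rule lnZ_lipschitz[OF I _ p])
  fix i sg assume "sg \<in> X"
  then show "\<bar>b * ph i sg\<bar> <= (\<Sum>sg\<in>X. \<bar>b * ph i sg\<bar>)" using X by (intro member_le_sum) auto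
 qed
 then show ?thesis unfolding ln_L by (intro expb_add expb_const)
qed

text \<open>Reweighting the noise by the likelihood of sg is the same as observing sg in noise, by
  \<open>gau_shift_integral\<close>; every planted expectation is reduced to pure noise in this
  way.\<close>

lemma lik_integral:
 assumes h [measurable]: "h \<in> borel_measurable (gau I)" and s: "sg \<in> X"
 shows "(LINT g|gau I. lik b sg g * h g) = (LINT g|gau I. h (obs b sg g))"
proof -
 have "lik b sg g = exp (\<Sum>i\<in>I. (b * ph i sg) * g i - (b * ph i sg)\<^sup>2 / 2)" for g
 proof -
  have "(\<Sum>i\<in>I. (b * ph i sg) * g i - (b * ph i sg)\<^sup>2 / 2) = b * (\<Sum>i\<in>I. ph i sg * g i) - b\<^sup>2 * (\<Sum>i\<in>I. (ph i sg)\<^sup>2) / 2"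
   by (simp add: sum_subtractf sum_distrib_left power_mult_distrib sum_divide_distrib mult.assoc)
  then show ?thesis by (simp add: lik_def norm[OF s])
 qed
 then show ?thesis
  unfolding obs_def by (subst gau_shift_integral[OF I h, of "%i. b * ph i sg"]) simp
qed

lemma lik_expectation: "sg \<in> X ==> (LINT g|gau I. lik b sg g) = 1"
proof -
 interpret P: prob_space "gau I" by (rule prob_space_gau)
 assume "sg \<in> X"
 then show ?thesis using lik_integral[of "%_. 1" sg b] by (simp add: P.prob_space)
qed

lemma integrable_lik: "integrable (gau I) (lik b sg)"
 by (rule expb_integrable[OF I expb_lik])

lemma L_expectation: "(LINT g|gau I. L b g) = 1"
 unfolding L_def by (subst avg_integral) (auto intro: integrable_lik simp: lik_expectation avg_const cong: avg_cong)

lemma lik_product: assumes "sg \<in> X" "ta \<in> X"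
 shows "(LINT g|gau I. lik b sg g * lik b ta g) = exp (b\<^sup>2 * K sg ta)"
 by (subst lik_integral[OF measurable_lik assms(1)])
  (simp add: lik_obs lik_expectation[OF assms(2)] K_sym[of sg] power2_eq_square)

text \<open>L times the posterior is the joint density of signal and observation relative to pure
  noise. Taking h to be itself a posterior average expresses that, under the planted law, the signal
  may be exchanged with a posterior sample.\<close>

lemma planted_expectation:
 assumes h: "!!sg. sg \<in> X ==> h sg \<in> borel_measurable (gau I)" and i: "!!sg. sg \<in> X ==> integrable (gau I) (%g. lik b sg g * h sg g)"
 shows "(LINT g|gau I. L b g * post b g (%sg. h sg g)) = avg (%sg. \<integral>g. h sg (obs b sg g) \<partial>gau I)"
proof -
 have "(LINT g|gau I. L b g * post b g (%sg. h sg g)) = avg (%sg. \<integral>g. lik b sg g * h sg g \<partial>gau I)"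
  unfolding L_post by (rule avg_integral[OF i])
 also have "... = avg (%sg. \<integral>g. h sg (obs b sg g) \<partial>gau I)"
  by (rule avg_cong) (simp add: lik_integral[OF h])
 finally show ?thesis .
qed

lemma post_const: "post b g (%_. c) = c"
 unfolding post_def by (rule gavg_const[OF posw_lik])

lemma planted_expectation_L:
 assumes h: "h \<in> borel_measurable (gau I)" and e: "expb I h"
 shows "(LINT g|gau I. L b g * h g) = avg (%sg. \<integral>g. h (obs b sg g) \<partial>gau I)"
 using planted_expectation[of "%_. h" b] h expb_integrable[OF I expb_mult[OF expb_lik e]] by (simp add: post_const)

text \<open>Since the features have constant square sum V, the variance term contributes V * Ph',
  which cancels against the derivative of the normalisation -b^2 * V / 2. What is left is Ph'' - Ph'
  times the mean Gram entry K of two posterior samples.\<close>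

lemma interpolation_L:
 fixes Ph Ph' Ph'' :: "real => real"
 assumes dPh: "!!x. (Ph has_real_derivative Ph' x) (at x)" "!!x. (Ph' has_real_derivative Ph'' x) (at x)"
  and cPh: "continuous_on UNIV Ph''"
  and bPh: "!!x. \<bar>Ph x\<bar> <= C * exp (k * \<bar>x\<bar>)" "!!x. \<bar>Ph' x\<bar> <= C * exp (k * \<bar>x\<bar>)" "!!x. \<bar>Ph'' x\<bar> <= C * exp (k * \<bar>x\<bar>)"
  and k: "k >= 0"
 shows "((%b. \<integral>g. Ph (ln (L b g)) \<partial>gau I) has_real_derivative
  b * (LINT g|gau I. (Ph'' (ln (L b g)) - Ph' (ln (L b g))) * post b g (%sg. post b g (K sg)))) (at b)"
proof -
 define w where "w = (%_::'x. 1 / real (card X))"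
 have w: "posw X w" using X card_pos by (simp add: posw_def w_def)
 \<comment> \<open>A crude common bound on the coefficients s, 1, s^2 * V / 2 and s * V for s within
   distance 1 of b.\<close>
 define B where "B = (\<bar>b\<bar> + 1)\<^sup>2 * (\<bar>V\<bar> + 1) + \<bar>b\<bar> + 1"
 have bt: "b \<in> {b - 1<..<b + 1}" by simp
 have b1: "1 <= (\<bar>b\<bar> + 1)\<^sup>2" by (simp add: power2_eq_square algebra_simps)
 have sb: "\<bar>s\<bar> <= \<bar>b\<bar> + 1" if "s \<in> {b - 1<..<b + 1}" for s using that by auto
 have B1: "\<bar>b\<bar> + 1 <= B" "1 <= B" unfolding B_def by auto
 have B2: "s\<^sup>2 * \<bar>V\<bar> / 2 <= B" "\<bar>s * V\<bar> <= B" if s: "s \<in> {b - 1<..<b + 1}" for s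
 proof -
  have "s\<^sup>2 <= (\<bar>b\<bar> + 1)\<^sup>2" using sb[OF s] by (metis abs_ge_zero power2_abs power_mono)
  then have "s\<^sup>2 * \<bar>V\<bar> <= (\<bar>b\<bar> + 1)\<^sup>2 * (\<bar>V\<bar> + 1)" by (intro mult_mono) auto
  moreover have "0 <= s\<^sup>2 * \<bar>V\<bar>" by simp
  ultimately show "s\<^sup>2 * \<bar>V\<bar> / 2 <= B" unfolding B_def by linarith
  have "\<bar>s * V\<bar> <= (\<bar>b\<bar> + 1) * (\<bar>V\<bar> + 1)" unfolding abs_mult using sb[OF s] by (intro mult_mono) auto
  also have "... <= (\<bar>b\<bar> + 1)\<^sup>2 * (\<bar>V\<bar> + 1)"
   by (intro mult_right_mono) (auto simp: power2_eq_square mult_le_cancel_left1)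
  finally show "\<bar>s * V\<bar> <= B" unfolding B_def by linarith
 qed
 define W where "W = gw I (%i sg. b * ph i sg) w"
 have pW: "posw X (W g)" for g unfolding W_def by (rule posw_gw[OF w])
 have pp: "post b g f = gavg X (W g) f" for g f
  unfolding W_def by (rule post_eq_gavg[where c="1 / real (card X)"]) (use card_pos in \<open>auto simp: w_def\<close>)
 define u where "u g = ln (L b g)" for g
 have u: "u g = lnZ X I (%i sg. b * ph i sg) w g + - (b\<^sup>2 * V / 2)" for g
  unfolding u_def w_def by (rule ln_L)
 have "((%s. \<integral>g. Ph (lnZ X I (%i sg. s * ph i sg) w g + - (s\<^sup>2 * V / 2)) \<partial>gau I) has_real_derivative
  (LINT g|gau I. (\<Sum>i\<in>I. b * 1 * (Ph'' (lnZ X I (%i sg. b * ph i sg) w g + - (b\<^sup>2 * V / 2)) * (gavg X (gw I (%i sg. b * ph i sg) w g) (ph i))\<^sup>2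
    + Ph' (lnZ X I (%i sg. b * ph i sg) w g + - (b\<^sup>2 * V / 2)) * (gavg X (gw I (%i sg. b * ph i sg) w g) (%sg. (ph i sg)\<^sup>2) - (gavg X (gw I (%i sg. b * ph i sg) w g) (ph i))\<^sup>2)))
    + - (b * V) * Ph' (lnZ X I (%i sg. b * ph i sg) w g + - (b\<^sup>2 * V / 2)))) (at b)"
 proof (rule gaussian_interpolation[OF I w bt dPh cPh bPh k, where B=B and c="%_ s. s" and c'="%_ _. 1" and d="%s. - (s\<^sup>2 * V / 2)" and d'="%s. - (s * V)"])
  fix s assume s: "s \<in> {b - 1<..<b + 1}"
  show "((%s. - (s\<^sup>2 * V / 2)) has_real_derivative - (s * V)) (at s)"
   by (auto intro!: derivative_eq_intros)
  show "\<bar>s\<bar> <= B" using sb[OF s] B1 by linarith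
  show "\<bar>1\<bar> <= B" using B1 by simp
  show "\<bar>- (s\<^sup>2 * V / 2)\<bar> <= B" using B2(1)[OF s] by (simp add: abs_mult)
  show "\<bar>- (s * V)\<bar> <= B" using B2(2)[OF s] by simp
 qed (auto intro!: derivative_eq_intros)
 also have "(%s. \<integral>g. Ph (lnZ X I (%i sg. s * ph i sg) w g + - (s\<^sup>2 * V / 2)) \<partial>gau I) = (%b. \<integral>g. Ph (ln (L b g)) \<partial>gau I)"
  by (simp only: ln_L w_def)
 also have "(LINT g|gau I. (\<Sum>i\<in>I. b * 1 * (Ph'' (lnZ X I (%i sg. b * ph i sg) w g + - (b\<^sup>2 * V / 2)) * (gavg X (gw I (%i sg. b * ph i sg) w g) (ph i))\<^sup>2
    + Ph' (lnZ X I (%i sg. b * ph i sg) w g + - (b\<^sup>2 * V / 2)) * (gavg X (gw I (%i sg. b * ph i sg) w g) (%sg. (ph i sg)\<^sup>2) - (gavg X (gw I (%i sg. b * ph i sg) w g) (ph i))\<^sup>2)))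
    + - (b * V) * Ph' (lnZ X I (%i sg. b * ph i sg) w g + - (b\<^sup>2 * V / 2)))
  = (LINT g|gau I. b * ((Ph'' (u g) - Ph' (u g)) * post b g (%sg. post b g (K sg))))"
  unfolding u[symmetric] W_def[symmetric]
 proof (rule Bochner_Integration.integral_cong[OF refl])
  fix g
  have 1: "(\<Sum>i\<in>I. gavg X (W g) (%sg. (ph i sg)\<^sup>2)) = V"
  proof -
   have "(\<Sum>i\<in>I. gavg X (W g) (%sg. (ph i sg)\<^sup>2)) = gavg X (W g) (%sg. V)"
    unfolding gavg_sum[symmetric] by (rule gavg_cong) (rule norm)
   then show ?thesis by (simp add: gavg_const[OF pW])
  qed
  have 2: "(\<Sum>i\<in>I. (gavg X (W g) (ph i))\<^sup>2) = post b g (%sg. post b g (K sg))"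
   unfolding pp K_def[abs_def] by (rule gavg2_square_sum)
  have "(\<Sum>i\<in>I. b * 1 * (Ph'' (u g) * (gavg X (W g) (ph i))\<^sup>2 + Ph' (u g) * (gavg X (W g) (%sg. (ph i sg)\<^sup>2) - (gavg X (W g) (ph i))\<^sup>2)))
   = b * (Ph'' (u g) * (\<Sum>i\<in>I. (gavg X (W g) (ph i))\<^sup>2) + Ph' (u g) * ((\<Sum>i\<in>I. gavg X (W g) (%sg. (ph i sg)\<^sup>2)) - (\<Sum>i\<in>I. (gavg X (W g) (ph i))\<^sup>2)))"
   by (simp only: sum_distrib_left sum.distrib sum_subtractf distrib_left right_diff_distrib mult.assoc mult_1_left)
  then show "(\<Sum>i\<in>I. b * 1 * (Ph'' (u g) * (gavg X (W g) (ph i))\<^sup>2 + Ph' (u g) * (gavg X (W g) (%sg. (ph i sg)\<^sup>2) - (gavg X (W g) (ph i))\<^sup>2)))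
    + - (b * V) * Ph' (u g) = b * ((Ph'' (u g) - Ph' (u g)) * post b g (%sg. post b g (K sg)))"
   unfolding 1 2 by (simp add: algebra_simps)
 qed
 also have "... = b * (LINT g|gau I. (Ph'' (u g) - Ph' (u g)) * post b g (%sg. post b g (K sg)))" by simp
 finally show ?thesis by (simp only: u_def)
qed

lemma post_K_nonneg: "0 <= post b g (%sg. post b g (K sg))"
 unfolding post_def K_def[abs_def] gavg2_square_sum[symmetric] by (simp add: sum_nonneg)

lemma post_mono: "(!!sg. sg \<in> X ==> f sg <= h sg) ==> post b g f <= post b g h"
 unfolding post_def by (rule gavg_mono[OF posw_lik])

lemma post_nonneg: "(!!sg. sg \<in> X ==> 0 <= f sg) ==> 0 <= post b g f"
 unfolding post_def by (rule gavg_nonneg[OF posw_lik])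

lemma post_le: "(!!sg. sg \<in> X ==> f sg <= c) ==> post b g f <= c"
 unfolding post_def by (rule gavg_le[OF posw_lik])

lemma expb_post:
 assumes "!!sg. sg \<in> X ==> expb I (%g. f g sg)"
 shows "expb I (%g. post b g (f g))"
proof -
 have "posw X (%_. 1)" using X by (simp add: posw_def)
 then show ?thesis
  unfolding post_eq_gavg[where w="%_. 1" and c=1, OF refl zero_less_one] by (rule expb_gavg) (rule assms)
qed

text \<open>Relative entropy of the planted law with respect to pure noise.\<close>

definition entropy :: "real => real" where
 "entropy b = (LINT g|gau I. L b g * ln (L b g))"

text \<open>Hellinger affinity of the planted law and pure noise. It is at most 1, decreases for b >
  0 at a rate given by the posterior overlap, and dominates exp (logmean / 2).\<close>

definition hellinger :: "real => real" where
 "hellinger b = (LINT g|gau I. sqrt (L b g))"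

definition logmean :: "real => real" where
 "logmean b = (LINT g|gau I. ln (L b g))"

text \<open>Ph = exp (x / 2) has Ph'' - Ph' = -Ph / 4.\<close>

lemma hellinger_deriv:
 "(hellinger has_real_derivative - (b / 4) * (LINT g|gau I. sqrt (L b g) * post b g (%sg. post b g (K sg)))) (at b)"
proof -
 have s: "sqrt (L b g) = exp (ln (L b g) / 2)" for b g
  by (rule real_sqrt_unique) (simp_all add: L_pos power2_eq_square exp_add[symmetric])
 have "((%b. \<integral>g. exp (ln (L b g) / 2) \<partial>gau I) has_real_derivative
  b * (LINT g|gau I. (exp (ln (L b g) / 2) / 4 - exp (ln (L b g) / 2) / 2) * post b g (%sg. post b g (K sg)))) (at b)"
 proof (rule interpolation_L[where C=1 and k=1])
  fix x :: real
  have "x / 2 <= \<bar>x\<bar>" by simp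
  then have e: "exp (x / 2) <= exp \<bar>x\<bar>" by simp
  show "\<bar>exp (x / 2)\<bar> <= 1 * exp (1 * \<bar>x\<bar>)" "\<bar>exp (x / 2) / 2\<bar> <= 1 * exp (1 * \<bar>x\<bar>)" "\<bar>exp (x / 2) / 4\<bar> <= 1 * exp (1 * \<bar>x\<bar>)"
   using e exp_gt_zero[of "x/2"] by (simp_all, linarith+)
 qed (auto intro!: derivative_eq_intros continuous_intros)
 also have "(LINT g|gau I. (exp (ln (L b g) / 2) / 4 - exp (ln (L b g) / 2) / 2) * post b g (%sg. post b g (K sg)))
  = (LINT g|gau I. (- 1 / 4) * (exp (ln (L b g) / 2) * post b g (%sg. post b g (K sg))))"
  by (rule Bochner_Integration.integral_cong[OF refl]) simp
 finally show ?thesis unfolding hellinger_def[abs_def] s by simp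
qed

text \<open>Ph = x * exp x has Ph'' - Ph' = exp x, so the overlap is weighted by L, that is averaged
  under the planted law.\<close>

lemma entropy_deriv:
 "(entropy has_real_derivative b * (LINT g|gau I. L b g * post b g (%sg. post b g (K sg)))) (at b)"
proof -
 have "((%b. \<integral>g. ln (L b g) * exp (ln (L b g)) \<partial>gau I) has_real_derivative
  b * (LINT g|gau I. ((ln (L b g) + 2) * exp (ln (L b g)) - (ln (L b g) + 1) * exp (ln (L b g))) * post b g (%sg. post b g (K sg)))) (at b)"
 proof (rule interpolation_L[where C=3 and k=2 and Ph="%x. x * exp x" and Ph'="%x. (x + 1) * exp x" and Ph''="%x. (x + 2) * exp x"])
  fix x :: real
  have b: "\<bar>(x + c) * exp x\<bar> <= 3 * exp (2 * \<bar>x\<bar>)" if c: "0 <= c" "c <= 2" for c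
  proof -
   have "\<bar>x + c\<bar> <= 3 * exp \<bar>x\<bar>" using c x_le_exp_abs[of x] one_le_exp_iff[of "\<bar>x\<bar>"] by linarith
   then have "\<bar>x + c\<bar> * exp x <= (3 * exp \<bar>x\<bar>) * exp \<bar>x\<bar>" by (intro mult_mono) auto
   then show ?thesis by (simp add: abs_mult mult.assoc exp_add[symmetric])
  qed
  show "\<bar>x * exp x\<bar> <= 3 * exp (2 * \<bar>x\<bar>)" "\<bar>(x + 1) * exp x\<bar> <= 3 * exp (2 * \<bar>x\<bar>)" "\<bar>(x + 2) * exp x\<bar> <= 3 * exp (2 * \<bar>x\<bar>)"
   using b[of 0] b[of 1] b[of 2] by auto
 qed (auto intro!: derivative_eq_intros continuous_intros simp: algebra_simps)
 also have "(LINT g|gau I. ((ln (L b g) + 2) * exp (ln (L b g)) - (ln (L b g) + 1) * exp (ln (L b g))) * post b g (%sg. post b g (K sg)))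
  = (LINT g|gau I. L b g * post b g (%sg. post b g (K sg)))"
  by (rule Bochner_Integration.integral_cong[OF refl]) (simp add: L_pos algebra_simps)
 finally show ?thesis unfolding entropy_def[abs_def] by (simp add: L_pos mult.commute)
qed

lemma entropy_mono:
 assumes "0 <= b1" "b1 <= b2" shows "entropy b1 <= entropy b2"
proof (rule DERIV_nonneg_imp_nondecreasing[OF assms(2)])
 fix b assume b: "b1 <= b" "b <= b2"
 have "0 <= (LINT g|gau I. L b g * post b g (%sg. post b g (K sg)))"
  by (rule integral_nonneg_AE) (auto intro!: mult_nonneg_nonneg less_imp_le[OF L_pos] post_K_nonneg)
 then have "0 <= b * (LINT g|gau I. L b g * post b g (%sg. post b g (K sg)))" using b assms by simp
 then show "\<exists>y. (entropy has_real_derivative y) (at b) \<and> 0 <= y" using entropy_deriv by blast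
qed

lemma expb_sqrt_L: "expb I (%g. sqrt (L b g))"
proof (rule expb_mono[OF expb_add[OF expb_const[of I 1] expb_L[of b]]])
 fix g
 have "0 <= (sqrt (L b g) - 1)\<^sup>2" by simp
 then have "2 * sqrt (L b g) <= 1 + L b g" using L_pos[of b g] by (simp add: power2_diff)
 then show "\<bar>sqrt (L b g)\<bar> <= \<bar>1 + L b g\<bar>" using L_pos[of b g] by simp
qed measurable

lemma hellinger_le_1: "hellinger b <= 1"
proof -
 interpret P: prob_space "gau I" by (rule prob_space_gau)
 have "hellinger b <= (LINT g|gau I. (1 + L b g) / 2)" unfolding hellinger_def
 proof (rule integral_mono)
  show "integrable (gau I) (%g. sqrt (L b g))" by (rule expb_integrable[OF I expb_sqrt_L])
  show "integrable (gau I) (%g. (1 + L b g) / 2)" using expb_integrable[OF I expb_L] by simp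
  fix g
  have "0 <= (sqrt (L b g) - 1)\<^sup>2" by simp
  then show "sqrt (L b g) <= (1 + L b g) / 2" using L_pos[of b g] by (simp add: power2_diff)
 qed
 also have "... = 1" using expb_integrable[OF I expb_L, of b] by (simp add: L_expectation P.prob_space)
 finally show ?thesis .
qed

lemma exp_logmean_le_hellinger: "exp (logmean b / 2) <= hellinger b"
proof -
 interpret P: prob_space "gau I" by (rule prob_space_gau)
 define m where "m = logmean b / 2"
 have il: "integrable (gau I) (%g. ln (L b g))" by (rule expb_integrable[OF I expb_lnL])
 have "exp m = (LINT g|gau I. exp m * (1 + (ln (L b g) / 2 - m)))"
  using il by (simp add: m_def logmean_def P.prob_space)
 also have "... <= hellinger b" unfolding hellinger_def
 proof (rule integral_mono)
  show "integrable (gau I) (%g. exp m * (1 + (ln (L b g) / 2 - m)))" using il by simp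
  show "integrable (gau I) (%g. sqrt (L b g))" by (rule expb_integrable[OF I expb_sqrt_L])
  fix g
  have "sqrt (L b g) = exp (ln (L b g) / 2)"
   by (rule real_sqrt_unique) (simp_all add: L_pos power2_eq_square exp_add[symmetric])
  also have "... = exp m * exp (ln (L b g) / 2 - m)" by (simp add: exp_add[symmetric])
  finally show "exp m * (1 + (ln (L b g) / 2 - m)) <= sqrt (L b g)"
   by (simp add: mult_left_mono exp_ge_add_one_self)
 qed
 finally show ?thesis by (simp add: m_def)
qed

end

section \<open>The p-spin signals, gauge symmetry and concentration\<close>

lemma gau_prob:
 assumes "Measurable.pred (gau I) P"
 shows "measure (gau I) {g \<in> space (gau I). P g} = (LINT g|gau I. (if P g then 1 else 0))"
proof -
 have "{g \<in> space (gau I). P g} \<in> sets (gau I)" using assms by measurable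
 then have "measure (gau I) {g \<in> space (gau I). P g} = (LINT g|gau I. indicator {g \<in> space (gau I). P g} g)" by simp
 also have "... = (LINT g|gau I. (if P g then 1 else 0))"
  by (rule Bochner_Integration.integral_cong) auto
 finally show ?thesis .
qed

lemma expb_ind:
 "Measurable.pred (gau I) P ==> expb I (%g. if P g then 1 else 0)"
 by (rule expb_bounded[where B=1]) (measurable, auto)

text \<open>Entries of the p-th tensor power of u in units in which the noise is standard: the noise
  has variance 2 / N, so the signal is multiplied by sqrt (N / 2).\<close>

definition feat :: "nat => nat => nat list => (nat => real) => real" where
 "feat p N is u = sqrt (real N / 2) * (\<Prod>j<p. u (is ! j))"

lemma S_eq: "S N = (%sg i. sg i / sqrt (real N)) ` Defs.Sigma N"
proof (intro equalityI subsetI)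
 fix u assume u: "u \<in> S N"
 have "u = (%i. u i * sqrt (real N) / sqrt (real N))" using u by (cases "N = 0") (auto simp: S_def fun_eq_iff)
 moreover have "(%i. u i * sqrt (real N)) \<in> Defs.Sigma N"
 proof -
  have "i < N ==> u i * sqrt (real N) = 1 \<or> u i * sqrt (real N) = - 1" for i
   using u[unfolded S_def] by (cases "u i = 1 / sqrt (real N)") auto
  then show ?thesis using u by (auto simp: Defs.Sigma_def S_def)
 qed
 ultimately show "u \<in> (%sg i. sg i / sqrt (real N)) ` Defs.Sigma N" by (rule image_eqI)
qed (auto simp: S_def Defs.Sigma_def)

lemma finite_S: "finite (S N)"
 unfolding S_eq using finite_Sigma_card[of N] by simp

lemma S_nonempty: "S N ~= {}"
 unfolding S_eq using finite_Sigma_card[of N] by auto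

lemma S_inj: "N > 0 ==> inj_on (%sg i. sg i / sqrt (real N)) A"
 by (auto simp: inj_on_def fun_eq_iff)

lemma card_S: "N > 0 ==> card (S N) = 2 ^ N"
 unfolding S_eq using finite_Sigma_card[of N] by (simp add: card_image[OF S_inj])

lemma S_square: "u \<in> S N ==> i < N ==> u i * u i = 1 / real N"
 by (auto simp: S_def)

lemma S_abs: "u \<in> S N ==> i < N ==> \<bar>u i\<bar> = 1 / sqrt (real N)"
 by (auto simp: S_def)

lemma vinner_sym: "vinner N u v = vinner N v u"
 by (simp add: vinner_def mult.commute)

lemma vinner_self: "u \<in> S N ==> N > 0 ==> vinner N u u = 1"
 by (simp add: vinner_def S_square)

lemma vinner_abs:
 assumes "u \<in> S N" "v \<in> S N" shows "\<bar>vinner N u v\<bar> <= 1"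
proof -
 have "\<bar>vinner N u v\<bar> <= (\<Sum>i<N. \<bar>u i * v i\<bar>)" unfolding vinner_def by (rule sum_abs)
 also have "... = (\<Sum>i<N. 1 / real N)" by (rule sum.cong) (simp_all add: abs_mult S_abs[OF assms(1)] S_abs[OF assms(2)])
 also have "... <= 1" by simp
 finally show ?thesis .
qed

lemma feat_product: "(\<Sum>is\<in>idx p N. feat p N is u * feat p N is v) = real N / 2 * vinner N u v ^ p"
proof -
 have "(\<Sum>is\<in>idx p N. feat p N is u * feat p N is v) = (\<Sum>is\<in>idx p N. real N / 2 * (\<Prod>j<p. u (is ! j) * v (is ! j)))"
  by (rule sum.cong[OF refl]) (simp add: feat_def prod.distrib mult_ac)
 then show ?thesis unfolding sum_distrib_left[symmetric] sum_idx_prod[of "%i. u i * v i"] vinner_def .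
qed

lemma feat_abs:
 assumes "u \<in> S N" "is \<in> idx p N" shows "\<bar>feat p N is u\<bar> = sqrt (real N / 2) * (1 / sqrt (real N)) ^ p"
proof -
 have "(\<Prod>j<p. \<bar>u (is ! j)\<bar>) = (\<Prod>j<p. 1 / sqrt (real N))"
  by (rule prod.cong[OF refl]) (simp add: S_abs[OF assms(1) idx_nth[OF assms(2)]])
 then show ?thesis by (simp add: feat_def abs_mult abs_prod)
qed

locale pspin =
 fixes p N :: nat
 assumes p: "p >= 3" and N: "N > 0"
begin

sublocale planted "S N" "idx p N" "feat p N" "real N / 2"
proof
 fix u assume "u \<in> S N"
 then show "(\<Sum>is\<in>idx p N. (feat p N is u)\<^sup>2) = real N / 2"
  using feat_product[of p N u u] N by (simp add: power2_eq_square vinner_self)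
qed (rule finite_S S_nonempty finite_idx)+

lemma K_eq: "K u v = real N / 2 * vinner N u v ^ p"
 by (simp add: K_def feat_product)

lemma vinner_power_abs: "u \<in> S N ==> v \<in> S N ==> \<bar>vinner N u v ^ p\<bar> <= 1"
 unfolding power_abs by (rule power_le_one) (auto simp: vinner_abs)

lemma lnL_lipschitz:
 assumes i: "is \<in> idx p N"
 shows "\<bar>ln (L b (g(is:=x))) - ln (L b (g(is:=y)))\<bar> <= (\<bar>b\<bar> * (sqrt (real N / 2) * (1 / sqrt (real N)) ^ p)) * \<bar>x - y\<bar>"
proof -
 have "posw (S N) (%_. 1 / real (card (S N)))" using X card_pos by (simp add: posw_def)
 from lnZ_lipschitz[OF I i this, of "%is sg. b * feat p N is sg" "%_. \<bar>b\<bar> * (sqrt (real N / 2) * (1 / sqrt (real N)) ^ p)" g x y]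
 show ?thesis unfolding ln_L using feat_abs[OF _ i] by (simp add: abs_mult)
qed

lemma lipschitz_sum: "(\<Sum>is\<in>idx p N. (\<bar>b\<bar> * (sqrt (real N / 2) * (1 / sqrt (real N)) ^ p))\<^sup>2) = b\<^sup>2 * real N / 2"
proof -
 have "((1 / sqrt (real N)) ^ p)\<^sup>2 = 1 / real N ^ p" using N
  by (simp add: power_mult[symmetric] power_divide) (simp add: mult.commute[of p] power_mult)
 then have "(\<bar>b\<bar> * (sqrt (real N / 2) * (1 / sqrt (real N)) ^ p))\<^sup>2 = b\<^sup>2 * (real N / 2) / real N ^ p"
  by (simp only: power_mult_distrib) simp
 then show ?thesis using N by (simp add: card_idx)
qed

text \<open>\<open>obs\<close> only translates the noise, so the planted log-likelihood has the same
  Lipschitz constants as the unplanted one. With V = b^2 * N / 2 a deviation r * N has exponent r^2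
  * N / (2 * b^2).\<close>

lemma lnL_tails:
 assumes b: "b ~= 0" and r: "r >= 0"
 shows "(LINT g|gau (idx p N). (if ln (L b g) >= logmean b + r * real N then 1 else 0)) <= exp (- (r\<^sup>2 / (2 * b\<^sup>2)) * real N)"
  and "(LINT g|gau (idx p N). (if ln (L b (obs b' u g)) <= (LINT g|gau (idx p N). ln (L b (obs b' u g))) - r * real N then 1 else 0)) <= exp (- (r\<^sup>2 / (2 * b\<^sup>2)) * real N)"
proof -
 have V: "b\<^sup>2 * real N / 2 > 0" using b N by simp
 have rN: "r * real N >= 0" using r by simp
 have e: "- (r * real N)\<^sup>2 / (4 * (b\<^sup>2 * real N / 2)) = - (r\<^sup>2 / (2 * b\<^sup>2)) * real N"
  using N b by (simp add: power2_eq_square field_simps)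
 have Vs: "(\<Sum>is\<in>idx p N. (\<bar>b\<bar> * (sqrt (real N / 2) * (1 / sqrt (real N)) ^ p))\<^sup>2) <= b\<^sup>2 * real N / 2"
  by (simp only: lipschitz_sum)
 have m1: "(%g. ln (L b g)) \<in> borel_measurable (gau (idx p N))" by measurable
 have pm1: "Measurable.pred (gau (idx p N)) (%g. c <= ln (L b g))" for c using m1 by measurable
 have "measure (gau (idx p N)) {g \<in> space (gau (idx p N)). ln (L b g) >= (LINT g|gau (idx p N). ln (L b g)) + r * real N} <= exp (- (r * real N)\<^sup>2 / (4 * (b\<^sup>2 * real N / 2)))"
  by (rule gau_upper_tail[OF I m1 _ Vs V rN]) (rule lnL_lipschitz)
 then show "(LINT g|gau (idx p N). (if ln (L b g) >= logmean b + r * real N then 1 else 0)) <= exp (- (r\<^sup>2 / (2 * b\<^sup>2)) * real N)"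
  unfolding e logmean_def by (simp add: gau_prob pm1)
 have m2: "(%g. ln (L b (obs b' u g))) \<in> borel_measurable (gau (idx p N))" by measurable
 have pm2: "Measurable.pred (gau (idx p N)) (%g. ln (L b (obs b' u g)) <= c)" for c using m2 by measurable
 have "measure (gau (idx p N)) {g \<in> space (gau (idx p N)). ln (L b (obs b' u g)) <= (LINT g|gau (idx p N). ln (L b (obs b' u g))) - r * real N} <= exp (- (r * real N)\<^sup>2 / (4 * (b\<^sup>2 * real N / 2)))"
 proof (rule gau_lower_tail[OF I m2 _ Vs V rN])
  fix g i x y assume i: "i \<in> idx p N"
  have o: "obs b' u (g(i:=z)) = (obs b' u g)(i := z + b' * feat p N i u)" for z
   using i by (auto simp: obs_def fun_eq_iff)
  show "\<bar>ln (L b (obs b' u (g(i := x)))) - ln (L b (obs b' u (g(i := y))))\<bar> <= \<bar>b\<bar> * (sqrt (real N / 2) * (1 / sqrt (real N)) ^ p) * \<bar>x - y\<bar>"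
   unfolding o using lnL_lipschitz[OF i, of b "obs b' u g" "x + b' * feat p N i u" "y + b' * feat p N i u"] by (simp del: fun_upd_apply)
 qed
 then show "(LINT g|gau (idx p N). (if ln (L b (obs b' u g)) <= (LINT g|gau (idx p N). ln (L b (obs b' u g))) - r * real N then 1 else 0)) <= exp (- (r\<^sup>2 / (2 * b\<^sup>2)) * real N)"
  unfolding e by (simp add: gau_prob pm2)
qed

text \<open>Identifies the normalised likelihood with the p-spin partition function: the feature
  normalisations agree because N^(-(p-1)/2) = sqrt N / (sqrt N)^p, and 2^(-N) is the uniform prior
  on signals.\<close>

lemma logmean_eq: "logmean b = free_energy b p N - real N * b\<^sup>2 / 4"
proof -
 interpret P: prob_space "gau (idx p N)" by (rule prob_space_gau)
 have f: "b * feat p N is (%i. sg i / sqrt (real N)) = pfeat b p N is sg" for "is" sg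
 proof -
  have "real N powr (- (real p - 1) / 2) = real N powr (1/2) / real N powr (real p / 2)"
   by (simp add: powr_diff[symmetric] diff_divide_distrib)
  also have "real N powr (real p / 2) = sqrt (real N) ^ p"
   using N by (simp add: powr_half_sqrt[symmetric] powr_powr[symmetric] powr_realpow[symmetric] powr_powr)
  finally show ?thesis
   by (simp add: feat_def pfeat_def prod_dividef powr_half_sqrt real_sqrt_divide)
 qed
 have "lnZ (S N) (idx p N) (%is u. b * feat p N is u) (%_. 1 / real (card (S N))) g
   = lnZ (Defs.Sigma N) (idx p N) (pfeat b p N) (%_. 2 powr - real N) g" for g
 proof -
  have "1 / real (card (S N)) = 2 powr - real N" using N by (simp add: card_S powr_minus powr_realpow inverse_eq_divide)
  then show ?thesis unfolding lnZ_def gw_def unfolding S_eq sum.reindex[OF S_inj[OF N]] by (simp add: f)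
 qed
 then have l: "ln (L b g) = lnZ (Defs.Sigma N) (idx p N) (pfeat b p N) (%_. 2 powr - real N) g + - (b\<^sup>2 * (real N / 2) / 2)" for g
  using ln_L by simp
 have "integrable (gau (idx p N)) (%g. ln (L b g) + b\<^sup>2 * (real N / 2) / 2)"
  by (intro Bochner_Integration.integrable_add expb_integrable[OF I expb_lnL]) simp
 then have i: "integrable (gau (idx p N)) (%g. lnZ (Defs.Sigma N) (idx p N) (pfeat b p N) (%_. 2 powr - real N) g)"
  unfolding l by simp
 show ?thesis unfolding logmean_def free_energy_def l using i by (simp add: P.prob_space mult.commute)
qed

text \<open>Flipping signs of the coordinates moves any signal to any other one and preserves the noise.\<close>
lemma obs_gauge:
 assumes u: "u \<in> S N" and v: "v \<in> S N"
 shows "(LINT g|gau (idx p N). ln (L b (obs b u g))) = (LINT g|gau (idx p N). ln (L b (obs b v g)))"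
proof -
 define s where "s is = (\<Prod>j<p. real N * u (is ! j) * v (is ! j))" for "is"
 define T where "T ta i = real N * ta i * u i * v i" for ta :: "nat => real" and i
 have uv: "\<bar>real N * u i * v i\<bar> = 1" if "i < N" for i
  using N by (simp add: abs_mult S_abs[OF u that] S_abs[OF v that])
 have sabs: "\<bar>s is\<bar> = 1" if "is \<in> idx p N" for "is"
  unfolding s_def abs_prod by (rule prod.neutral) (simp add: uv idx_nth[OF that])
 have uv2: "(real N * u i * v i) * (real N * u i * v i) = 1" if "i < N" for i
  using uv[OF that] by (metis abs_mult_self_eq mult_1)
 have T2: "T (T ta) = ta" if "ta \<in> S N" for ta
 proof
  fix i show "T (T ta) i = ta i"
  proof (cases "i < N")
   case True
   have "T (T ta) i = ((real N * u i * v i) * (real N * u i * v i)) * ta i" by (simp add: T_def)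
   then show ?thesis using uv2[OF True] by simp
  qed (use that in \<open>auto simp: T_def S_def\<close>)
 qed
 have TS: "T ta \<in> S N" if "ta \<in> S N" for ta
 proof -
  have "T ta i = 1 / sqrt (real N) \<or> T ta i = - 1 / sqrt (real N)" if i: "i < N" for i
  proof -
   have "\<bar>T ta i\<bar> = \<bar>real N * u i * v i\<bar> * \<bar>ta i\<bar>" by (simp add: T_def abs_mult)
   then have "\<bar>T ta i\<bar> = 1 / sqrt (real N)" using uv[OF i] S_abs[OF \<open>ta \<in> S N\<close> i] by simp
   then show ?thesis by (auto simp: abs_if split: if_splits)
  qed
  moreover have "T ta i = 0" if "i >= N" for i using \<open>ta \<in> S N\<close> that by (auto simp: T_def S_def)
  ultimately show ?thesis by (auto simp: S_def)
 qed
 have bij: "bij_betw T (S N) (S N)"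
  by (rule bij_betw_byWitness[where f'=T]) (auto simp: T2 TS)
 have fT: "feat p N is (T ta) = feat p N is ta * s is" for "is" ta
  by (simp add: feat_def T_def s_def prod.distrib mult_ac)
 have lT: "lik b ta (\<lambda>i\<in>idx p N. s i * g i) = lik b (T ta) g" for ta g
  unfolding lik_def fT by (simp add: mult.assoc cong: sum.cong)
 have vT: "K ta u = K (T ta) v" for ta
 proof -
  have "vinner N (T ta) v = vinner N ta u" unfolding vinner_def
  proof (rule sum.cong[OF refl])
   fix i assume "i \<in> {..<N}"
   then have "v i * v i = 1 / real N" using S_square[OF v] by simp
   then have "T ta i * v i = real N * ta i * u i * (1 / real N)" by (simp add: T_def mult.assoc)
   then show "T ta i * v i = ta i * u i" using N by simp
  qed
  then show ?thesis by (simp add: K_eq)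
 qed
 have LT: "L b (obs b u (\<lambda>i\<in>idx p N. s i * g i)) = L b (obs b v g)" for g
 proof -
  have "(\<Sum>ta\<in>S N. lik b (T ta) g * exp (b * b * K (T ta) v)) = (\<Sum>ta\<in>S N. lik b ta g * exp (b * b * K ta v))"
   by (rule sum.reindex_bij_betw[OF bij, of "%ta. lik b ta g * exp (b * b * K ta v)"])
  then show ?thesis unfolding L_def avg_def lik_obs lT vT by simp
 qed
 have "(LINT g|gau (idx p N). ln (L b (obs b u (\<lambda>i\<in>idx p N. s i * g i)))) = (LINT g|gau (idx p N). ln (L b (obs b u g)))"
  by (rule gau_sign_integral[OF I sabs]) (assumption, measurable)
 then show ?thesis unfolding LT by simp
qed

text \<open>By gauge invariance the planted mean of ln L is the same for every signal, hence equal
  to its average, the entropy; concentration may then be used signal by signal.\<close>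

lemma entropy_obs:
 assumes u: "u \<in> S N" shows "(LINT g|gau (idx p N). ln (L b (obs b u g))) = entropy b"
proof -
 have "entropy b = avg (%v. \<integral>g. ln (L b (obs b v g)) \<partial>gau (idx p N))"
  unfolding entropy_def by (rule planted_expectation_L[OF _ expb_lnL]) measurable
 also have "... = avg (%v. \<integral>g. ln (L b (obs b u g)) \<partial>gau (idx p N))"
  by (rule avg_cong) (rule obs_gauge[OF _ u])
 finally show ?thesis by (simp add: avg_const)
qed

text \<open>Planting u multiplies the likelihood of ta by exp (b^2 * K ta u), which is at most exp
  (b^2 * k) wherever q does not vanish.\<close>

lemma post_obs_le:
 assumes q: "!!ta. ta \<in> S N ==> 0 <= q ta \<and> q ta <= 1 \<and> (q ta ~= 0 --> K ta u <= k)"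
 shows "L b (obs b u g) * post b (obs b u g) q <= exp (b\<^sup>2 * k) * L b g"
proof -
 have "L b (obs b u g) * post b (obs b u g) q <= avg (%ta. exp (b\<^sup>2 * k) * lik b ta g)"
  unfolding L_post
 proof (rule avg_mono)
  fix ta assume t: "ta \<in> S N"
  have "exp (b * b * K ta u) * q ta <= exp (b\<^sup>2 * k) * 1"
  proof (cases "q ta = 0")
   case False
   then have "b * b * K ta u <= b\<^sup>2 * k" using q[OF t] by (simp add: power2_eq_square[symmetric] mult_left_mono)
   then show ?thesis using q[OF t] by (intro mult_mono) auto
  qed simp
  then have "lik b ta g * (exp (b * b * K ta u) * q ta) <= lik b ta g * (exp (b\<^sup>2 * k) * 1)"
   by (intro mult_left_mono less_imp_le[OF lik_pos])
  then show "lik b ta (obs b u g) * q ta <= exp (b\<^sup>2 * k) * lik b ta g" by (simp add: lik_obs mult_ac)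
 qed
 then show ?thesis by (simp add: avg_cmult L_def)
qed

text \<open>Large entropy means that the planted likelihood is at least exp (3/4 * d * N) up to
  exponentially small probability, by concentration with deviation d / 4. Signals with overlap power
  below ka contribute at most exp (d * N / 4) times the L of pure noise, by
  \<open>post_obs_le\<close> and the bound on ka. Their posterior mass is thus at most exp (-d * N /
  2) * L, and L has mean one.\<close>

lemma overlap_small:
 assumes b: "0 < b" "b <= b2" and d: "d > 0" "entropy b >= real N * d" and u: "u \<in> S N" and k: "ka <= d / (2 * b2\<^sup>2)"
 shows "(LINT g|gau (idx p N). post b (obs b u g) (%ta. if vinner N u ta ^ p < ka then 1 else 0))
  <= exp (- (d\<^sup>2 / (32 * b2\<^sup>2)) * real N) + exp (- (d / 2) * real N)"
proof -
 interpret P: prob_space "gau (idx p N)" by (rule prob_space_gau)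
 let ?q = "%ta. if vinner N u ta ^ p < ka then 1 else 0 :: real"
 let ?bad = "%g. if ln (L b (obs b u g)) <= (LINT g|gau (idx p N). ln (L b (obs b u g))) - (d / 4) * real N then 1 else 0 :: real"
 have pm [measurable]: "(%g. post b g ?q) \<in> borel_measurable (gau (idx p N))" by (rule measurable_post) simp
 have p01: "0 <= post b g ?q" "post b g ?q <= 1" for g by (rule post_nonneg post_le, simp)+
 have "b2\<^sup>2 > 0" using b by simp
 then have bk: "b\<^sup>2 * (real N / 2 * ka) <= d / 4 * real N"
 proof -
  have "b\<^sup>2 * ka <= d / 2"
  proof (cases "ka >= 0")
   case True
   have "b\<^sup>2 * ka <= b2\<^sup>2 * ka" using b True by (intro mult_right_mono power_mono) auto
   also have "... <= b2\<^sup>2 * (d / (2 * b2\<^sup>2))" using k by (intro mult_left_mono) auto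
   finally show ?thesis using \<open>b2\<^sup>2 > 0\<close> by simp
  next
   case False
   then have "b\<^sup>2 * ka <= 0" by (intro mult_nonneg_nonpos) auto
   then show ?thesis using d by linarith
  qed
  then have "(b\<^sup>2 * ka) * (real N / 2) <= d / 2 * (real N / 2)" by (rule mult_right_mono) simp
  then show ?thesis by (simp add: mult_ac)
 qed
 have pw: "post b (obs b u g) ?q <= ?bad g + exp (- (d / 2) * real N) * L b g" for g
 proof (cases "ln (L b (obs b u g)) <= (LINT g|gau (idx p N). ln (L b (obs b u g))) - (d / 4) * real N")
  case True
  then show ?thesis using p01(2)[of "obs b u g"] L_pos[of b g] by (simp add: add_increasing2)
 next
  case False
  then have "3 * d / 4 * real N <= ln (L b (obs b u g))" using d(2) unfolding entropy_obs[OF u] by (simp add: algebra_simps)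
  then have Lo: "exp (3 * d / 4 * real N) <= L b (obs b u g)" by (rule ln_ge_iff[OF L_pos, THEN iffD1])
  have "exp (3 * d / 4 * real N) * post b (obs b u g) ?q <= L b (obs b u g) * post b (obs b u g) ?q"
   by (rule mult_right_mono[OF Lo p01(1)])
  also have "... <= exp (b\<^sup>2 * (real N / 2 * ka)) * L b g"
   by (rule post_obs_le) (use N in \<open>auto simp: K_eq vinner_sym[of N _ u] intro: mult_left_mono\<close>)
  also have "... <= exp (d / 4 * real N) * L b g"
   using bk less_imp_le[OF L_pos] by (intro mult_right_mono) auto
  finally have "exp (- (3 * d / 4 * real N)) * (exp (3 * d / 4 * real N) * post b (obs b u g) ?q) <= exp (- (3 * d / 4 * real N)) * (exp (d / 4 * real N) * L b g)"
   by (intro mult_left_mono) auto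
  then have "post b (obs b u g) ?q <= exp (- (d / 2) * real N) * L b g"
   by (simp add: mult.assoc[symmetric] exp_add[symmetric])
  then show ?thesis using False by simp
 qed
 have ib: "integrable (gau (idx p N)) ?bad" by (rule expb_integrable[OF I expb_ind]) measurable
 have iL: "integrable (gau (idx p N)) (L b)" by (rule expb_integrable[OF I expb_L])
 have "(LINT g|gau (idx p N). post b (obs b u g) ?q) <= (LINT g|gau (idx p N). ?bad g + exp (- (d / 2) * real N) * L b g)"
 proof (rule integral_mono)
  show "integrable (gau (idx p N)) (%g. post b (obs b u g) ?q)"
   by (rule P.integrable_const_bound[where B=1]) (use p01 in auto)
  show "integrable (gau (idx p N)) (%g. ?bad g + exp (- (d / 2) * real N) * L b g)"
   by (rule Bochner_Integration.integrable_add[OF ib integrable_mult_right[OF iL]])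
 qed (rule pw)
 also have "... = (LINT g|gau (idx p N). ?bad g) + exp (- (d / 2) * real N)"
  by (subst Bochner_Integration.integral_add[OF ib integrable_mult_right[OF iL]]) (simp add: L_expectation)
 also have "(LINT g|gau (idx p N). ?bad g) <= exp (- ((d / 4)\<^sup>2 / (2 * b\<^sup>2)) * real N)"
  by (rule lnL_tails(2)) (use b d in auto)
 also have "- ((d / 4)\<^sup>2 / (2 * b\<^sup>2)) * real N <= - (d\<^sup>2 / (32 * b2\<^sup>2)) * real N"
 proof -
  have "d\<^sup>2 / (32 * b2\<^sup>2) <= d\<^sup>2 / (32 * b\<^sup>2)" using b by (intro divide_left_mono mult_left_mono power_mono) auto
  then show ?thesis by (intro mult_right_mono) (auto simp: power2_eq_square)
 qed
 finally show ?thesis by simp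
qed

end

section \<open>Overlaps of independent signals\<close>

lemma cosh_le_exp_square: "cosh x <= exp (x\<^sup>2 / 2)" for x :: real
proof -
 have 1: "sinh y <= y * cosh y" if "0 <= y" for y :: real
 proof -
  have "0 * cosh 0 - sinh 0 <= y * cosh y - sinh y"
  proof (rule DERIV_nonneg_imp_nondecreasing[OF that])
   fix t :: real assume "0 <= t"
   moreover have "((%t. t * cosh t - sinh t) has_real_derivative t * sinh t) (at t)"
    by (auto intro!: derivative_eq_intros)
   ultimately show "\<exists>z. ((%t. t * cosh t - sinh t) has_real_derivative z) (at t) \<and> 0 <= z" by auto
  qed
  then show ?thesis by simp
 qed
 have 2: "cosh y * exp (- (y\<^sup>2 / 2)) <= 1" if "0 <= y" for y :: real
 proof -
  have "cosh y * exp (- (y\<^sup>2 / 2)) <= cosh 0 * exp (- (0\<^sup>2 / 2))"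
  proof (rule DERIV_nonpos_imp_nonincreasing[OF that])
   fix t :: real assume "0 <= t"
   then have "(sinh t - t * cosh t) * exp (- (t\<^sup>2 / 2)) <= 0" using 1 by (intro mult_nonpos_nonneg) auto
   moreover have "((%t. cosh t * exp (- (t\<^sup>2 / 2))) has_real_derivative (sinh t - t * cosh t) * exp (- (t\<^sup>2 / 2))) (at t)"
    by (auto intro!: derivative_eq_intros simp: algebra_simps)
   ultimately show "\<exists>z. ((%t. cosh t * exp (- (t\<^sup>2 / 2))) has_real_derivative z) (at t) \<and> z <= 0" by blast
  qed
  then show ?thesis by simp
 qed
 have "cosh \<bar>x\<bar> * exp (- (\<bar>x\<bar>\<^sup>2 / 2)) * exp (x\<^sup>2 / 2) <= 1 * exp (x\<^sup>2 / 2)"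
  by (rule mult_right_mono[OF 2]) auto
 then show ?thesis by (simp add: mult.assoc exp_add[symmetric] cosh_real_abs)
qed

text \<open>The integrand times the density is a multiple of the normal density with variance 1 / (1
  - 2 * a).\<close>

lemma stdn_exp_square:
 assumes a: "a < 1 / 2"
 shows "integrable stdn (%z. exp (a * z\<^sup>2))" "(LINT z|stdn. exp (a * z\<^sup>2)) = 1 / sqrt (1 - 2 * a)"
proof -
 define s where "s = 1 / sqrt (1 - 2 * a)"
 have s: "s > 0" using a by (simp add: s_def)
 have s2: "s\<^sup>2 = 1 / (1 - 2 * a)" using a by (simp add: s_def power_divide)
 have e: "normal_density 0 1 z * exp (a * z\<^sup>2) = s * normal_density 0 s z" for z
 proof -
  have "exp (- (z\<^sup>2 / 2)) * exp (a * z\<^sup>2) = exp (- (z\<^sup>2 / (2 * s\<^sup>2)))"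
   unfolding exp_add[symmetric] s2 using a by (simp add: field_simps)
  moreover have "sqrt (2 * pi * s\<^sup>2) = s * sqrt (2 * pi)" using s by (simp add: real_sqrt_mult)
  ultimately show ?thesis using s by (simp add: normal_density_def mult.commute)
 qed
 have m: "(%z :: real. exp (a * z\<^sup>2)) \<in> borel_measurable lborel" by measurable
 show "integrable stdn (%z. exp (a * z\<^sup>2))" unfolding stdn_def
  by (subst integrable_density) (use m s in \<open>auto simp: e\<close>)
 have "(LINT z|stdn. exp (a * z\<^sup>2)) = (LINT z|lborel. normal_density 0 1 z *\<^sub>R exp (a * z\<^sup>2))"
  unfolding stdn_def by (rule integral_density[OF m]) auto
 also have "... = (LINT z|lborel. s * normal_density 0 s z)" by (simp only: real_scaleR_def e)
 also have "... = s" using integral_normal_density[OF s, of 0] by simp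
 finally show "(LINT z|stdn. exp (a * z\<^sup>2)) = 1 / sqrt (1 - 2 * a)" by (simp only: s_def)
qed

text \<open>The coordinates of v are chosen freely and independently, so the sum factorises; the
  sign of u i disappears because cosh is even.\<close>

lemma sum_S_exp:
 assumes N: "N > 0" and u: "u \<in> S N"
 shows "(\<Sum>v\<in>S N. exp (c * vinner N u v)) = (2 * cosh (c / real N)) ^ N"
proof -
 define B where "B = {1 / sqrt (real N), - 1 / sqrt (real N)}"
 have bij: "bij_betw (%h i. if i < N then h i else 0) ({..<N} \<rightarrow>\<^sub>E B) (S N)"
 proof (rule bij_betw_byWitness[where f'="%v. restrict v {..<N}"])
  show "\<forall>h\<in>{..<N} \<rightarrow>\<^sub>E B. restrict (%i. if i < N then h i else 0) {..<N} = h"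
  proof
   fix h assume "h \<in> {..<N} \<rightarrow>\<^sub>E B"
   then have "h \<in> extensional {..<N}" unfolding PiE_def by simp
   then show "restrict (%i. if i < N then h i else 0) {..<N} = h"
    by (intro extensionalityI[of _ "{..<N}"]) auto
  qed
  show "\<forall>v\<in>S N. (%i. if i < N then restrict v {..<N} i else 0) = v"
   by (intro ballI ext) (auto simp: S_def)
  show "(%h i. if i < N then h i else 0) ` ({..<N} \<rightarrow>\<^sub>E B) \<subseteq> S N"
  proof (rule image_subsetI)
   fix h assume h: "h \<in> {..<N} \<rightarrow>\<^sub>E B"
   have "h i \<in> B" if "i < N" for i by (rule PiE_mem[OF h]) (simp add: that)
   then have "h i = 1 / sqrt (real N) \<or> h i = - 1 / sqrt (real N)" if "i < N" for i using that unfolding B_def by blast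
   then show "(%i. if i < N then h i else 0) \<in> S N" unfolding S_def by simp
  qed
  show "(%v. restrict v {..<N}) ` S N \<subseteq> {..<N} \<rightarrow>\<^sub>E B"
  proof (rule image_subsetI)
   fix v assume "v \<in> S N"
   then have "v i \<in> B" if "i < N" for i using that unfolding S_def B_def by blast
   then show "restrict v {..<N} \<in> {..<N} \<rightarrow>\<^sub>E B" unfolding restrict_PiE_iff by simp
  qed
 qed
 have "(\<Sum>v\<in>S N. exp (c * vinner N u v)) = (\<Sum>h\<in>{..<N} \<rightarrow>\<^sub>E B. exp (c * vinner N u (%i. if i < N then h i else 0)))"
  by (rule sum.reindex_bij_betw[OF bij, symmetric])
 also have "... = (\<Sum>h\<in>{..<N} \<rightarrow>\<^sub>E B. \<Prod>i<N. exp (c * u i * h i))"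
  by (rule sum.cong[OF refl]) (simp add: vinner_def sum_distrib_left exp_sum mult.assoc)
 also have "... = (\<Prod>i<N. \<Sum>y\<in>B. exp (c * u i * y))"
  by (rule prod_sum_PiE[symmetric]) (auto simp: B_def)
 also have "... = (\<Prod>i<N. 2 * cosh (c / real N))"
 proof (rule prod.cong[OF refl])
  fix i assume i: "i \<in> {..<N}"
  have "1 / sqrt (real N) ~= - 1 / sqrt (real N)" using N by (simp add: field_simps)
  then have "(\<Sum>y\<in>B. exp (c * u i * y)) = exp (c * u i * (1 / sqrt (real N))) + exp (c * u i * (- 1 / sqrt (real N)))"
   by (simp add: B_def)
  also have "... = 2 * cosh (c / real N)"
  proof -
   have "u i = 1 / sqrt (real N) \<or> u i = - 1 / sqrt (real N)" using u i by (auto simp: S_def)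
   then show ?thesis by (rule disjE) (simp_all add: cosh_def)
  qed
  finally show "(\<Sum>y\<in>B. exp (c * u i * y)) = 2 * cosh (c / real N)" .
 qed
 finally show ?thesis by simp
qed

context pspin
begin

text \<open>Linearise the square by an auxiliary Gaussian variable.\<close>
lemma overlap_square_mgf:
 assumes u: "u \<in> S N" and a: "0 <= a" "a < 1 / 2"
 shows "avg (%v. exp (a * real N * (vinner N u v)\<^sup>2)) <= 1 / sqrt (1 - 2 * a)"
proof -
 define k where "k = sqrt (2 * a * real N)"
 have k2: "k\<^sup>2 = 2 * a * real N" using a by (simp add: k_def)
 have l: "exp (a * real N * (vinner N u v)\<^sup>2) = (LINT z|stdn. exp ((k * vinner N u v) * z))" for v
  unfolding stdn_exp(2) by (simp add: power_mult_distrib k2)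
 have pw: "avg (%v. exp ((k * vinner N u v) * z)) <= exp (a * z\<^sup>2)" for z
 proof -
  have "avg (%v. exp ((k * vinner N u v) * z)) = cosh (k * z / real N) ^ N"
   using sum_S_exp[OF N u, of "k * z"] N by (simp add: avg_def card_S power_mult_distrib mult_ac)
  also have "... <= exp ((k * z / real N)\<^sup>2 / 2) ^ N" by (rule power_mono[OF cosh_le_exp_square]) (simp add: less_imp_le cosh_real_pos)
  also have "... = exp (a * z\<^sup>2)" using N
   by (simp add: exp_of_nat_mult[symmetric] power_divide power_mult_distrib k2) (simp add: power2_eq_square)
  finally show ?thesis .
 qed
 have "avg (%v. exp (a * real N * (vinner N u v)\<^sup>2)) = (LINT z|stdn. avg (%v. exp ((k * vinner N u v) * z)))"
  unfolding l by (rule avg_integral[symmetric]) (rule stdn_exp(1))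
 also have "... <= (LINT z|stdn. exp (a * z\<^sup>2))"
 proof (rule integral_mono[OF _ stdn_exp_square(1)[OF a(2)] pw])
  show "integrable stdn (%z. avg (%v. exp ((k * vinner N u v) * z)))"
   unfolding avg_def by (intro Bochner_Integration.integrable_divide Bochner_Integration.integrable_sum stdn_exp(1))
 qed
 finally show ?thesis by (simp add: stdn_exp_square(2)[OF a(2)])
qed

text \<open>Bounds the indicator by 4 / (N * ep^2) * (exp (N * R^2 / 4) - 1), whose mean is
  controlled by the moment at a = 1/4, where 1 / sqrt (1 - 2 * a) <= 2.\<close>

lemma overlap_far:
 assumes u: "u \<in> S N" and e: "ep > 0"
 shows "avg (%v. if ep <= \<bar>vinner N u v\<bar> then 1 else 0) <= 4 / (real N * ep\<^sup>2)"
proof -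
 have Ne: "real N * ep\<^sup>2 > 0" using N e by simp
 have "avg (%v. if ep <= \<bar>vinner N u v\<bar> then 1 else 0) <= avg (%v. (4 / (real N * ep\<^sup>2)) * (exp (1 / 4 * real N * (vinner N u v)\<^sup>2) - 1))"
 proof (rule avg_mono)
  fix v
  have x: "real N * (vinner N u v)\<^sup>2 / 4 <= exp (1 / 4 * real N * (vinner N u v)\<^sup>2) - 1"
  proof -
   have "1 / 4 * real N * (vinner N u v)\<^sup>2 = real N * (vinner N u v)\<^sup>2 / 4" by simp
   then show ?thesis using exp_ge_add_one_self[of "1 / 4 * real N * (vinner N u v)\<^sup>2"] by linarith
  qed
  show "(if ep <= \<bar>vinner N u v\<bar> then 1 else 0) <= (4 / (real N * ep\<^sup>2)) * (exp (1 / 4 * real N * (vinner N u v)\<^sup>2) - 1)"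
  proof (cases "ep <= \<bar>vinner N u v\<bar>")
   case True
   then have "ep\<^sup>2 <= (vinner N u v)\<^sup>2" using e by (metis abs_le_square_iff abs_of_pos)
   then have "real N * ep\<^sup>2 <= real N * (vinner N u v)\<^sup>2" by (rule mult_left_mono) simp
   then have "real N * ep\<^sup>2 <= 4 * (exp (1 / 4 * real N * (vinner N u v)\<^sup>2) - 1)" using mult_left_mono[OF x, of 4] by simp
   then show ?thesis using Ne True by (simp add: le_divide_eq)
  next
   case False
   then show ?thesis using Ne by (simp add: zero_le_divide_iff)
  qed
 qed
 also have "... = (4 / (real N * ep\<^sup>2)) * (avg (%v. exp (1 / 4 * real N * (vinner N u v)\<^sup>2)) - 1)"
  unfolding avg_cmult using avg_add[of "%v. exp (1 / 4 * real N * (vinner N u v)\<^sup>2)" "%_. -1"] by (simp add: avg_const)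
 also have "... <= (4 / (real N * ep\<^sup>2)) * 1"
 proof (rule mult_left_mono)
  have "sqrt (1/4) <= sqrt (1 - 2 * (1/4::real))" by (rule real_sqrt_le_mono) simp
  then have "1/2 <= sqrt (1 - 2 * (1/4::real))" by (simp add: real_sqrt_divide)
  then have "1 / sqrt (1 - 2 * (1/4::real)) <= 2" by (simp add: divide_le_eq)
  then show "avg (%v. exp (1 / 4 * real N * (vinner N u v)\<^sup>2)) - 1 <= 1" using overlap_square_mgf[OF u, of "1/4"] by simp
 qed (use Ne in simp)
 finally show ?thesis by simp
qed

section \<open>Large entropy forces exponential decay of the likelihood\<close>

text \<open>By monotonicity the entropy stays above N * d on [b1, b2], so there two posterior
  samples have overlap power at least ka up to a small planted probability. This gives h' <= -(b * N
  * ka / 8) * (h - m) for the Hellinger affinity h, with an exponentially small m. Integrating from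
  b1 to b2 and using exp (logmean / 2) <= h gives the bound.\<close>

lemma logmean_decay:
 assumes b: "0 < b1" "b1 < b2" and d: "d > 0" "entropy b1 >= real N * d"
 defines "ka == min 1 (d / (2 * b2\<^sup>2))" and "c == min (d\<^sup>2 / (32 * b2\<^sup>2)) (d / 2)"
 shows "exp (logmean b2 / 2) <= 4 / ka * exp (- (c / 2) * real N) + exp (- (ka * (b2\<^sup>2 - b1\<^sup>2) / 16) * real N)"
proof -
 interpret P: prob_space "gau (idx p N)" by (rule prob_space_gau)
 define q where "q sg ta = (if vinner N sg ta ^ p < ka then 1 else 0 :: real)" for sg ta
 \<comment> \<open>Posterior probability that two samples have small overlap; under the planted law
   one of them may be taken to be the signal.\<close>
 define e where "e b g = post b g (%sg. post b g (q sg))" for b g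
 \<comment> \<open>The rate c is halved because the Hellinger integral is weighted by sqrt L:
   E[L * e] <= 2 * t^2 yields only E[sqrt L * e] <= 2 * t.\<close>
 define t where "t = exp (- (c / 2) * real N)"
 define m where "m = 4 / ka * t"
 have k: "0 < ka" "ka <= 1" using b d by (auto simp: ka_def)
 have t: "t > 0" "t * t = exp (- c * real N)" by (simp_all add: t_def exp_add[symmetric])
 have em [measurable]: "e b \<in> borel_measurable (gau (idx p N))" for b
  unfolding e_def[abs_def] by (intro measurable_post) measurable
 have p1m: "(%g. post b g (q sg)) \<in> borel_measurable (gau (idx p N))" for b sg by (rule measurable_post) simp
 have ee: "expb (idx p N) (e b)" for b unfolding e_def[abs_def] by (intro expb_post expb_const)
 have q01: "0 <= q sg ta" "q sg ta <= 1" for sg ta by (auto simp: q_def)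
 have e01: "0 <= e b g" "e b g <= 1" for b g
  unfolding e_def by (intro post_nonneg q01) (intro post_le q01)
 have ineq: "- (b / 4) * (LINT g|gau (idx p N). sqrt (L b g) * post b g (%sg. post b g (K sg))) <= - (b * real N * ka / 8) * (hellinger b - m)"
  if bb: "b1 <= b" "b <= b2" for b
 proof -
  have b0: "0 < b" using bb b by linarith
  have ent: "entropy b >= real N * d" using entropy_mono[of b1 b] b bb d by linarith
  have "(LINT g|gau (idx p N). L b g * e b g) = avg (%sg. \<integral>g. post b (obs b sg g) (q sg) \<partial>gau (idx p N))"
   unfolding e_def
  proof (rule planted_expectation)
   show "(%g. post b g (q sg)) \<in> borel_measurable (gau (idx p N))" for sg by (rule p1m)
   show "integrable (gau (idx p N)) (%g. lik b sg g * post b g (q sg))" for sg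
    by (rule expb_integrable[OF I expb_mult[OF expb_lik expb_post]]) (rule expb_const)
  qed
  also have "... <= avg (%sg. exp (- (d\<^sup>2 / (32 * b2\<^sup>2)) * real N) + exp (- (d / 2) * real N))"
   unfolding q_def by (rule avg_mono, rule overlap_small[OF b0 bb(2) d(1) ent]) (auto simp: ka_def)
  also have "... <= 2 * (t * t)"
  proof -
   have "exp (- (d\<^sup>2 / (32 * b2\<^sup>2)) * real N) <= t * t" "exp (- (d / 2) * real N) <= t * t"
    unfolding t exp_le_cancel_iff by (intro mult_right_mono; simp add: c_def)+
   then show ?thesis by (simp add: avg_const)
  qed
  finally have Le: "(LINT g|gau (idx p N). L b g * e b g) <= 2 * (t * t)" .
  have iLe: "integrable (gau (idx p N)) (%g. L b g * e b g)" by (rule expb_integrable[OF I expb_mult[OF expb_L ee]])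
  have ise: "integrable (gau (idx p N)) (%g. sqrt (L b g) * e b g)" by (rule expb_integrable[OF I expb_mult[OF expb_sqrt_L ee]])
  have iS: "integrable (gau (idx p N)) (%g. sqrt (L b g))" by (rule expb_integrable[OF I expb_sqrt_L])
  have "(LINT g|gau (idx p N). (2 * t) * (sqrt (L b g) * e b g)) <= (LINT g|gau (idx p N). L b g * e b g + t * t)"
  proof (rule integral_mono)
   show "integrable (gau (idx p N)) (%g. (2 * t) * (sqrt (L b g) * e b g))" using ise by (rule integrable_mult_right)
   show "integrable (gau (idx p N)) (%g. L b g * e b g + t * t)" using iLe by simp
   fix g
   \<comment> \<open>Passes from the weight L to the weight sqrt L; e^2 <= e is used
     afterwards.\<close>
   have "0 <= (sqrt (L b g) * e b g - t)\<^sup>2" by simp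
   also have "... = L b g * (e b g * e b g) - (2 * t) * (sqrt (L b g) * e b g) + t * t"
    using L_pos[of b g] by (simp add: power2_diff power_mult_distrib power2_eq_square[of "e b g"] power2_eq_square[of t])
   also have "L b g * (e b g * e b g) <= L b g * (e b g * 1)"
    using e01 by (intro mult_left_mono less_imp_le[OF L_pos]) auto
   finally show "(2 * t) * (sqrt (L b g) * e b g) <= L b g * e b g + t * t" by simp
  qed
  also have "... <= 3 * (t * t)" using iLe Le by (simp add: P.prob_space)
  finally have "t * (2 * (LINT g|gau (idx p N). sqrt (L b g) * e b g)) <= t * (3 * t)" by (simp add: mult_ac)
  then have se: "(LINT g|gau (idx p N). sqrt (L b g) * e b g) <= 2 * t" using t(1) by (simp add: mult_le_cancel_left_pos)
  have "(LINT g|gau (idx p N). (real N / 2 * ka) * sqrt (L b g) - real N * (sqrt (L b g) * e b g))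
   <= (LINT g|gau (idx p N). sqrt (L b g) * post b g (%sg. post b g (K sg)))"
  proof (rule integral_mono)
   show "integrable (gau (idx p N)) (%g. (real N / 2 * ka) * sqrt (L b g) - real N * (sqrt (L b g) * e b g))"
    by (intro Bochner_Integration.integrable_diff integrable_mult_right iS ise)
   show "integrable (gau (idx p N)) (%g. sqrt (L b g) * post b g (%sg. post b g (K sg)))"
    by (intro expb_integrable[OF I] expb_mult expb_sqrt_L expb_post expb_const)
   fix g
   have "real N / 2 * ka - real N * e b g = post b g (%sg. post b g (%ta. real N / 2 * ka - real N * q sg ta))"
    unfolding e_def post_def by (simp only: gavg_diff gavg_cmult gavg_const[OF posw_lik])
   also have "... <= post b g (%sg. post b g (K sg))"
   proof (intro post_mono)
    fix sg ta assume st: "sg \<in> S N" "ta \<in> S N"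
    \<comment> \<open>On the exceptional event the overlap power is only known to be at least -1,
      which is at least ka - 2.\<close>
    have "ka - 2 * q sg ta <= vinner N sg ta ^ p" using vinner_power_abs[OF st] k by (auto simp: q_def abs_le_iff)
    then have "real N / 2 * (ka - 2 * q sg ta) <= real N / 2 * vinner N sg ta ^ p" by (rule mult_left_mono) simp
    then show "real N / 2 * ka - real N * q sg ta <= K sg ta" by (simp add: K_eq algebra_simps)
   qed
   finally have "sqrt (L b g) * (real N / 2 * ka - real N * e b g) <= sqrt (L b g) * post b g (%sg. post b g (K sg))"
    using L_pos[of b g] by (intro mult_left_mono) auto
   then show "(real N / 2 * ka) * sqrt (L b g) - real N * (sqrt (L b g) * e b g) <= sqrt (L b g) * post b g (%sg. post b g (K sg))"
    by (simp add: algebra_simps)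
  qed
  then have "(real N / 2 * ka) * hellinger b - real N * (LINT g|gau (idx p N). sqrt (L b g) * e b g) <= (LINT g|gau (idx p N). sqrt (L b g) * post b g (%sg. post b g (K sg)))"
   using iS ise by (simp add: hellinger_def)
  moreover have "real N * (LINT g|gau (idx p N). sqrt (L b g) * e b g) <= real N * (2 * t)" by (rule mult_left_mono[OF se]) simp
  ultimately have "(real N / 2 * ka) * hellinger b - real N * (2 * t) <= (LINT g|gau (idx p N). sqrt (L b g) * post b g (%sg. post b g (K sg)))" by linarith
  then have "(b / 4) * ((real N / 2 * ka) * hellinger b - real N * (2 * t)) <= (b / 4) * (LINT g|gau (idx p N). sqrt (L b g) * post b g (%sg. post b g (K sg)))"
   using b0 by (intro mult_left_mono) auto
  moreover have "(b / 4) * ((real N / 2 * ka) * hellinger b - real N * (2 * t)) = (b * real N * ka / 8) * (hellinger b - m)"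
   using k by (simp add: m_def field_simps)
  ultimately show ?thesis unfolding mult_minus_left by linarith
 qed
 \<comment> \<open>exp (a * b^2) is the integrating factor, since 2 * a * b = b * N * ka /
   8.\<close>
 define a where "a = real N * ka / 16"
 have "(hellinger b2 - m) * exp (a * b2\<^sup>2) <= (hellinger b1 - m) * exp (a * b1\<^sup>2)"
 proof (rule DERIV_nonpos_imp_nonincreasing[OF less_imp_le[OF b(2)]])
  fix b assume bb: "b1 <= b" "b <= b2"
  let ?h = "- (b / 4) * (LINT g|gau (idx p N). sqrt (L b g) * post b g (%sg. post b g (K sg)))"
  have "((%b. (hellinger b - m) * exp (a * b\<^sup>2)) has_real_derivative ?h * exp (a * b\<^sup>2) + (hellinger b - m) * (exp (a * b\<^sup>2) * (a * (2 * b)))) (at b)"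
   by (auto intro!: derivative_eq_intros hellinger_deriv)
  moreover have "?h * exp (a * b\<^sup>2) + (hellinger b - m) * (exp (a * b\<^sup>2) * (a * (2 * b))) <= 0"
  proof -
   have "?h * exp (a * b\<^sup>2) <= (- (b * real N * ka / 8) * (hellinger b - m)) * exp (a * b\<^sup>2)" by (rule mult_right_mono[OF ineq[OF bb]]) simp
   also have "... = - ((hellinger b - m) * (exp (a * b\<^sup>2) * (a * (2 * b))))" by (simp add: a_def)
   finally show ?thesis by simp
  qed
  ultimately show "\<exists>y. ((%b. (hellinger b - m) * exp (a * b\<^sup>2)) has_real_derivative y) (at b) \<and> y <= 0" by blast
 qed
 also have "... <= 1 * exp (a * b1\<^sup>2)"
 proof (rule mult_right_mono)
  have "m >= 0" using k t by (simp add: m_def)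
  then show "hellinger b1 - m <= 1" using hellinger_le_1[of b1] by linarith
 qed simp
 finally have "(hellinger b2 - m) * exp (a * b2\<^sup>2) * exp (- (a * b2\<^sup>2)) <= 1 * exp (a * b1\<^sup>2) * exp (- (a * b2\<^sup>2))"
  by (rule mult_right_mono) simp
 then have "hellinger b2 - m <= exp (- (a * (b2\<^sup>2 - b1\<^sup>2)))"
  by (simp add: mult.assoc exp_add[symmetric] right_diff_distrib)
 then have "hellinger b2 <= m + exp (- (a * (b2\<^sup>2 - b1\<^sup>2)))" by simp
 also have "- (a * (b2\<^sup>2 - b1\<^sup>2)) = - (ka * (b2\<^sup>2 - b1\<^sup>2) / 16) * real N" by (simp add: a_def)
 finally show ?thesis using exp_logmean_le_hellinger[of b2] by (simp add: m_def t_def)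
qed

text \<open>Two parameters are involved: the observation is planted at b, the likelihood is taken at
  be. Either L b is at least exp (et * N / 2), which has small planted probability by Markov for the
  entropy, or the planted density is below exp (et * N / 2) relative to pure noise, under which L be
  >= exp (et * N) has probability at most exp (-et * N).\<close>

lemma planted_tail:
 assumes et: "et > 0"
 shows "avg (%u. \<integral>g. (if exp (et * real N) <= L be (obs b u g) then 1 else 0) \<partial>gau (idx p N))
  <= 2 * (entropy b + 1) / (et * real N) + exp (- (et / 2) * real N)"
proof -
 interpret P: prob_space "gau (idx p N)" by (rule prob_space_gau)
 let ?h = "%g. if exp (et * real N) <= L be g then 1 else 0 :: real"
 have hm: "Measurable.pred (gau (idx p N)) (%g. exp (et * real N) <= L be g)" by measurable
 have iLl: "integrable (gau (idx p N)) (%g. L b g * ln (L b g))" by (rule expb_integrable[OF I expb_mult[OF expb_L expb_lnL]])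
 have iL: "integrable (gau (idx p N)) (L be)" by (rule expb_integrable[OF I expb_L])
 have etN: "et * real N / 2 > 0" using et N by simp
 have "avg (%u. \<integral>g. ?h (obs b u g) \<partial>gau (idx p N)) = (LINT g|gau (idx p N). L b g * ?h g)"
  by (rule planted_expectation_L[symmetric, OF _ expb_ind[OF hm]]) (use hm in measurable)
 also have "... <= (LINT g|gau (idx p N). (L b g * ln (L b g) + 1) / (et * real N / 2) + exp (- (et / 2) * real N) * L be g)"
 proof (rule integral_mono)
  show "integrable (gau (idx p N)) (%g. L b g * ?h g)" by (rule expb_integrable[OF I expb_mult[OF expb_L expb_ind[OF hm]]])
  show "integrable (gau (idx p N)) (%g. (L b g * ln (L b g) + 1) / (et * real N / 2) + exp (- (et / 2) * real N) * L be g)"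
   using iLl iL by simp
  fix g
  \<comment> \<open>x * ln x >= x - 1, so adding 1 makes the entropy integrand nonnegative and
    Markov's inequality applicable.\<close>
  have "1 - 1 / L b g <= ln (L b g)" using ln_le_minus_one[of "1 / L b g"] L_pos[of b g] by (simp add: ln_div)
  then have "L b g * (1 - 1 / L b g) <= L b g * ln (L b g)" by (intro mult_left_mono less_imp_le[OF L_pos])
  then have xl: "0 <= L b g * ln (L b g) + 1" using L_pos[of b g] by (simp add: right_diff_distrib)
  then have xl': "0 <= (L b g * ln (L b g) + 1) / (et * real N / 2)" using etN by (intro divide_nonneg_pos)
  have p2: "0 <= exp (- (et / 2) * real N) * L be g" using L_pos[of be g] by simp
  consider "\<not> exp (et * real N) <= L be g" | "exp (et * real N) <= L be g" "et * real N / 2 <= ln (L b g)"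
   | "exp (et * real N) <= L be g" "\<not> et * real N / 2 <= ln (L b g)" by blast
  then show "L b g * ?h g <= (L b g * ln (L b g) + 1) / (et * real N / 2) + exp (- (et / 2) * real N) * L be g"
  proof cases
   case 1 then show ?thesis using xl' p2 by simp
  next
   case 2
   have "L b g * (et * real N / 2) <= L b g * ln (L b g) + 1"
    using mult_left_mono[OF 2(2) less_imp_le[OF L_pos[of b g]]] by linarith
   then have "L b g <= (L b g * ln (L b g) + 1) / (et * real N / 2)" using etN by (simp only: le_divide_eq if_True)
   then show ?thesis using 2 p2 by simp
  next
   case 3
   then have "L b g <= exp (et * real N / 2)" using ln_ge_iff[OF L_pos[of b g], of "et * real N / 2"] by linarith
   also have "... = exp (- (et / 2) * real N) * exp (et * real N)" by (simp add: exp_add[symmetric])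
   also have "... <= exp (- (et / 2) * real N) * L be g" by (rule mult_left_mono[OF 3(1)]) simp
   finally show ?thesis using xl' 3(1) by simp
  qed
 qed
 also have "... = 2 * (entropy b + 1) / (et * real N) + exp (- (et / 2) * real N)"
  using iLl iL by (simp add: P.prob_space entropy_def L_expectation)
 finally show ?thesis .
qed

end

section \<open>The truncated second moment\<close>

context pspin
begin

abbreviation exg :: "((nat list => real) => real) => real" where
 "exg f == integral\<^sup>L (gau (idx p N)) f"

lemma exg_int: "expb (idx p N) f ==> integrable (gau (idx p N)) f"
 by (rule expb_integrable[OF I])

lemma exg_mono:
 "expb (idx p N) f ==> expb (idx p N) h ==> (!!g. f g <= h g) ==> exg f <= exg h"
 by (rule integral_mono) (auto intro: exg_int)

lemma exg_add: "expb (idx p N) f ==> expb (idx p N) h ==> exg (%g. f g + h g) = exg f + exg h"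
 by (rule Bochner_Integration.integral_add) (auto intro: exg_int)

lemma exg_diff: "expb (idx p N) f ==> expb (idx p N) h ==> exg (%g. f g - h g) = exg f - exg h"
 by (rule Bochner_Integration.integral_diff) (auto intro: exg_int)

lemma exg_const: "exg (%_. c) = c"
proof -
 interpret P: prob_space "gau (idx p N)" by (rule prob_space_gau)
 show ?thesis by (simp add: P.prob_space)
qed

lemma exg_avg: "(!!u. u \<in> S N ==> expb (idx p N) (f u)) ==> exg (%g. avg (%u. f u g)) = avg (%u. exg (f u))"
 by (rule avg_integral) (rule exg_int)

text \<open>Far means far from orthogonal to u: the part of L due to signals with macroscopic
  overlap with u, including u itself when ep <= 1.\<close>

definition farlik :: "real => real => (nat => real) => (nat list => real) => real" where
 "farlik be ep u g = avg (%v. lik be v g * (if ep <= \<bar>vinner N u v\<bar> then 1 else 0))"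

text \<open>An observation counts for u only if the signals correlated with u carry little
  likelihood. The condition bounds the correlated part of the second moment, while the likelihood
  alone controls the nearly orthogonal part.\<close>

definition trunc :: "real => real => real => (nat => real) => (nat list => real) => real" where
 "trunc be ep de u g = (if farlik be ep u g <= de then lik be u g else 0)"

lemma measurable_farlik [measurable]: "farlik be ep u \<in> borel_measurable (gau (idx p N))"
 unfolding farlik_def[abs_def] avg_def by measurable

lemma measurable_trunc [measurable]: "trunc be ep de u \<in> borel_measurable (gau (idx p N))"
 unfolding trunc_def[abs_def] by measurable

lemma trunc_bounds: "0 <= trunc be ep de u g" "trunc be ep de u g <= lik be u g"
 using lik_pos[of be u g] by (auto simp: trunc_def)

lemma expb_trunc: "expb (idx p N) (trunc be ep de u)"
 by (rule expb_mono[OF expb_lik measurable_trunc]) (use trunc_bounds in \<open>simp add: less_imp_le[OF lik_pos]\<close>)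

lemma expb_farlik: "expb (idx p N) (farlik be ep u)"
 unfolding farlik_def[abs_def] by (intro expb_avg expb_mult expb_lik expb_const)

text \<open>Raising the planted strength from be to b multiplies the likelihood of a signal with
  overlap R by exp (be * (b - be) * N / 2 * R^p), at least exp (2 * et * N) when R^p > 0 and |R| >=
  ep. That part of the far likelihood observed at be is thus exponentially smaller than L be
  observed at b. If R^p <= 0, planting does not increase the likelihood and the pure noise term
  suffices.\<close>

lemma farlik_obs:
 assumes b: "0 < be" "be < b" and e: "ep > 0" and u: "u \<in> S N"
 defines "et == be * (b - be) * ep ^ p / 4"
 shows "farlik be ep u (obs be u g) <= farlik be ep u g + exp (- (2 * et) * real N) * L be (obs b u g)"
proof -
 have "farlik be ep u (obs be u g) <= avg (%v. lik be v g * (if ep <= \<bar>vinner N u v\<bar> then 1 else 0) + exp (- (2 * et) * real N) * lik be v (obs b u g))"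
  unfolding farlik_def
 proof (rule avg_mono)
  fix v
  let ?R = "vinner N u v"
  have p2: "0 <= exp (- (2 * et) * real N) * lik be v (obs b u g)" using lik_pos[of be v "obs b u g"] by simp
  consider "\<not> ep <= \<bar>?R\<bar>" | "ep <= \<bar>?R\<bar>" "?R ^ p <= 0" | "ep <= \<bar>?R\<bar>" "?R ^ p > 0" by linarith
  then show "lik be v (obs be u g) * (if ep <= \<bar>?R\<bar> then 1 else 0)
   <= lik be v g * (if ep <= \<bar>?R\<bar> then 1 else 0) + exp (- (2 * et) * real N) * lik be v (obs b u g)"
  proof cases
   case 1 then show ?thesis using p2 by simp
  next
   case 2
   then have "be * be * K v u <= 0" unfolding K_eq vinner_sym[of N v] by (intro mult_nonneg_nonpos) auto
   then have "lik be v g * exp (be * be * K v u) <= lik be v g * 1" by (intro mult_left_mono less_imp_le[OF lik_pos]) simp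
   then show ?thesis using p2 2 unfolding lik_obs[of be v be] by simp
  next
   case 3
   have "ep ^ p <= \<bar>?R\<bar> ^ p" using 3 e by (intro power_mono) auto
   also have "... = ?R ^ p" using 3(2) by (simp add: power_abs[symmetric])
   finally have "(be * (b - be) * (real N / 2)) * ep ^ p <= (be * (b - be) * (real N / 2)) * ?R ^ p" using b by (intro mult_left_mono) auto
   moreover have "(be * (b - be) * (real N / 2)) * ep ^ p = 2 * et * real N" by (simp add: et_def)
   moreover have "(be * (b - be) * (real N / 2)) * ?R ^ p = be * b * K v u - be * be * K v u"
    unfolding K_eq vinner_sym[of N v] by (simp add: algebra_simps)
   ultimately have "be * be * K v u <= - (2 * et) * real N + be * b * K v u" unfolding mult_minus_left by linarith
   then have "exp (be * be * K v u) <= exp (- (2 * et) * real N) * exp (be * b * K v u)" by (simp add: exp_add[symmetric])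
   then have "lik be v g * exp (be * be * K v u) <= lik be v g * (exp (- (2 * et) * real N) * exp (be * b * K v u))"
    by (intro mult_left_mono less_imp_le[OF lik_pos])
   then have "lik be v (obs be u g) <= exp (- (2 * et) * real N) * lik be v (obs b u g)" unfolding lik_obs by (simp only: mult_ac)
   then show ?thesis using 3 less_imp_le[OF lik_pos[of be v g]] by (simp add: add_increasing)
  qed
 qed
 then show ?thesis by (simp add: avg_add avg_cmult L_def farlik_def)
qed

text \<open>With the same noise g in both observations, the truncation fails at be only if L be
  observed at b reaches exp (et * N), which is rare by \<open>planted_tail\<close>, or if the far
  part under pure noise exceeds de / 2, which is rare by Markov and
  \<open>overlap_far\<close>.\<close>

lemma trunc_mass:
 assumes b: "0 < be" "be < b" and e: "ep > 0" and d: "de > 0"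
 defines "et == be * (b - be) * ep ^ p / 4"
 assumes small: "exp (- et * real N) <= de / 2"
 shows "1 - (2 * (entropy b + 1) / (et * real N) + exp (- (et / 2) * real N) + 8 / (de * ep\<^sup>2 * real N)) <= exg (%g. avg (%u. trunc be ep de u g))"
proof -
 have et: "et > 0" using b e by (simp add: et_def)
 let ?A = "%u g. if exp (et * real N) <= L be (obs b u g) then 1 else 0 :: real"
 have m1: "Measurable.pred (gau (idx p N)) (%g. exp (et * real N) <= L be (obs b u g))" for u by measurable
 have m2: "Measurable.pred (gau (idx p N)) (%g. farlik be ep u (obs be u g) <= de)" for u by measurable
 have m3: "(%g. if farlik be ep u g <= de then 1 else 0 :: real) \<in> borel_measurable (gau (idx p N))" for u by measurable
 have one: "1 - (exg (?A u) + 8 / (de * ep\<^sup>2 * real N)) <= exg (trunc be ep de u)" if u: "u \<in> S N" for u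
 proof -
  have pw: "1 - (?A u g + (2 / de) * farlik be ep u g) <= (if farlik be ep u (obs be u g) <= de then 1 else 0)" for g
  proof -
   have f0: "0 <= (2 / de) * farlik be ep u g" unfolding farlik_def using d less_imp_le[OF lik_pos]
    by (intro mult_nonneg_nonneg avg_nonneg) auto
   show ?thesis
   proof (cases "exp (et * real N) <= L be (obs b u g) \<or> farlik be ep u (obs be u g) <= de")
    case True then show ?thesis using f0 by auto
   next
    case False
    have "exp (- (2 * et) * real N) * L be (obs b u g) <= exp (- (2 * et) * real N) * exp (et * real N)"
     using False by (intro mult_left_mono) auto
    also have "... = exp (- et * real N)" by (simp add: exp_add[symmetric])
    finally have "de < farlik be ep u g + de / 2" using farlik_obs[OF b e u, folded et_def, of g] small False by linarith
    then have "1 <= (2 / de) * farlik be ep u g" using d by (simp add: field_simps)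
    then show ?thesis by auto
   qed
  qed
  have "exg (farlik be ep u) = avg (%v. if ep <= \<bar>vinner N u v\<bar> then 1 else 0)"
   unfolding farlik_def[abs_def]
   by (subst exg_avg) (auto intro!: expb_mult expb_lik avg_cong simp: lik_expectation)
  then have ef: "exg (farlik be ep u) <= 4 / (real N * ep\<^sup>2)" using overlap_far[OF u e] by simp
  have x2: "expb (idx p N) (%g. (2 / de) * farlik be ep u g)" by (rule expb_mult[OF expb_const expb_farlik])
  have "exg (%g. 1 - (?A u g + (2 / de) * farlik be ep u g)) <= exg (%g. if farlik be ep u (obs be u g) <= de then 1 else 0)"
   by (rule exg_mono[OF expb_diff[OF expb_const expb_add[OF expb_ind[OF m1] x2]] expb_ind[OF m2] pw])
  also have "... = exg (%g. lik be u g * (if farlik be ep u g <= de then 1 else 0))"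
   by (rule lik_integral[OF m3 u, symmetric])
  also have "... = exg (trunc be ep de u)"
   by (rule Bochner_Integration.integral_cong[OF refl]) (simp add: trunc_def)
  also have "exg (%g. 1 - (?A u g + (2 / de) * farlik be ep u g)) = 1 - (exg (?A u) + (2 / de) * exg (farlik be ep u))"
   unfolding exg_diff[OF expb_const expb_add[OF expb_ind[OF m1] x2]] exg_add[OF expb_ind[OF m1] x2] exg_const by simp
  finally have A: "1 - (exg (?A u) + (2 / de) * exg (farlik be ep u)) <= exg (trunc be ep de u)" .
  have "(2 / de) * exg (farlik be ep u) <= (2 / de) * (4 / (real N * ep\<^sup>2))" using ef d by (intro mult_left_mono) auto
  also have "... = 8 / (de * ep\<^sup>2 * real N)" by simp
  finally show ?thesis using A by linarith
 qed
 have "avg (%u. 1 - (exg (?A u) + 8 / (de * ep\<^sup>2 * real N))) <= avg (%u. exg (trunc be ep de u))"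
  by (rule avg_mono[OF one])
 also have "avg (%u. 1 - (exg (?A u) + 8 / (de * ep\<^sup>2 * real N))) = 1 - (avg (%u. exg (?A u)) + 8 / (de * ep\<^sup>2 * real N))"
 proof -
  have "(%u. 1 - (exg (?A u) + 8 / (de * ep\<^sup>2 * real N))) = (%u. (1 - 8 / (de * ep\<^sup>2 * real N)) + (-1) * exg (?A u))" by (simp add: fun_eq_iff)
  then show ?thesis by (simp only: avg_add avg_const avg_cmult)
 qed
 also have "avg (%u. exg (trunc be ep de u)) = exg (%g. avg (%u. trunc be ep de u g))"
  by (rule exg_avg[symmetric]) (rule expb_trunc)
 finally show ?thesis using planted_tail[OF et, of be b] by linarith
qed

text \<open>Pairs with |R| < ep have E[lik * lik] = exp (be^2 * N / 2 * R^p), and |R|^p <= ep * R^2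
  because p >= 3, so \<open>overlap_square_mgf\<close> sums them. For the other pairs the truncation
  bounds the inner sum by de. The weight rh is 1 for total variation (with r = 1) and the absolute
  overlap for recovery (with r = ep).\<close>

lemma trunc_pair:
 assumes e: "0 < ep" "ep <= 1" and be: "be\<^sup>2 * ep < 1" and d: "de > 0" and r: "0 <= r"
  and rh: "!!u v. u \<in> S N ==> v \<in> S N ==> 0 <= rh u v \<and> rh u v <= 1 \<and> (\<bar>vinner N u v\<bar> < ep --> rh u v <= r)"
 shows "exg (%g. avg (%u. avg (%v. trunc be ep de u g * trunc be ep de v g * rh u v))) <= r / sqrt (1 - be\<^sup>2 * ep) + de"
proof -
 let ?T = "%g. avg (%u. avg (%v. trunc be ep de u g * trunc be ep de v g * rh u v))"
 let ?n = "%u v. if \<bar>vinner N u v\<bar> < ep then r else 0"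
 let ?f = "%u v. if ep <= \<bar>vinner N u v\<bar> then 1 else 0 :: real"
 have xT: "expb (idx p N) ?T" by (intro expb_avg expb_mult expb_trunc expb_const)
 have xN: "expb (idx p N) (%g. avg (%u. avg (%v. lik be u g * lik be v g * ?n u v)))"
  by (intro expb_avg expb_mult expb_lik expb_const)
 have xL: "expb (idx p N) (%g. de * L be g)" by (intro expb_mult expb_const expb_L)
 have pw: "?T g <= avg (%u. avg (%v. lik be u g * lik be v g * ?n u v)) + de * L be g" for g
 proof -
  have "?T g <= avg (%u. avg (%v. lik be u g * lik be v g * ?n u v) + de * lik be u g)"
  proof (rule avg_mono)
   fix u assume u: "u \<in> S N"
   have "avg (%v. trunc be ep de u g * trunc be ep de v g * rh u v) <= avg (%v. lik be u g * lik be v g * ?n u v + trunc be ep de u g * (lik be v g * ?f u v))"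
   proof (rule avg_mono)
    fix v assume v: "v \<in> S N"
    have tt: "trunc be ep de u g * trunc be ep de v g <= lik be u g * lik be v g"
     using lik_pos[of be u g] by (intro mult_mono trunc_bounds) auto
    have tt2: "trunc be ep de u g * trunc be ep de v g <= trunc be ep de u g * lik be v g"
     by (intro mult_left_mono trunc_bounds)
    have l0: "0 <= lik be u g * lik be v g" using lik_pos[of be u g] lik_pos[of be v g] by simp
    have t0: "0 <= trunc be ep de u g * lik be v g" using trunc_bounds(1)[of be ep de u g] lik_pos[of be v g] by simp
    show "trunc be ep de u g * trunc be ep de v g * rh u v <= lik be u g * lik be v g * ?n u v + trunc be ep de u g * (lik be v g * ?f u v)"
    proof (cases "\<bar>vinner N u v\<bar> < ep")
     case True
     then have "trunc be ep de u g * trunc be ep de v g * rh u v <= lik be u g * lik be v g * r"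
      using rh[OF u v] by (intro mult_mono tt l0) auto
     then show ?thesis using True by simp
    next
     case False
     have "trunc be ep de u g * trunc be ep de v g * rh u v <= trunc be ep de u g * lik be v g * 1"
      using rh[OF u v] by (intro mult_mono tt2 t0) auto
     then show ?thesis using False by simp
    qed
   qed
   also have "... = avg (%v. lik be u g * lik be v g * ?n u v) + trunc be ep de u g * farlik be ep u g"
    by (simp only: avg_add avg_cmult farlik_def)
   also have "trunc be ep de u g * farlik be ep u g <= de * lik be u g"
    using lik_pos[of be u g] d by (auto simp: trunc_def mult.commute)
   finally show "avg (%v. trunc be ep de u g * trunc be ep de v g * rh u v) <= avg (%v. lik be u g * lik be v g * ?n u v) + de * lik be u g" by simp
  qed
  then show ?thesis by (simp only: avg_add avg_cmult L_def)
 qed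
 have "exg ?T <= exg (%g. avg (%u. avg (%v. lik be u g * lik be v g * ?n u v)) + de * L be g)"
  by (rule exg_mono[OF xT expb_add[OF xN xL] pw])
 also have "... = avg (%u. avg (%v. exg (%g. lik be u g * lik be v g * ?n u v))) + de"
 proof -
  have "exg (%g. avg (%u. avg (%v. lik be u g * lik be v g * ?n u v))) = avg (%u. exg (%g. avg (%v. lik be u g * lik be v g * ?n u v)))"
   by (rule exg_avg) (intro expb_avg expb_mult expb_lik expb_const)
  also have "... = avg (%u. avg (%v. exg (%g. lik be u g * lik be v g * ?n u v)))"
   by (intro avg_cong exg_avg expb_mult expb_lik expb_const)
  finally show ?thesis by (simp add: exg_add[OF xN xL] L_expectation)
 qed
 also have "avg (%u. avg (%v. exg (%g. lik be u g * lik be v g * ?n u v))) <= avg (%u. r * (1 / sqrt (1 - 2 * (be\<^sup>2 * ep / 2))))"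
 proof (rule avg_mono)
  fix u assume u: "u \<in> S N"
  have "avg (%v. exg (%g. lik be u g * lik be v g * ?n u v)) <= avg (%v. r * exp (be\<^sup>2 * ep / 2 * real N * (vinner N u v)\<^sup>2))"
  proof (rule avg_mono)
   fix v assume v: "v \<in> S N"
   show "exg (%g. lik be u g * lik be v g * ?n u v) <= r * exp (be\<^sup>2 * ep / 2 * real N * (vinner N u v)\<^sup>2)"
   proof (cases "\<bar>vinner N u v\<bar> < ep")
    case True
    let ?R = "vinner N u v"
    have "?R ^ p <= \<bar>?R\<bar> ^ p" by (metis abs_ge_self power_abs)
    also have "... = \<bar>?R\<bar> ^ (p - 2) * \<bar>?R\<bar>\<^sup>2" by (subst power_add[symmetric], subst le_add_diff_inverse2) (use p in simp_all)
    also have "\<bar>?R\<bar> ^ (p - 2) <= ep"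
    proof -
     have "\<bar>?R\<bar> ^ (p - 2) <= ep ^ (p - 2)" using True by (intro power_mono) auto
     also have "... <= ep ^ 1" using e p by (intro power_decreasing) auto
     finally show ?thesis by simp
    qed
    finally have "?R ^ p <= ep * ?R\<^sup>2" by (simp add: mult_right_mono)
    then have "be\<^sup>2 * (real N / 2 * ?R ^ p) <= be\<^sup>2 * (real N / 2 * (ep * ?R\<^sup>2))" by (intro mult_left_mono) auto
    then have "exp (be\<^sup>2 * K u v) <= exp (be\<^sup>2 * ep / 2 * real N * ?R\<^sup>2)" by (simp add: K_eq mult_ac)
    then have "exp (be\<^sup>2 * K u v) * r <= exp (be\<^sup>2 * ep / 2 * real N * ?R\<^sup>2) * r" using r by (rule mult_right_mono)
    then show ?thesis using True lik_product[OF u v, of be] by (simp add: mult.commute)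
   qed (use r in simp)
  qed
  also have "... <= r * (1 / sqrt (1 - 2 * (be\<^sup>2 * ep / 2)))"
   unfolding avg_cmult by (rule mult_left_mono[OF overlap_square_mgf[OF u] r]) (use e be in auto)
  finally show "avg (%v. exg (%g. lik be u g * lik be v g * ?n u v)) <= r * (1 / sqrt (1 - 2 * (be\<^sup>2 * ep / 2)))" .
 qed
 finally show ?thesis by (simp add: avg_const)
qed

end

section \<open>From the truncated second moment to total variation and recovery\<close>

context pspin
begin

text \<open>The truncated ratio w has mean at least 1 - e1 and second moment at most 1 + e2, hence
  E|1 - w| <= e through 2 * e * |1 - w| <= (1 - w)^2 + e^2. As w <= L gives control on one side
  only, the estimate is applied to h and to 1 - h, and E L = 1 turns the second into the other
  side.\<close>

lemma tv_bound:
 assumes e: "e > 0" and mass: "1 - e1 <= exg (%g. avg (%u. trunc be ep de u g))"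
  and second: "exg (%g. avg (%u. avg (%v. trunc be ep de u g * trunc be ep de v g * 1))) <= 1 + e2"
  and small: "e2 + 2 * e1 <= e\<^sup>2"
  and h: "h \<in> borel_measurable (gau (idx p N))" "!!g. 0 <= h g \<and> h g <= 1"
 shows "\<bar>exg h - exg (%g. L be g * h g)\<bar> <= e"
proof -
 define w where "w g = avg (%u. trunc be ep de u g)" for g
 have xw: "expb (idx p N) w" unfolding w_def[abs_def] by (intro expb_avg expb_trunc)
 have xc: "expb (idx p N) h" using h by (intro expb_bounded[where B=1]) (auto simp: abs_le_iff intro: order_trans[of _ 0])
 have ww: "avg (%u. avg (%v. trunc be ep de u g * trunc be ep de v g * 1)) = w g * w g" for g
 proof -
  have "avg (%u. avg (%v. trunc be ep de u g * trunc be ep de v g * 1)) = avg (%u. w g * trunc be ep de u g)"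
   unfolding w_def by (simp add: avg_cmult mult.commute)
  then show ?thesis by (simp add: avg_cmult w_def)
 qed
 have wL: "w g <= L be g" for g unfolding w_def L_def by (rule avg_mono) (rule trunc_bounds)
 have xa: "expb (idx p N) (%g. \<bar>1 - w g\<bar>)" by (intro expb_abs expb_diff expb_const xw)
 have xw2: "expb (idx p N) (%g. w g * w g)" by (intro expb_mult xw)
 have xr: "expb (idx p N) (%g. ((1 + e\<^sup>2) + w g * w g) - 2 * w g)" by (intro expb_diff expb_add expb_const xw2 expb_mult xw)
 have "2 * e * exg (%g. \<bar>1 - w g\<bar>) = exg (%g. 2 * e * \<bar>1 - w g\<bar>)" by simp
 also have "... <= exg (%g. ((1 + e\<^sup>2) + w g * w g) - 2 * w g)"
 proof (rule exg_mono[OF _ xr])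
  fix g
  have "0 <= (\<bar>1 - w g\<bar> - e)\<^sup>2" by simp
  then show "2 * e * \<bar>1 - w g\<bar> <= ((1 + e\<^sup>2) + w g * w g) - 2 * w g"
   by (simp add: power2_diff) (simp add: power2_eq_square algebra_simps)
 qed (intro expb_mult expb_const xa)
 also have "... = (1 + e\<^sup>2) + exg (%g. w g * w g) - 2 * exg w"
  unfolding exg_diff[OF expb_add[OF expb_const xw2] expb_mult[OF expb_const xw]] exg_add[OF expb_const xw2] exg_const by simp
 also have "... <= 2 * e * e" using mass second small unfolding ww w_def[symmetric] by (simp add: power2_eq_square)
 finally have X: "exg (%g. \<bar>1 - w g\<bar>) <= e" using e by simp
 have half: "exg ps - exg (%g. L be g * ps g) <= e"
  if xp: "expb (idx p N) ps" and p01: "!!g. 0 <= ps g \<and> ps g <= 1" for ps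
 proof -
  have "exg ps - exg (%g. L be g * ps g) = exg (%g. ps g - L be g * ps g)"
   by (rule exg_diff[symmetric, OF xp expb_mult[OF expb_L xp]])
  also have "... <= exg (%g. \<bar>1 - w g\<bar>)"
  proof (rule exg_mono[OF expb_diff[OF xp expb_mult[OF expb_L xp]] xa])
   fix g
   have "ps g - L be g * ps g = (1 - L be g) * ps g" by (simp add: algebra_simps)
   also have "... <= \<bar>1 - w g\<bar> * ps g" using wL[of g] p01[of g] by (intro mult_right_mono) auto
   also have "... <= \<bar>1 - w g\<bar> * 1" using p01[of g] by (intro mult_left_mono) auto
   finally show "ps g - L be g * ps g <= \<bar>1 - w g\<bar>" by simp
  qed
  finally show ?thesis using X by linarith
 qed
 have "exg (%g. 1 - h g) - exg (%g. L be g * (1 - h g)) <= e"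
  by (rule half) (intro expb_diff expb_const xc, use h in simp)
 also have "exg (%g. 1 - h g) = 1 - exg h" using exg_diff[OF expb_const xc, of 1] by (simp only: exg_const)
 also have "exg (%g. L be g * (1 - h g)) = 1 - exg (%g. L be g * h g)"
  using exg_diff[OF expb_L expb_mult[OF expb_L xc], of be be] by (simp add: L_expectation right_diff_distrib)
 finally show ?thesis using half[OF xc h(2)] by linarith
qed

text \<open>Cauchy-Schwarz in R^N for ta against the average of a u * sgn (overlap of u and ta) * u,
  whose squared norm is a double average of signed overlaps.\<close>

lemma overlap_average_square:
 assumes a: "!!u. 0 <= a u" and t: "ta \<in> S N"
 shows "(avg (%u. a u * \<bar>vinner N u ta\<bar>))\<^sup>2 <= avg (%u. avg (%v. a u * a v * \<bar>vinner N u v\<bar>))"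
proof -
 define s where "s u = sgn (vinner N u ta)" for u
 define c where "c = real (card (S N))"
 have c: "c > 0" using card_pos by (simp add: c_def)
 define A where "A i = avg (%u. a u * s u * u i)" for i
 have s1: "\<bar>s u\<bar> <= 1" for u by (simp add: s_def sgn_if)
 have "avg (%u. a u * \<bar>vinner N u ta\<bar>) = (\<Sum>i<N. A i * ta i)"
 proof -
  have "a u * \<bar>vinner N u ta\<bar> = (\<Sum>i<N. a u * s u * u i * ta i)" for u
  proof -
   have "a u * \<bar>vinner N u ta\<bar> = a u * s u * vinner N u ta" by (simp add: s_def abs_sgn[of "vinner N u ta"] mult_ac)
   then show ?thesis by (simp add: vinner_def sum_distrib_left mult.assoc)
  qed
  then show ?thesis unfolding A_def avg_def sum_divide_distrib[symmetric]
   by (simp add: sum_distrib_right sum_divide_distrib) (rule sum.swap)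
 qed
 then have "(avg (%u. a u * \<bar>vinner N u ta\<bar>))\<^sup>2 <= (\<Sum>i<N. (A i)\<^sup>2) * (\<Sum>i<N. (ta i)\<^sup>2)"
  using Cauchy_Schwarz_ineq_sum[of A ta "{..<N}"] by simp
 also have "(\<Sum>i<N. (ta i)\<^sup>2) = 1" using vinner_self[OF t N] by (simp add: vinner_def power2_eq_square)
 also have "(\<Sum>i<N. (A i)\<^sup>2) * 1 = avg (%u. avg (%v. (a u * s u) * (a v * s v) * vinner N u v))"
 proof -
  have "(A i)\<^sup>2 = (\<Sum>u\<in>S N. \<Sum>v\<in>S N. (a u * s u) * (a v * s v) * (u i * v i)) / c / c" for i
   unfolding A_def avg_def c_def[symmetric] power2_eq_square by (simp add: sum_product mult_ac)
  then have "(\<Sum>i<N. (A i)\<^sup>2) = (\<Sum>i<N. \<Sum>u\<in>S N. \<Sum>v\<in>S N. (a u * s u) * (a v * s v) * (u i * v i)) / c / c"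
   by (simp add: sum_divide_distrib)
  also have "(\<Sum>i<N. \<Sum>u\<in>S N. \<Sum>v\<in>S N. (a u * s u) * (a v * s v) * (u i * v i)) = (\<Sum>u\<in>S N. \<Sum>i<N. \<Sum>v\<in>S N. (a u * s u) * (a v * s v) * (u i * v i))"
   by (rule sum.swap)
  also have "... = (\<Sum>u\<in>S N. \<Sum>v\<in>S N. (a u * s u) * (a v * s v) * vinner N u v)"
   unfolding vinner_def sum_distrib_left by (intro sum.cong refl sum.swap)
  finally show ?thesis unfolding avg_def c_def[symmetric] by (simp add: sum_divide_distrib)
 qed
 also have "... <= avg (%u. avg (%v. a u * a v * \<bar>vinner N u v\<bar>))"
 proof (intro avg_mono)
  fix u v
  have "(a u * s u) * (a v * s v) * vinner N u v <= \<bar>(a u * s u) * (a v * s v) * vinner N u v\<bar>" by (rule abs_ge_self)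
  also have "... = (a u * a v * \<bar>vinner N u v\<bar>) * (\<bar>s u\<bar> * \<bar>s v\<bar>)" using a by (simp add: abs_mult mult_ac)
  also have "... <= (a u * a v * \<bar>vinner N u v\<bar>) * 1"
   using a[of u] a[of v] s1[of u] s1[of v] by (intro mult_left_mono mult_le_one) auto
  finally show "(a u * s u) * (a v * s v) * vinner N u v <= a u * a v * \<bar>vinner N u v\<bar>" by simp
 qed
 finally show ?thesis .
qed

text \<open>Replacing likelihoods by truncated ones costs E[L - w] <= e1. For each fixed estimate ta
  the truncated overlap average x satisfies x^2 <= B with B independent of ta, so x <= (B / e + e) /
  2 and this bound survives averaging over the kernel m.\<close>

lemma recovery_bound:
 assumes e: "e > 0" and mass: "1 - e1 <= exg (%g. avg (%u. trunc be ep de u g))"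
  and second: "exg (%g. avg (%u. avg (%v. trunc be ep de u g * trunc be ep de v g * \<bar>vinner N u v\<bar>))) <= e\<^sup>2"
  and m: "!!ta. ta \<in> S N ==> m ta \<in> borel_measurable (gau (idx p N))" "!!ta g. 0 <= m ta g" "!!g. (\<Sum>ta\<in>S N. m ta g) = 1"
 shows "exg (%g. avg (%u. lik be u g * (\<Sum>ta\<in>S N. m ta g * \<bar>vinner N u ta\<bar>))) <= e1 + e"
proof -
 let ?f = "%u g. \<Sum>ta\<in>S N. m ta g * \<bar>vinner N u ta\<bar>"
 let ?t = "trunc be ep de"
 define w where "w g = avg (%u. ?t u g)" for g
 define B where "B g = avg (%u. avg (%v. ?t u g * ?t v g * \<bar>vinner N u v\<bar>))" for g
 have xw: "expb (idx p N) w" unfolding w_def[abs_def] by (intro expb_avg expb_trunc)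
 have xB: "expb (idx p N) B" unfolding B_def[abs_def] by (intro expb_avg expb_mult expb_trunc expb_const)
 have m1: "m ta g <= 1" if "ta \<in> S N" for ta g
  using member_le_sum[OF that, of "%ta. m ta g"] finite_S m by simp
 have xm: "expb (idx p N) (m ta)" if "ta \<in> S N" for ta
  by (rule expb_bounded[where B=1]) (use m m1 that in auto)
 have f1: "?f u g <= 1" if "u \<in> S N" for u g
 proof -
  have "?f u g <= (\<Sum>ta\<in>S N. m ta g * 1)" by (intro sum_mono mult_left_mono vinner_abs that m)
  then show ?thesis using m by simp
 qed
 have pw: "avg (%u. lik be u g * ?f u g) <= (L be g - w g) + (B g / e + e) / 2" for g
 proof -
  have "avg (%u. lik be u g * ?f u g) <= avg (%u. (lik be u g + (-1) * ?t u g) + ?t u g * ?f u g)"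
  proof (rule avg_mono)
   fix u assume u: "u \<in> S N"
   have "(lik be u g - ?t u g) * ?f u g <= (lik be u g - ?t u g) * 1"
    using trunc_bounds(2)[of be ep de u g] by (intro mult_left_mono f1[OF u]) simp
   then show "lik be u g * ?f u g <= (lik be u g + (-1) * ?t u g) + ?t u g * ?f u g"
    unfolding left_diff_distrib by linarith
  qed
  also have "... = (L be g - w g) + avg (%u. ?t u g * ?f u g)"
   unfolding avg_add avg_cmult by (simp add: L_def w_def)
  also have "avg (%u. ?t u g * ?f u g) = (\<Sum>ta\<in>S N. m ta g * avg (%u. ?t u g * \<bar>vinner N u ta\<bar>))"
   unfolding avg_def sum_distrib_left times_divide_eq_right sum_divide_distrib
   by (subst sum.swap) (simp add: mult_ac)
  also have "... <= (\<Sum>ta\<in>S N. m ta g * ((B g / e + e) / 2))"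
  proof (intro sum_mono mult_left_mono m)
   fix ta assume t: "ta \<in> S N"
   define x where "x = avg (%u. ?t u g * \<bar>vinner N u ta\<bar>)"
   have "x\<^sup>2 <= B g" unfolding x_def B_def by (rule overlap_average_square[OF trunc_bounds(1) t])
   then have "2 * x * e <= B g + e\<^sup>2" using zero_le_power2[of "x - e"] unfolding power2_diff by linarith
   then show "x <= (B g / e + e) / 2" using e by (simp add: field_simps power2_eq_square)
  qed
  also have "... = (B g / e + e) / 2" unfolding sum_distrib_right[symmetric] m(3) by simp
  finally show ?thesis by simp
 qed
 have xs: "expb (idx p N) (%g. L be g - w g)" by (intro expb_diff expb_L xw)
 have xt: "expb (idx p N) (%g. (B g / e + e) / 2)" unfolding divide_inverse by (intro expb_mult expb_add xB expb_const)
 have "exg (%g. avg (%u. lik be u g * ?f u g)) <= exg (%g. (L be g - w g) + (B g / e + e) / 2)"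
  by (rule exg_mono[OF _ expb_add[OF xs xt] pw]) (intro expb_avg expb_mult expb_lik expb_sum xm expb_const)
 also have "... = (1 - exg w) + (exg B / e + e) / 2"
 proof -
  interpret P: prob_space "gau (idx p N)" by (rule prob_space_gau)
  have "exg (%g. (B g / e + e) / 2) = (exg B / e + e) / 2" using exg_int[OF xB] by (simp add: P.prob_space)
  then show ?thesis unfolding exg_add[OF xs xt] exg_diff[OF expb_L xw] L_expectation by simp
 qed
 also have "... <= e1 + e"
 proof -
  have "exg B / e <= e\<^sup>2 / e" using second e unfolding B_def[abs_def] by (intro divide_right_mono) auto
  then have "exg B / e <= e" using e by (simp add: power2_eq_square)
  moreover have "1 - e1 <= exg w" using mass by (simp only: w_def[abs_def])
  moreover have "1 - x + (y + e) / 2 <= e1 + e" if "y <= e" "1 - e1 <= x" for x y :: real using that by (simp add: field_simps)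
  ultimately show ?thesis by blast
 qed
 finally show ?thesis .
qed

section \<open>Estimates above the critical value and bounds on its location\<close>

text \<open>The planted density relative to noise is L itself, so on the event L <= x it is at most
  x.\<close>

lemma L_lower_planted:
 "avg (%u. exg (%g. if L be (obs be u g) <= x then 1 else 0)) <= x" if "x >= 0"
proof -
 have m: "Measurable.pred (gau (idx p N)) (%g. L be g <= x)" by measurable
 have "avg (%u. exg (%g. if L be (obs be u g) <= x then 1 else 0)) = exg (%g. L be g * (if L be g <= x then 1 else 0))"
  by (rule planted_expectation_L[symmetric, OF _ expb_ind[OF m]]) (use m in measurable)
 also have "... <= exg (%_. x)"
  by (rule exg_mono[OF expb_mult[OF expb_L expb_ind[OF m]] expb_const]) (use that in auto)
 finally show ?thesis by (simp only: exg_const)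
qed

text \<open>Suppose L is at most exp (-de * N) under noise while the planted one is at least exp
  (-de * N / 2). Signals with |overlap| < c are tilted by at most exp (de * N / 4), by the choice of
  c, so their posterior mass is at most exp (-de * N / 4) <= 1/2.\<close>

lemma posterior_overlap:
 assumes c: "c > 0" "be\<^sup>2 * (c ^ p / 2) <= de / 4" and d: "exp (- (de / 4) * real N) <= 1 / 2"
 shows "avg (%u. exg (%g. if 1 / 2 < post be (obs be u g) (%ta. if \<bar>vinner N u ta\<bar> < c then 1 else 0) then 1 else 0))
  <= exg (%g. if exp (- de * real N) < L be g then 1 else 0) + exp (- (de / 2) * real N)"
proof -
 let ?q = "%u ta. if \<bar>vinner N u ta\<bar> < c then 1 else 0 :: real"
 have pm [measurable]: "(%g. post be g (?q u)) \<in> borel_measurable (gau (idx p N))" for u by (rule measurable_post) simp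
 have m1: "Measurable.pred (gau (idx p N)) (%g. 1 / 2 < post be (obs be u g) (?q u))" for u by measurable
 have m2: "Measurable.pred (gau (idx p N)) (%g. exp (- de * real N) < L be g)" by measurable
 have m3: "Measurable.pred (gau (idx p N)) (%g. L be (obs be u g) <= exp (- (de / 2) * real N))" for u by measurable
 have "avg (%u. exg (%g. if 1 / 2 < post be (obs be u g) (?q u) then 1 else 0))
  <= avg (%u. exg (%g. if exp (- de * real N) < L be g then 1 else 0) + exg (%g. if L be (obs be u g) <= exp (- (de / 2) * real N) then 1 else 0))"
 proof (rule avg_mono)
  fix u assume u: "u \<in> S N"
  have "exg (%g. if 1 / 2 < post be (obs be u g) (?q u) then 1 else 0) <= exg (%g. (if exp (- de * real N) < L be g then 1 else 0) + (if L be (obs be u g) <= exp (- (de / 2) * real N) then 1 else 0))"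
  proof (rule exg_mono[OF expb_ind[OF m1] expb_add[OF expb_ind[OF m2] expb_ind[OF m3]]])
   fix g
   show "(if 1 / 2 < post be (obs be u g) (?q u) then 1 else 0) <= ((if exp (- de * real N) < L be g then 1 else 0) + (if L be (obs be u g) <= exp (- (de / 2) * real N) then 1 else 0) :: real)"
   proof (cases "exp (- de * real N) < L be g \<or> L be (obs be u g) <= exp (- (de / 2) * real N)")
    case False
    then have L1: "L be g <= exp (- de * real N)" and L2: "exp (- (de / 2) * real N) <= L be (obs be u g)" by linarith+
    have p0: "0 <= post be (obs be u g) (?q u)" by (rule post_nonneg) simp
    have "exp (- (de / 2) * real N) * post be (obs be u g) (?q u) <= L be (obs be u g) * post be (obs be u g) (?q u)"
     by (rule mult_right_mono[OF L2 p0])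
    also have "... <= exp (be\<^sup>2 * (real N / 2 * c ^ p)) * L be g"
    proof (rule post_obs_le)
     fix ta
     have "vinner N ta u ^ p <= c ^ p" if "\<bar>vinner N u ta\<bar> < c"
     proof -
      have "vinner N ta u ^ p <= \<bar>vinner N u ta\<bar> ^ p" unfolding vinner_sym[of N ta] by (metis abs_ge_self power_abs)
      also have "... <= c ^ p" using that by (intro power_mono) auto
      finally show ?thesis .
     qed
     then show "0 <= ?q u ta \<and> ?q u ta <= 1 \<and> (?q u ta ~= 0 --> K ta u <= real N / 2 * c ^ p)"
      by (auto simp: K_eq intro!: mult_left_mono)
    qed
    also have "... <= exp (de / 4 * real N) * exp (- de * real N)"
    proof (rule mult_mono[OF _ L1])
     have "(be\<^sup>2 * (c ^ p / 2)) * real N <= de / 4 * real N" by (rule mult_right_mono[OF c(2)]) simp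
     then show "exp (be\<^sup>2 * (real N / 2 * c ^ p)) <= exp (de / 4 * real N)" by (simp add: mult_ac)
    qed (use less_imp_le[OF L_pos] in auto)
    also have "... = exp (- (de / 2) * real N) * exp (- (de / 4) * real N)" by (simp add: exp_add[symmetric])
    finally have "post be (obs be u g) (?q u) <= 1 / 2" using d by simp
    then show ?thesis by simp
   qed auto
  qed
  also have "... = exg (%g. if exp (- de * real N) < L be g then 1 else 0) + exg (%g. if L be (obs be u g) <= exp (- (de / 2) * real N) then 1 else 0)"
   by (rule exg_add[OF expb_ind[OF m2] expb_ind[OF m3]])
  finally show "exg (%g. if 1 / 2 < post be (obs be u g) (?q u) then 1 else 0) <= exg (%g. if exp (- de * real N) < L be g then 1 else 0) + exg (%g. if L be (obs be u g) <= exp (- (de / 2) * real N) then 1 else 0)" .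
 qed
 also have "... <= exg (%g. if exp (- de * real N) < L be g then 1 else 0) + exp (- (de / 2) * real N)"
  unfolding avg_add avg_const using L_lower_planted[of "exp (- (de / 2) * real N)" be] by simp
 finally show ?thesis .
qed

lemma logmean_nonpos: "logmean b <= 0"
 using order_trans[OF exp_logmean_le_hellinger hellinger_le_1, of b] by simp

text \<open>Every single likelihood satisfies lik 1 u <= 2^N * L 1, so the linear exponent is at
  most ln (L 1) + 5/4 * N, with ln 2 <= 1 and N / 4 from the normalisation. For large b the
  quadratic term -b^2 / 4 wins, which bounds the set defining \<open>critical_temp\<close>.\<close>

lemma logmean_high:
 assumes b: "b >= 1" shows "logmean b <= (5 / 4 * b - b\<^sup>2 / 4) * real N"
proof -
 have pw: "ln (L b g) <= b * ln (L 1 g) + (5 / 4 * b - b\<^sup>2 / 4) * real N" for g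
 proof -
  define x where "x u = (\<Sum>i\<in>idx p N. feat p N i u * g i)" for u
  have "lik b u g <= exp (b * ln (L 1 g) + (5 / 4 * b - b\<^sup>2 / 4) * real N)" if u: "u \<in> S N" for u
  proof -
   have "lik 1 u g <= (\<Sum>v\<in>S N. lik 1 v g)" by (rule member_le_sum[OF u _ finite_S]) (simp add: less_imp_le[OF lik_pos])
   also have "... = 2 ^ N * L 1 g" using card_S[OF N] by (simp add: L_def avg_def)
   finally have "ln (lik 1 u g) <= ln (2 ^ N * L 1 g)" using lik_pos[of 1 u g] by (simp add: ln_mono)
   also have "... = real N * ln 2 + ln (L 1 g)" using L_pos[of 1 g] by (simp add: ln_mult_pos ln_realpow)
   also have "... <= real N * 1 + ln (L 1 g)" using ln_le_minus_one[of "2::real"] by (intro add_right_mono mult_left_mono) auto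
   finally have "x u <= ln (L 1 g) + 5 / 4 * real N" by (simp add: lik_def x_def)
   then have "b * x u <= b * (ln (L 1 g) + 5 / 4 * real N)" using b by (intro mult_left_mono) auto
   then show ?thesis unfolding lik_def x_def by (simp add: algebra_simps)
  qed
  then have "L b g <= avg (%_. exp (b * ln (L 1 g) + (5 / 4 * b - b\<^sup>2 / 4) * real N))" unfolding L_def by (rule avg_mono)
  then have "ln (L b g) <= ln (exp (b * ln (L 1 g) + (5 / 4 * b - b\<^sup>2 / 4) * real N))" using L_pos[of b g] by (simp only: avg_const ln_mono)
  then show ?thesis by (simp only: ln_exp)
 qed
 have x1: "expb (idx p N) (%g. b * ln (L 1 g))" by (intro expb_mult expb_const expb_lnL)
 have "logmean b <= exg (%g. b * ln (L 1 g) + (5 / 4 * b - b\<^sup>2 / 4) * real N)"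
  unfolding logmean_def by (rule exg_mono[OF expb_lnL expb_add[OF x1 expb_const] pw])
 also have "... = b * logmean 1 + (5 / 4 * b - b\<^sup>2 / 4) * real N"
  unfolding exg_add[OF x1 expb_const] exg_const logmean_def by simp
 also have "b * logmean 1 <= 0" using logmean_nonpos[of 1] b by (intro mult_nonneg_nonpos) auto
 finally show ?thesis by simp
qed

text \<open>At b = 1/2 the second moment of L is at most 2, by \<open>overlap_square_mgf\<close>
  with a = 1/8. As L <= L^2 / 8 + 2, values of L above exp (logmean + r * N) carry mass at most 1/4
  plus a concentration term. So logmean cannot be of order -N, and 1/2 lies in the set defining
  \<open>critical_temp\<close>.\<close>

lemma logmean_half:
 assumes r: "r >= 0" shows "1 <= exp (logmean (1/2) + r * real N) + 1 / 4 + 2 * exp (- (2 * r\<^sup>2) * real N)"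
proof -
 let ?b = "1 / 2 :: real" and ?A = "%g. if ln (L (1/2) g) >= logmean (1/2) + r * real N then 1 else 0 :: real"
 have mA: "Measurable.pred (gau (idx p N)) (%g. ln (L (1/2) g) >= logmean (1/2) + r * real N)" by measurable
 have xL2: "expb (idx p N) (%g. 1 / 8 * (L ?b g * L ?b g))" by (intro expb_mult expb_const expb_L)
 have x2: "expb (idx p N) (%g. 2 * ?A g)" by (intro expb_mult[OF expb_const expb_ind[OF mA]])
 have LL: "exg (%g. L ?b g * L ?b g) <= 2"
 proof -
  have "exg (%g. L ?b g * L ?b g) = avg (%u. exg (%g. L ?b (obs ?b u g)))"
   by (rule planted_expectation_L[OF measurable_L expb_L])
  also have "... <= avg (%u. 2)"
  proof (rule avg_mono)
   fix u assume u: "u \<in> S N"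
   have "exg (%g. L ?b (obs ?b u g)) = avg (%v. exg (%g. lik ?b v (obs ?b u g)))"
    unfolding L_def by (rule exg_avg) (unfold lik_obs, intro expb_mult expb_lik expb_const)
   also have "... <= avg (%v. exp (1 / 8 * real N * (vinner N u v)\<^sup>2))"
   proof (rule avg_mono)
    fix v assume v: "v \<in> S N"
    have "vinner N v u ^ p <= \<bar>vinner N u v\<bar> ^ p" unfolding vinner_sym[of N v] by (metis abs_ge_self power_abs)
    also have "... <= \<bar>vinner N u v\<bar> ^ 2" using p vinner_abs[OF u v] by (intro power_decreasing) auto
    finally have "real N * vinner N v u ^ p <= real N * (vinner N u v)\<^sup>2" by (simp add: mult_left_mono)
    then show "exg (%g. lik ?b v (obs ?b u g)) <= exp (1 / 8 * real N * (vinner N u v)\<^sup>2)"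
     unfolding lik_obs by (simp add: lik_expectation[OF v] K_eq)
   qed
   also have "... <= 1 / sqrt (1 - 2 * (1 / 8))" by (rule overlap_square_mgf[OF u]) auto
   also have "... <= 2"
   proof -
    have "sqrt (1/4) <= sqrt (1 - 2 * (1 / 8 :: real))" by (rule real_sqrt_le_mono) simp
    then have "1/2 <= sqrt (1 - 2 * (1 / 8 :: real))" by (simp add: real_sqrt_divide)
    then show ?thesis by (simp add: divide_le_eq)
   qed
   finally show "exg (%g. L ?b (obs ?b u g)) <= 2" .
  qed
  finally show ?thesis by (simp add: avg_const)
 qed
 have "1 = exg (L ?b)" by (simp add: L_expectation)
 also have "... <= exg (%g. exp (logmean ?b + r * real N) + (1 / 8 * (L ?b g * L ?b g) + 2 * ?A g))"
 proof (rule exg_mono[OF expb_L expb_add[OF expb_const expb_add[OF xL2 x2]]])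
  fix g
  have q: "0 <= (L ?b g)\<^sup>2 + 4\<^sup>2 - 2 * L ?b g * 4" using zero_le_power2[of "L ?b g - 4"] unfolding power2_diff .
  show "L ?b g <= exp (logmean ?b + r * real N) + (1 / 8 * (L ?b g * L ?b g) + 2 * ?A g)"
  proof (cases "ln (L (1/2) g) >= logmean (1/2) + r * real N")
   case True
   have "L ?b g <= 1 / 8 * (L ?b g * L ?b g) + 2" using q by (simp add: power2_eq_square)
   then show ?thesis unfolding if_P[OF True] using exp_gt_zero[of "logmean ?b + r * real N"] by linarith
  next
   case False
   then have "L ?b g < exp (logmean ?b + r * real N)" using ln_ge_iff[OF L_pos[of ?b g]] by (simp add: not_le)
   moreover have "0 <= 1 / 8 * (L ?b g * L ?b g)" by simp
   ultimately show ?thesis unfolding if_not_P[OF False] by linarith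
  qed
 qed
 also have "... = exp (logmean ?b + r * real N) + (1 / 8 * exg (%g. L ?b g * L ?b g) + 2 * exg ?A)"
  unfolding exg_add[OF expb_const expb_add[OF xL2 x2]] exg_add[OF xL2 x2] exg_const by simp
 also have "... <= exp (logmean ?b + r * real N) + (1 / 8 * 2 + 2 * exp (- (r\<^sup>2 / (2 * ?b\<^sup>2)) * real N))"
  using LL lnL_tails(1)[OF _ r, of ?b] by (intro add_mono mult_left_mono) auto
 also have "- (r\<^sup>2 / (2 * ?b\<^sup>2)) = - (2 * r\<^sup>2)" by (simp add: power2_eq_square)
 finally show ?thesis by linarith
qed

end

section \<open>Symmetrisation and transfer to the observation T\<close>

lemma permute_idx_in: "\<pi> permutes {..<p} ==> is \<in> idx p N ==> permute_idx p \<pi> is \<in> idx p N"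
proof -
 assume \<pi>: "\<pi> permutes {..<p}" and i: "is \<in> idx p N"
 have "is ! \<pi> j < N" if "j < p" for j
  by (rule idx_nth[OF i]) (use permutes_in_image[OF \<pi>, of j] that in simp)
 then show ?thesis by (auto simp: permute_idx_def idx_def)
qed

lemma permute_idx_comp:
 assumes "sg permutes {..<p}"
 shows "permute_idx p sg (permute_idx p \<pi> is) = permute_idx p (\<pi> \<circ> sg) is"
proof -
 have "sg j < p" if "j < p" for j using permutes_in_image[OF assms, of j] that by simp
 then show ?thesis by (simp add: permute_idx_def)
qed

lemma permute_idx_id: "is \<in> idx p N ==> permute_idx p id is = is"
 by (auto simp: permute_idx_def idx_def intro: nth_equalityI)

lemma permute_idx_bij:
 assumes \<pi>: "\<pi> permutes {..<p}" shows "bij_betw (permute_idx p \<pi>) (idx p N) (idx p N)"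
proof (rule bij_betw_byWitness[where f'="permute_idx p (inv \<pi>)"])
 have i: "inv \<pi> permutes {..<p}" by (rule permutes_inv[OF \<pi>])
 show "\<forall>a\<in>idx p N. permute_idx p (inv \<pi>) (permute_idx p \<pi> a) = a"
  using permutes_inv_o[OF \<pi>] by (simp add: permute_idx_comp[OF i] permute_idx_id)
 show "\<forall>a\<in>idx p N. permute_idx p \<pi> (permute_idx p (inv \<pi>) a) = a"
  using permutes_inv_o[OF \<pi>] by (simp add: permute_idx_comp[OF \<pi>] permute_idx_id)
 show "permute_idx p \<pi> ` idx p N \<subseteq> idx p N" by (rule image_subsetI) (rule permute_idx_in[OF \<pi>])
 show "permute_idx p (inv \<pi>) ` idx p N \<subseteq> idx p N" by (rule image_subsetI) (rule permute_idx_in[OF i])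
qed

lemma prod_permute_idx:
 assumes \<pi>: "\<pi> permutes {..<p}" shows "(\<Prod>j<p. (u :: nat => real) (permute_idx p \<pi> is ! j)) = (\<Prod>j<p. u (is ! j))"
proof -
 have "(\<Prod>j<p. u (permute_idx p \<pi> is ! j)) = (\<Prod>j<p. u (is ! \<pi> j))" by (rule prod.cong) (simp_all add: permute_idx_def)
 also have "... = (\<Prod>j<p. u (is ! j))" using prod.permute[OF \<pi>, of "%j. u (is ! j)"] by (simp add: comp_def)
 finally show ?thesis .
qed

lemma card_permutes: "(\<Sum>\<pi> | \<pi> permutes {..<p}. c) = fact p * (c :: real)"
 by (simp add: card_permutations[OF refl])

lemma symmetrize_in: "symmetrize p N y \<in> sym_tensors p N"
proof -
 have "symmetrize p N y (permute_idx p sg is) = symmetrize p N y is" if s: "sg permutes {..<p}" and i: "is \<in> idx p N" for sg "is"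
 proof -
  have "(\<Sum>\<pi> | \<pi> permutes {..<p}. y (permute_idx p \<pi> (permute_idx p sg is))) = (\<Sum>\<pi> | \<pi> permutes {..<p}. y (permute_idx p (sg \<circ> \<pi>) is))"
   by (rule sum.cong[OF refl]) (simp add: permute_idx_comp)
  also have "... = (\<Sum>\<pi> | \<pi> permutes {..<p}. y (permute_idx p \<pi> is))"
   by (rule setum_permutations_compose_left[OF s, symmetric])
  finally show ?thesis using i permute_idx_in[OF s i] by (simp add: symmetrize_def)
 qed
 moreover have "symmetrize p N y \<in> space (tensor_space p N)" by (simp add: tensor_space_def space_PiM symmetrize_def)
 ultimately show ?thesis by (simp add: sym_tensors_def)
qed

lemma sym_tensors_sets: "sym_tensors p N \<in> sets (tensor_space p N)"
proof -
 have "finite {\<pi>. \<pi> permutes {..<p}}" by (rule finite_permutations) simp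
 moreover have "{w \<in> space (tensor_space p N). w (permute_idx p \<pi> is) = w is} \<in> sets (tensor_space p N)"
  if "\<pi> permutes {..<p}" "is \<in> idx p N" for \<pi> "is"
 proof -
  have "(%w. w (permute_idx p \<pi> is)) \<in> borel_measurable (tensor_space p N)" "(%w. w is) \<in> borel_measurable (tensor_space p N)"
   unfolding tensor_space_def by (rule measurable_component_singleton; use permute_idx_in that in blast)+
  then show ?thesis by measurable
 qed
 ultimately have "{w \<in> space (tensor_space p N). \<forall>\<pi>\<in>{\<pi>. \<pi> permutes {..<p}}. \<forall>is\<in>idx p N. w (permute_idx p \<pi> is) = w is} \<in> sets (tensor_space p N)"
  by (intro sets.sets_Collect_finite_All' sets.sets_Collect_finite_All) auto
 then show ?thesis by (simp add: sym_tensors_def)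
qed

text \<open>Treats pure noise as the planted model of strength 0, where the likelihood ratio is
  1.\<close>

lemma W_eq_T: "W_rv p N = T_rv p N 0"
 by (auto simp: fun_eq_iff W_rv_def T_rv_def symmetrize_def)

lemma measurable_T: "T_rv p N be \<in> measurable (joint p N) (tensor_space p N)"
proof -
 have c: "(%om. fst om i) \<in> borel_measurable (joint p N)" if "i \<in> idx p N" for i
 proof -
  have "(%y. y i) \<in> measurable (Y_law p N) (density lborel (normal_density 0 (sqrt (2 / real N))))"
   unfolding Y_law_def by (rule measurable_component_singleton[OF that])
  then have "(%y. y i) \<in> borel_measurable (Y_law p N)" by (simp cong: measurable_cong_sets)
  then show ?thesis unfolding joint_def by (rule measurable_compose[OF measurable_fst])
 qed
 have s: "(%om. f (snd om)) \<in> borel_measurable (joint p N)" for f :: "(nat => real) => real"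
  unfolding joint_def by (rule measurable_compose[OF measurable_snd]) simp
 have "(%om. (1 / fact p) * (\<Sum>\<pi> \<in> {\<pi>. \<pi> permutes {..<p}}. fst om (permute_idx p \<pi> is)) + be * (\<Prod>j<p. snd om (is ! j))) \<in> borel_measurable (joint p N)"
  if i: "is \<in> idx p N" for "is"
 proof -
  have "(%om. \<Sum>\<pi> \<in> {\<pi>. \<pi> permutes {..<p}}. fst om (permute_idx p \<pi> is)) \<in> borel_measurable (joint p N)"
   by (rule borel_measurable_sum) (use permute_idx_in[OF _ i] in \<open>auto intro: c\<close>)
  with s[of "%u. \<Prod>j<p. u (is ! j)"] show ?thesis by measurable
 qed
 then have "(%om. \<lambda>is\<in>idx p N. (1 / fact p) * (\<Sum>\<pi> \<in> {\<pi>. \<pi> permutes {..<p}}. fst om (permute_idx p \<pi> is)) + be * (\<Prod>j<p. snd om (is ! j))) \<in> measurable (joint p N) (tensor_space p N)"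
  unfolding tensor_space_def by (rule measurable_restrict)
 also have "(%om. \<lambda>is\<in>idx p N. (1 / fact p) * (\<Sum>\<pi> \<in> {\<pi>. \<pi> permutes {..<p}}. fst om (permute_idx p \<pi> is)) + be * (\<Prod>j<p. snd om (is ! j))) = T_rv p N be"
  by (auto simp: fun_eq_iff T_rv_def symmetrize_def tensor_power_def)
 finally show ?thesis .
qed

lemma T_in: "T_rv p N be om \<in> sym_tensors p N"
proof -
 have s: "symmetrize p N (fst om) \<in> sym_tensors p N" by (rule symmetrize_in)
 have "T_rv p N be om (permute_idx p \<pi> is) = T_rv p N be om is" if "\<pi> permutes {..<p}" "is \<in> idx p N" for \<pi> "is"
  using s that permute_idx_in[OF that] by (simp add: T_rv_def sym_tensors_def tensor_power_def prod_permute_idx)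
 then show ?thesis by (simp add: sym_tensors_def tensor_space_def space_PiM T_rv_def)
qed

lemma measurable_T_sym: "T_rv p N be \<in> measurable (joint p N) (restrict_space (tensor_space p N) (sym_tensors p N))"
 by (rule measurable_restrict_space2) (use T_in measurable_T in auto)

lemma prob_space_joint: "N > 0 ==> prob_space (joint p N)"
proof -
 assume N: "N > 0"
 interpret Y: prob_space "Y_law p N" unfolding Y_law_def
  by (rule prob_space_PiM) (rule prob_space_normal_density, use N in simp)
 interpret P: pair_prob_space "Y_law p N" "measure_pmf (pmf_of_set (S N))" ..
 show ?thesis unfolding joint_def by (rule P.prob_space_axioms)
qed

text \<open>The likelihood depends on the observation only through its symmetrisation.\<close>
definition plik :: "nat => nat => real => (nat => real) => (nat list => real) => real" where
 "plik p N be u t = exp (be * (\<Sum>is\<in>idx p N. feat p N is u * (sqrt (real N / 2) * t is)) - be\<^sup>2 * (real N / 2) / 2)"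

context pspin
begin

definition scaled :: "(nat list => real) => nat list => real" where
 "scaled g = (\<lambda>i\<in>idx p N. sqrt (2 / real N) * g i)"

text \<open>The symmetric tensor as a function of the unsymmetrised standard noise;
  \<open>sobs (obs be u g)\<close> is the observation T (\<open>T_scaled\<close>).\<close>

definition sobs :: "(nat list => real) => nat list => real" where
 "sobs g = symmetrize p N (scaled g)"

lemma scale_cancel: "sqrt (real N / 2) * sqrt (2 / real N) = 1"
 unfolding real_sqrt_mult[symmetric] using N by simp

lemma Y_law_scaled: "distr (gau (idx p N)) (Y_law p N) scaled = Y_law p N"
 unfolding Y_law_def scaled_def[abs_def] by (rule distr_gau_scale[OF I]) (use N in simp)

lemma measurable_scaled: "scaled \<in> measurable (gau (idx p N)) (Y_law p N)"
proof -
 have "scaled \<in> measurable (gau (idx p N)) (PiM (idx p N) (%_. borel))"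
  unfolding scaled_def[abs_def] by (rule measurable_restrict) measurable
 moreover have "sets (Y_law p N) = sets (PiM (idx p N) (%_. borel))"
  unfolding Y_law_def by (rule sets_PiM_cong) auto
 ultimately show ?thesis by (simp cong: measurable_cong_sets)
qed

lemma T_scaled: "T_rv p N be (scaled g, u) = sobs (obs be u g)"
proof
 fix "is"
 show "T_rv p N be (scaled g, u) is = sobs (obs be u g) is"
 proof (cases "is \<in> idx p N")
  case True
  have "scaled (obs be u g) (permute_idx p \<pi> is) = scaled g (permute_idx p \<pi> is) + be * (\<Prod>j<p. u (is ! j))" if \<pi>: "\<pi> permutes {..<p}" for \<pi>
  proof -
   have "sqrt (2 / real N) * (be * feat p N (permute_idx p \<pi> is) u) = (sqrt (real N / 2) * sqrt (2 / real N)) * (be * (\<Prod>j<p. u (is ! j)))"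
    unfolding feat_def prod_permute_idx[OF \<pi>] by (simp only: mult_ac)
   then show ?thesis using permute_idx_in[OF \<pi> True] unfolding scale_cancel by (simp add: scaled_def obs_def distrib_left)
  qed
  then have "(\<Sum>\<pi> | \<pi> permutes {..<p}. scaled (obs be u g) (permute_idx p \<pi> is)) = (\<Sum>\<pi> | \<pi> permutes {..<p}. scaled g (permute_idx p \<pi> is)) + fact p * (be * (\<Prod>j<p. u (is ! j)))"
   unfolding card_permutes[symmetric] sum.distrib[symmetric] by (intro sum.cong) auto
  then show ?thesis using True by (simp add: T_rv_def sobs_def symmetrize_def tensor_power_def add_divide_distrib)
 qed (simp add: T_rv_def sobs_def symmetrize_def)
qed

text \<open>A signal tensor is invariant under permutations of positions, so its inner product with
  a tensor equals that with the symmetrisation. Hence L, the posterior and the test events are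
  functions of the symmetric observation although they are computed from unsymmetrised
  noise.\<close>

lemma lik_plik: "lik be u g = plik p N be u (sobs g)"
proof -
 let ?u = "%is. \<Prod>j<p. u (is ! j)"
 have 1: "(\<Sum>is\<in>idx p N. ?u is * scaled g (permute_idx p \<pi> is)) = (\<Sum>is\<in>idx p N. ?u is * scaled g is)" if \<pi>: "\<pi> permutes {..<p}" for \<pi>
  using sum.reindex_bij_betw[OF permute_idx_bij[OF \<pi>], of "%is. ?u is * scaled g is" N] by (simp add: prod_permute_idx[OF \<pi>])
 have "(\<Sum>is\<in>idx p N. ?u is * sobs g is) = (\<Sum>is\<in>idx p N. \<Sum>\<pi> | \<pi> permutes {..<p}. (1 / fact p) * (?u is * scaled g (permute_idx p \<pi> is)))"
  by (rule sum.cong[OF refl]) (simp add: sobs_def symmetrize_def sum_distrib_left mult_ac)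
 also have "... = (\<Sum>\<pi> | \<pi> permutes {..<p}. \<Sum>is\<in>idx p N. (1 / fact p) * (?u is * scaled g (permute_idx p \<pi> is)))"
  by (rule sum.swap)
 also have "... = (\<Sum>\<pi> | \<pi> permutes {..<p}. (1 / fact p) * (\<Sum>is\<in>idx p N. ?u is * scaled g is))"
  unfolding sum_distrib_left[symmetric] by (simp add: 1)
 also have "... = (\<Sum>is\<in>idx p N. ?u is * scaled g is)" unfolding card_permutes by simp
 finally have s: "(\<Sum>is\<in>idx p N. ?u is * sobs g is) = (\<Sum>is\<in>idx p N. ?u is * scaled g is)" .
 have "(\<Sum>is\<in>idx p N. feat p N is u * (sqrt (real N / 2) * sobs g is)) = (real N / 2) * (\<Sum>is\<in>idx p N. ?u is * sobs g is)"
  unfolding sum_distrib_left by (rule sum.cong[OF refl]) (simp add: feat_def mult_ac)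
 also have "... = (\<Sum>is\<in>idx p N. feat p N is u * g is)" unfolding s sum_distrib_left
 proof (rule sum.cong[OF refl])
  fix "is" assume i: "is \<in> idx p N"
  have "(sqrt (real N / 2) * sqrt (real N / 2)) * (?u is * (sqrt (2 / real N) * g is)) = (sqrt (real N / 2) * sqrt (2 / real N)) * (sqrt (real N / 2) * ?u is * g is)"
   by (simp only: mult_ac)
  then have "real N / 2 * (?u is * (sqrt (2 / real N) * g is)) = (sqrt (real N / 2) * sqrt (2 / real N)) * (sqrt (real N / 2) * ?u is * g is)"
   by (simp only: real_sqrt_mult_self abs_of_nonneg divide_nonneg_pos of_nat_0_le_iff zero_less_numeral)
  then show "real N / 2 * (?u is * scaled g is) = feat p N is u * g is" unfolding scale_cancel using i by (simp add: scaled_def feat_def)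
 qed
 finally show ?thesis by (simp add: lik_def plik_def)
qed

lemma measurable_sobs: "sobs \<in> measurable (gau (idx p N)) (restrict_space (tensor_space p N) (sym_tensors p N))"
proof (rule measurable_restrict_space2)
 show "sobs \<in> measurable (gau (idx p N)) (tensor_space p N)"
  unfolding tensor_space_def sobs_def[abs_def] symmetrize_def
 proof (rule measurable_restrict)
  fix "is" assume i: "is \<in> idx p N"
  have "(%g. scaled g (permute_idx p \<pi> is)) \<in> borel_measurable (gau (idx p N))" if "\<pi> permutes {..<p}" for \<pi>
   using permute_idx_in[OF that i] unfolding scaled_def by simp
  then have "(%g. \<Sum>\<pi> \<in> {\<pi>. \<pi> permutes {..<p}}. scaled g (permute_idx p \<pi> is)) \<in> borel_measurable (gau (idx p N))"
   by (intro borel_measurable_sum) auto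
  then show "(%g. (1 / fact p) * (\<Sum>\<pi> \<in> {\<pi>. \<pi> permutes {..<p}}. scaled g (permute_idx p \<pi> is))) \<in> borel_measurable (gau (idx p N))"
   by measurable
 qed
qed (auto simp: sobs_def symmetrize_in)

text \<open>Fubini, with the uniform law of the signal written as \<open>avg\<close> and the noise
  rescaled to standard Gaussians: the dictionary between the probability space of the theorem and
  the Gaussian calculus.\<close>

lemma joint_prob:
 assumes Q: "{om \<in> space (joint p N). Q om} \<in> sets (joint p N)"
 shows "measure (joint p N) {om \<in> space (joint p N). Q om} = avg (%u. exg (%g. if Q (scaled g, u) then 1 else 0))"
proof -
 let ?A = "{om \<in> space (joint p N). Q om}" and ?U = "measure_pmf (pmf_of_set (S N))"
 interpret J: prob_space "joint p N" by (rule prob_space_joint[OF N])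
 interpret Y: prob_space "Y_law p N" unfolding Y_law_def
  by (rule prob_space_PiM) (rule prob_space_normal_density, use N in simp)
 interpret P: pair_sigma_finite "Y_law p N" ?U ..
 have i: "integrable (Y_law p N \<Otimes>\<^sub>M ?U) (indicator ?A :: _ => real)"
  using Q J.emeasure_finite unfolding joint_def[symmetric] by (simp add: less_top[symmetric])
 have "measure (joint p N) ?A = (LINT om|joint p N. indicator ?A om)" using Q by simp
 also have "... = (LINT u|?U. (LINT y|Y_law p N. indicator ?A (y, u)))"
  unfolding joint_def[of p N] by (rule P.integral_snd[symmetric, of "%y u. indicator ?A (y, u)", unfolded split_beta prod.collapse, unfolded joint_def[of p N]]) (use i in \<open>simp add: joint_def\<close>)
 also have "... = avg (%u. \<integral>y. indicator ?A (y, u) \<partial>Y_law p N)"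
  unfolding avg_def by (rule integral_pmf_of_set[OF S_nonempty finite_S])
 also have "... = avg (%u. exg (%g. if Q (scaled g, u) then 1 else 0))"
 proof (rule avg_cong)
  fix u
  have "(%y. indicator ?A (y, u) :: real) \<in> borel_measurable (Y_law p N)"
   by (rule measurable_compose[OF measurable_Pair2'[of u ?U]]) (use Q in \<open>simp_all add: joint_def[symmetric]\<close>)
  then have "(LINT y|Y_law p N. indicator ?A (y, u)) = exg (%g. indicator ?A (scaled g, u))"
   by (subst Y_law_scaled[symmetric]) (rule integral_distr[OF measurable_scaled])
  also have "... = exg (%g. if Q (scaled g, u) then 1 else 0)"
   by (rule Bochner_Integration.integral_cong[OF refl])
    (use measurable_space[OF measurable_scaled] in \<open>auto simp: joint_def space_pair_measure indicator_def\<close>)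
  finally show "(LINT y|Y_law p N. indicator ?A (y, u)) = exg (%g. if Q (scaled g, u) then 1 else 0)" .
 qed
 finally show ?thesis .
qed

lemma prob_T:
 assumes A: "A \<in> sets (tensor_space p N)"
 shows "measure (joint p N) {om \<in> space (joint p N). T_rv p N be om \<in> A} = exg (%g. L be g * (if sobs g \<in> A then 1 else 0))"
proof -
 have "sobs \<in> measurable (gau (idx p N)) (tensor_space p N)"
  using measurable_sobs by (rule measurable_restrict_space2_iff[THEN iffD1, THEN conjunct1])
 then have m: "Measurable.pred (gau (idx p N)) (%g. sobs g \<in> A)" using A by (rule pred_sets2[rotated])
 have "{om \<in> space (joint p N). T_rv p N be om \<in> A} \<in> sets (joint p N)"
  using measurable_sets[OF measurable_T A] by (simp add: vimage_def Int_def conj_commute)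
 then show ?thesis
  by (simp only: joint_prob T_scaled) (rule planted_expectation_L[symmetric, OF _ expb_ind[OF m]], use m in measurable)
qed

end

section \<open>Kernels and the Bayes posterior\<close>

lemma measure_diff_le_one: assumes "prob_space M" shows "\<bar>measure M A - measure M B\<bar> <= 1"
 using prob_space.prob_le_1[OF assms, of A] prob_space.prob_le_1[OF assms, of B] measure_nonneg[of M A] measure_nonneg[of M B] by linarith

lemma kernel_prob:
 assumes m: "random_prob_measure p N mu" and t: "t \<in> sym_tensors p N"
 shows "prob_space (mu t)" "sets (mu t) = Pow (S N)"
proof -
 have "t \<in> space (restrict_space (tensor_space p N) (sym_tensors p N))"
  using t by (simp add: space_restrict_space sym_tensors_def)
 then have "mu t \<in> space (prob_algebra (count_space (S N)))"
  using m unfolding random_prob_measure_def by (auto dest: measurable_space)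
 then show "prob_space (mu t)" "sets (mu t) = Pow (S N)" by (auto simp: space_prob_algebra)
qed

text \<open>A probability measure on the finite set \<open>S N\<close> is a point measure, so its
  integrals become the finite sums of the recovery bounds.\<close>

lemma kernel_integral:
 fixes f :: "(nat => real) => real"
 assumes m: "random_prob_measure p N mu" and t: "t \<in> sym_tensors p N"
 shows "(LINT ta|mu t. f ta) = (\<Sum>ta\<in>S N. measure (mu t) {ta} * f ta)"
proof -
 interpret P: prob_space "mu t" by (rule kernel_prob[OF m t])
 have "mu t = point_measure (S N) (%ta. ennreal (measure (mu t) {ta}))"
 proof (rule measure_eqI_finite[OF kernel_prob(2)[OF m t] _ finite_S])
  show "sets (point_measure (S N) (%ta. ennreal (measure (mu t) {ta}))) = Pow (S N)" by (simp add: sets_point_measure)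
  fix a assume "a \<in> S N"
  then show "emeasure (mu t) {a} = emeasure (point_measure (S N) (%ta. ennreal (measure (mu t) {ta}))) {a}"
   by (simp add: emeasure_point_measure_finite finite_S P.emeasure_eq_measure)
 qed
 then have "(LINT ta|mu t. f ta) = (LINT ta|point_measure (S N) (%ta. ennreal (measure (mu t) {ta})). f ta)" by (rule arg_cong)
 also have "... = (\<Sum>ta\<in>S N. measure (mu t) {ta} * f ta)"
  by (subst lebesgue_integral_point_measure_finite) (auto simp: finite_S)
 finally show ?thesis .
qed

lemma kernel_measurable:
 assumes m: "random_prob_measure p N mu" and t: "ta \<in> S N"
 shows "(%t. measure (mu t) {ta}) \<in> borel_measurable (restrict_space (tensor_space p N) (sym_tensors p N))"
 by (rule measurable_compose[OF measurable_prob_algebraD[OF m[unfolded random_prob_measure_def]] measurable_measure_subprob_algebra])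
  (use t in simp)

text \<open>The Bayes posterior written through \<open>plik\<close>, hence as a function of the
  symmetric tensor alone, as a kernel has to be.\<close>

definition posterior :: "nat => nat => real => (nat list => real) => (nat => real) measure" where
 "posterior p N be t = point_measure (S N) (%ta. ennreal (plik p N be ta t / (\<Sum>v\<in>S N. plik p N be v t)))"

lemma plik_sum_pos: "(\<Sum>v\<in>S N. plik p N be v t) > 0"
 using finite_S S_nonempty by (intro sum_pos) (auto simp: plik_def)

lemma measurable_plik: "plik p N be u \<in> borel_measurable (tensor_space p N)"
proof -
 have "(%t. t i) \<in> borel_measurable (tensor_space p N)" if "i \<in> idx p N" for i
  unfolding tensor_space_def by (rule measurable_component_singleton[OF that])
 then have "(%t. \<Sum>i\<in>idx p N. feat p N i u * (sqrt (real N / 2) * t i)) \<in> borel_measurable (tensor_space p N)"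
  by (intro borel_measurable_sum borel_measurable_times) auto
 then show ?thesis unfolding plik_def[abs_def] by measurable
qed

lemma posterior_emeasure:
 "A \<subseteq> S N ==> emeasure (posterior p N be t) A = ennreal (\<Sum>ta\<in>A. plik p N be ta t / (\<Sum>v\<in>S N. plik p N be v t))"
 unfolding posterior_def using plik_sum_pos[of p N be t] finite_S[of N]
 by (subst emeasure_point_measure_finite) (auto intro!: sum_ennreal divide_nonneg_pos simp: plik_def)

text \<open>Covers N = 0 as well, because the theorem asks for a kernel for every N.\<close>

lemma posterior_kernel: "random_prob_measure p N (posterior p N be)"
 unfolding random_prob_measure_def
proof (rule measurable_prob_algebraI)
 have s: "sets (posterior p N be t) = Pow (S N)" "space (posterior p N be t) = S N" for t
  by (simp_all add: posterior_def sets_point_measure space_point_measure)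
 show pr: "prob_space (posterior p N be t)" for t
  by (rule prob_spaceI) (use plik_sum_pos[of p N be t] in \<open>simp add: s posterior_emeasure sum_divide_distrib[symmetric]\<close>)
 show "posterior p N be \<in> restrict_space (tensor_space p N) (sym_tensors p N) \<rightarrow>\<^sub>M subprob_algebra (count_space (S N))"
 proof (rule measurable_subprob_algebra)
  show "subprob_space (posterior p N be t)" for t by (rule prob_space_imp_subprob_space[OF pr])
  show "sets (posterior p N be t) = sets (count_space (S N))" for t by (simp add: s)
  fix A assume "A \<in> sets (count_space (S N))"
  then have "A \<subseteq> S N" by simp
  then have "(%t. emeasure (posterior p N be t) A) = (%t. ennreal (\<Sum>ta\<in>A. plik p N be ta t / (\<Sum>v\<in>S N. plik p N be v t)))"
   by (simp add: posterior_emeasure)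
  also have "... \<in> borel_measurable (tensor_space p N)"
   using measurable_plik by measurable
  finally show "(%t. emeasure (posterior p N be t) A) \<in> borel_measurable (restrict_space (tensor_space p N) (sym_tensors p N))"
   by (rule measurable_restrict_space1)
 qed
qed

lemma posterior_point: "ta \<in> S N ==> measure (posterior p N be t) {ta} = plik p N be ta t / (\<Sum>v\<in>S N. plik p N be v t)"
 using plik_sum_pos[of p N be t] by (simp add: measure_def posterior_emeasure plik_def)

section \<open>Total variation and recovery in terms of the likelihood ratio\<close>

context pspin
begin

lemma dTV_le_one: "dTV p N be <= 1"
proof -
 interpret J: prob_space "joint p N" by (rule prob_space_joint[OF N])
 show ?thesis unfolding dTV_def
  by (rule cSUP_least) (auto intro: measure_diff_le_one[OF J.prob_space_axioms])
qed

text \<open>Indicators of events of the symmetric tensor are among the test functions h, and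
  \<open>W_rv\<close> is \<open>T_rv\<close> at strength 0.\<close>

lemma dTV_le:
 assumes h: "!!h. h \<in> borel_measurable (gau (idx p N)) ==> (!!g. 0 <= h g \<and> h g <= 1) ==> \<bar>exg h - exg (%g. L be g * h g)\<bar> <= e"
 shows "dTV p N be <= e"
 unfolding dTV_def
proof (rule cSUP_least)
 show "{A \<in> sets (tensor_space p N). A \<subseteq> sym_tensors p N} ~= {}" by blast
 fix A assume "A \<in> {A \<in> sets (tensor_space p N). A \<subseteq> sym_tensors p N}"
 then have A: "A \<in> sets (tensor_space p N)" by simp
 have "sobs \<in> measurable (gau (idx p N)) (tensor_space p N)"
  using measurable_sobs by (rule measurable_restrict_space2_iff[THEN iffD1, THEN conjunct1])
 then have m: "Measurable.pred (gau (idx p N)) (%g. sobs g \<in> A)" using A by (rule pred_sets2[rotated])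
 have "(%g. if sobs g \<in> A then 1 else 0 :: real) \<in> borel_measurable (gau (idx p N))" using m by measurable
 from h[OF this]
 show "\<bar>measure (joint p N) {om \<in> space (joint p N). W_rv p N om \<in> A} - measure (joint p N) {om \<in> space (joint p N). T_rv p N be om \<in> A}\<bar> <= e"
  unfolding W_eq_T prob_T[OF A] by (simp add: L_def lik_def avg_const)
qed

text \<open>Tests with the event L <= x: its probability under T is at most x, and under W it is 1 -
  P(L > x).\<close>

lemma dTV_ge:
 assumes x: "x >= 0" shows "1 - exg (%g. if x < L be g then 1 else 0) - x <= dTV p N be"
proof -
 interpret J: prob_space "joint p N" by (rule prob_space_joint[OF N])
 define A where "A = {t \<in> sym_tensors p N. avg (%u. plik p N be u t) <= x}"
 have "{t \<in> space (tensor_space p N). avg (%u. plik p N be u t) <= x} \<in> sets (tensor_space p N)"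
  unfolding avg_def using measurable_plik by measurable
 from sets.Int[OF sym_tensors_sets this] have A: "A \<in> sets (tensor_space p N)"
  unfolding A_def by (rule back_subst[where P="%B. B \<in> sets (tensor_space p N)"]) (auto simp: sym_tensors_def)
 have sA: "sobs g \<in> A \<longleftrightarrow> L be g <= x" for g
  unfolding A_def sobs_def by (simp add: symmetrize_in) (simp add: sobs_def[symmetric] lik_plik[symmetric] L_def)
 have m: "Measurable.pred (gau (idx p N)) (%g. L be g <= x)" "Measurable.pred (gau (idx p N)) (%g. x < L be g)" by measurable
 have L0: "L 0 g = 1" for g by (simp add: L_def lik_def avg_const)
 have W: "measure (joint p N) {om \<in> space (joint p N). W_rv p N om \<in> A} = 1 - exg (%g. if x < L be g then 1 else 0)"
 proof -
  have "measure (joint p N) {om \<in> space (joint p N). W_rv p N om \<in> A} = exg (%g. 1 - (if x < L be g then 1 else 0))"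
   unfolding W_eq_T prob_T[OF A] sA L0 by (rule Bochner_Integration.integral_cong) auto
  then show ?thesis unfolding exg_diff[OF expb_const expb_ind[OF m(2)]] exg_const .
 qed
 have T: "measure (joint p N) {om \<in> space (joint p N). T_rv p N be om \<in> A} <= exg (%_. x)"
  unfolding prob_T[OF A] sA by (rule exg_mono[OF expb_mult[OF expb_L expb_ind[OF m(1)]] expb_const]) (use x in auto)
 have "\<bar>measure (joint p N) {om \<in> space (joint p N). W_rv p N om \<in> A} - measure (joint p N) {om \<in> space (joint p N). T_rv p N be om \<in> A}\<bar> <= dTV p N be"
  unfolding dTV_def
 proof (rule cSUP_upper)
  show "A \<in> {A \<in> sets (tensor_space p N). A \<subseteq> sym_tensors p N}" using A by (auto simp: A_def)
  show "bdd_above ((%A. \<bar>measure (joint p N) {om \<in> space (joint p N). W_rv p N om \<in> A} - measure (joint p N) {om \<in> space (joint p N). T_rv p N be om \<in> A}\<bar>) ` {A \<in> sets (tensor_space p N). A \<subseteq> sym_tensors p N})"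
   by (rule bdd_aboveI2[where M=1]) (auto intro: measure_diff_le_one[OF J.prob_space_axioms])
 qed
 then show ?thesis using W T unfolding exg_const by linarith
qed

lemma recovery_eq:
 assumes m: "random_prob_measure p N mu"
 shows "recovery_prob p N be mu c = avg (%u. exg (%g. if c <= (\<Sum>ta\<in>S N. measure (mu (sobs (obs be u g))) {ta} * \<bar>vinner N u ta\<bar>) then 1 else 0))"
proof -
 have i: "(LINT ta|mu (T_rv p N be om). \<bar>vinner N u ta\<bar>) = (\<Sum>ta\<in>S N. measure (mu (T_rv p N be om)) {ta} * \<bar>vinner N u ta\<bar>)" for u om
  by (rule kernel_integral[OF m T_in])
 have v: "(%om. \<bar>vinner N (snd om) ta\<bar>) \<in> borel_measurable (joint p N)" for ta
  unfolding joint_def by (rule measurable_compose[OF measurable_snd, of "%u. \<bar>vinner N u ta\<bar>"]) simp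
 have "(%om. \<Sum>ta\<in>S N. measure (mu (T_rv p N be om)) {ta} * \<bar>vinner N (snd om) ta\<bar>) \<in> borel_measurable (joint p N)"
  by (rule borel_measurable_sum, rule borel_measurable_times[OF measurable_compose[OF measurable_T_sym kernel_measurable[OF m]] v])
 then have "{om \<in> space (joint p N). c <= (\<Sum>ta\<in>S N. measure (mu (T_rv p N be om)) {ta} * \<bar>vinner N (snd om) ta\<bar>)} \<in> sets (joint p N)"
  by measurable
 from joint_prob[OF this] show ?thesis unfolding recovery_prob_def i by (simp add: T_scaled)
qed

lemma kernel_gau:
 assumes m: "random_prob_measure p N mu" and t: "ta \<in> S N"
 shows "(%g. measure (mu (sobs g)) {ta}) \<in> borel_measurable (gau (idx p N))"
 by (rule measurable_compose[OF measurable_sobs kernel_measurable[OF m t]])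

text \<open>Markov's inequality for the mean overlap, after \<open>lik_integral\<close> has
  rewritten the planted mean as a likelihood-weighted mean over noise.\<close>

lemma recovery_le:
 assumes m: "random_prob_measure p N mu" and c: "c > 0"
  and b: "exg (%g. avg (%u. lik be u g * (\<Sum>ta\<in>S N. measure (mu (sobs g)) {ta} * \<bar>vinner N u ta\<bar>))) <= e"
 shows "recovery_prob p N be mu c <= e / c"
proof -
 let ?f = "%u g. \<Sum>ta\<in>S N. measure (mu (sobs g)) {ta} * \<bar>vinner N u ta\<bar>"
 have fm [measurable]: "?f u \<in> borel_measurable (gau (idx p N))" for u
  by (rule borel_measurable_sum, rule borel_measurable_times[OF kernel_gau[OF m] borel_measurable_const])
 have f0: "0 <= ?f u g" for u g by (intro sum_nonneg mult_nonneg_nonneg) auto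
 have f1: "?f u g <= (\<Sum>ta\<in>S N. \<bar>vinner N u ta\<bar>)" for u g
 proof (rule sum_mono)
  fix ta
  interpret P: prob_space "mu (sobs g)" by (rule kernel_prob[OF m]) (simp add: sobs_def symmetrize_in)
  show "measure (mu (sobs g)) {ta} * \<bar>vinner N u ta\<bar> <= \<bar>vinner N u ta\<bar>"
   using mult_right_mono[OF P.prob_le_1[of "{ta}"], of "\<bar>vinner N u ta\<bar>"] by simp
 qed
 have xo: "expb (idx p N) (%g. ?f u (obs be u g))" for u
  by (rule expb_bounded[where B="\<Sum>ta\<in>S N. \<bar>vinner N u ta\<bar>"], measurable) (use f0 f1 in \<open>simp add: abs_of_nonneg\<close>)
 have xf: "expb (idx p N) (?f u)" for u
  by (rule expb_bounded[where B="\<Sum>ta\<in>S N. \<bar>vinner N u ta\<bar>", OF fm]) (use f0 f1 in \<open>simp add: abs_of_nonneg\<close>)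
 have pm: "Measurable.pred (gau (idx p N)) (%g. c <= ?f u (obs be u g))" for u by measurable
 have "recovery_prob p N be mu c <= avg (%u. (1 / c) * exg (%g. lik be u g * ?f u g))"
  unfolding recovery_eq[OF m]
 proof (rule avg_mono)
  fix u assume u: "u \<in> S N"
  have "exg (%g. if c <= ?f u (obs be u g) then 1 else 0) <= exg (%g. (1 / c) * ?f u (obs be u g))"
  proof (rule exg_mono[OF expb_ind[OF pm] expb_mult[OF expb_const xo]])
   fix g show "(if c <= ?f u (obs be u g) then 1 else 0) <= (1 / c) * ?f u (obs be u g)"
    using c f0[of "obs be u g" u] by (simp add: le_divide_eq)
  qed
  also have "... = (1 / c) * exg (%g. lik be u g * ?f u g)"
   unfolding lik_integral[OF fm u] by simp
  finally show "exg (%g. if c <= ?f u (obs be u g) then 1 else 0) <= (1 / c) * exg (%g. lik be u g * ?f u g)" .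
 qed
 also have "... = (1 / c) * exg (%g. avg (%u. lik be u g * ?f u g))"
  unfolding avg_cmult by (subst exg_avg[OF expb_mult[OF expb_lik xf]]) (rule refl)
 also have "... <= (1 / c) * e" using b c by (intro mult_left_mono) auto
 finally show ?thesis by simp
qed

text \<open>If the posterior gives mass at most 1/2 to signals with |overlap| < c, its mean absolute
  overlap is at least c * (1 - 1/2).\<close>

lemma recovery_posterior:
 assumes c: "c > 0"
 shows "1 - avg (%u. exg (%g. if 1 / 2 < post be (obs be u g) (%ta. if \<bar>vinner N u ta\<bar> < c then 1 else 0) then 1 else 0)) <= recovery_prob p N be (posterior p N be) (c / 2)"
proof -
 let ?q = "%u ta. if \<bar>vinner N u ta\<bar> < c then 1 else 0 :: real"
 let ?P = "%u g. 1 / 2 < post be (obs be u g) (?q u)"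
 let ?f = "%u g. \<Sum>ta\<in>S N. measure (posterior p N be (sobs g)) {ta} * \<bar>vinner N u ta\<bar>"
 have fm [measurable]: "?f u \<in> borel_measurable (gau (idx p N))" for u
  by (rule borel_measurable_sum, rule borel_measurable_times[OF kernel_gau[OF posterior_kernel] borel_measurable_const])
 have [measurable]: "(%g. post be g (?q u)) \<in> borel_measurable (gau (idx p N))" for u by (rule measurable_post) simp
 have m1: "Measurable.pred (gau (idx p N)) (?P u)" for u by measurable
 have m2: "Measurable.pred (gau (idx p N)) (%g. c / 2 <= ?f u (obs be u g))" for u by measurable
 have fp: "?f u g = post be g (%ta. \<bar>vinner N u ta\<bar>)" for u g
  unfolding post_def gavg_def lik_plik sum_divide_distrib by (rule sum.cong[OF refl]) (simp add: posterior_point)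
 have "avg (%u. 1 + (-1) * exg (%g. if ?P u g then 1 else 0)) <= recovery_prob p N be (posterior p N be) (c / 2)"
  unfolding recovery_eq[OF posterior_kernel]
 proof (rule avg_mono)
  fix u assume u: "u \<in> S N"
  have "exg (%g. 1 - (if ?P u g then 1 else 0)) <= exg (%g. if c / 2 <= ?f u (obs be u g) then 1 else 0)"
  proof (rule exg_mono[OF expb_diff[OF expb_const expb_ind[OF m1]] expb_ind[OF m2]])
   fix g
   have "c * (1 - post be (obs be u g) (?q u)) = post be (obs be u g) (%ta. c * (1 - ?q u ta))"
    unfolding post_def by (simp only: gavg_cmult gavg_diff gavg_const[OF posw_lik])
   also have "... <= ?f u (obs be u g)" unfolding fp by (rule post_mono) auto
   finally have f: "c * (1 - post be (obs be u g) (?q u)) <= ?f u (obs be u g)" .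
   show "1 - (if ?P u g then 1 else 0) <= (if c / 2 <= ?f u (obs be u g) then 1 else 0 :: real)"
   proof (cases "?P u g")
    case False
    then have "c * (1 / 2) <= c * (1 - post be (obs be u g) (?q u))" using c by (intro mult_left_mono) auto
    then show ?thesis using f by simp
   qed simp
  qed
  then show "1 + (-1) * exg (%g. if ?P u g then 1 else 0) <= exg (%g. if c / 2 <= ?f u (obs be u g) then 1 else 0)"
   unfolding exg_diff[OF expb_const expb_ind[OF m1]] exg_const by simp
 qed
 then show ?thesis unfolding avg_add avg_const avg_cmult by simp
qed

lemma recovery_le_one: "recovery_prob p N be mu c <= 1"
 unfolding recovery_prob_def by (rule prob_space.prob_le_1[OF prob_space_joint[OF N]])

end

section \<open>Location of the critical value\<close>

abbreviation lmean :: "nat => nat => real => real" where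
 "lmean p N b == planted.logmean (S N) (idx p N) (feat p N) (real N / 2) b"

abbreviation ent :: "nat => nat => real => real" where
 "ent p N b == planted.entropy (S N) (idx p N) (feat p N) (real N / 2) b"

lemma exp_decay: "c > 0 ==> (%N. exp (- c * real N)) \<longlonglongrightarrow> 0"
proof -
 assume "c > 0"
 then have "(%N. exp (- c) ^ N) \<longlonglongrightarrow> 0" by (intro LIMSEQ_power_zero) simp
 then show ?thesis by (simp add: exp_of_nat_mult[symmetric] mult.commute)
qed

lemma logmean_limit:
 assumes p: "p >= 3" and b: "b > 0"
 shows "(%N. lmean p N b / real N) \<longlonglongrightarrow> F p b - b\<^sup>2 / 4"
proof (rule Lim_transform_eventually)
 show "(%N. free_energy b p N / real N - b\<^sup>2 / 4) \<longlonglongrightarrow> F p b - b\<^sup>2 / 4"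
  by (rule tendsto_diff[OF F_limit tendsto_const]) (use p b in auto)
 show "\<forall>\<^sub>F N in sequentially. free_energy b p N / real N - b\<^sup>2 / 4 = lmean p N b / real N"
  using eventually_gt_at_top[of 0]
 proof eventually_elim
  case (elim N)
  interpret pspin p N by standard (use p elim in auto)
  show ?case using elim by (simp add: logmean_eq diff_divide_distrib)
 qed
qed

lemma F_upper_bound:
 assumes p: "p >= 3" and b: "b > 0" shows "F p b <= b\<^sup>2 / 4"
proof -
 have "F p b - b\<^sup>2 / 4 <= 0"
 proof (rule LIMSEQ_le_const2[OF logmean_limit[OF p b]], intro exI allI impI)
  fix N :: nat assume N: "1 <= N"
  interpret pspin p N by standard (use p N in auto)
  show "lmean p N b / real N <= 0" using logmean_nonpos[of b] by (intro divide_nonpos_nonneg) auto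
 qed
 then show ?thesis by simp
qed

text \<open>If F(1/2) were smaller by d, then logmean (1/2) would eventually lie below -N * d / 2,
  and \<open>logmean_half\<close> would give 1 <= 1/4 in the limit. This makes the set defining
  \<open>critical_temp\<close> nonempty.\<close>

lemma F_half:
 assumes p: "p >= 3" shows "F p (1/2) = (1/2)\<^sup>2 / 4"
proof (rule ccontr)
 assume "F p (1/2) ~= (1/2)\<^sup>2 / 4"
 then have lt: "F p (1/2) < (1/2)\<^sup>2 / 4" using F_upper_bound[OF p, of "1/2"] by simp
 define d where "d = (1/2)\<^sup>2 / 4 - F p (1/2)"
 have d: "d > 0" using lt by (simp add: d_def)
 have "F p (1/2) - (1/2)\<^sup>2 / 4 = - d" by (simp add: d_def)
 then have "F p (1/2) - (1/2)\<^sup>2 / 4 < - (d / 2)" using d by simp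
 from order_tendstoD(2)[OF logmean_limit[OF p, of "1/2"] this]
 have ev: "\<forall>\<^sub>F N in sequentially. lmean p N (1/2) / real N < - (d / 2)" by simp
 have "\<forall>\<^sub>F N in sequentially. 1 <= exp (- (d / 4) * real N) + 1 / 4 + 2 * exp (- (2 * (d / 4)\<^sup>2) * real N)"
  using ev eventually_gt_at_top[of 0]
 proof eventually_elim
  case (elim N)
  interpret pspin p N by standard (use p elim in auto)
  have "lmean p N (1/2) <= - (d / 2) * real N" using elim by (simp add: divide_less_eq)
  then have "logmean (1/2) + d / 4 * real N <= - (d / 4) * real N" by simp
  then have "exp (logmean (1/2) + d / 4 * real N) <= exp (- (d / 4) * real N)" by (simp only: exp_le_cancel_iff)
  then show ?case using logmean_half[of "d / 4"] d by linarith
 qed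
 moreover have "(%N. exp (- (d / 4) * real N) + 1 / 4 + 2 * exp (- (2 * (d / 4)\<^sup>2) * real N)) \<longlonglongrightarrow> 0 + 1 / 4 + 2 * 0"
  using d by (intro tendsto_add tendsto_mult tendsto_const exp_decay) auto
 ultimately have "1 <= (0 + 1 / 4 + 2 * 0 :: real)"
  by (intro tendsto_lowerbound[OF _ _ trivial_limit_sequentially])
 then show False by simp
qed

text \<open>The limit of \<open>logmean_high\<close> reads 0 <= 5/4 * b - b^2 / 4 on that
  set.\<close>

lemma critical_bounded:
 assumes p: "p >= 3" and b: "b > 0" "F p b = b\<^sup>2 / 4" shows "b <= 5"
proof (cases "b >= 1")
 case True
 have "0 <= 5 / 4 * b - b\<^sup>2 / 4"
 proof (rule LIMSEQ_le_const2)
  show "(%N. lmean p N b / real N) \<longlonglongrightarrow> 0" using logmean_limit[OF p b(1)] b(2) by simp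
  show "\<exists>M. \<forall>N\<ge>M. lmean p N b / real N <= 5 / 4 * b - b\<^sup>2 / 4"
  proof (intro exI allI impI)
   fix N :: nat assume N: "1 <= N"
   interpret pspin p N by standard (use p N in auto)
   show "lmean p N b / real N <= 5 / 4 * b - b\<^sup>2 / 4" using logmean_high[OF True] N by (simp add: divide_le_eq)
  qed
 qed
 then have "b * b <= 5 * b" by (simp add: power2_eq_square)
 then show ?thesis using b by simp
qed simp

lemma below_critical:
 assumes p: "p >= 3" and b: "be < critical_temp p"
 obtains b2 where "be < b2" "b2 > 0" "F p b2 = b2\<^sup>2 / 4"
proof -
 have "{be. be > 0 \<and> F p be = be\<^sup>2 / 4} ~= {}" using F_half[OF p] by (intro ex_in_conv[THEN iffD1] exI[of _ "1/2"]) simp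
 from less_cSupE[OF b[unfolded critical_temp_def] this] show ?thesis using that by blast
qed

lemma above_critical:
 assumes p: "p >= 3" and b: "be > critical_temp p" shows "be > 0" "F p be < be\<^sup>2 / 4"
proof -
 have le: "x <= critical_temp p" if "x > 0" "F p x = x\<^sup>2 / 4" for x
  unfolding critical_temp_def
 proof (rule cSup_upper)
  show "bdd_above {be. be > 0 \<and> F p be = be\<^sup>2 / 4}" by (rule bdd_aboveI[of _ 5]) (use critical_bounded[OF p] in blast)
 qed (use that in simp)
 show b0: "be > 0" using le[OF _ F_half[OF p]] b by simp
 show "F p be < be\<^sup>2 / 4" using le[OF b0] F_upper_bound[OF p b0] b by fastforce
qed

text \<open>Otherwise \<open>logmean_decay\<close> would make exp (logmean b2 / 2) at most a
  constant times exp (-th * N), while F(b2) = b2^2 / 4 keeps logmean b2 above -th * N, that is exp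
  (logmean b2 / 2) above exp (-th * N / 2).\<close>

lemma entropy_small:
 assumes p: "p >= 3" and b: "0 < b" "b < b2" and F: "F p b2 = b2\<^sup>2 / 4" and d: "d > 0"
 shows "\<forall>\<^sub>F N in sequentially. N > 0 \<and> ent p N b < real N * d"
proof -
 define ka where "ka = min 1 (d / (2 * b2\<^sup>2))"
 define c where "c = min (d\<^sup>2 / (32 * b2\<^sup>2)) (d / 2)"
 have k: "ka > 0" "c > 0" using b d by (auto simp: ka_def c_def)
 define a2 where "a2 = ka * (b2\<^sup>2 - b\<^sup>2) / 16"
 have "b\<^sup>2 < b2\<^sup>2" using b by (intro power_strict_mono) auto
 then have a2: "a2 > 0" using k by (simp add: a2_def)
 define th where "th = min (c / 2) a2"
 have th: "th > 0" "th <= c / 2" "th <= a2" using k a2 by (auto simp: th_def)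
 have "(%N. lmean p N b2 / real N) \<longlonglongrightarrow> 0" using logmean_limit[OF p, of b2] F b by simp
 then have ev1: "\<forall>\<^sub>F N in sequentially. - th < lmean p N b2 / real N" by (rule order_tendstoD(1)) (use th in simp)
 have "(%N. 4 / ka * exp (- (th / 2) * real N) + exp (- (th / 2) * real N)) \<longlonglongrightarrow> 4 / ka * 0 + 0"
  using th by (intro tendsto_add tendsto_mult tendsto_const exp_decay) auto
 then have ev2: "\<forall>\<^sub>F N in sequentially. 4 / ka * exp (- (th / 2) * real N) + exp (- (th / 2) * real N) < 1"
  by (rule order_tendstoD(2)) simp
 show ?thesis using ev1 ev2 eventually_gt_at_top[of 0]
 proof eventually_elim
  case (elim N)
  interpret pspin p N by standard (use p elim in auto)
  have "\<not> real N * d <= ent p N b"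
  proof
   assume "real N * d <= ent p N b"
   from logmean_decay[OF b d this, folded ka_def c_def, folded a2_def]
   have 1: "exp (logmean b2 / 2) <= 4 / ka * exp (- (c / 2) * real N) + exp (- a2 * real N)" .
   have "- th * real N < logmean b2" using elim by (simp add: less_divide_eq)
   then have "exp (- (th / 2) * real N) <= exp (logmean b2 / 2)" by simp
   also note 1
   also have "4 / ka * exp (- (c / 2) * real N) + exp (- a2 * real N) <= 4 / ka * exp (- th * real N) + exp (- th * real N)"
    using th k by (intro add_mono mult_left_mono exp_le_cancel_iff[THEN iffD2] mult_right_mono) auto
   also have "... = exp (- (th / 2) * real N) * (4 / ka * exp (- (th / 2) * real N) + exp (- (th / 2) * real N))"
    by (simp add: distrib_left mult.left_commute exp_add[symmetric])
   also have "... < exp (- (th / 2) * real N) * 1" using elim by (intro mult_strict_left_mono) auto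
   finally show False by simp
  qed
  then show ?case using elim by simp
 qed
qed

section \<open>The two regimes\<close>

lemma below_critical_bounds:
 assumes p: "p >= 3" and b: "0 < be" "be < critical_temp p" and e: "e > 0"
 shows "\<forall>\<^sub>F N in sequentially. dTV p N be <= e \<and> (\<forall>mu c. random_prob_measure p N mu --> c > 0 --> recovery_prob p N be mu c <= 2 * e / c)"
proof -
 obtain b2 where b2: "be < b2" "b2 > 0" "F p b2 = b2\<^sup>2 / 4" using below_critical[OF p b(2)] .
 \<comment> \<open>Room on both sides: b1 < b2 for the entropy bound, be < b1 for the exponential
   loss in \<open>farlik_obs\<close>.\<close>
 define b1 where "b1 = (be + b2) / 2"
 have b1: "be < b1" "0 < b1" "b1 < b2" using b b2 by (auto simp: b1_def)
 \<comment> \<open>s <= e^2 / 16 keeps the defect 2 * s + 2 * s in \<open>tv_bound\<close> below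
   e^2; s <= e / 2 absorbs the lost mass in the recovery bound.\<close>
 define s where "s = min (e\<^sup>2 / 16) (e / 2)"
 have s: "s > 0" "s <= e\<^sup>2 / 16" "s <= e / 2" using e by (auto simp: s_def)
 have t1: "((%x. 1 / sqrt (1 - be\<^sup>2 * x)) \<longlongrightarrow> 1 / sqrt (1 - be\<^sup>2 * 0)) (at_right 0)"
  by (intro tendsto_intros) auto
 have t2: "((%x. x / sqrt (1 - be\<^sup>2 * x)) \<longlongrightarrow> 0 / sqrt (1 - be\<^sup>2 * 0)) (at_right 0)"
  by (intro tendsto_intros) auto
 have t3: "((%x. be\<^sup>2 * x) \<longlongrightarrow> be\<^sup>2 * 0) (at_right 0)" by (intro tendsto_intros)
 have e1: "\<forall>\<^sub>F x in at_right 0. 1 / sqrt (1 - be\<^sup>2 * x) < 1 + s" by (rule order_tendstoD(2)[OF t1]) (use s in simp)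
 have e2: "\<forall>\<^sub>F x in at_right 0. x / sqrt (1 - be\<^sup>2 * x) < s" by (rule order_tendstoD(2)[OF t2]) (use s in simp)
 have e3: "\<forall>\<^sub>F x in at_right 0. be\<^sup>2 * x < 1" by (rule order_tendstoD(2)[OF t3]) simp
 have e4: "\<forall>\<^sub>F x in at_right 0. x \<in> {0<..<1::real}" by (rule eventually_at_right_real) simp
 from e1 e2 e3 e4 have "\<forall>\<^sub>F x in at_right 0. 1 / sqrt (1 - be\<^sup>2 * x) < 1 + s \<and> x / sqrt (1 - be\<^sup>2 * x) < s \<and> be\<^sup>2 * x < 1 \<and> 0 < x \<and> x < 1"
  by eventually_elim simp
 \<comment> \<open>x becomes the overlap cutoff ep: so small that nearly orthogonal pairs contribute
   at most 1 + s to the second moment and at most s to the overlap-weighted one.\<close>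
 then obtain x where x: "1 / sqrt (1 - be\<^sup>2 * x) < 1 + s" "x / sqrt (1 - be\<^sup>2 * x) < s" "be\<^sup>2 * x < 1" "0 < x" "x < 1"
  using eventually_happens'[OF trivial_limit_at_right_real] by blast
 define et where "et = be * (b1 - be) * x ^ p / 4"
 have et: "et > 0" using b b1 x by (simp add: et_def)
 \<comment> \<open>Entropy below N * d makes the term 2 * entropy / (et * N) of
   \<open>trunc_mass\<close> at most s / 4.\<close>
 define d where "d = et * s / 8"
 have d: "d > 0" using et s by (simp add: d_def)
 have "(%N. (2 / et + 8 / (s * x\<^sup>2)) * inverse (real N) + exp (- (et / 2) * real N)) \<longlonglongrightarrow> (2 / et + 8 / (s * x\<^sup>2)) * 0 + 0"
  using et by (intro tendsto_add tendsto_mult tendsto_const lim_inverse_n exp_decay) simp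
 then have ev1: "\<forall>\<^sub>F N in sequentially. (2 / et + 8 / (s * x\<^sup>2)) * inverse (real N) + exp (- (et / 2) * real N) < s / 2"
  by (rule order_tendstoD(2)) (use s in simp)
 have ev2: "\<forall>\<^sub>F N in sequentially. exp (- et * real N) < s / 2"
  by (rule order_tendstoD(2)[OF exp_decay[OF et]]) (use s in simp)
 show ?thesis using ev1 ev2 entropy_small[OF p b1(2,3) b2(3) d]
 proof eventually_elim
  case (elim N)
  interpret pspin p N by standard (use p elim in auto)
  have sm: "exp (- et * real N) <= s / 2" using elim by simp
  have q: "2 * (entropy b1 + 1) / (et * real N) + exp (- (et / 2) * real N) + 8 / (s * x\<^sup>2 * real N) <= s"
  proof -
   have "2 * entropy b1 / (et * real N) <= 2 * (real N * d) / (et * real N)"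
    using elim et by (intro divide_right_mono) auto
   also have "... = s / 4" using elim et by (simp add: d_def)
   finally have "2 * entropy b1 / (et * real N) <= s / 4" .
   moreover have "2 * (entropy b1 + 1) / (et * real N) + 8 / (s * x\<^sup>2 * real N) = 2 * entropy b1 / (et * real N) + (2 / et + 8 / (s * x\<^sup>2)) * inverse (real N)"
   proof -
    have "2 * (h + 1) / (et * n) + 8 / (s * y * n) = 2 * h / (et * n) + (2 / et + 8 / (s * y)) * inverse n" if "n > 0" "y > 0" for h n y :: real
     using that et s(1) by (simp add: field_simps)
    then show ?thesis using elim x(4) by simp
   qed
   ultimately show ?thesis using elim s by linarith
  qed
  have mass: "1 - s <= exg (%g. avg (%u. trunc be x s u g))"
   using trunc_mass[OF b(1) b1(1) x(4) s(1), folded et_def, OF sm] q by linarith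
  have "exg (%g. avg (%u. avg (%v. trunc be x s u g * trunc be x s v g * 1))) <= 1 / sqrt (1 - be\<^sup>2 * x) + s"
   by (rule trunc_pair[OF x(4) less_imp_le[OF x(5)] x(3) s(1) zero_le_one]) simp
  also have "... <= 1 + 2 * s" using x(1) by linarith
  finally have sec1: "exg (%g. avg (%u. avg (%v. trunc be x s u g * trunc be x s v g * 1))) <= 1 + 2 * s" .
  have "exg (%g. avg (%u. avg (%v. trunc be x s u g * trunc be x s v g * \<bar>vinner N u v\<bar>))) <= x / sqrt (1 - be\<^sup>2 * x) + s"
   by (rule trunc_pair[OF x(4) less_imp_le[OF x(5)] x(3) s(1) less_imp_le[OF x(4)]]) (simp add: vinner_abs)
  also have "... <= e\<^sup>2" using x(2) s(2) zero_le_power2[of e] by linarith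
  finally have sec2: "exg (%g. avg (%u. avg (%v. trunc be x s u g * trunc be x s v g * \<bar>vinner N u v\<bar>))) <= e\<^sup>2" .
  have "2 * s + 2 * s <= e\<^sup>2" using s(2) zero_le_power2[of e] by linarith
  from tv_bound[OF e mass sec1 this] have "dTV p N be <= e" by (rule dTV_le)
  moreover have "recovery_prob p N be mu c <= 2 * e / c" if m: "random_prob_measure p N mu" and c: "c > 0" for mu c
  proof (rule recovery_le[OF m c])
   have sy: "sobs g \<in> sym_tensors p N" for g by (simp add: sobs_def symmetrize_in)
   have 1: "(\<Sum>ta\<in>S N. measure (mu (sobs g)) {ta}) = 1" for g
    using kernel_integral[OF m sy[of g], where f="%_. 1"] prob_space.prob_space[OF kernel_prob(1)[OF m sy[of g]]] by simp
   have "exg (%g. avg (%u. lik be u g * (\<Sum>ta\<in>S N. measure (mu (sobs g)) {ta} * \<bar>vinner N u ta\<bar>))) <= s + e"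
    by (rule recovery_bound[OF e mass sec2 kernel_gau[OF m] _ 1]) auto
   then show "exg (%g. avg (%u. lik be u g * (\<Sum>ta\<in>S N. measure (mu (sobs g)) {ta} * \<bar>vinner N u ta\<bar>))) <= 2 * e"
    using s(3) e by linarith
  qed
  ultimately show ?case by blast
 qed
qed

lemma dTV_nonneg: assumes p: "p >= 3" and N: "N > 0" shows "0 <= dTV p N be"
proof -
 interpret pspin p N by standard (use p N in auto)
 interpret J: prob_space "joint p N" by (rule prob_space_joint[OF N])
 have "\<bar>measure (joint p N) {om \<in> space (joint p N). W_rv p N om \<in> {}} - measure (joint p N) {om \<in> space (joint p N). T_rv p N be om \<in> {}}\<bar> <= dTV p N be"
  unfolding dTV_def
  by (rule cSUP_upper, simp, rule bdd_aboveI2[where M=1]) (auto intro: measure_diff_le_one[OF J.prob_space_axioms])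
 then show ?thesis by simp
qed

lemma recovery_nonneg: "0 <= recovery_prob p N be mu c"
 by (simp add: recovery_prob_def)

lemma above_critical_bounds:
 assumes p: "p >= 3" and b: "critical_temp p < be"
 obtains c a where "c > 0" "a > 0"
  "\<forall>\<^sub>F N in sequentially. 1 - 2 * exp (- a * real N) <= dTV p N be \<and> 1 - 2 * exp (- a * real N) <= recovery_prob p N be (posterior p N be) c
   \<and> dTV p N be <= 1 \<and> recovery_prob p N be (posterior p N be) c <= 1"
proof -
 have b0: "be > 0" and F: "F p be < be\<^sup>2 / 4" by (rule above_critical[OF p b])+
 \<comment> \<open>Half of the gap: logmean is eventually below -3/2 * de * N, so concentration with
   deviation de / 2 gives L <= exp (-de * N) with high probability.\<close>
 define de where "de = (be\<^sup>2 / 4 - F p be) / 2"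
 have d: "de > 0" using F by (simp add: de_def)
 \<comment> \<open>c^p = y makes be^2 * c^p / 2 equal to de / 4, the tilt allowed in
   \<open>posterior_overlap\<close>.\<close>
 define y where "y = de / (2 * be\<^sup>2)"
 define c where "c = root p y"
 have y: "y > 0" using d b0 by (simp add: y_def)
 have c: "c > 0" "c ^ p = y" using y p by (auto simp: c_def real_root_gt_zero real_root_pow_pos)
 have cc: "be\<^sup>2 * (c ^ p / 2) <= de / 4" unfolding c(2) y_def using b0 by simp
 \<comment> \<open>A common rate for the two exponentially small errors: concentration of the
   log-likelihood under noise and the lower tail of L under planting.\<close>
 define a where "a = min (de / 2) ((de / 2)\<^sup>2 / (2 * be\<^sup>2))"
 have a: "a > 0" using d b0 by (simp add: a_def)
 have "F p be - be\<^sup>2 / 4 = - 2 * de" by (simp add: de_def)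
 then have "F p be - be\<^sup>2 / 4 < - (3 / 2 * de)" using d by simp
 from order_tendstoD(2)[OF logmean_limit[OF p b0] this]
 have ev: "\<forall>\<^sub>F N in sequentially. lmean p N be / real N < - (3 / 2 * de)" .
 have "de / 4 > 0" using d by simp
 from order_tendstoD(2)[OF exp_decay[OF this], of "1/2"]
 have ev2: "\<forall>\<^sub>F N in sequentially. exp (- (de / 4) * real N) < 1 / 2" by simp
 show thesis
 proof (rule that[of "c / 2" a])
  show "\<forall>\<^sub>F N in sequentially. 1 - 2 * exp (- a * real N) <= dTV p N be \<and> 1 - 2 * exp (- a * real N) <= recovery_prob p N be (posterior p N be) (c / 2)
   \<and> dTV p N be <= 1 \<and> recovery_prob p N be (posterior p N be) (c / 2) <= 1"
   using ev ev2 eventually_gt_at_top[of 0]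
  proof eventually_elim
   case (elim N)
   interpret pspin p N by standard (use p elim in auto)
   have lm: "logmean be + de / 2 * real N <= - de * real N" using elim by (simp add: divide_less_eq)
   have m1: "Measurable.pred (gau (idx p N)) (%g. exp (- de * real N) < L be g)" by measurable
   have m2: "Measurable.pred (gau (idx p N)) (%g. logmean be + de / 2 * real N <= ln (L be g))" by measurable
   have "exg (%g. if exp (- de * real N) < L be g then 1 else 0) <= exg (%g. if logmean be + de / 2 * real N <= ln (L be g) then 1 else 0)"
   proof (rule exg_mono[OF expb_ind[OF m1] expb_ind[OF m2]])
    fix g
    have "logmean be + de / 2 * real N <= ln (L be g)" if "exp (- de * real N) < L be g"
     using lm ln_ge_iff[OF L_pos[of be g], of "- de * real N"] that by linarith
    then show "(if exp (- de * real N) < L be g then 1 else 0) <= (if logmean be + de / 2 * real N <= ln (L be g) then 1 else 0 :: real)" by simp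
   qed
   also have "... <= exp (- ((de / 2)\<^sup>2 / (2 * be\<^sup>2)) * real N)" by (rule lnL_tails(1)) (use b0 d in auto)
   also have "... <= exp (- a * real N)"
    unfolding exp_le_cancel_iff by (rule mult_right_mono) (auto simp: a_def)
   finally have 1: "exg (%g. if exp (- de * real N) < L be g then 1 else 0) <= exp (- a * real N)" .
   have 2: "exp (- (de / 2) * real N) <= exp (- a * real N)"
    unfolding exp_le_cancel_iff by (rule mult_right_mono) (auto simp: a_def)
   have 3: "exp (- de * real N) <= exp (- (de / 2) * real N)"
    unfolding exp_le_cancel_iff by (rule mult_right_mono) (use d in auto)
   have "1 - 2 * exp (- a * real N) <= dTV p N be"
    using dTV_ge[of "exp (- de * real N)" be] 1 2 3 exp_ge_zero[of "- de * real N"] by linarith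
   moreover have "1 - 2 * exp (- a * real N) <= recovery_prob p N be (posterior p N be) (c / 2)"
    using recovery_posterior[OF c(1), of be] posterior_overlap[OF c(1) cc] elim(2) 1 2 by linarith
   ultimately show ?case using dTV_le_one recovery_le_one by blast
  qed
 qed (use a c in auto)
qed

theorem mainTheorem1:
  fixes p :: nat
  assumes "p \<ge> 3"
  shows "(\<forall>\<beta>. 0 < \<beta> \<and> \<beta> < critical_temp p \<longrightarrow>
            (\<lambda>N. dTV p N \<beta>) \<longlonglongrightarrow> 0 \<and>
            (\<forall>\<mu> c. (\<forall>N. random_prob_measure p N (\<mu> N)) \<and> c > 0 \<longrightarrow>
               (\<lambda>N. recovery_prob p N \<beta> (\<mu> N) c) \<longlonglongrightarrow> 0))
       \<and> (\<forall>\<beta>. \<beta> > critical_temp p \<longrightarrow>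
            (\<lambda>N. dTV p N \<beta>) \<longlonglongrightarrow> 1 \<and>
            (\<exists>\<mu> c. (\<forall>N. random_prob_measure p N (\<mu> N)) \<and> c > 0 \<and>
               (\<lambda>N. recovery_prob p N \<beta> (\<mu> N) c) \<longlonglongrightarrow> 1))"
proof (intro conjI allI impI; (elim conjE)?)
 fix be :: real assume b: "0 < be" "be < critical_temp p"
 show "(%N. dTV p N be) \<longlonglongrightarrow> 0"
 proof (rule tendstoI)
  fix e :: real assume e: "0 < e"
  have "e / 2 > 0" using e by simp
  from below_critical_bounds[OF assms b this] eventually_gt_at_top[of 0]
  show "\<forall>\<^sub>F N in sequentially. dist (dTV p N be) 0 < e"
   by eventually_elim (use e dTV_nonneg[OF assms] in \<open>auto simp: abs_of_nonneg\<close>)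
 qed
 fix mu c assume m: "\<forall>N. random_prob_measure p N (mu N)" and c: "(c::real) > 0"
 show "(%N. recovery_prob p N be (mu N) c) \<longlonglongrightarrow> 0"
 proof (rule tendstoI)
  fix e :: real assume e: "0 < e"
  have "e * c / 4 > 0" using e c by simp
  from below_critical_bounds[OF assms b this]
  show "\<forall>\<^sub>F N in sequentially. dist (recovery_prob p N be (mu N) c) 0 < e"
  proof eventually_elim
   case (elim N)
   then have "recovery_prob p N be (mu N) c <= 2 * (e * c / 4) / c" using m c by blast
   also have "... = e / 2" using c by simp
   finally show ?case using e recovery_nonneg[of p N be "mu N" c] by simp
  qed
 qed
next
 fix be assume b: "critical_temp p < be"
 obtain c a where c: "c > 0" and a: "a > 0"
  and ev: "\<forall>\<^sub>F N in sequentially. 1 - 2 * exp (- a * real N) <= dTV p N be \<and> 1 - 2 * exp (- a * real N) <= recovery_prob p N be (posterior p N be) c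
   \<and> dTV p N be <= 1 \<and> recovery_prob p N be (posterior p N be) c <= 1"
  using above_critical_bounds[OF assms b] .
 have "(%N. 1 - 2 * exp (- a * real N)) \<longlonglongrightarrow> 1 - 2 * 0"
  by (intro tendsto_diff tendsto_mult tendsto_const exp_decay[OF a])
 then have l: "(%N. 1 - 2 * exp (- a * real N)) \<longlonglongrightarrow> 1" by simp
 show "(%N. dTV p N be) \<longlonglongrightarrow> 1"
  by (rule tendsto_sandwich[OF _ _ l tendsto_const]) (use ev in \<open>auto elim: eventually_mono\<close>)
 have "(%N. recovery_prob p N be (posterior p N be) c) \<longlonglongrightarrow> 1"
  by (rule tendsto_sandwich[OF _ _ l tendsto_const]) (use ev in \<open>auto elim: eventually_mono\<close>)
 then show "\<exists>mu c. (\<forall>N. random_prob_measure p N (mu N)) \<and> c > 0 \<and> (%N. recovery_prob p N be (mu N) c) \<longlonglongrightarrow> 1"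
  using posterior_kernel c by (intro exI[of _ "%N. posterior p N be"] exI[of _ c]) auto
qed

end
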